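(* Let $p\in[1,\infty]$ and let $M\in\mathcal{M}_{\boldsymbol{h}}$ be a macro-element for which the macro-element edges $\sigma_X$ associated with the vertices $X$ of $M$ are chosen such that $h_k(\omega_M)\le C_0\,h_k(M)$ for $k=1,2$. Then for every $u\in W_{3,p}(\omega_M)\cap C^1(M)$ $$|u-\tilde\Pi u|_{W_{1,p}(M)}\le C\,C_{M,p}\sum_{|\boldsymbol{\alpha}|=2}\boldsymbol{h}_M^{\boldsymbol{\alpha}}\,|\boldsymbol{D}^{\boldsymbol{\alpha}}u|_{W_{1,p}(\omega_M)},$$ where $$C_{M,p}=\left(\frac{\operatorname{meas}M}{\min_{M'\in\mathcal{M}_{\boldsymbol{h}},\,M'\subset\omega_M}\operatorname{meas}M'}\right)^{1/p}$$ and the constant $C$ depends only on $p$ and $C_0$ (not on $u$, $M$ or the mesh).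
   Context: Mesh. $\mathcal{M}_{\boldsymbol{h}}$ (macro-element mesh) is the tensor product mesh of closed rectangles $[x_i,x_{i+1}]\times[y_j,y_{j+1}]$ generated by two arbitrary one-dimensional meshes $x_0<\dots<x_n$, $y_0<\dots<y_m$; its members are called macro-elements, and their edges macro-element edges. No restriction is imposed on the step sizes. $h_k(T)$ denotes the side length of an axis-parallel rectangle $T$ in the $k$-th coordinate direction, $\boldsymbol{h}_M=(h_1(M),h_2(M))$, $\boldsymbol{h}_M^{\boldsymbol{\alpha}}=h_1(M)^{\alpha_1}h_2(M)^{\alpha_2}$. 1D splines. For an interval $J=[a,b]$ with midpoint $m$ and half-length $h=(b-a)/2$ and $e\in\{a,b\}$ let $\varphi^J_e,\psi^J_e\in C^1(J)$ be the functions that are quadratic polynomials on each of $[a,m]$, $[m,b]$, determined by $\varphi^J_e(k)=\delta_{ek}$, $(\varphi_e^J)'(k)=0$, $\psi^J_e(k)=0$, $(\psi^J_e)'(k)=\delta_{ek}$ for $k\in\{a,b\}$. Let $\mathbb{V}^J=\mathrm{span}\{\psi^J_a+\psi^J_b,\ \theta^J\}$ with $\theta^J(x)=\left(\frac{x-m}{h}\right)^2-\frac16$, and let $d^J_a,d^J_b\in\mathbb{V}^J$ be the dual functions determined by $\int_J(\psi^J_k)'(x)\,d^J_e(x)\,dx=\delta_{ke}$ for $k,e\in\{a,b\}$. Operator. With every vertex $X=(x_i,y_j)$ of the macro-element mesh a macro-element edge $\sigma_X$ with $X\in\sigma_X$ is associated. Put $a_X=\int_J u_{xy}(x,y_j)\,d^J_{x_i}(x)\,dx$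 if $\sigma_X=J\times\{y_j\}$ is horizontal and $a_X=\int_K u_{xy}(x_i,y)\,d^K_{y_j}(y)\,dy$ if $\sigma_X=\{x_i\}\times K$ is vertical. On a macro-element $M=J\times K$ the quasi-interpolant is $$\tilde\Pi u|_M=\sum_{X=(e,f)}\Big(u(X)\varphi^J_e(x)\varphi^K_f(y)+u_x(X)\psi^J_e(x)\varphi^K_f(y)+u_y(X)\varphi^J_e(x)\psi^K_f(y)+a_X\psi^J_e(x)\psi^K_f(y)\Big),$$ the sum being over the four vertices $X=(e,f)$ of $M$. The associated macro-element patch $\omega_M$ is the smallest (in area) rectangular patch of macro-elements containing the convex hull of the four edges $\sigma_X$, $X$ a vertex of $M$. *)

theory Defs
  imports "HOL-Analysis.Analysis" "HOL-Probability.Essential_Supremum"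
begin

text \<open>Lebesgue spaces; real-valued norms, meaningful on members of the space only.\<close>

definition Lp :: "ereal \<Rightarrow> 'a::euclidean_space set \<Rightarrow> ('a \<Rightarrow> real) set" where
  "Lp p S = {f. f \<in> borel_measurable (lebesgue_on S) \<and>
     (if p = \<infinity> then esssup (lebesgue_on S) (\<lambda>z. ereal \<bar>f z\<bar>) < \<infinity>
      else integrable (lebesgue_on S) (\<lambda>z. \<bar>f z\<bar> powr real_of_ereal p))}"

definition Lp_norm :: "ereal \<Rightarrow> 'a::euclidean_space set \<Rightarrow> ('a \<Rightarrow> real) \<Rightarrow> real" where
  "Lp_norm p S f =
     (if p = \<infinity> then real_of_ereal (esssup (lebesgue_on S) (\<lambda>z. ereal \<bar>f z\<bar>))
      else (\<integral>z. \<bar>f z\<bar> powr real_of_ereal p \<partial>lebesgue_on S) powr (1 / real_of_ereal p))"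

text \<open>
  Classical derivatives are taken within \<open>S\<close>, hence one-sided on the boundary if \<open>S\<close> is a
  closed rectangle. They are unique for open sets and for nondegenerate closed rectangles, the
  only sets to which the following definitions are applied.
\<close>

definition pdx :: "(real \<times> real) set \<Rightarrow> (real \<times> real \<Rightarrow> real) \<Rightarrow> real \<times> real \<Rightarrow> real" where
  "pdx S f z = frechet_derivative f (at z within S) (1, 0)"

definition pdy :: "(real \<times> real) set \<Rightarrow> (real \<times> real \<Rightarrow> real) \<Rightarrow> real \<times> real \<Rightarrow> real" where
  "pdy S f z = frechet_derivative f (at z within S) (0, 1)"

primrec Ck_on :: "nat \<Rightarrow> (real \<times> real) set \<Rightarrow> (real \<times> real \<Rightarrow> real) \<Rightarrow> bool" where
  "Ck_on 0 S f = continuous_on S f"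
| "Ck_on (Suc k) S f = (f differentiable_on S \<and> Ck_on k S (pdx S f) \<and> Ck_on k S (pdy S f))"

definition smooth :: "(real \<times> real \<Rightarrow> real) \<Rightarrow> bool" where
  "smooth f \<longleftrightarrow> (\<forall>k. Ck_on k UNIV f)"

definition test_functions :: "(real \<times> real) set \<Rightarrow> (real \<times> real \<Rightarrow> real) set" where
  "test_functions \<Omega> =
     {f. smooth f \<and> compact (closure {z. f z \<noteq> 0}) \<and> closure {z. f z \<noteq> 0} \<subseteq> \<Omega>}"

definition multi_indices :: "nat \<Rightarrow> (nat \<times> nat) set" where
  "multi_indices k = {\<alpha>. fst \<alpha> + snd \<alpha> = k}"

definition classical_D :: "nat \<times> nat \<Rightarrow> (real \<times> real \<Rightarrow> real) \<Rightarrow> real \<times> real \<Rightarrow> real" where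
  "classical_D \<alpha> f = (pdx UNIV ^^ fst \<alpha>) ((pdy UNIV ^^ snd \<alpha>) f)"

definition locally_integrable :: "(real \<times> real) set \<Rightarrow> (real \<times> real \<Rightarrow> real) \<Rightarrow> bool" where
  "locally_integrable \<Omega> f \<longleftrightarrow> (\<forall>K. compact K \<and> K \<subseteq> \<Omega> \<longrightarrow> set_integrable lebesgue K f)"

definition has_weak_D ::
  "(real \<times> real \<Rightarrow> real) \<Rightarrow> nat \<times> nat \<Rightarrow> (real \<times> real) set \<Rightarrow> (real \<times> real \<Rightarrow> real) \<Rightarrow> bool" where
  "has_weak_D u \<alpha> \<Omega> g \<longleftrightarrow> locally_integrable \<Omega> u \<and> locally_integrable \<Omega> g \<and>
     (\<forall>\<phi>\<in>test_functions \<Omega>.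
        (LINT z:\<Omega>|lebesgue. u z * classical_D \<alpha> \<phi> z) =
        (-1) ^ (fst \<alpha> + snd \<alpha>) * (LINT z:\<Omega>|lebesgue. g z * \<phi> z))"

text \<open>Some representative of the weak derivative, which is unique up to null sets.\<close>

definition weak_D ::
  "(real \<times> real) set \<Rightarrow> nat \<times> nat \<Rightarrow> (real \<times> real \<Rightarrow> real) \<Rightarrow> real \<times> real \<Rightarrow> real" where
  "weak_D \<Omega> \<alpha> u = (SOME g. has_weak_D u \<alpha> \<Omega> g)"

definition sobolev :: "nat \<Rightarrow> ereal \<Rightarrow> (real \<times> real) set \<Rightarrow> (real \<times> real \<Rightarrow> real) set" where
  "sobolev k p \<Omega> = {u. u \<in> Lp p \<Omega> \<and>
     (\<forall>l\<le>k. \<forall>\<alpha>\<in>multi_indices l. \<exists>g\<in>Lp p \<Omega>. has_weak_D u \<alpha> \<Omega> g)}"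

definition lp_combine :: "ereal \<Rightarrow> 'i set \<Rightarrow> ('i \<Rightarrow> real) \<Rightarrow> real" where
  "lp_combine p A r =
     (if p = \<infinity> then Max (r ` A)
      else (\<Sum>i\<in>A. r i powr real_of_ereal p) powr (1 / real_of_ereal p))"

definition sobolev_seminorm ::
  "nat \<Rightarrow> ereal \<Rightarrow> (real \<times> real) set \<Rightarrow> (real \<times> real \<Rightarrow> real) \<Rightarrow> real" where
  "sobolev_seminorm k p \<Omega> u =
     lp_combine p (multi_indices k) (\<lambda>\<alpha>. Lp_norm p \<Omega> (weak_D \<Omega> \<alpha> u))"

definition sobolev_norm ::
  "nat \<Rightarrow> ereal \<Rightarrow> (real \<times> real) set \<Rightarrow> (real \<times> real \<Rightarrow> real) \<Rightarrow> real" where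
  "sobolev_norm k p \<Omega> u =
     lp_combine p (\<Union>l\<le>k. multi_indices l) (\<lambda>\<alpha>. Lp_norm p \<Omega> (weak_D \<Omega> \<alpha> u))"

text \<open>
  Trace of a \<open>W\<^sub>1\<^sub>,\<^sub>1\<close> function on a segment \<open>\<gamma> ` J\<close> in the closure of the rectangle \<open>\<Omega>\<close>, as the
  continuous extension of the restriction of smooth functions. The exponent 1 suffices for all
  \<open>p\<close> since \<open>\<Omega>\<close> is bounded, and it avoids the failure of density for \<open>p = \<infinity>\<close>.
\<close>

definition has_trace ::
  "(real \<times> real \<Rightarrow> real) \<Rightarrow> (real \<times> real) set \<Rightarrow> (real \<Rightarrow> real \<times> real) \<Rightarrow> real set \<Rightarrow> (real \<Rightarrow> real) \<Rightarrow> bool" where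
  "has_trace w \<Omega> \<gamma> J g \<longleftrightarrow> w \<in> sobolev 1 1 \<Omega> \<and> g \<in> Lp 1 J \<and>
     (\<exists>v. (\<forall>k::nat. smooth (v k) \<and> v k \<in> sobolev 1 1 \<Omega>) \<and>
        (\<lambda>k. sobolev_norm 1 1 \<Omega> (\<lambda>z. v k z - w z)) \<longlonglongrightarrow> 0 \<and>
        (\<lambda>k. Lp_norm 1 J (\<lambda>t. v k (\<gamma> t) - g t)) \<longlonglongrightarrow> 0)"

definition edge_trace ::
  "(real \<times> real) set \<Rightarrow> (real \<Rightarrow> real \<times> real) \<Rightarrow> real set \<Rightarrow> (real \<times> real \<Rightarrow> real) \<Rightarrow> real \<Rightarrow> real" where
  "edge_trace \<Omega> \<gamma> J w = (SOME g. has_trace w \<Omega> \<gamma> J g)"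

text \<open>
  One-dimensional splines on \<open>{a..b}\<close>. They are extended by zero so that the
  defining conditions determine a function on all reals.
\<close>

definition deriv_on :: "real \<Rightarrow> real \<Rightarrow> (real \<Rightarrow> real) \<Rightarrow> real \<Rightarrow> real" where
  "deriv_on a b f t = vector_derivative f (at t within {a..b})"

definition quadratic_on :: "real set \<Rightarrow> (real \<Rightarrow> real) \<Rightarrow> bool" where
  "quadratic_on S f \<longleftrightarrow> (\<exists>c0 c1 c2. \<forall>t\<in>S. f t = c0 + c1 * t + c2 * t\<^sup>2)"

definition splines :: "real \<Rightarrow> real \<Rightarrow> (real \<Rightarrow> real) set" where
  "splines a b = {f. f differentiable_on {a..b} \<and> continuous_on {a..b} (deriv_on a b f) \<and>
     quadratic_on {a..(a + b) / 2} f \<and> quadratic_on {(a + b) / 2..b} f \<and>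
     (\<forall>t. t \<notin> {a..b} \<longrightarrow> f t = 0)}"

definition spline_phi :: "real \<Rightarrow> real \<Rightarrow> real \<Rightarrow> real \<Rightarrow> real" where
  "spline_phi a b e = (THE f. f \<in> splines a b \<and>
     (\<forall>k\<in>{a, b}. f k = of_bool (e = k) \<and> deriv_on a b f k = 0))"

definition spline_psi :: "real \<Rightarrow> real \<Rightarrow> real \<Rightarrow> real \<Rightarrow> real" where
  "spline_psi a b e = (THE f. f \<in> splines a b \<and>
     (\<forall>k\<in>{a, b}. f k = 0 \<and> deriv_on a b f k = of_bool (e = k)))"

definition spline_theta :: "real \<Rightarrow> real \<Rightarrow> real \<Rightarrow> real" where
  "spline_theta a b t = ((t - (a + b) / 2) / ((b - a) / 2))\<^sup>2 - 1 / 6"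

definition dual_space :: "real \<Rightarrow> real \<Rightarrow> (real \<Rightarrow> real) set" where
  "dual_space a b =
     {\<lambda>t. c1 * (spline_psi a b a t + spline_psi a b b t) + c2 * spline_theta a b t | c1 c2. True}"

definition dual_fun :: "real \<Rightarrow> real \<Rightarrow> real \<Rightarrow> real \<Rightarrow> real" where
  "dual_fun a b e = (THE d. d \<in> dual_space a b \<and>
     (\<forall>k\<in>{a, b}. (LINT t:{a..b}|lebesgue. deriv_on a b (spline_psi a b k) t * d t) = of_bool (k = e)))"

text \<open>The mesh is given by points \<open>x 0 < \<dots> < x n\<close> and \<open>y 0 < \<dots> < y m\<close>.\<close>

definition macro :: "(nat \<Rightarrow> real) \<Rightarrow> (nat \<Rightarrow> real) \<Rightarrow> nat \<Rightarrow> nat \<Rightarrow> (real \<times> real) set" where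
  "macro x y i j = {x i..x (Suc i)} \<times> {y j..y (Suc j)}"

definition mesh :: "nat \<Rightarrow> nat \<Rightarrow> (nat \<Rightarrow> real) \<Rightarrow> (nat \<Rightarrow> real) \<Rightarrow> (real \<times> real) set set" where
  "mesh n m x y = {macro x y i j | i j. i < n \<and> j < m}"

text \<open>
  \<open>Horizontal i j\<close> joins \<open>(x i, y j)\<close> to its right neighbour,
  \<open>Vertical i j\<close> joins it to its upper neighbour.
\<close>

datatype edge = Horizontal nat nat | Vertical nat nat

fun edge_set :: "(nat \<Rightarrow> real) \<Rightarrow> (nat \<Rightarrow> real) \<Rightarrow> edge \<Rightarrow> (real \<times> real) set" where
  "edge_set x y (Horizontal i j) = {x i..x (Suc i)} \<times> {y j}"
| "edge_set x y (Vertical i j) = {x i} \<times> {y j..y (Suc j)}"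

fun mesh_edge :: "nat \<Rightarrow> nat \<Rightarrow> edge \<Rightarrow> bool" where
  "mesh_edge n m (Horizontal i j) \<longleftrightarrow> i < n \<and> j \<le> m"
| "mesh_edge n m (Vertical i j) \<longleftrightarrow> i \<le> n \<and> j < m"

definition edge_choice ::
  "nat \<Rightarrow> nat \<Rightarrow> (nat \<Rightarrow> real) \<Rightarrow> (nat \<Rightarrow> real) \<Rightarrow> (nat \<Rightarrow> nat \<Rightarrow> edge) \<Rightarrow> bool" where
  "edge_choice n m x y \<sigma> \<longleftrightarrow>
     (\<forall>i\<le>n. \<forall>j\<le>m. mesh_edge n m (\<sigma> i j) \<and> (x i, y j) \<in> edge_set x y (\<sigma> i j))"

definition rect_patches ::
  "nat \<Rightarrow> nat \<Rightarrow> (nat \<Rightarrow> real) \<Rightarrow> (nat \<Rightarrow> real) \<Rightarrow> (real \<times> real) set set" where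
  "rect_patches n m x y =
     {{x i..x k} \<times> {y j..y l} | i j k l. i < k \<and> k \<le> n \<and> j < l \<and> l \<le> m}"

definition patch ::
  "nat \<Rightarrow> nat \<Rightarrow> (nat \<Rightarrow> real) \<Rightarrow> (nat \<Rightarrow> real) \<Rightarrow> (nat \<Rightarrow> nat \<Rightarrow> edge) \<Rightarrow> nat \<Rightarrow> nat \<Rightarrow> (real \<times> real) set" where
  "patch n m x y \<sigma> i j = (ARG_MIN (measure lebesgue) R. R \<in> rect_patches n m x y \<and>
     convex hull (\<Union>k\<in>{i, Suc i}. \<Union>l\<in>{j, Suc j}. edge_set x y (\<sigma> k l)) \<subseteq> R)"

definition side1 :: "(real \<times> real) set \<Rightarrow> real" where
  "side1 T = Sup (fst ` T) - Inf (fst ` T)"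

definition side2 :: "(real \<times> real) set \<Rightarrow> real" where
  "side2 T = Sup (snd ` T) - Inf (snd ` T)"

definition h_pow :: "(real \<times> real) set \<Rightarrow> nat \<times> nat \<Rightarrow> real" where
  "h_pow T \<alpha> = side1 T ^ fst \<alpha> * side2 T ^ snd \<alpha>"

text \<open>
  The coefficient \<open>a\<^sub>X\<close> for \<open>X = (x i, y j)\<close>. The mixed derivative is the weak one in \<open>\<Omega>\<close>,
  restricted to the edge in the sense of traces.
\<close>

definition edge_coeff ::
  "(nat \<Rightarrow> real) \<Rightarrow> (nat \<Rightarrow> real) \<Rightarrow> (nat \<Rightarrow> nat \<Rightarrow> edge) \<Rightarrow> (real \<times> real) set \<Rightarrow>
   (real \<times> real \<Rightarrow> real) \<Rightarrow> nat \<Rightarrow> nat \<Rightarrow> real" where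
  "edge_coeff x y \<sigma> \<Omega> u i j = (case \<sigma> i j of
     Horizontal k _ \<Rightarrow>
       LINT t:{x k..x (Suc k)}|lebesgue.
         edge_trace \<Omega> (\<lambda>t. (t, y j)) {x k..x (Suc k)} (weak_D \<Omega> (1, 1) u) t
         * dual_fun (x k) (x (Suc k)) (x i) t
   | Vertical _ l \<Rightarrow>
       LINT t:{y l..y (Suc l)}|lebesgue.
         edge_trace \<Omega> (\<lambda>t. (x i, t)) {y l..y (Suc l)} (weak_D \<Omega> (1, 1) u) t
         * dual_fun (y l) (y (Suc l)) (y j) t)"

text \<open>The restriction of the quasi-interpolant to \<open>macro x y i j\<close>.\<close>

definition quasi_interp ::
  "(nat \<Rightarrow> real) \<Rightarrow> (nat \<Rightarrow> real) \<Rightarrow> (nat \<Rightarrow> nat \<Rightarrow> edge) \<Rightarrow> (real \<times> real) set \<Rightarrow> nat \<Rightarrow> nat \<Rightarrow>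
   (real \<times> real \<Rightarrow> real) \<Rightarrow> real \<times> real \<Rightarrow> real" where
  "quasi_interp x y \<sigma> \<Omega> i j u z =
     (let M = macro x y i j;
          \<phi>1 = spline_phi (x i) (x (Suc i)); \<psi>1 = spline_psi (x i) (x (Suc i));
          \<phi>2 = spline_phi (y j) (y (Suc j)); \<psi>2 = spline_psi (y j) (y (Suc j))
      in \<Sum>k\<in>{i, Suc i}. \<Sum>l\<in>{j, Suc j}.
           u (x k, y l) * \<phi>1 (x k) (fst z) * \<phi>2 (y l) (snd z)
         + pdx M u (x k, y l) * \<psi>1 (x k) (fst z) * \<phi>2 (y l) (snd z)
         + pdy M u (x k, y l) * \<phi>1 (x k) (fst z) * \<psi>2 (y l) (snd z)
         + edge_coeff x y \<sigma> \<Omega> u k l * \<psi>1 (x k) (fst z) * \<psi>2 (y l) (snd z))"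

definition mesh_constant ::
  "nat \<Rightarrow> nat \<Rightarrow> (nat \<Rightarrow> real) \<Rightarrow> (nat \<Rightarrow> real) \<Rightarrow> ereal \<Rightarrow> (real \<times> real) set \<Rightarrow> (real \<times> real) set \<Rightarrow> real" where
  "mesh_constant n m x y p M \<omega> =
     (measure lebesgue M / Min (measure lebesgue ` {M' \<in> mesh n m x y. M' \<subseteq> \<omega>}))
       powr real_of_ereal (1 / p)"

end

theory Submission
  imports Defs
begin

text \<open>
  Each first derivative of the error is bounded pointwise on \<open>M\<close> by \<open>L\<^sub>1\<close> norms of third derivatives of
  \<open>u\<close>; the exponent \<open>p\<close> enters only at the end, through Hoelder's inequality. Let \<open>\<gamma>\<close> be the mean of \<open>u\<^sub>x\<^sub>y\<close>
  over \<open>M\<close>. With \<open>\<gamma>\<close> in place of the coefficients \<open>a\<^sub>X\<close> the interpolation is local to \<open>M\<close> and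
  reproduces enough polynomials for a Sobolev-type inequality to apply to the first derivatives of \<open>u\<close>.
  Since the dual functions have integral 1 and are bounded by 8 over the length of the edge,
  \<open>a\<^sub>X - \<gamma>\<close> is bounded by the mean oscillation of \<open>u\<^sub>x\<^sub>y\<close> on the edge, which is estimated by its
  derivatives on a macro-element adjacent to the edge and on strips of the patch. All this is shown
  for smooth functions and carried over by mollification. As the rectangles are only
  anisotropically scaled, mollifying means averaging over a rectangle that is shrunk towards the
  point of evaluation, so that no extension of \<open>u\<close> is required.
\<close>

subsection \<open>Smooth functions in the plane\<close>

text \<open>Neighbouring macro-elements may have incomparable step sizes, so no bound may contain
  the ratio of side lengths of different elements. An edge is therefore joined to \<open>M\<close>
  by axis-parallel paths, averaged over the widths of rectangles that contain a whole element of the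
  patch. An L1 norm over such a rectangle divided by one side is, by Hoelder, at most a multiple of
  the other side, which is at most \<open>C0\<close> times that of \<open>M\<close>, times the area
  to the power -1/p. Bounding all these areas below by the smallest element, and taking the norm
  over \<open>M\<close> of a pointwise bound, gives exactly the mesh constant. All coefficients are
  compared with one number, the mean over \<open>M\<close>, because the local interpolation with
  this number reproduces linear first derivatives. A second obstacle: weak derivatives and traces
  are fixed only by a choice. Hence almost everywhere uniqueness of weak derivatives and existence
  of traces are proved, and trace estimates are made along the approximating sequence of the chosen
  trace.\<close>

lemma Ck_on_Suc_UNIV:
  assumes "\<And>z. (f has_derivative (\<lambda>h. fst h * G z + snd h * H z)) (at z)"
    and "Ck_on k UNIV G" "Ck_on k UNIV H"
  shows "Ck_on (Suc k) UNIV f" "pdx UNIV f = G" "pdy UNIV f = H"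
proof -
  show 1: "pdx UNIV f = G"
    by (rule ext) (simp add: pdx_def frechet_derivative_at[OF assms(1), symmetric])
  show 2: "pdy UNIV f = H"
    by (rule ext) (simp add: pdy_def frechet_derivative_at[OF assms(1), symmetric])
  show "Ck_on (Suc k) UNIV f"
    using assms by (auto simp: 1 2 differentiable_on_def differentiable_def)
qed

text \<open>Linearity recovers the whole derivative from its values on the two unit vectors.\<close>

lemma Ck_on_Suc_UNIV_iff:
  "Ck_on (Suc k) UNIV f \<longleftrightarrow>
    (\<forall>z. (f has_derivative (\<lambda>h. fst h * pdx UNIV f z + snd h * pdy UNIV f z)) (at z)) \<and>
    Ck_on k UNIV (pdx UNIV f) \<and> Ck_on k UNIV (pdy UNIV f)"
proof -
  have "(f has_derivative (\<lambda>h. fst h * pdx UNIV f z + snd h * pdy UNIV f z)) (at z)"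
    if "f differentiable_on UNIV" for z
  proof -
    have D: "(f has_derivative frechet_derivative f (at z)) (at z)"
      using that frechet_derivative_works differentiable_on_def by blast
    interpret linear "frechet_derivative f (at z)"
      using D has_derivative_linear by blast
    have "frechet_derivative f (at z) h = fst h * pdx UNIV f z + snd h * pdy UNIV f z" for h
    proof -
      have "h = fst h *\<^sub>R (1, 0) + snd h *\<^sub>R (0, 1)" by (simp add: prod_eq_iff)
      then have "frechet_derivative f (at z) h = frechet_derivative f (at z) (fst h *\<^sub>R (1, 0) + snd h *\<^sub>R (0, 1))"
        by simp
      also have "\<dots> = fst h * pdx UNIV f z + snd h * pdy UNIV f z"
        unfolding add scaleR by (simp add: pdx_def pdy_def)
      finally show ?thesis .
    qed
    then have "frechet_derivative f (at z) = (\<lambda>h. fst h * pdx UNIV f z + snd h * pdy UNIV f z)" by blast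
    then show ?thesis using D by simp
  qed
  moreover have "f differentiable_on UNIV"
    if "\<forall>z. (f has_derivative (\<lambda>h. fst h * pdx UNIV f z + snd h * pdy UNIV f z)) (at z)"
    using that differentiable_def differentiable_on_def by blast
  ultimately show ?thesis by fastforce
qed

lemma Ck_on_continuous_on: "Ck_on k S f \<Longrightarrow> continuous_on S f"
  by (cases k) (auto simp: differentiable_imp_continuous_on)

lemma smooth_continuous_on: "smooth f \<Longrightarrow> continuous_on S f"
  using Ck_on_continuous_on[of 0 UNIV f] continuous_on_subset by (force simp: smooth_def)

lemma smooth_pdx: "smooth f \<Longrightarrow> smooth (pdx UNIV f)"
  and smooth_pdy: "smooth f \<Longrightarrow> smooth (pdy UNIV f)"
  by (auto simp: smooth_def dest: spec[of _ "Suc _"])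

lemma smooth_has_derivative:
  "smooth f \<Longrightarrow> (f has_derivative (\<lambda>h. fst h * pdx UNIV f z + snd h * pdy UNIV f z)) (at z)"
  unfolding smooth_def using Ck_on_Suc_UNIV_iff by blast

lemma Ck_on_const: "Ck_on k UNIV (\<lambda>z. c)"
proof (induction k arbitrary: c)
  case (Suc k)
  show ?case by (rule Ck_on_Suc_UNIV(1)[where G="\<lambda>_. 0" and H="\<lambda>_. 0"]) (auto simp: Suc)
qed auto

lemma Ck_on_add:
  "Ck_on k UNIV f \<Longrightarrow> Ck_on k UNIV g \<Longrightarrow> Ck_on k UNIV (\<lambda>z. f z + g z)"
proof (induction k arbitrary: f g)
  case (Suc k)
  then have *: "\<And>z. (f has_derivative (\<lambda>h. fst h * pdx UNIV f z + snd h * pdy UNIV f z)) (at z)"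
    "\<And>z. (g has_derivative (\<lambda>h. fst h * pdx UNIV g z + snd h * pdy UNIV g z)) (at z)"
    using Ck_on_Suc_UNIV_iff by blast+
  show ?case
  proof (rule Ck_on_Suc_UNIV(1)[where G="\<lambda>z. pdx UNIV f z + pdx UNIV g z" and H="\<lambda>z. pdy UNIV f z + pdy UNIV g z"])
    show "((\<lambda>z. f z + g z) has_derivative (\<lambda>h. fst h * (pdx UNIV f z + pdx UNIV g z) + snd h * (pdy UNIV f z + pdy UNIV g z))) (at z)" for z
      by (rule has_derivative_eq_rhs[OF has_derivative_add[OF *]]) (auto simp: algebra_simps)
  qed (use Suc in auto)
qed (auto intro: continuous_intros)

text \<open>The product rule puts \<open>f\<close> and \<open>g\<close> themselves next to their
  derivatives, so the induction for products needs them in the lower class too.\<close>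

lemma Ck_on_Suc_D: "Ck_on (Suc k) UNIV f \<Longrightarrow> Ck_on k UNIV f"
proof (induction k arbitrary: f)
  case 0 then show ?case by (auto simp: differentiable_imp_continuous_on)
next
  case (Suc k)
  then show ?case by (metis Ck_on.simps(2))
qed

lemma Ck_on_mult:
  "Ck_on k UNIV f \<Longrightarrow> Ck_on k UNIV g \<Longrightarrow> Ck_on k UNIV (\<lambda>z. f z * g z)"
proof (induction k arbitrary: f g)
  case (Suc k)
  then have *: "\<And>z. (f has_derivative (\<lambda>h. fst h * pdx UNIV f z + snd h * pdy UNIV f z)) (at z)"
    "\<And>z. (g has_derivative (\<lambda>h. fst h * pdx UNIV g z + snd h * pdy UNIV g z)) (at z)"
    using Ck_on_Suc_UNIV_iff by blast+
  have "Ck_on k UNIV f" "Ck_on k UNIV g" using Suc Ck_on_Suc_D by blast+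
  then show ?case
  proof (intro Ck_on_Suc_UNIV(1)[where G="\<lambda>z. f z * pdx UNIV g z + pdx UNIV f z * g z" and H="\<lambda>z. f z * pdy UNIV g z + pdy UNIV f z * g z"])
    show "((\<lambda>z. f z * g z) has_derivative (\<lambda>h. fst h * (f z * pdx UNIV g z + pdx UNIV f z * g z) + snd h * (f z * pdy UNIV g z + pdy UNIV f z * g z))) (at z)" for z
      by (rule has_derivative_eq_rhs[OF has_derivative_mult[OF *]]) (auto simp: algebra_simps)
  qed (use Suc in \<open>auto intro!: Ck_on_add\<close>)
qed (auto intro: continuous_intros)

text \<open>The kernel of a mollification, seen as a test function of the integration variable, has
  this form.\<close>

lemma has_derivative_affine_compose:
  assumes "\<And>z. (f has_derivative (\<lambda>h. fst h * G z + snd h * H z)) (at z)"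
  shows "((\<lambda>s. f (c *\<^sub>R s + v)) has_derivative
     (\<lambda>h. fst h * (c * G (c *\<^sub>R z + v)) + snd h * (c * H (c *\<^sub>R z + v)))) (at z)"
proof -
  have "((\<lambda>s. c *\<^sub>R s + v) has_derivative (\<lambda>h. c *\<^sub>R h)) (at z)"
    by (auto intro!: derivative_eq_intros)
  from has_derivative_compose[OF this assms]
  show ?thesis by (rule has_derivative_eq_rhs) (auto simp: algebra_simps)
qed

lemma Ck_on_affine_compose:
  "Ck_on k UNIV f \<Longrightarrow> Ck_on k UNIV (\<lambda>s. f (c *\<^sub>R s + v))"
proof (induction k arbitrary: f)
  case 0
  then have "continuous_on UNIV f" by simp
  then show ?case by (auto intro!: continuous_intros continuous_on_compose2[of UNIV f])
next
  case (Suc k)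
  then have *: "\<And>z. (f has_derivative (\<lambda>h. fst h * pdx UNIV f z + snd h * pdy UNIV f z)) (at z)"
    using Ck_on_Suc_UNIV_iff by blast
  have "Ck_on k UNIV (pdx UNIV f)" "Ck_on k UNIV (pdy UNIV f)" using Suc.prems by auto
  from this[THEN Suc.IH] show ?case
    by (intro Ck_on_Suc_UNIV(1)[OF has_derivative_affine_compose[OF *]] Ck_on_mult Ck_on_const)
qed

lemma smooth_mult: "smooth f \<Longrightarrow> smooth g \<Longrightarrow> smooth (\<lambda>z. f z * g z)"
  and smooth_const: "smooth (\<lambda>z. c)"
  and smooth_affine_compose: "smooth f \<Longrightarrow> smooth (\<lambda>s. f (c *\<^sub>R s + v))"
  by (simp_all add: smooth_def Ck_on_mult Ck_on_const Ck_on_affine_compose)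

lemma pd_affine_compose:
  assumes "smooth f"
  shows "pdx UNIV (\<lambda>s. f (c *\<^sub>R s + v)) = (\<lambda>s. c * pdx UNIV f (c *\<^sub>R s + v))"
    "pdy UNIV (\<lambda>s. f (c *\<^sub>R s + v)) = (\<lambda>s. c * pdy UNIV f (c *\<^sub>R s + v))"
proof -
  have "Ck_on 0 UNIV (\<lambda>s. c * pdx UNIV f (c *\<^sub>R s + v))" "Ck_on 0 UNIV (\<lambda>s. c * pdy UNIV f (c *\<^sub>R s + v))"
    using smooth_mult[OF smooth_const smooth_affine_compose] assms smooth_pdx smooth_pdy
    unfolding smooth_def by blast+
  note Ck_on_Suc_UNIV[OF has_derivative_affine_compose[OF smooth_has_derivative[OF assms]] this]
  then show "pdx UNIV (\<lambda>s. f (c *\<^sub>R s + v)) = (\<lambda>s. c * pdx UNIV f (c *\<^sub>R s + v))"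
    "pdy UNIV (\<lambda>s. f (c *\<^sub>R s + v)) = (\<lambda>s. c * pdy UNIV f (c *\<^sub>R s + v))" by auto
qed

lemma smooth_DERIV_fst:
  assumes "smooth f"
  shows "((\<lambda>t. f (t, y)) has_real_derivative pdx UNIV f (x, y)) (at x within S)"
proof -
  have "((\<lambda>t. (t, y)) has_derivative (\<lambda>h. (h, 0))) (at x within S)"
    by (auto intro!: derivative_eq_intros)
  from has_derivative_compose[OF this smooth_has_derivative[OF assms]]
  show ?thesis by (simp add: has_field_derivative_def mult.commute mult_commute_abs)
qed

lemma smooth_DERIV_snd:
  assumes "smooth f"
  shows "((\<lambda>t. f (x, t)) has_real_derivative pdy UNIV f (x, y)) (at y within S)"
proof -
  have "((\<lambda>t. (x, t)) has_derivative (\<lambda>h. (0, h))) (at y within S)"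
    by (auto intro!: derivative_eq_intros)
  from has_derivative_compose[OF this smooth_has_derivative[OF assms]]
  show ?thesis by (simp add: has_field_derivative_def mult.commute mult_commute_abs)
qed

text \<open>Schwarz's theorem through the fundamental theorem: an increment of \<open>f\<close> in x
  is the integral of its x-derivative; differentiate in y under the integral, then in x at the upper
  limit.\<close>

lemma pdx_pdy_commute:
  assumes f: "smooth f"
  shows "pdx UNIV (pdy UNIV f) = pdy UNIV (pdx UNIV f)"
proof
  fix z :: "real \<times> real"
  obtain x y where z: "z = (x, y)" by force
  let ?g = "pdy UNIV (pdx UNIV f)"
  \<comment> \<open>With a base point left of x, the point x is interior to
    \<open>{x0..x+1}\<close>, so the derivative of the integral within this interval is
    two-sided.\<close>
  define x0 where "x0 = x - 1"
  note [continuous_intros] = smooth_continuous_on[OF f]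
    smooth_continuous_on[OF smooth_pdx[OF f]] smooth_continuous_on[OF smooth_pdy[OF f]]
    continuous_on_compose2[OF smooth_continuous_on[OF smooth_pdy[OF smooth_pdx[OF f]], where S=UNIV]]
    continuous_on_compose2[OF smooth_continuous_on[OF smooth_pdx[OF f], where S=UNIV]]
  have eq: "f (t, s) - f (x0, s) = integral {x0..t} (\<lambda>r. pdx UNIV f (r, s))" if "x0 \<le> t" for t s
    using fundamental_theorem_of_calculus[OF that, of "\<lambda>r. f (r, s)" "\<lambda>r. pdx UNIV f (r, s)"]
      smooth_DERIV_fst[OF f]
    by (auto simp: has_real_derivative_iff_has_vector_derivative dest!: integral_unique)
  have eq2: "pdy UNIV f (t, y) - pdy UNIV f (x0, y) = integral {x0..t} (\<lambda>r. ?g (r, y))" if "x0 \<le> t" for t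
  proof -
    have "((\<lambda>s. integral (cbox x0 t) (\<lambda>r. pdx UNIV f (r, s))) has_real_derivative
            integral (cbox x0 t) (\<lambda>r. ?g (r, y))) (at y within UNIV)"
    proof (rule leibniz_rule_field_derivative)
      show "(\<lambda>r. pdx UNIV f (r, s)) integrable_on cbox x0 t" for s
        by (rule integrable_continuous) (auto intro!: continuous_intros)
    qed (auto intro!: smooth_DERIV_snd smooth_pdx f continuous_intros simp: split_beta)
    moreover have "((\<lambda>s. f (t, s) - f (x0, s)) has_real_derivative pdy UNIV f (t, y) - pdy UNIV f (x0, y)) (at y)"
      by (intro DERIV_diff smooth_DERIV_snd f)
    ultimately show ?thesis
      using DERIV_unique eq that by (simp add: eq[OF that])
  qed
  have "((\<lambda>t. integral {x0..t} (\<lambda>r. ?g (r, y))) has_real_derivative ?g (x, y)) (at x within {x0..x+1})"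
    by (rule integral_has_real_derivative) (auto intro!: continuous_intros simp: x0_def)
  then have "((\<lambda>t. integral {x0..t} (\<lambda>r. ?g (r, y)) + pdy UNIV f (x0, y)) has_real_derivative ?g (x, y)) (at x within {x0..x+1})"
    by (auto intro!: derivative_eq_intros)
  then have "((\<lambda>t. pdy UNIV f (t, y)) has_real_derivative ?g (x, y)) (at x within {x0..x+1})"
  proof (rule has_field_derivative_transform_within[where d=1])
    show "integral {x0..t} (\<lambda>r. ?g (r, y)) + pdy UNIV f (x0, y) = pdy UNIV f (t, y)"
      if "t \<in> {x0..x + 1}" for t
      using eq2[of t] that by simp
  qed (auto simp: x0_def)
  then have "((\<lambda>t. pdy UNIV f (t, y)) has_real_derivative ?g (x, y)) (at x)"
    by (simp add: x0_def at_within_Icc_at)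
  with smooth_DERIV_fst[OF smooth_pdy[OF f], of y x UNIV] show "pdx UNIV (pdy UNIV f) z = ?g z"
    using DERIV_unique z by blast
qed

text \<open>\<open>classical_D\<close> differentiates in y first, so an extra x-derivative on the
  inside has to be moved past all y-derivatives, whereas an extra y-derivative is already in
  place.\<close>

lemma pdx_classical_D_commute:
  assumes "smooth f"
  shows "classical_D (a, b) (pdx UNIV f) = classical_D (Suc a, b) f"
    "classical_D (a, b) (pdy UNIV f) = classical_D (a, Suc b) f"
proof -
  have "(pdy UNIV ^^ b) (pdx UNIV f) = pdx UNIV ((pdy UNIV ^^ b) f) \<and> smooth ((pdy UNIV ^^ b) f)"
    using assms by (induction b) (auto simp: pdx_pdy_commute smooth_pdy)
  then show "classical_D (a, b) (pdx UNIV f) = classical_D (Suc a, b) f"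
    by (simp add: classical_D_def funpow_swap1)
qed (simp add: classical_D_def funpow_swap1)

subsection \<open>Test functions\<close>

text \<open>The polynomial parameter closes the family under differentiation: for t > 0 the
  derivative of q(1/t) exp(-1/t) is (q - q')(1/t) / t^2 times the exponential, the same expression
  with the polynomial X^2 (q - q').\<close>

definition flat :: "real poly \<Rightarrow> real \<Rightarrow> real" where
  "flat q t = (if t > 0 then poly q (1 / t) * exp (- (1 / t)) else 0)"

lemma poly_exp_tendsto_0: "((\<lambda>x. poly q x * exp (- x)) \<longlongrightarrow> (0::real)) at_top"
proof -
  have "((\<lambda>x. \<Sum>i\<le>degree q. coeff q i * (x ^ i / exp x)) \<longlongrightarrow> (\<Sum>i\<le>degree q. coeff q i * 0)) at_top"
    by (intro tendsto_intros tendsto_power_div_exp_0)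
  then show ?thesis
    by (simp add: poly_altdef exp_minus sum_distrib_right divide_inverse mult.assoc)
qed

lemma flat_DERIV: "(flat q has_real_derivative flat ([:0, 0, 1:] * (q - pderiv q)) t) (at t)"
proof -
  consider "t > 0" | "t < 0" | "t = 0" by linarith
  then show ?thesis
  proof cases
    case 1
    have "((\<lambda>t. poly q (1 / t) * exp (- (1 / t))) has_real_derivative flat ([:0, 0, 1:] * (q - pderiv q)) t) (at t)"
      using 1 by (auto intro!: derivative_eq_intros DERIV_chain2[OF poly_DERIV] simp: flat_def field_simps power2_eq_square)
    then show ?thesis
      by (rule has_field_derivative_transform_within_open[where S="{0<..}"]) (use 1 in \<open>auto simp: flat_def\<close>)
  next
    case 2
    have "((\<lambda>t. 0) has_real_derivative flat ([:0, 0, 1:] * (q - pderiv q)) t) (at t)"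
      using 2 by (auto simp: flat_def)
    then show ?thesis
      by (rule has_field_derivative_transform_within_open[where S="{..<0}"]) (use 2 in \<open>auto simp: flat_def\<close>)
  next
    case 3
    \<comment> \<open>For h > 0 the difference quotient at 0 has the same shape, with the polynomial
      X q in 1/h, and the exponential wins.\<close>
    have r: "((\<lambda>h. flat q h / h) \<longlongrightarrow> 0) (at_right 0)"
    proof -
      have "((\<lambda>h. poly ([:0,1:] * q) (inverse h) * exp (- inverse h)) \<longlongrightarrow> 0) (at_right (0::real))"
        by (rule filterlim_compose[OF poly_exp_tendsto_0 filterlim_inverse_at_top_right])
      then show ?thesis
        by (rule Lim_transform_eventually)
          (auto simp: flat_def eventually_at_filter field_simps inverse_eq_divide)
    qed
    have l: "((\<lambda>h. flat q h / h) \<longlongrightarrow> 0) (at_left 0)"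
      by (rule Lim_transform_eventually[OF tendsto_const])
        (auto simp: flat_def eventually_at_filter)
    show ?thesis
      using filterlim_split_at[OF l r] 3 by (simp add: DERIV_def flat_def)
  qed
qed

text \<open>The scalar \<open>c\<close> and the polynomial stay free in the induction because each
  differentiation produces a factor \<open>\<alpha>\<close> or \<open>\<beta>\<close> and a new
  polynomial. The affine argument gives one-sided cut-offs in either coordinate direction.\<close>

lemma Ck_on_flat: "Ck_on k UNIV (\<lambda>z. c * flat q (\<alpha> * fst z + \<beta> * snd z + \<gamma>))"
proof (induction k arbitrary: c q)
  case 0
  have "continuous_on UNIV (flat q)"
    using flat_DERIV by (meson DERIV_continuous_on has_field_derivative_at_within)
  then show ?case by (auto intro!: continuous_intros continuous_on_compose2[of UNIV "flat q"])
next
  case (Suc k)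
  let ?q = "[:0, 0, 1:] * (q - pderiv q)"
  show ?case
  proof (rule Ck_on_Suc_UNIV(1)[OF _ Suc[of "c * \<alpha>" ?q] Suc[of "c * \<beta>" ?q]])
    fix z :: "real \<times> real"
    have 1: "((\<lambda>z. \<alpha> * fst z + \<beta> * snd z + \<gamma>) has_derivative (\<lambda>h. \<alpha> * fst h + \<beta> * snd h)) (at z)"
      by (auto intro!: derivative_eq_intros)
    have "((\<lambda>z. flat q (\<alpha> * fst z + \<beta> * snd z + \<gamma>)) has_derivative
       (\<lambda>h. flat ?q (\<alpha> * fst z + \<beta> * snd z + \<gamma>) * (\<alpha> * fst h + \<beta> * snd h))) (at z)"
      using has_derivative_compose[OF 1 flat_DERIV[unfolded has_field_derivative_def, of q]] .
    then show "((\<lambda>z. c * flat q (\<alpha> * fst z + \<beta> * snd z + \<gamma>)) has_derivative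
       (\<lambda>h. fst h * (c * \<alpha> * flat ?q (\<alpha> * fst z + \<beta> * snd z + \<gamma>)) + snd h * (c * \<beta> * flat ?q (\<alpha> * fst z + \<beta> * snd z + \<gamma>)))) (at z)"
      by (auto intro!: derivative_eq_intros simp: algebra_simps)
  qed
qed

lemma test_functionsI:
  assumes "smooth f" "compact K" "K \<subseteq> \<Omega>" "\<And>z. z \<notin> K \<Longrightarrow> f z = 0"
  shows "f \<in> test_functions \<Omega>"
proof -
  have "closure {z. f z \<noteq> 0} \<subseteq> K"
    using assms(2,4) by (metis (mono_tags, lifting) closure_minimal compact_imp_closed mem_Collect_eq subsetI)
  moreover from this have "compact (closure {z. f z \<noteq> 0})"
    using assms(2) by (metis closed_closure compact_Int_closed inf.absorb_iff2)
  ultimately show ?thesis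
    using assms by (auto simp: test_functions_def)
qed

lemma test_functions_support:
  assumes "f \<in> test_functions \<Omega>"
  obtains K where "compact K" "K \<subseteq> \<Omega>" "\<And>z. z \<notin> K \<Longrightarrow> f z = 0" 
proof (rule that[of "closure {z. f z \<noteq> 0}"])
  show "f z = 0" if "z \<notin> closure {z. f z \<noteq> 0}" for z
    using that closure_subset[of "{z. f z \<noteq> 0}"] by blast
qed (use assms in \<open>simp_all add: test_functions_def\<close>)

lemma test_functions_smooth: "f \<in> test_functions \<Omega> \<Longrightarrow> smooth f"
  by (simp add: test_functions_def)

text \<open>Off its closed support the function vanishes on an open set, so its derivative vanishes
  there as well.\<close>

lemma test_functions_pd:
  assumes "f \<in> test_functions \<Omega>"
  shows "pdx UNIV f \<in> test_functions \<Omega>" "pdy UNIV f \<in> test_functions \<Omega>"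
proof -
  let ?K = "closure {z. f z \<noteq> 0}"
  have "pdx UNIV f z = 0 \<and> pdy UNIV f z = 0" if "z \<notin> ?K" for z
  proof -
    have "((\<lambda>z. 0) has_derivative (\<lambda>h. 0)) (at z)" by simp
    moreover have "0 = f s" if "s \<in> - ?K" for s
      using that closure_subset[of "{z. f z \<noteq> 0}"] by (metis (mono_tags) ComplD mem_Collect_eq subsetD)
    moreover have "open (- ?K)" by (intro open_Compl closed_closure)
    ultimately have "(f has_derivative (\<lambda>h. 0)) (at z)"
      using that has_derivative_transform_within_open[of "\<lambda>z. 0" "\<lambda>h. 0" z UNIV "- ?K" f] by blast
    then show ?thesis by (simp add: pdx_def pdy_def frechet_derivative_at[symmetric])
  qed
  moreover have "smooth f" "compact ?K" "?K \<subseteq> \<Omega>" using assms by (simp_all add: test_functions_def)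
  ultimately show "pdx UNIV f \<in> test_functions \<Omega>" "pdy UNIV f \<in> test_functions \<Omega>"
    using test_functionsI smooth_pdx smooth_pdy by metis+
qed

lemma test_functions_mono: "\<Omega> \<subseteq> \<Omega>' \<Longrightarrow> f \<in> test_functions \<Omega> \<Longrightarrow> f \<in> test_functions \<Omega>'"
  by (auto simp: test_functions_def)

lemma ex_bump:
  fixes a b c d :: real
  assumes "a < b" "c < d"
  obtains \<kappa> where "\<kappa> \<in> test_functions (box (a, c) (b, d))" "\<And>z. \<kappa> z \<ge> 0"
    "integrable lborel \<kappa>" "(\<integral>z. \<kappa> z \<partial>lborel) = 1"
proof -
  \<comment> \<open>The middle thirds: the support is a closed rectangle inside the open
    one.\<close>
  define a' b' c' d' where "a' = (2*a+b)/3" "b' = (a+2*b)/3" "c' = (2*c+d)/3" "d' = (c+2*d)/3"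
  note ends = this
  define k where "k z = flat 1 (fst z - a') * flat 1 (b' - fst z) * (flat 1 (snd z - c') * flat 1 (d' - snd z))" for z
  let ?K = "cbox (a', c') (b', d')"
  have flat_nonneg: "flat 1 t \<ge> 0" for t by (simp add: flat_def)
  have ord: "a < a'" "a' < b'" "b' < b" "c < c'" "c' < d'" "d' < d" using assms by (auto simp: ends)
  have K: "?K \<subseteq> box (a, c) (b, d)"
    using ord by (auto simp: mem_box Basis_prod_def)
  have "smooth k"
    unfolding k_def
    using Ck_on_flat[of _ 1 1 1 0 "-a'"] Ck_on_flat[of _ 1 1 "-1" 0 "b'"] Ck_on_flat[of _ 1 1 0 1 "-c'"] Ck_on_flat[of _ 1 1 0 "-1" "d'"]
    by (intro smooth_mult) (auto simp: smooth_def algebra_simps)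
  have out: "k z = 0" if "z \<notin> ?K" for z
    using that by (cases z) (auto simp: k_def flat_def)
  have "k \<in> test_functions (box (a, c) (b, d))"
    by (rule test_functionsI[OF \<open>smooth k\<close> _ K out]) auto
  have nn: "k z \<ge> 0" for z by (simp add: k_def flat_nonneg)
  have cont: "continuous_on ?K k" using smooth_continuous_on[OF \<open>smooth k\<close>] .
  have keq: "k = (\<lambda>z. indicator ?K z *\<^sub>R k z)" by (rule ext) (metis indicator_simps out scaleR_one scaleR_zero_left)
  have int: "integrable lborel k"
    by (subst keq, rule borel_integrable_compact[OF _ cont]) auto
  \<comment> \<open>Normalisation needs a positive integral. If it were 0, the continuous
    nonnegative \<open>k\<close> would vanish on the rectangle, but it is positive at the
    centre.\<close>
  have "(\<integral>z. k z \<partial>lborel) \<noteq> 0"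
  proof
    assume "(\<integral>z. k z \<partial>lborel) = 0"
    moreover have "(k has_integral (\<integral>z. k z \<partial>lborel)) UNIV"
      by (rule has_integral_integral_lborel[OF int])
    ultimately have "((\<lambda>z. if z \<in> ?K then k z else 0) has_integral 0) UNIV"
      using out by (smt (verit, ccfv_SIG) has_integral_cong)
    then have "(k has_integral 0) ?K"
      using has_integral_restrict_UNIV by blast
    moreover have "((a'+b')/2, (c'+d')/2) \<in> box (a',c') (b',d')" using ord by (auto simp: mem_box Basis_prod_def)
    moreover have "((a'+b')/2, (c'+d')/2) \<in> ?K" using ord by (auto simp: mem_box Basis_prod_def)
    ultimately have "k ((a'+b')/2, (c'+d')/2) = 0"
      using has_integral_0_cbox_imp_0[OF cont nn] by blast
    then show False using ord by (auto simp: k_def flat_def)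
  qed
  moreover have "(\<integral>z. k z \<partial>lborel) \<ge> 0" by (simp add: nn)
  ultimately have pos: "(\<integral>z. k z \<partial>lborel) > 0" by linarith
  show ?thesis
  proof (rule that[of "\<lambda>z. k z / (\<integral>z. k z \<partial>lborel)"])
    have "smooth (\<lambda>z. k z / (\<integral>z. k z \<partial>lborel))"
      using smooth_mult[OF \<open>smooth k\<close> smooth_const[of "1 / (\<integral>z. k z \<partial>lborel)"]] by simp
    then show "(\<lambda>z. k z / (\<integral>z. k z \<partial>lborel)) \<in> test_functions (box (a, c) (b, d))"
      by (rule test_functionsI[OF _ _ K]) (use out in auto)
  qed (use pos nn int in auto)
qed

subsection \<open>Mollification\<close>

lemma test_functions_bounded:
  assumes "f \<in> test_functions \<Omega>"
  obtains B where "B > 0" "\<And>z. \<bar>f z\<bar> \<le> B"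
proof -
  obtain K where K: "compact K" "\<And>z. z \<notin> K \<Longrightarrow> f z = 0"
    using test_functions_support[OF assms] by metis
  have "bounded (f ` K)"
    using smooth_continuous_on[OF test_functions_smooth[OF assms]] K(1) compact_continuous_image compact_imp_bounded by blast
  then obtain B where B: "B > 0" "\<And>z. z \<in> K \<Longrightarrow> \<bar>f z\<bar> \<le> B"
    by (auto simp: bounded_pos)
  show ?thesis
  proof (rule that[OF B(1)])
    show "\<bar>f z\<bar> \<le> B" for z using B K(2)[of z] by (cases "z \<in> K") auto
  qed
qed

lemma test_functions_uniformly_continuous:
  assumes "f \<in> test_functions \<Omega>"
  shows "uniformly_continuous_on UNIV f"
proof -
  obtain K where K: "compact K" "\<And>z. z \<notin> K \<Longrightarrow> f z = 0"
    using test_functions_support[OF assms] by metis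
  obtain R where R: "\<And>z. z \<in> K \<Longrightarrow> norm z \<le> R"
    using compact_imp_bounded[OF K(1)] by (auto simp: bounded_iff)
  \<comment> \<open>The radius is enlarged by 1: of two points closer than 1, either both lie in the
    ball or both lie outside the support.\<close>
  let ?C = "cball 0 (R + 1) :: (real \<times> real) set"
  have uc: "uniformly_continuous_on ?C f"
    using smooth_continuous_on[OF test_functions_smooth[OF assms]] by (intro compact_uniformly_continuous) auto
  show ?thesis
    unfolding uniformly_continuous_on_def
  proof (intro allI impI)
    fix e :: real assume "e > 0"
    then obtain d where d: "d > 0" "\<And>x y. x \<in> ?C \<Longrightarrow> y \<in> ?C \<Longrightarrow> dist y x < d \<Longrightarrow> dist (f y) (f x) < e"
      using uc by (auto simp: uniformly_continuous_on_def)
    have "dist (f y) (f x) < e" if "dist y x < min d 1" for x y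
    proof (cases "x \<in> ?C \<and> y \<in> ?C")
      case True then show ?thesis using d that by auto
    next
      case False
      have "norm y \<le> norm x + 1" "norm x \<le> norm y + 1"
        using that norm_triangle_sub[of y x] norm_triangle_sub[of x y] by (auto simp: dist_norm norm_minus_commute)
      then have "norm x > R" "norm y > R" using False by auto
      then have "x \<notin> K" "y \<notin> K" using R[of x] R[of y] by auto
      then have "f x = 0" "f y = 0" by (auto intro: K(2))
      then show ?thesis using \<open>e > 0\<close> by simp
    qed
    then show "\<exists>d>0. \<forall>x\<in>UNIV. \<forall>y\<in>UNIV. dist y x < d \<longrightarrow> dist (f y) (f x) < e"
      using d(1) by (metis min_less_iff_conj zero_less_one)
  qed
qed

text \<open>Uniformity in \<open>z\<close> lets the remainder be integrated against a merely
  integrable weight, which is how mollifications are differentiated. It follows from uniform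
  continuity of the partial derivatives and the mean value inequality on a ball.\<close>

lemma test_functions_uniform_derivative:
  assumes f: "f \<in> test_functions \<Omega>" and "e > 0"
  obtains d where "d > 0"
    "\<And>z h. norm h < d \<Longrightarrow> \<bar>f (z + h) - f z - (fst h * pdx UNIV f z + snd h * pdy UNIV f z)\<bar> \<le> e * norm h"
proof -
  have uc: "\<exists>d>0. \<forall>x y. dist y x < d \<longrightarrow> dist (g y) (g x) < e / 2" if "g \<in> test_functions \<Omega>" for g
    using test_functions_uniformly_continuous[OF that] half_gt_zero[OF \<open>e > 0\<close>]
    unfolding uniformly_continuous_on_def by blast
  obtain d1 where d1: "d1 > 0" "\<And>x y. dist y x < d1 \<Longrightarrow> dist (pdx UNIV f y) (pdx UNIV f x) < e / 2"
    using uc[OF test_functions_pd(1)[OF f]] by blast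
  obtain d2 where d2: "d2 > 0" "\<And>x y. dist y x < d2 \<Longrightarrow> dist (pdy UNIV f y) (pdy UNIV f x) < e / 2"
    using uc[OF test_functions_pd(2)[OF f]] by blast
  show ?thesis
  proof (rule that[of "min d1 d2"])
    fix z h :: "real \<times> real" assume h: "norm h < min d1 d2"
    let ?D = "\<lambda>z h. fst h * pdx UNIV f z + snd h * pdy UNIV f z"
    let ?S = "ball z (min d1 d2)"
    have on: "onorm (?D x - ?D z) \<le> e" if "x \<in> ?S" for x
    proof (rule onorm_bound)
      show "norm ((?D x - ?D z) k) \<le> e * norm k" for k
      proof -
        have "(?D x - ?D z) k = fst k * (pdx UNIV f x - pdx UNIV f z) + snd k * (pdy UNIV f x - pdy UNIV f z)"
          by (simp add: algebra_simps)
        then have "norm ((?D x - ?D z) k) \<le> \<bar>fst k\<bar> * \<bar>pdx UNIV f x - pdx UNIV f z\<bar> + \<bar>snd k\<bar> * \<bar>pdy UNIV f x - pdy UNIV f z\<bar>"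
          by (simp only: real_norm_def abs_mult[symmetric] abs_triangle_ineq)
        also have "\<dots> \<le> norm k * (e / 2) + norm k * (e / 2)"
        proof -
          have "dist x z < d1" "dist x z < d2" using that by (simp_all add: dist_commute)
          from d1(2)[OF this(1)] d2(2)[OF this(2)] norm_fst_le[of "fst k" "snd k"] norm_snd_le[of "snd k" "fst k"]
          show ?thesis by (intro add_mono mult_mono) (simp_all add: dist_real_def)
        qed
        finally show ?thesis by (simp add: algebra_simps)
      qed
    qed (use \<open>e > 0\<close> in simp)
    have "norm (f (z + h) - f z - ?D z (z + h - z)) \<le> norm (z + h - z) * e"
    proof (rule differentiable_bound_linearization[where f'="?D" and S="?S", OF _ _ on])
      show "z + t *\<^sub>R (z + h - z) \<in> ?S" if "t \<in> {0..1}" for t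
      proof -
        have "norm (t *\<^sub>R h) \<le> norm h" using that mult_left_le_one_le[of "norm h" t] by auto
        then show ?thesis using h by (auto simp: dist_norm)
      qed
      show "(f has_derivative ?D x) (at x within ?S)" for x
        using smooth_has_derivative[OF test_functions_smooth[OF f]] has_derivative_at_withinI by blast
    qed (simp_all add: d1(1) d2(1))
    then show "\<bar>f (z + h) - f z - ?D z h\<bar> \<le> e * norm h" by (simp add: mult.commute)
  qed (simp add: d1(1) d2(1))
qed

lemma integrable_mult_bounded:
  fixes w g :: "'a \<Rightarrow> real"
  assumes "integrable M w" "g \<in> borel_measurable M" "\<And>x. \<bar>g x\<bar> \<le> B"
  shows "integrable M (\<lambda>x. w x * g x)"
proof (rule Bochner_Integration.integrable_bound[of M "\<lambda>x. B * w x"])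
  have "B \<ge> 0" using assms(3) by (meson abs_ge_zero order_trans)
  then show "AE x in M. norm (w x * g x) \<le> norm (B * w x)"
    using assms(3) by (intro AE_I2) (simp add: abs_mult mult.commute mult_right_mono)
qed (use assms in auto)

lemma test_functions_affine_measurable:
  assumes "K \<in> test_functions \<Omega>"
  shows "(\<lambda>s. K (\<alpha> *\<^sub>R s + v)) \<in> borel_measurable borel"
  by (intro borel_measurable_continuous_onI smooth_continuous_on smooth_affine_compose
      test_functions_smooth[OF assms])

text \<open>Two independent scale factors instead of a convolution, because the contraction used
  below moves \<open>s\<close> and \<open>z\<close> with different weights.\<close>

definition mollify ::
  "(real \<times> real \<Rightarrow> real) \<Rightarrow> real \<Rightarrow> real \<Rightarrow> (real \<times> real \<Rightarrow> real) \<Rightarrow> real \<times> real \<Rightarrow> real" where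
  "mollify K \<alpha> \<beta> w z = (\<integral>s. w s * K (\<alpha> *\<^sub>R s + \<beta> *\<^sub>R z) \<partial>lborel)"

lemma mollify_integrable:
  assumes "K \<in> test_functions \<Omega>" "integrable lborel w"
  shows "integrable lborel (\<lambda>s. w s * K (\<alpha> *\<^sub>R s + v))"
proof -
  obtain B where B: "\<And>z. \<bar>K z\<bar> \<le> B" using test_functions_bounded[OF assms(1)] by metis
  show ?thesis
    by (rule integrable_mult_bounded[OF assms(2) _ B])
      (use test_functions_affine_measurable[OF assms(1)] in simp)
qed

lemma mollify_has_derivative:
  assumes K: "K \<in> test_functions \<Omega>" and w: "integrable lborel w"
  shows "(mollify K \<alpha> \<beta> w has_derivative
    (\<lambda>h. fst h * (\<beta> * mollify (pdx UNIV K) \<alpha> \<beta> w z) + snd h * (\<beta> * mollify (pdy UNIV K) \<alpha> \<beta> w z))) (at z)"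
  (is "(_ has_derivative ?D) _")
  unfolding has_derivative_at_alt
proof (intro conjI allI impI)
  have "linear ?D" by (auto intro!: linearI simp: algebra_simps)
  then show "bounded_linear ?D" by (rule linear_conv_bounded_linear[THEN iffD1])
next
  fix e :: real assume "e > 0"
  define W where "W = (\<integral>s. \<bar>w s\<bar> \<partial>lborel)"
  have "W \<ge> 0" by (simp add: W_def)
  \<comment> \<open>The added 1 keeps the denominator positive when \<open>\<beta>\<close> or the
    integral of |w| is 0.\<close>
  define e' where "e' = e / (\<bar>\<beta>\<bar> * W + 1)"
  have "e' > 0" using \<open>e > 0\<close> \<open>W \<ge> 0\<close> by (simp add: e'_def add_nonneg_pos)
  obtain d where d: "d > 0"
    "\<And>z h. norm h < d \<Longrightarrow> \<bar>K (z + h) - K z - (fst h * pdx UNIV K z + snd h * pdy UNIV K z)\<bar> \<le> e' * norm h"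
    using test_functions_uniform_derivative[OF K \<open>e' > 0\<close>] by metis
  have "norm (mollify K \<alpha> \<beta> w y - mollify K \<alpha> \<beta> w z - ?D (y - z)) \<le> e * norm (y - z)"
    if y: "norm (y - z) < d / (\<bar>\<beta>\<bar> + 1)" for y
  proof -
    let ?h = "\<beta> *\<^sub>R (y - z)"
    note int = mollify_integrable[OF _ w]
    have "\<bar>\<beta>\<bar> * norm (y - z) \<le> norm (y - z) * (\<bar>\<beta>\<bar> + 1)" by (simp add: algebra_simps)
    also have "\<dots> < d" using y by (simp add: field_simps)
    finally have h: "norm ?h < d" by simp
    let ?R = "\<lambda>s. w s * (K (\<alpha> *\<^sub>R s + \<beta> *\<^sub>R z + ?h) - K (\<alpha> *\<^sub>R s + \<beta> *\<^sub>R z)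
        - (fst ?h * pdx UNIV K (\<alpha> *\<^sub>R s + \<beta> *\<^sub>R z) + snd ?h * pdy UNIV K (\<alpha> *\<^sub>R s + \<beta> *\<^sub>R z)))"
    have yz: "\<alpha> *\<^sub>R s + \<beta> *\<^sub>R z + ?h = \<alpha> *\<^sub>R s + \<beta> *\<^sub>R y" for s
      by (simp add: algebra_simps)
    have Req: "?R s = w s * K (\<alpha> *\<^sub>R s + \<beta> *\<^sub>R y) - w s * K (\<alpha> *\<^sub>R s + \<beta> *\<^sub>R z)
        - (fst ?h * (w s * pdx UNIV K (\<alpha> *\<^sub>R s + \<beta> *\<^sub>R z)) + snd ?h * (w s * pdy UNIV K (\<alpha> *\<^sub>R s + \<beta> *\<^sub>R z)))" for s
      unfolding yz by (simp add: algebra_simps)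
    have intR: "integrable lborel ?R"
      unfolding Req using int[OF K] int[OF test_functions_pd(1)[OF K]] int[OF test_functions_pd(2)[OF K]]
      by (intro Bochner_Integration.integrable_add Bochner_Integration.integrable_diff integrable_mult_right) auto
    have "(\<integral>s. ?R s \<partial>lborel) = mollify K \<alpha> \<beta> w y - mollify K \<alpha> \<beta> w z - ?D (y - z)"
      unfolding Req mollify_def using int[OF K] int[OF test_functions_pd(1)[OF K]] int[OF test_functions_pd(2)[OF K]]
      by simp
    moreover have "norm (\<integral>s. ?R s \<partial>lborel) \<le> (\<integral>s. \<bar>w s\<bar> * (e' * norm ?h) \<partial>lborel)"
    proof (rule order_trans[OF integral_norm_bound])
      show "(\<integral>s. norm (?R s) \<partial>lborel) \<le> (\<integral>s. \<bar>w s\<bar> * (e' * norm ?h) \<partial>lborel)"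
      proof (rule integral_mono)
        show "norm (?R s) \<le> \<bar>w s\<bar> * (e' * norm ?h)" for s
          unfolding real_norm_def abs_mult by (rule mult_left_mono[OF d(2)[OF h]]) simp
      qed (use intR w in auto)
    qed
    moreover have "(\<integral>s. \<bar>w s\<bar> * (e' * norm ?h) \<partial>lborel) = e' * (\<bar>\<beta>\<bar> * W) * norm (y - z)"
      by (simp add: W_def)
    moreover have e'e: "e' * (\<bar>\<beta>\<bar> * W) \<le> e"
    proof -
      have "e' * (\<bar>\<beta>\<bar> * W) \<le> e' * (\<bar>\<beta>\<bar> * W + 1)" using \<open>e' > 0\<close> by simp
      also have "\<dots> = e" using \<open>W \<ge> 0\<close> by (simp add: e'_def add_nonneg_eq_0_iff)
      finally show ?thesis .
    qed
    ultimately have "norm (mollify K \<alpha> \<beta> w y - mollify K \<alpha> \<beta> w z - ?D (y - z)) \<le> e' * (\<bar>\<beta>\<bar> * W) * norm (y - z)"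
      by metis
    also have "\<dots> \<le> e * norm (y - z)" by (rule mult_right_mono[OF e'e]) simp
    finally show ?thesis .
  qed
  moreover have "d / (\<bar>\<beta>\<bar> + 1) > 0" using d by (simp add: add_nonneg_pos)
  ultimately show "\<exists>d>0. \<forall>y. norm (y - z) < d \<longrightarrow>
      norm (mollify K \<alpha> \<beta> w y - mollify K \<alpha> \<beta> w z - ?D (y - z)) \<le> e * norm (y - z)" by blast
qed

text \<open>A derivative of a mollification is a multiple of a mollification with a derivative of
  the kernel, so the induction runs over all kernels while \<open>w\<close> stays fixed.\<close>

lemma smooth_mollify:
  assumes "K \<in> test_functions \<Omega>" "integrable lborel w"
  shows "smooth (mollify K \<alpha> \<beta> w)"
proof -
  have "Ck_on k UNIV (mollify K \<alpha> \<beta> w)" for k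
    using assms(1)
  proof (induction k arbitrary: K)
    case 0
    show ?case
      by (simp add: continuous_at_imp_continuous_on has_derivative_continuous[OF mollify_has_derivative[OF 0 assms(2)]])
  next
    case (Suc k)
    show ?case
      by (rule Ck_on_Suc_UNIV(1)[OF mollify_has_derivative[OF Suc.prems assms(2)]])
        (intro Ck_on_mult Ck_on_const Suc.IH test_functions_pd[OF Suc.prems])+
  qed
  then show ?thesis by (simp add: smooth_def)
qed

lemma nn_integral_affine:
  fixes f :: "real \<times> real \<Rightarrow> ennreal"
  assumes [measurable]: "f \<in> borel_measurable borel" and "c \<noteq> 0"
  shows "(\<integral>\<^sup>+z. f (v + c *\<^sub>R z) \<partial>lborel) = ennreal (1 / c\<^sup>2) * (\<integral>\<^sup>+z. f z \<partial>lborel)"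
proof -
  have "(\<integral>\<^sup>+z. f z \<partial>lborel) = ennreal (c\<^sup>2) * (\<integral>\<^sup>+z. f (v + c *\<^sub>R z) \<partial>lborel)"
    by (subst lborel_affine[OF \<open>c \<noteq> 0\<close>, of v])
      (simp add: nn_integral_density nn_integral_distr nn_integral_cmult power2_eq_square)
  then have "ennreal (1 / c\<^sup>2) * (\<integral>\<^sup>+z. f z \<partial>lborel) = (ennreal (1 / c\<^sup>2) * ennreal (c\<^sup>2)) * (\<integral>\<^sup>+z. f (v + c *\<^sub>R z) \<partial>lborel)"
    by (simp add: mult.assoc)
  also have "ennreal (1 / c\<^sup>2) * ennreal (c\<^sup>2) = 1"
    using assms by (simp flip: ennreal_mult)
  finally show ?thesis by simp
qed

text \<open>Tonelli: integrated over \<open>z\<close> first, the kernel contributes its own integral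
  divided by \<open>\<beta>\<^sup>2\<close>, whatever \<open>s\<close> is.\<close>

lemma nn_integral_mollify_le:
  assumes K: "K \<in> test_functions \<Omega>" "\<And>z. K z \<ge> 0" and w: "integrable lborel w" and "\<beta> \<noteq> 0"
  shows "(\<integral>\<^sup>+z. \<bar>mollify K \<alpha> \<beta> w z\<bar> \<partial>lborel) \<le> ennreal (1 / \<beta>\<^sup>2) * (\<integral>\<^sup>+z. K z \<partial>lborel) * (\<integral>\<^sup>+z. \<bar>w z\<bar> \<partial>lborel)"
proof -
  have [measurable]: "w \<in> borel_measurable borel" using w by auto
  have "smooth K" using K test_functions_smooth by blast
  then have [measurable]: "K \<in> borel_measurable borel"
    by (intro borel_measurable_continuous_onI smooth_continuous_on)
  have "(\<integral>\<^sup>+z. \<bar>mollify K \<alpha> \<beta> w z\<bar> \<partial>lborel) \<le> (\<integral>\<^sup>+z. (\<integral>\<^sup>+s. ennreal \<bar>w s\<bar> * K (\<alpha> *\<^sub>R s + \<beta> *\<^sub>R z) \<partial>lborel) \<partial>lborel)"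
  proof (rule nn_integral_mono)
    fix z
    have "ennreal \<bar>mollify K \<alpha> \<beta> w z\<bar> \<le> (\<integral>\<^sup>+s. norm (w s * K (\<alpha> *\<^sub>R s + \<beta> *\<^sub>R z)) \<partial>lborel)"
      unfolding mollify_def
      using integral_norm_bound_ennreal[OF mollify_integrable[OF K(1) w, of \<alpha> "\<beta> *\<^sub>R z"]] by simp
    then show "ennreal \<bar>mollify K \<alpha> \<beta> w z\<bar> \<le> (\<integral>\<^sup>+s. ennreal \<bar>w s\<bar> * K (\<alpha> *\<^sub>R s + \<beta> *\<^sub>R z) \<partial>lborel)"
      using K(2) by (simp add: abs_mult ennreal_mult)
  qed
  also have "\<dots> = (\<integral>\<^sup>+s. (\<integral>\<^sup>+z. ennreal \<bar>w s\<bar> * K (\<alpha> *\<^sub>R s + \<beta> *\<^sub>R z) \<partial>lborel) \<partial>lborel)"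
    by (rule lborel_pair.Fubini') measurable
  also have "\<dots> = (\<integral>\<^sup>+s. ennreal \<bar>w s\<bar> * (ennreal (1 / \<beta>\<^sup>2) * (\<integral>\<^sup>+z. K z \<partial>lborel)) \<partial>lborel)"
    using nn_integral_affine[of "\<lambda>z. ennreal (K z)" \<beta>] \<open>\<beta> \<noteq> 0\<close> by (simp add: nn_integral_cmult)
  also have "\<dots> = ennreal (1 / \<beta>\<^sup>2) * (\<integral>\<^sup>+z. K z \<partial>lborel) * (\<integral>\<^sup>+z. \<bar>w z\<bar> \<partial>lborel)"
    by (simp add: nn_integral_multc mult_ac)
  finally show ?thesis .
qed

text \<open>Induction over the construction of integrable functions: for an indicator, a Urysohn
  function between a closed set inside and an open set outside; sums by adding; limits by dominated
  convergence.\<close>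

lemma integrable_approx_continuous:
  fixes w :: "'a::euclidean_space \<Rightarrow> real"
  assumes "integrable lborel w" "e > 0"
  obtains f where "continuous_on UNIV f" "integrable lborel f" "(\<integral>\<^sup>+z. \<bar>w z - f z\<bar> \<partial>lborel) < ennreal e"
proof -
  have "\<forall>e>0. \<exists>f. continuous_on UNIV f \<and> integrable lborel f \<and> (\<integral>\<^sup>+z. \<bar>w z - f z\<bar> \<partial>lborel) < ennreal e"
    using assms(1)
  proof (induction rule: integrable_induct)
    case (base A c)
    show ?case
    proof (intro allI impI)
      fix e :: real assume "e > 0"
      \<comment> \<open>The error is at most |c| on two sets of measure below \<open>e'\<close>, so
        2 |c| e' has to stay below e; the 1 covers c = 0.\<close>
      define e' where "e' = e / (\<bar>c\<bar> + 1) / 2"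
      have "e' > 0" using \<open>e > 0\<close> by (auto simp: e'_def)
      have A[measurable]: "A \<in> sets borel" and Al: "A \<in> sets lebesgue" using base by auto
      obtain U where U: "open U" "A \<subseteq> U" "emeasure lebesgue (U - A) < ennreal e'"
        using sets_lebesgue_outer_open[OF Al \<open>e' > 0\<close>] by metis
      obtain T where T: "closed T" "T \<subseteq> A" "emeasure lebesgue (A - T) < ennreal e'"
        using sets_lebesgue_inner_closed[OF Al \<open>e' > 0\<close>] by metis
      have "closed (- U)" "T \<inter> - U = {}" using U T by auto
      then obtain g where g: "continuous_on UNIV g" "\<And>x. g x \<in> closed_segment 1 (0::real)"
        "\<And>x. x \<in> T \<Longrightarrow> g x = 1" "\<And>x. x \<in> - U \<Longrightarrow> g x = 0"
        using Urysohn[OF T(1), of "- U"] by metis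
      have g01: "0 \<le> g x \<and> g x \<le> 1" for x using g(2)[of x] by (auto simp: closed_segment_eq_real_ivl)
      have [measurable]: "g \<in> borel_measurable borel" using g(1) borel_measurable_continuous_onI by blast
      have [measurable]: "U \<in> sets borel" "T \<in> sets borel" using U T by auto
      have eU: "emeasure lborel (U - A) < ennreal e'" "emeasure lborel (A - T) < ennreal e'"
        using U(3) T(3) by simp_all
      have "A \<union> (U - A) = U" using U(2) by blast
      then have "emeasure lborel U \<le> emeasure lborel A + emeasure lborel (U - A)"
        using emeasure_subadditive[of A lborel "U - A"] by simp
      moreover have "emeasure lborel (U - A) < \<infinity>"
        using eU(1) by (rule less_trans) simp
      ultimately have "emeasure lborel U < \<infinity>"
        using base(2) by (simp add: ennreal_add_less_top order.strict_trans1)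
      then have intU: "integrable lborel (indicator U :: _ \<Rightarrow> real)" by simp
      have "integrable lborel g"
        by (rule Bochner_Integration.integrable_bound[OF intU]) (use g01 g(4) in \<open>auto simp: indicator_def\<close>)
      then have "integrable lborel (\<lambda>z. c * g z)" by simp
      moreover have "continuous_on UNIV (\<lambda>z. c * g z)" using g(1) by (intro continuous_intros)
      moreover have "(\<integral>\<^sup>+z. \<bar>indicator A z *\<^sub>R c - c * g z\<bar> \<partial>lborel) < ennreal e"
      proof -
        have "(\<integral>\<^sup>+z. \<bar>indicator A z *\<^sub>R c - c * g z\<bar> \<partial>lborel)
            \<le> (\<integral>\<^sup>+z. ennreal \<bar>c\<bar> * (indicator (U - A) z + indicator (A - T) z) \<partial>lborel)"
        proof (rule nn_integral_mono)
          fix z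
          have "\<bar>indicator A z - g z\<bar> \<le> indicator (U - A) z + (indicator (A - T) z :: real)"
            using g01[of z] g(3,4)[of z] U(2) T(2) by (auto simp: indicator_def)
          then have "\<bar>c\<bar> * \<bar>indicator A z - g z\<bar> \<le> \<bar>c\<bar> * (indicator (U - A) z + (indicator (A - T) z :: real))"
            by (rule mult_left_mono) simp
          moreover have "\<bar>indicator A z *\<^sub>R c - c * g z\<bar> = \<bar>c\<bar> * \<bar>indicator A z - g z\<bar>"
            by (simp flip: abs_mult add: algebra_simps)
          ultimately have "ennreal \<bar>indicator A z *\<^sub>R c - c * g z\<bar> \<le> ennreal (\<bar>c\<bar> * (indicator (U - A) z + (indicator (A - T) z :: real)))"
            by (intro ennreal_leI) simp
          also have "\<dots> = ennreal \<bar>c\<bar> * (indicator (U - A) z + indicator (A - T) z)"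
            by (auto simp: indicator_def)
          finally show "ennreal \<bar>indicator A z *\<^sub>R c - c * g z\<bar> \<le> ennreal \<bar>c\<bar> * (indicator (U - A) z + indicator (A - T) z)" .
        qed
        also have "\<dots> = ennreal \<bar>c\<bar> * (emeasure lborel (U - A) + emeasure lborel (A - T))"
          by (simp add: nn_integral_cmult nn_integral_add)
        also have "\<dots> \<le> ennreal \<bar>c\<bar> * (ennreal e' + ennreal e')"
          using eU by (intro mult_left_mono add_mono) auto
        also have "\<dots> = ennreal (\<bar>c\<bar> * (e' + e'))"
          using \<open>e' > 0\<close> by (simp add: ennreal_mult ennreal_plus del: mult_2 add: mult_2[symmetric])
        also have "\<dots> < ennreal e"
        proof (rule ennreal_lessI[OF \<open>e > 0\<close>])
          have "\<bar>c\<bar> * (e' + e') < (\<bar>c\<bar> + 1) * (e' + e')" using \<open>e' > 0\<close> by (intro mult_strict_right_mono) auto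
          also have "\<dots> = e" by (simp add: e'_def field_simps add_nonneg_eq_0_iff)
          finally show "\<bar>c\<bar> * (e' + e') < e" .
        qed
        finally show ?thesis .
      qed
      ultimately show "\<exists>f. continuous_on UNIV f \<and> integrable lborel f \<and> (\<integral>\<^sup>+z. \<bar>indicator A z *\<^sub>R c - f z\<bar> \<partial>lborel) < ennreal e"
        by blast
    qed
  next
    case (add f g)
    show ?case
    proof (intro allI impI)
      fix e :: real assume "e > 0"
      then obtain f' g' where f': "continuous_on UNIV f'" "integrable lborel f'" "(\<integral>\<^sup>+z. \<bar>f z - f' z\<bar> \<partial>lborel) < ennreal (e/2)"
        and g': "continuous_on UNIV g'" "integrable lborel g'" "(\<integral>\<^sup>+z. \<bar>g z - g' z\<bar> \<partial>lborel) < ennreal (e/2)"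
        using add by (meson half_gt_zero)
      have [measurable]: "f \<in> borel_measurable lborel" "g \<in> borel_measurable lborel" "f' \<in> borel_measurable lborel" "g' \<in> borel_measurable lborel"
        using add f' g' by auto
      have "(\<integral>\<^sup>+z. \<bar>f z + g z - (f' z + g' z)\<bar> \<partial>lborel) \<le> (\<integral>\<^sup>+z. ennreal \<bar>f z - f' z\<bar> + ennreal \<bar>g z - g' z\<bar> \<partial>lborel)"
        by (intro nn_integral_mono) (simp flip: ennreal_plus)
      also have "\<dots> = (\<integral>\<^sup>+z. \<bar>f z - f' z\<bar> \<partial>lborel) + (\<integral>\<^sup>+z. \<bar>g z - g' z\<bar> \<partial>lborel)"
        by (rule nn_integral_add) auto
      also have "\<dots> < ennreal (e/2) + ennreal (e/2)" using f'(3) g'(3) by (rule add_strict_mono)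
      also have "\<dots> = ennreal e" using \<open>e > 0\<close> by (simp flip: ennreal_plus)
      finally show "\<exists>h. continuous_on UNIV h \<and> integrable lborel h \<and> (\<integral>\<^sup>+z. \<bar>f z + g z - h z\<bar> \<partial>lborel) < ennreal e"
        using f' g' by (intro exI[of _ "\<lambda>z. f' z + g' z"]) (auto intro!: continuous_intros)
    qed
  next
    case (lim f s)
    show ?case
    proof (intro allI impI)
      fix e :: real assume "e > 0"
      have [measurable]: "f \<in> borel_measurable lborel" "s i \<in> borel_measurable lborel" for i
        using lim by auto
      have "(\<lambda>i. (\<integral>\<^sup>+z. norm (f z - s i z) \<partial>lborel)) \<longlonglongrightarrow> 0"
      proof (rule nn_integral_dominated_convergence_norm[where w="\<lambda>z. 2 * norm (f z)"])
        have "integrable lborel (\<lambda>z. 2 * norm (f z))" using lim by simp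
        then show "(\<integral>\<^sup>+ x. ennreal (2 * norm (f x)) \<partial>lborel) < \<infinity>"
          unfolding integrable_iff_bounded by (simp del: ennreal_mult'' add: abs_mult)
      qed (use lim in auto)
      then have "eventually (\<lambda>i. (\<integral>\<^sup>+z. norm (f z - s i z) \<partial>lborel) < ennreal (e/2)) sequentially"
        using \<open>e > 0\<close> by (intro order_tendstoD(2)) auto
      then obtain i where i: "(\<integral>\<^sup>+z. \<bar>f z - s i z\<bar> \<partial>lborel) < ennreal (e/2)"
        by (auto simp: eventually_sequentially)
      obtain g' where g': "continuous_on UNIV g'" "integrable lborel g'" "(\<integral>\<^sup>+z. \<bar>s i z - g' z\<bar> \<partial>lborel) < ennreal (e/2)"
        using lim.IH[of i] \<open>e > 0\<close> by (meson half_gt_zero)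
      have [measurable]: "g' \<in> borel_measurable lborel" using g' by auto
      have "(\<integral>\<^sup>+z. \<bar>f z - g' z\<bar> \<partial>lborel) \<le> (\<integral>\<^sup>+z. ennreal \<bar>f z - s i z\<bar> + ennreal \<bar>s i z - g' z\<bar> \<partial>lborel)"
        by (intro nn_integral_mono) (simp flip: ennreal_plus)
      also have "\<dots> = (\<integral>\<^sup>+z. \<bar>f z - s i z\<bar> \<partial>lborel) + (\<integral>\<^sup>+z. \<bar>s i z - g' z\<bar> \<partial>lborel)"
        by (rule nn_integral_add) auto
      also have "\<dots> < ennreal (e/2) + ennreal (e/2)" using i g'(3) by (rule add_strict_mono)
      also have "\<dots> = ennreal e" using \<open>e > 0\<close> by (simp flip: ennreal_plus)
      finally show "\<exists>h. continuous_on UNIV h \<and> integrable lborel h \<and> (\<integral>\<^sup>+z. \<bar>f z - h z\<bar> \<partial>lborel) < ennreal e"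
        using g' by blast
    qed
  qed
  then show ?thesis using assms(2) that by blast
qed

lemma measurable_lborel_lebesgue: "f \<in> borel_measurable borel \<Longrightarrow> f \<in> borel_measurable lebesgue"
  by (simp add: measurable_completion)

section \<open>Averages over contracted rectangles\<close>

locale rect =
  fixes a b c d :: real
  assumes ab: "a < b" and cd: "c < d"
begin

abbreviation "R \<equiv> box (a, c) (b, d)"
abbreviation "CR \<equiv> cbox (a, c) (b, d)"

lemma mem_R: "z \<in> R \<longleftrightarrow> a < fst z \<and> fst z < b \<and> c < snd z \<and> snd z < d"
  by (cases z) (auto simp: mem_box Basis_prod_def)

lemma mem_CR: "z \<in> CR \<longleftrightarrow> a \<le> fst z \<and> fst z \<le> b \<and> c \<le> snd z \<and> snd z \<le> d"
  by (cases z) auto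

lemma R_subset_CR: "R \<subseteq> CR"
  by (rule box_subset_cbox)

definition kernel :: "real \<times> real \<Rightarrow> real" where
  "kernel = (SOME \<kappa>. \<kappa> \<in> test_functions R \<and> (\<forall>z. \<kappa> z \<ge> 0) \<and> integrable lborel \<kappa> \<and> (\<integral>z. \<kappa> z \<partial>lborel) = 1)"

lemma kernel: "kernel \<in> test_functions R" "kernel z \<ge> 0" "integrable lborel kernel" "(\<integral>z. kernel z \<partial>lborel) = 1"
proof -
  have "\<exists>\<kappa>. \<kappa> \<in> test_functions R \<and> (\<forall>z. \<kappa> z \<ge> 0) \<and> integrable lborel \<kappa> \<and> (\<integral>z. \<kappa> z \<partial>lborel) = 1"
    using ex_bump[OF ab cd] by metis
  from someI_ex[OF this, folded kernel_def]
  show "kernel \<in> test_functions R" "kernel z \<ge> 0" "integrable lborel kernel" "(\<integral>z. kernel z \<partial>lborel) = 1"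
    by blast+
qed

lemma kernel_nonzero: "kernel z \<noteq> 0 \<Longrightarrow> z \<in> R"
  by (rule test_functions_support[OF kernel(1)]) blast

lemma kernel_measurable[measurable]: "kernel \<in> borel_measurable borel"
  using kernel(3) by auto

text \<open>
  With \<open>\<delta> = 1 / (k + 2)\<close>, the value at \<open>z\<close> is the average of \<open>w ((1 - \<delta>) z + \<delta> q)\<close> over \<open>q \<in> R\<close>
  with density \<open>kernel\<close>. The contraction towards \<open>q\<close> keeps the average inside \<open>R\<close> for all \<open>z\<close> in the
  closed rectangle.
\<close>

definition approx :: "nat \<Rightarrow> (real \<times> real \<Rightarrow> real) \<Rightarrow> real \<times> real \<Rightarrow> real" where
  "approx k w z = (real k + 2)\<^sup>2 * mollify kernel (real k + 2) (- (real k + 1)) w z"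

lemma smooth_approx:
  assumes "integrable lborel w"
  shows "smooth (approx k w)"
  unfolding approx_def by (intro smooth_mult smooth_const smooth_mollify[OF kernel(1) assms])

lemma approx_measurable[measurable]:
  assumes "integrable lborel w"
  shows "approx k w \<in> borel_measurable borel"
  by (intro borel_measurable_continuous_onI smooth_continuous_on smooth_approx assms)

lemma nn_integral_kernel: "(\<integral>\<^sup>+z. kernel z \<partial>lborel) = 1"
  using kernel by (simp add: nn_integral_eq_integral)

text \<open>The quotient of the scale factors is ((k + 2) / (k + 1))^2, at most 4. The density
  argument for L1 convergence needs a bound independent of \<open>k\<close>.\<close>

lemma nn_integral_approx_le:
  assumes w: "integrable lborel w"
  shows "(\<integral>\<^sup>+z. \<bar>approx k w z\<bar> \<partial>lborel) \<le> 4 * (\<integral>\<^sup>+z. \<bar>w z\<bar> \<partial>lborel)"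
proof -
  define m where "m = mollify kernel (real k + 2) (- (real k + 1)) w"
  have "smooth m" using smooth_mollify[OF kernel(1) w] by (simp only: m_def)
  then have [measurable]: "m \<in> borel_measurable borel"
    by (intro borel_measurable_continuous_onI smooth_continuous_on)
  have "(\<integral>\<^sup>+z. \<bar>approx k w z\<bar> \<partial>lborel) = ennreal ((real k + 2)\<^sup>2) * (\<integral>\<^sup>+z. \<bar>m z\<bar> \<partial>lborel)"
    unfolding approx_def m_def[symmetric] by (simp add: abs_mult ennreal_mult nn_integral_cmult)
  also have "\<dots> \<le> ennreal ((real k + 2)\<^sup>2) * (ennreal (1 / (real k + 1)\<^sup>2) * (\<integral>\<^sup>+z. kernel z \<partial>lborel) * (\<integral>\<^sup>+z. \<bar>w z\<bar> \<partial>lborel))"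
  proof (rule mult_left_mono)
    have "- (real k + 1) \<noteq> 0" by linarith
    from nn_integral_mollify_le[OF kernel(1,2) w this, of "real k + 2"]
    show "(\<integral>\<^sup>+z. \<bar>m z\<bar> \<partial>lborel) \<le> ennreal (1 / (real k + 1)\<^sup>2) * (\<integral>\<^sup>+z. kernel z \<partial>lborel) * (\<integral>\<^sup>+z. \<bar>w z\<bar> \<partial>lborel)"
      unfolding m_def power2_minus .
  qed simp
  also have "\<dots> = ennreal ((real k + 2)\<^sup>2 / (real k + 1)\<^sup>2) * (\<integral>\<^sup>+z. \<bar>w z\<bar> \<partial>lborel)"
    by (simp add: nn_integral_kernel mult.assoc[symmetric] ennreal_mult[symmetric])
  also have "\<dots> \<le> ennreal 4 * (\<integral>\<^sup>+z. \<bar>w z\<bar> \<partial>lborel)"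
  proof (intro mult_right_mono ennreal_leI)
    have "(real k + 2)\<^sup>2 \<le> (2 * (real k + 1))\<^sup>2" by (intro power_mono) auto
    then show "(real k + 2)\<^sup>2 / (real k + 1)\<^sup>2 \<le> 4"
      unfolding power_mult_distrib by (subst divide_le_eq) (simp del: power2_eq_square)
  qed simp
  finally show ?thesis by simp
qed

lemma kernel_affine_integral:
  assumes "N > 0"
  shows "integrable lborel (\<lambda>s. kernel (N *\<^sub>R s + v))" "(\<integral>s. kernel (N *\<^sub>R s + v) \<partial>lborel) = 1 / N\<^sup>2"
proof -
  have "(\<integral>\<^sup>+s. kernel (N *\<^sub>R s + v) \<partial>lborel) = ennreal (1 / N\<^sup>2)"
    using nn_integral_affine[of "\<lambda>z. ennreal (kernel z)" N v] assms nn_integral_kernel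
    by (simp add: add.commute)
  then have "has_bochner_integral lborel (\<lambda>s. kernel (N *\<^sub>R s + v)) (1 / N\<^sup>2)"
    using kernel(2) by (intro has_bochner_integral_nn_integral) auto
  then show "integrable lborel (\<lambda>s. kernel (N *\<^sub>R s + v))" "(\<integral>s. kernel (N *\<^sub>R s + v) \<partial>lborel) = 1 / N\<^sup>2"
    by (auto simp: has_bochner_integral_iff)
qed

text \<open>A point \<open>s\<close> seen by the kernel equals ((k + 1) z + q) / (k + 2) with
  \<open>q\<close> in the open rectangle. Convexity puts it into \<open>R\<close> even for
  \<open>z\<close> on the boundary, and s - z = (q - z) / (k + 2) gives the distance.\<close>

lemma approx_support:
  assumes "z \<in> CR" "kernel ((real k + 2) *\<^sub>R s + (- (real k + 1)) *\<^sub>R z) \<noteq> 0"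
  shows "s \<in> R" "dist s z \<le> ((b - a) + (d - c)) / (real k + 2)"
proof -
  let ?q = "(real k + 2) *\<^sub>R s + (- (real k + 1)) *\<^sub>R z"
  have q: "?q \<in> R" using assms(2) kernel_nonzero by blast
  have s: "(real k + 2) * fst s = (real k + 1) * fst z + fst ?q" "(real k + 2) * snd s = (real k + 1) * snd z + snd ?q"
    by (simp_all add: algebra_simps)
  have "(real k + 1) * a \<le> (real k + 1) * fst z" "(real k + 1) * fst z \<le> (real k + 1) * b"
    "(real k + 1) * c \<le> (real k + 1) * snd z" "(real k + 1) * snd z \<le> (real k + 1) * d"
    using assms(1) by (auto simp: mem_CR intro!: mult_left_mono)
  then have "(real k + 2) * a < (real k + 2) * fst s" "(real k + 2) * fst s < (real k + 2) * b"
    "(real k + 2) * c < (real k + 2) * snd s" "(real k + 2) * snd s < (real k + 2) * d"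
    unfolding s using q unfolding mem_R by (simp_all add: algebra_simps)
  then show "s \<in> R" by (simp add: mem_R mult_less_cancel_left_pos)
  have "(real k + 2) *\<^sub>R (s - z) = ?q - z" by (simp add: prod_eq_iff algebra_simps)
  then have "(real k + 2) * dist s z = norm (?q - z)"
    by (metis abs_of_nonneg add_nonneg_nonneg dist_norm norm_scaleR of_nat_0_le_iff zero_le_numeral)
  also have "\<dots> \<le> norm (fst (?q - z)) + norm (snd (?q - z))" by (metis norm_Pair_le prod.collapse)
  also have "\<dots> \<le> (b - a) + (d - c)"
    using q assms(1) unfolding mem_R mem_CR by (intro add_mono) (auto simp: abs_le_iff)
  finally show "dist s z \<le> ((b - a) + (d - c)) / (real k + 2)" by (simp add: field_simps)
qed

text \<open>The weights are nonnegative with total mass 1, as \<open>N\<^sup>2\<close> cancels the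
  scale factor; an average of values within \<open>e\<close> of \<open>y\<close> is within
  \<open>e\<close> of \<open>y\<close>.\<close>

lemma approx_close:
  assumes w: "integrable lborel w" and z: "z \<in> CR"
    and e: "\<And>s. s \<in> R \<Longrightarrow> dist s z \<le> ((b - a) + (d - c)) / (real k + 2) \<Longrightarrow> \<bar>w s - y\<bar> \<le> e"
  shows "\<bar>approx k w z - y\<bar> \<le> e"
proof -
  define N where "N = real k + 2"
  define v where "v = (- (real k + 1)) *\<^sub>R z"
  have N: "N > 0" by (simp add: N_def)
  note ker = kernel_affine_integral[OF N, of v]
  note int = mollify_integrable[OF kernel(1) w, of N v]
  have "approx k w z - y = N\<^sup>2 * ((\<integral>s. w s * kernel (N *\<^sub>R s + v) \<partial>lborel) - y * (\<integral>s. kernel (N *\<^sub>R s + v) \<partial>lborel))"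
    unfolding approx_def mollify_def N_def[symmetric] v_def[symmetric] ker using N by (simp add: right_diff_distrib)
  also have "\<dots> = N\<^sup>2 * (\<integral>s. (w s - y) * kernel (N *\<^sub>R s + v) \<partial>lborel)"
    using int ker(1) by (simp add: left_diff_distrib)
  finally have "\<bar>approx k w z - y\<bar> = N\<^sup>2 * \<bar>\<integral>s. (w s - y) * kernel (N *\<^sub>R s + v) \<partial>lborel\<bar>" by (simp add: abs_mult)
  also have "\<bar>\<integral>s. (w s - y) * kernel (N *\<^sub>R s + v) \<partial>lborel\<bar> \<le> (\<integral>s. e * kernel (N *\<^sub>R s + v) \<partial>lborel)"
  proof (rule order_trans[OF integral_abs_bound integral_mono])
    show "\<bar>(w s - y) * kernel (N *\<^sub>R s + v)\<bar> \<le> e * kernel (N *\<^sub>R s + v)" for s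
    proof (cases "kernel (N *\<^sub>R s + v) = 0")
      case False
      have "\<bar>w s - y\<bar> \<le> e" using approx_support[OF z False[unfolded N_def v_def]] e by blast
      then show ?thesis
        using kernel(2)[of "N *\<^sub>R s + v"] by (simp add: abs_mult mult_right_mono)
    qed simp
    show "integrable lborel (\<lambda>s. \<bar>(w s - y) * kernel (N *\<^sub>R s + v)\<bar>)"
      using int ker(1) by (simp add: left_diff_distrib)
  qed (use ker in simp)
  also have "(\<integral>s. e * kernel (N *\<^sub>R s + v) \<partial>lborel) = e / N\<^sup>2" using ker by simp
  finally show ?thesis using N by (simp add: mult_left_mono)
qed

text \<open>Convergence reaches the boundary because the averages see only values inside
  \<open>R\<close>. The vertex values of \<open>u\<close> and of its first derivatives are recovered
  in this way.\<close>

lemma approx_uniform: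
  assumes w: "integrable lborel w" and u: "continuous_on CR u" "\<And>z. z \<in> R \<Longrightarrow> w z = u z" and "e > 0"
  shows "eventually (\<lambda>k. \<forall>z\<in>CR. \<bar>approx k w z - u z\<bar> \<le> e) sequentially"
proof -
  have "uniformly_continuous_on CR u" by (rule compact_uniformly_continuous[OF u(1) compact_cbox])
  then obtain r where r: "r > 0" "\<And>x y. x \<in> CR \<Longrightarrow> y \<in> CR \<Longrightarrow> dist y x < r \<Longrightarrow> dist (u y) (u x) < e"
    using \<open>e > 0\<close> unfolding uniformly_continuous_on_def by blast
  have "((\<lambda>k. ((b - a) + (d - c)) / (real k + 2)) \<longlongrightarrow> 0) sequentially"
    using tendsto_mult_right_zero[OF LIMSEQ_Suc[OF LIMSEQ_inverse_real_of_nat], of "(b - a) + (d - c)"]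
    by (simp add: divide_inverse add.commute)
  then have "eventually (\<lambda>k. ((b - a) + (d - c)) / (real k + 2) < r) sequentially"
    using r(1) by (rule order_tendstoD(2))
  then show ?thesis
  proof (rule eventually_mono, intro ballI)
    fix k z assume k: "((b - a) + (d - c)) / (real k + 2) < r" and z: "z \<in> CR"
    show "\<bar>approx k w z - u z\<bar> \<le> e"
    proof (rule approx_close[OF w z])
      show "\<bar>w s - u z\<bar> \<le> e" if "s \<in> R" "dist s z \<le> ((b - a) + (d - c)) / (real k + 2)" for s
        using r(2)[OF z, of s] that k R_subset_CR u(2)[OF that(1)] by (force simp: dist_real_def)
    qed
  qed
qed

lemma approx_tendsto:
  assumes "integrable lborel w" "continuous_on CR u" "\<And>z. z \<in> R \<Longrightarrow> w z = u z" "z \<in> CR"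
  shows "(\<lambda>k. approx k w z) \<longlonglongrightarrow> u z"
proof (rule tendstoI)
  fix e :: real assume "e > 0"
  then have "eventually (\<lambda>k. \<forall>z\<in>CR. \<bar>approx k w z - u z\<bar> \<le> e/2) sequentially"
    by (intro approx_uniform assms) auto
  then show "eventually (\<lambda>k. dist (approx k w z) (u z) < e) sequentially"
    by (rule eventually_mono) (use assms(4) \<open>e > 0\<close> in \<open>force simp: dist_real_def\<close>)
qed

lemma approx_L1:
  assumes w: "integrable lborel w"
  shows "(\<lambda>k. \<integral>\<^sup>+z\<in>R. \<bar>approx k w z - w z\<bar> \<partial>lborel) \<longlonglongrightarrow> 0"
proof (rule tendsto_zero_ennreal)
  fix e :: real assume "e > 0"
  have [measurable]: "w \<in> borel_measurable borel" using w by auto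
  \<comment> \<open>Six units are used: 4 for the average of w - f, 1 for w - f itself, and 1 for
    the uniform error of f integrated over \<open>R\<close>.\<close>
  define e1 where "e1 = e / 10"
  have "e1 > 0" using \<open>e > 0\<close> by (simp add: e1_def)
  obtain f where f: "continuous_on UNIV f" "integrable lborel f" "(\<integral>\<^sup>+z. \<bar>w z - f z\<bar> \<partial>lborel) < ennreal e1"
    using integrable_approx_continuous[OF w \<open>e1 > 0\<close>] by metis
  have [measurable]: "f \<in> borel_measurable borel" using f(2) by auto
  have wf: "integrable lborel (\<lambda>z. w z - f z)" using w f(2) by simp
  note approx_measurable[OF w, measurable] approx_measurable[OF f(2), measurable] approx_measurable[OF wf, measurable]
  define V where "V = (b - a) * (d - c)"
  have V: "V > 0" "emeasure lborel R = ennreal V"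
    using ab cd by (auto simp: V_def emeasure_lborel_box_eq Basis_prod_def)
  have "eventually (\<lambda>k. \<forall>z\<in>CR. \<bar>approx k f z - f z\<bar> \<le> e1 / V) sequentially"
    using \<open>e1 > 0\<close> V(1) by (intro approx_uniform f continuous_on_subset[OF f(1)]) auto
  then show "eventually (\<lambda>k. (\<integral>\<^sup>+z\<in>R. \<bar>approx k w z - w z\<bar> \<partial>lborel) < ennreal e) sequentially"
  proof (rule eventually_mono)
    fix k assume k: "\<forall>z\<in>CR. \<bar>approx k f z - f z\<bar> \<le> e1 / V"
    have lin: "approx k w z = approx k (\<lambda>z. w z - f z) z + approx k f z" for z
      using mollify_integrable[OF kernel(1) w] mollify_integrable[OF kernel(1) f(2)]
      by (simp add: approx_def mollify_def left_diff_distrib right_diff_distrib)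
    have "(\<integral>\<^sup>+z\<in>R. \<bar>approx k w z - w z\<bar> \<partial>lborel) \<le>
       (\<integral>\<^sup>+z. (ennreal \<bar>approx k (\<lambda>z. w z - f z) z\<bar> + ennreal \<bar>w z - f z\<bar>) + ennreal (e1 / V) * indicator R z \<partial>lborel)"
    proof (rule nn_integral_mono)
      fix z
      show "ennreal \<bar>approx k w z - w z\<bar> * indicator R z \<le>
         (ennreal \<bar>approx k (\<lambda>z. w z - f z) z\<bar> + ennreal \<bar>w z - f z\<bar>) + ennreal (e1 / V) * indicator R z"
      proof (cases "z \<in> R")
        case True
        then have "\<bar>approx k f z - f z\<bar> \<le> e1 / V" using k R_subset_CR by blast
        then have "\<bar>approx k w z - w z\<bar> \<le> (\<bar>approx k (\<lambda>z. w z - f z) z\<bar> + \<bar>w z - f z\<bar>) + e1 / V"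
          unfolding lin[of z] by linarith
        then have "ennreal \<bar>approx k w z - w z\<bar> \<le> ennreal ((\<bar>approx k (\<lambda>z. w z - f z) z\<bar> + \<bar>w z - f z\<bar>) + e1 / V)"
          by (rule ennreal_leI)
        also have "\<dots> = (ennreal \<bar>approx k (\<lambda>z. w z - f z) z\<bar> + ennreal \<bar>w z - f z\<bar>) + ennreal (e1 / V)"
          using \<open>e1 > 0\<close> V(1) by (simp add: ennreal_plus)
        finally show ?thesis using True by simp
      qed simp
    qed
    also have "\<dots> = (\<integral>\<^sup>+z. \<bar>approx k (\<lambda>z. w z - f z) z\<bar> \<partial>lborel) + (\<integral>\<^sup>+z. \<bar>w z - f z\<bar> \<partial>lborel) + ennreal (e1 / V) * emeasure lborel R"
      by (simp add: nn_integral_add nn_integral_cmult_indicator)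
    also have "\<dots> \<le> ennreal 4 * ennreal e1 + ennreal e1 + ennreal (e1 / V) * ennreal V"
    proof (intro add_mono)
      show "(\<integral>\<^sup>+z. \<bar>approx k (\<lambda>z. w z - f z) z\<bar> \<partial>lborel) \<le> ennreal 4 * ennreal e1"
        using order_trans[OF nn_integral_approx_le[OF wf, of k] mult_left_mono[OF less_imp_le[OF f(3)], of 4]] by simp
    qed (use f(3) V(2) in auto)
    also have "\<dots> = ennreal (4 * e1 + e1 + e1)"
      using \<open>e1 > 0\<close> V(1)
      by (simp add: ennreal_mult[symmetric] ennreal_plus[symmetric] del: ennreal_plus ennreal_numeral)
    also have "\<dots> < ennreal e" using \<open>e > 0\<close> by (intro ennreal_lessI) (auto simp: e1_def)
    finally show "(\<integral>\<^sup>+z\<in>R. \<bar>approx k w z - w z\<bar> \<partial>lborel) < ennreal e" .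
  qed
qed

end

subsection \<open>Weak derivatives on rectangles\<close>

lemma AE_on_negligible:
  "(AE z in lebesgue. z \<in> S \<longrightarrow> P z) \<Longrightarrow> negligible {z. \<not> (z \<in> S \<longrightarrow> P z)}"
  unfolding completion.AE_iff_null_sets by (simp add: negligible_iff_null_sets)

lemma integral_cong_AE_on:
  fixes f g :: "'a::euclidean_space \<Rightarrow> real"
  assumes "AE z in lebesgue. z \<in> S \<longrightarrow> f z = g z"
  shows "integral S f = integral S g"
  by (rule integral_spike[OF AE_on_negligible[OF assms]]) auto

lemma absolutely_integrable_cong_AE_on:
  fixes f g :: "'a::euclidean_space \<Rightarrow> real"
  assumes "AE z in lebesgue. z \<in> S \<longrightarrow> f z = g z" "f absolutely_integrable_on S"
  shows "g absolutely_integrable_on S"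
  by (rule absolutely_integrable_spike[OF assms(2) AE_on_negligible[OF assms(1)]]) auto

lemma set_lebesgue_integral_cong_AE_on:
  fixes f g :: "'a::euclidean_space \<Rightarrow> real"
  assumes "AE z in lebesgue. z \<in> S \<longrightarrow> f z = g z"
  shows "(LINT z:S|lebesgue. f z) = (LINT z:S|lebesgue. g z)"
proof (cases "f absolutely_integrable_on S")
  case True
  then show ?thesis
    using absolutely_integrable_cong_AE_on[OF assms] integral_cong_AE_on[OF assms]
    by (simp add: set_lebesgue_integral_eq_integral(2))
next
  case False
  have "AE z in lebesgue. z \<in> S \<longrightarrow> g z = f z" using assms by (rule eventually_mono) auto
  then have "\<not> g absolutely_integrable_on S"
    using False absolutely_integrable_cong_AE_on by blast
  then show ?thesis
    using False by (simp add: set_integrable_def set_lebesgue_integral_def not_integrable_integral_eq)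
qed

text \<open>The gauge integral of a non-integrable function is 0 by convention, so no integrability
  has to be assumed.\<close>

lemma integral_nonneg_real:
  fixes f :: "'a::euclidean_space \<Rightarrow> real"
  assumes "\<And>z. z \<in> S \<Longrightarrow> 0 \<le> f z"
  shows "0 \<le> integral S f"
  using assms Henstock_Kurzweil_Integration.integral_nonneg not_integrable_integral
  by (metis order_refl)

text \<open>The product lives on the compact support of \<phi>, where \<open>u\<close> is integrable
  and \<phi> is bounded.\<close>

lemma test_functions_times_absolutely_integrable:
  assumes \<phi>: "\<phi> \<in> test_functions \<Omega>" and u: "locally_integrable \<Omega> u"
  shows "(\<lambda>z. u z * \<phi> z) absolutely_integrable_on \<Omega>"
proof -
  obtain K where K: "compact K" "K \<subseteq> \<Omega>" "\<And>z. z \<notin> K \<Longrightarrow> \<phi> z = 0"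
    using test_functions_support[OF \<phi>] by metis
  obtain B where B: "\<And>z. \<bar>\<phi> z\<bar> \<le> B" using test_functions_bounded[OF \<phi>] by metis
  have int: "integrable lebesgue (\<lambda>z. indicator K z *\<^sub>R u z)"
    using u K by (auto simp: locally_integrable_def set_integrable_def)
  have "smooth \<phi>" using \<phi> test_functions_smooth by blast
  then have "\<phi> \<in> borel_measurable lebesgue"
    by (intro measurable_lborel_lebesgue borel_measurable_continuous_onI smooth_continuous_on)
  then have "integrable lebesgue (\<lambda>z. (indicator K z *\<^sub>R u z) * \<phi> z)"
    by (rule integrable_mult_bounded[OF int _ B])
  also have "(\<lambda>z. (indicator K z *\<^sub>R u z) * \<phi> z) = (\<lambda>z. indicator \<Omega> z *\<^sub>R (u z * \<phi> z))"
    using K(2) K(3) by (fastforce simp: indicator_def)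
  finally show ?thesis by (simp add: set_integrable_def)
qed

lemma has_weak_D_cong_AE:
  assumes "has_weak_D u \<alpha> \<Omega> g"
    and u: "AE z in lebesgue. z \<in> \<Omega> \<longrightarrow> u z = u' z" and g: "AE z in lebesgue. z \<in> \<Omega> \<longrightarrow> g z = g' z"
  shows "has_weak_D u' \<alpha> \<Omega> g'"
proof -
  have loc: "locally_integrable \<Omega> f'" if "locally_integrable \<Omega> f" "AE z in lebesgue. z \<in> \<Omega> \<longrightarrow> f z = f' z" for f f'
    unfolding locally_integrable_def
  proof (intro allI impI)
    fix K assume K: "compact K \<and> K \<subseteq> \<Omega>"
    have "AE z in lebesgue. z \<in> K \<longrightarrow> f z = f' z"
      using that(2) by (rule eventually_mono) (use K in blast)
    then show "f' absolutely_integrable_on K"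
      using absolutely_integrable_cong_AE_on that(1) K unfolding locally_integrable_def by blast
  qed
  have "(LINT z:\<Omega>|lebesgue. u z * classical_D \<alpha> \<phi> z) = (LINT z:\<Omega>|lebesgue. u' z * classical_D \<alpha> \<phi> z)"
    "(LINT z:\<Omega>|lebesgue. g z * \<phi> z) = (LINT z:\<Omega>|lebesgue. g' z * \<phi> z)" for \<phi>
    by (rule set_lebesgue_integral_cong_AE_on, rule eventually_mono[OF u], simp)
      (rule set_lebesgue_integral_cong_AE_on, rule eventually_mono[OF g], simp)
  then show ?thesis
    using assms(1) loc[OF _ u] loc[OF _ g] by (simp add: has_weak_D_def)
qed

text \<open>Test functions on the smaller set are test functions on the larger one, and both
  integrals then run over the support only.\<close>

lemma has_weak_D_subset:
  assumes "has_weak_D u \<alpha> \<Omega> g" "\<Omega>' \<subseteq> \<Omega>"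
  shows "has_weak_D u \<alpha> \<Omega>' g"
proof -
  have D: "classical_D \<alpha> \<phi> \<in> test_functions \<Omega>'" if "\<phi> \<in> test_functions \<Omega>'" for \<phi>
  proof -
    have "(pdx UNIV ^^ m) \<psi> \<in> test_functions \<Omega>' \<and> (pdy UNIV ^^ m) \<psi> \<in> test_functions \<Omega>'"
      if "\<psi> \<in> test_functions \<Omega>'" for m \<psi>
      using that by (induction m) (auto intro: test_functions_pd)
    then show ?thesis using that by (simp add: classical_D_def)
  qed
  have eq: "(LINT z:\<Omega>|lebesgue. f z * \<psi> z) = (LINT z:\<Omega>'|lebesgue. f z * \<psi> z)"
    if "\<psi> \<in> test_functions \<Omega>'" for f \<psi>
  proof -
    obtain K where K: "K \<subseteq> \<Omega>'" "\<And>z. z \<notin> K \<Longrightarrow> \<psi> z = 0"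
      using test_functions_support[OF \<open>\<psi> \<in> test_functions \<Omega>'\<close>] by metis
    have "(\<lambda>z. indicator \<Omega> z *\<^sub>R (f z * \<psi> z)) = (\<lambda>z. indicator \<Omega>' z *\<^sub>R (f z * \<psi> z))"
      using K assms(2) by (fastforce simp: indicator_def)
    then show ?thesis by (simp add: set_lebesgue_integral_def)
  qed
  show ?thesis
    unfolding has_weak_D_def
  proof (intro conjI ballI)
    show "locally_integrable \<Omega>' u" "locally_integrable \<Omega>' g"
      using assms unfolding has_weak_D_def locally_integrable_def by blast+
    fix \<phi> assume \<phi>: "\<phi> \<in> test_functions \<Omega>'"
    then have "\<phi> \<in> test_functions \<Omega>" using assms(2) test_functions_mono by blast
    then have "(LINT z:\<Omega>|lebesgue. u z * classical_D \<alpha> \<phi> z) = (-1) ^ (fst \<alpha> + snd \<alpha>) * (LINT z:\<Omega>|lebesgue. g z * \<phi> z)"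
      using assms(1) unfolding has_weak_D_def by blast
    then show "(LINT z:\<Omega>'|lebesgue. u z * classical_D \<alpha> \<phi> z) = (-1) ^ (fst \<alpha> + snd \<alpha>) * (LINT z:\<Omega>'|lebesgue. g z * \<phi> z)"
      by (simp add: eq[OF \<phi>] eq[OF D[OF \<phi>]])
  qed
qed

text \<open>Testing the definition for \<open>u\<close> with a derivative of \<phi> gives the
  pairing with \<open>g\<close>; the common sign \<open>(-1) ^ (m + n)\<close> cancels. Higher
  derivatives of \<open>u\<close> thus become chains of first-order ones, the form in which
  mollification handles them.\<close>

lemma has_weak_D_compose:
  assumes g: "has_weak_D u (m, n) \<Omega> g"
  shows "has_weak_D u (Suc m, n) \<Omega> k \<Longrightarrow> has_weak_D g (1, 0) \<Omega> k"
    and "has_weak_D u (m, Suc n) \<Omega> k \<Longrightarrow> has_weak_D g (0, 1) \<Omega> k"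
proof -
  have *: "(LINT z:\<Omega>|lebesgue. g z * classical_D (1, 0) \<phi> z) = - (LINT z:\<Omega>|lebesgue. k z * \<phi> z)"
    if k: "has_weak_D u (Suc m, n) \<Omega> k" and \<phi>: "\<phi> \<in> test_functions \<Omega>" for \<phi>
  proof -
    have "(LINT z:\<Omega>|lebesgue. u z * classical_D (m, n) (pdx UNIV \<phi>) z) = (-1) ^ (m + n) * (LINT z:\<Omega>|lebesgue. g z * pdx UNIV \<phi> z)"
      using g test_functions_pd(1)[OF \<phi>] by (simp add: has_weak_D_def)
    moreover have "(LINT z:\<Omega>|lebesgue. u z * classical_D (Suc m, n) \<phi> z) = (-1) ^ (Suc (m + n)) * (LINT z:\<Omega>|lebesgue. k z * \<phi> z)"
      using k \<phi> by (simp add: has_weak_D_def)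
    moreover have "classical_D (1, 0) \<phi> = pdx UNIV \<phi>" by (simp add: classical_D_def)
    ultimately show ?thesis
      unfolding pdx_classical_D_commute(1)[OF test_functions_smooth[OF \<phi>]]
      by (auto simp: minus_one_power_iff split: if_splits)
  qed
  have **: "(LINT z:\<Omega>|lebesgue. g z * classical_D (0, 1) \<phi> z) = - (LINT z:\<Omega>|lebesgue. k z * \<phi> z)"
    if k: "has_weak_D u (m, Suc n) \<Omega> k" and \<phi>: "\<phi> \<in> test_functions \<Omega>" for \<phi>
  proof -
    have "(LINT z:\<Omega>|lebesgue. u z * classical_D (m, n) (pdy UNIV \<phi>) z) = (-1) ^ (m + n) * (LINT z:\<Omega>|lebesgue. g z * pdy UNIV \<phi> z)"
      using g test_functions_pd(2)[OF \<phi>] by (simp add: has_weak_D_def)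
    moreover have "(LINT z:\<Omega>|lebesgue. u z * classical_D (m, Suc n) \<phi> z) = (-1) ^ (Suc (m + n)) * (LINT z:\<Omega>|lebesgue. k z * \<phi> z)"
      using k \<phi> by (simp add: has_weak_D_def)
    moreover have "classical_D (0, 1) \<phi> = pdy UNIV \<phi>" by (simp add: classical_D_def)
    ultimately show ?thesis
      unfolding pdx_classical_D_commute(2)[OF test_functions_smooth[OF \<phi>]]
      by (auto simp: minus_one_power_iff split: if_splits)
  qed
  show "has_weak_D u (Suc m, n) \<Omega> k \<Longrightarrow> has_weak_D g (1, 0) \<Omega> k"
    "has_weak_D u (m, Suc n) \<Omega> k \<Longrightarrow> has_weak_D g (0, 1) \<Omega> k"
    using g * ** by (simp_all add: has_weak_D_def)
qed

section \<open>Mollified weak derivatives and uniqueness\<close>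

lemma box_integral_iterated:
  fixes f :: "real \<times> real \<Rightarrow> real"
  assumes "continuous_on (cbox (a, c) (b, d)) f"
  shows "integral (cbox (a, c) (b, d)) f = integral {a..b} (\<lambda>x. integral {c..d} (\<lambda>y. f (x, y)))"
    and "integral (cbox (a, c) (b, d)) f = integral {c..d} (\<lambda>y. integral {a..b} (\<lambda>x. f (x, y)))"
proof -
  show 1: "integral (cbox (a, c) (b, d)) f = integral {a..b} (\<lambda>x. integral {c..d} (\<lambda>y. f (x, y)))"
    using integral_prod_continuous[OF assms] by simp
  show "integral (cbox (a, c) (b, d)) f = integral {c..d} (\<lambda>y. integral {a..b} (\<lambda>x. f (x, y)))"
    unfolding 1 using integral_swap_continuous[of a c b d "\<lambda>x y. f (x, y)"] assms by simp
qed

context rect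
begin

lemma R_lebesgue [simp]: "R \<in> sets lebesgue" "CR \<in> sets lebesgue" "R \<in> sets borel"
  by auto

lemma absolutely_integrable_on_R:
  fixes f :: "real \<times> real \<Rightarrow> real"
  shows "f absolutely_integrable_on CR \<Longrightarrow> f absolutely_integrable_on R"
  by (rule set_integrable_subset[OF _ _ R_subset_CR]) simp_all

lemma locally_integrable_R: "u absolutely_integrable_on R \<Longrightarrow> locally_integrable R u"
  unfolding locally_integrable_def
  by (metis compact_imp_closed lmeasurable_compact fmeasurableD set_integrable_subset)

lemma continuous_absolutely_integrable:
  fixes u :: "real \<times> real \<Rightarrow> real"
  assumes "continuous_on CR u"
  shows "u absolutely_integrable_on R" "locally_integrable R u"
  using absolutely_integrable_on_R[OF absolutely_integrable_continuous[OF assms]] locally_integrable_R by blast+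

text \<open>A weak derivative is only Lebesgue measurable and fixed up to null sets on
  \<open>R\<close>, while \<open>mollify\<close> integrates over the whole plane with
  \<open>lborel\<close>. A version is a Borel representative extended by 0.\<close>

definition version :: "(real \<times> real \<Rightarrow> real) \<Rightarrow> (real \<times> real \<Rightarrow> real) \<Rightarrow> bool" where
  "version u w \<longleftrightarrow> integrable lborel w \<and> (AE z in lebesgue. z \<in> R \<longrightarrow> u z = w z) \<and> (\<forall>z. z \<notin> R \<longrightarrow> w z = 0)"

lemma ex_version:
  assumes "u absolutely_integrable_on R"
  shows "\<exists>w. version u w"
proof -
  have int: "integrable lebesgue (\<lambda>z. indicator R z *\<^sub>R u z)" using assms by (simp add: set_integrable_def)
  then obtain w0 where w0: "w0 \<in> borel_measurable lborel" "AE z in lborel. indicator R z *\<^sub>R u z = w0 z"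
    using completion_ex_borel_measurable_real[of "\<lambda>z. indicator R z *\<^sub>R u z" lborel] by auto
  define w where "w z = indicator R z * w0 z" for z
  have w: "w \<in> borel_measurable borel" using w0(1) unfolding w_def by measurable
  have ae: "AE z in lebesgue. indicator R z *\<^sub>R u z = w z"
    using AE_completion[OF w0(2)] by (rule eventually_mono) (metis indicator_simps mult_1 mult_zero_left scaleR_one scaleR_zero_left w_def)
  have "integrable lebesgue w"
    using integrable_cong_AE[THEN iffD1, OF borel_measurable_integrable[OF int] measurable_lborel_lebesgue[OF w] ae int] .
  then have "integrable lborel w" using integrable_completion[of w lborel] w by simp
  moreover have "AE z in lebesgue. z \<in> R \<longrightarrow> u z = w z"
    using ae by (rule eventually_mono) (metis indicator_simps(1) scaleR_one)
  ultimately show ?thesis unfolding version_def by (intro exI[of _ w]) (simp add: w_def)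
qed

text \<open>For continuous functions equality on all of \<open>R\<close> is recorded, not only
  almost everywhere, since \<open>approx_uniform\<close> asks for it.\<close>

lemma version_continuous:
  assumes "continuous_on CR u"
  obtains w where "version u w" "\<And>z. z \<in> R \<Longrightarrow> w z = u z"
proof (rule that[of "\<lambda>z. indicator R z * u z"])
  have "integrable lborel (\<lambda>z. indicator CR z *\<^sub>R u z)"
    using assms by (intro borel_integrable_compact) auto
  then have "integrable lborel (\<lambda>z. (indicator CR z *\<^sub>R u z) * indicator R z)"
    by (rule integrable_mult_bounded[where B=1]) (simp_all add: indicator_def)
  also have "(\<lambda>z. (indicator CR z *\<^sub>R u z) * indicator R z) = (\<lambda>z. indicator R z * u z)"
  proof
    show "(indicator CR z *\<^sub>R u z) * indicator R z = indicator R z * u z" for z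
    proof (cases "z \<in> R")
      case True
      then have "z \<in> CR" using R_subset_CR by (rule set_mp[rotated])
      with True show ?thesis by (simp only: indicator_simps scaleR_one mult_1 mult_1_right)
    qed simp
  qed
  finally show "version u (\<lambda>z. indicator R z * u z)" by (simp add: version_def)
qed simp

lemma version_integral:
  assumes v: "version u w" and [measurable]: "\<phi> \<in> borel_measurable borel"
  shows "(LINT z:R|lebesgue. u z * \<phi> z) = (\<integral>z. w z * \<phi> z \<partial>lborel)"
proof -
  have [measurable]: "w \<in> borel_measurable borel" using v by (auto simp: version_def)
  have "(LINT z:R|lebesgue. u z * \<phi> z) = (LINT z:R|lebesgue. w z * \<phi> z)"
  proof (rule set_lebesgue_integral_cong_AE_on)
    have "AE z in lebesgue. z \<in> R \<longrightarrow> u z = w z" using v by (simp add: version_def)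
    then show "AE z in lebesgue. z \<in> R \<longrightarrow> u z * \<phi> z = w z * \<phi> z"
      by (rule eventually_mono) simp
  qed
  also have "\<dots> = (\<integral>z. w z * \<phi> z \<partial>lebesgue)"
    unfolding set_lebesgue_integral_def
  proof (intro Bochner_Integration.integral_cong refl)
    show "indicator R z *\<^sub>R (w z * \<phi> z) = w z * \<phi> z" for z
    proof (cases "z \<in> R")
      case False
      then have "w z = 0" using v unfolding version_def by blast
      then show ?thesis by simp
    qed simp
  qed
  also have "\<dots> = (\<integral>z. w z * \<phi> z \<partial>lborel)" by (rule integral_completion) measurable
  finally show ?thesis .
qed

lemma approx_L1_tendsto:
  assumes v: "version u w"
  shows "(\<lambda>k. integral R (\<lambda>z. \<bar>approx k w z - u z\<bar>)) \<longlonglongrightarrow> 0"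
proof -
  have w: "integrable lborel w" using v by (simp add: version_def)
  have [measurable]: "w \<in> borel_measurable borel" using w by auto
  have eq: "ennreal (integral R (\<lambda>z. \<bar>approx k w z - u z\<bar>)) = (\<integral>\<^sup>+z\<in>R. \<bar>approx k w z - w z\<bar> \<partial>lborel)" for k
  proof -
    note approx_measurable[OF w, measurable]
    have "(\<lambda>z. approx k w z) absolutely_integrable_on R"
      using continuous_absolutely_integrable smooth_continuous_on[OF smooth_approx[OF w]] by blast
    moreover have "w absolutely_integrable_on R"
      unfolding set_integrable_def using integrable_mult_indicator[of R lborel w] w
      by (subst integrable_completion) auto
    ultimately have "(\<lambda>z. approx k w z - w z) absolutely_integrable_on R" by (rule set_integral_diff)
    then have ai: "(\<lambda>z. \<bar>approx k w z - w z\<bar>) absolutely_integrable_on R"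
      using absolutely_integrable_norm[where f="\<lambda>z. approx k w z - w z" and S=R] by (simp add: o_def)
    then have "integral R (\<lambda>z. \<bar>approx k w z - w z\<bar>) = (\<integral>z. indicator R z *\<^sub>R \<bar>approx k w z - w z\<bar> \<partial>lebesgue)"
      unfolding set_lebesgue_integral_def[symmetric] by (rule set_lebesgue_integral_eq_integral(2)[symmetric])
    also have "ennreal \<dots> = (\<integral>\<^sup>+z. indicator R z *\<^sub>R \<bar>approx k w z - w z\<bar> \<partial>lebesgue)"
      using ai by (subst nn_integral_eq_integral) (simp_all add: set_integrable_def)
    also have "\<dots> = (\<integral>\<^sup>+z\<in>R. \<bar>approx k w z - w z\<bar> \<partial>lborel)"
      unfolding nn_integral_completion by (intro nn_integral_cong) (simp add: indicator_def)
    finally have "ennreal (integral R (\<lambda>z. \<bar>approx k w z - w z\<bar>)) = (\<integral>\<^sup>+z\<in>R. \<bar>approx k w z - w z\<bar> \<partial>lborel)" .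
    moreover have "integral R (\<lambda>z. \<bar>approx k w z - w z\<bar>) = integral R (\<lambda>z. \<bar>approx k w z - u z\<bar>)"
    proof (rule integral_cong_AE_on)
      have "AE z in lebesgue. z \<in> R \<longrightarrow> u z = w z" using v by (simp add: version_def)
      then show "AE z in lebesgue. z \<in> R \<longrightarrow> \<bar>approx k w z - w z\<bar> = \<bar>approx k w z - u z\<bar>"
        by (rule eventually_mono) simp
    qed
    ultimately show ?thesis by simp
  qed
  have "(\<lambda>k. ennreal (integral R (\<lambda>z. \<bar>approx k w z - u z\<bar>))) \<longlonglongrightarrow> ennreal 0"
    unfolding eq using approx_L1[OF w] by simp
  then show ?thesis
    by (rule tendsto_ennrealD) (simp_all add: integral_nonneg_real)
qed

text \<open>The support is the image of a compact subset of \<open>R\<close> under a contraction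
  towards \<open>z\<close>, hence a compact subset of the open rectangle even for \<open>z\<close>
  on the boundary. So weak derivatives can be tested with the kernel up to the boundary.\<close>

lemma kernel_test_function:
  assumes "z \<in> CR"
  shows "(\<lambda>s. kernel ((real k + 2) *\<^sub>R s + (- (real k + 1)) *\<^sub>R z)) \<in> test_functions R"
proof -
  obtain K where K: "compact K" "K \<subseteq> R" "\<And>z. z \<notin> K \<Longrightarrow> kernel z = 0"
    using test_functions_support[OF kernel(1)] by metis
  let ?f = "\<lambda>q. (1 / (real k + 2)) *\<^sub>R q + ((real k + 1) / (real k + 2)) *\<^sub>R z"
  have "(1 / N) *\<^sub>R (N *\<^sub>R s + (- m) *\<^sub>R z) + (m / N) *\<^sub>R z = s" if "N \<noteq> 0" for N m :: real and s
    using that by (simp add: scaleR_right_distrib scaleR_diff_right)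
  then have inv: "?f ((real k + 2) *\<^sub>R s + (- (real k + 1)) *\<^sub>R z) = s" for s
    by (metis add_nonneg_eq_0_iff of_nat_0_le_iff zero_le_numeral zero_neq_numeral)
  have "?f ` K \<subseteq> R"
  proof
    fix s assume "s \<in> ?f ` K"
    then obtain q where q: "q \<in> K" "s = ?f q" by blast
    then have qR: "q \<in> R" using K(2) by blast
    define r where "r = (real k + 1) / (real k + 2)"
    have r: "0 \<le> r" "1 / (real k + 2) = 1 - r" "r < 1"
      by (simp_all add: r_def field_simps)
    have between: "l < (1 - r) * s + r * t \<and> (1 - r) * s + r * t < h" if "l < s" "s < h" "l \<le> t" "t \<le> h" for l h s t
    proof -
      have "(1 - r) * l < (1 - r) * s" "(1 - r) * s < (1 - r) * h" using that r(3) by simp_all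
      moreover have "r * l \<le> r * t" "r * t \<le> r * h" using that r(1) by (simp_all add: mult_left_mono)
      ultimately show ?thesis by (simp add: algebra_simps)
    qed
    show "s \<in> R"
      using between[of a "fst q" b "fst z"] between[of c "snd q" d "snd z"] qR assms
      unfolding q(2) r_def[symmetric] r(2) mem_R mem_CR by simp
  qed
  moreover have "compact (?f ` K)"
    by (intro compact_continuous_image continuous_intros K(1))
  moreover have "kernel ((real k + 2) *\<^sub>R s + (- (real k + 1)) *\<^sub>R z) = 0" if "s \<notin> ?f ` K" for s
  proof (rule K(3), rule notI)
    assume "(real k + 2) *\<^sub>R s + (- (real k + 1)) *\<^sub>R z \<in> K"
    from imageI[OF this, of ?f] show False using that unfolding inv by (rule notE[rotated])
  qed
  ultimately show ?thesis
    using test_functionsI[OF smooth_affine_compose[OF test_functions_smooth[OF kernel(1)]]] by blast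
qed

lemma approx_as_test_integral:
  assumes "version u w"
  shows "approx k w z = (real k + 2)\<^sup>2 * (LINT s:R|lebesgue. u s * kernel ((real k + 2) *\<^sub>R s + (- (real k + 1)) *\<^sub>R z))"
  unfolding approx_def mollify_def
  using version_integral[OF assms test_functions_affine_measurable[OF kernel(1)]] by metis

text \<open>For the kernel taken at (k + 2) s - (k + 1) z, a derivative in \<open>z\<close> is -(k +
  1) / (k + 2) times one in \<open>s\<close>; the weak derivative moves the latter to
  \<open>u\<close>, and the minus signs cancel. Averaging and differentiation thus commute up to a
  factor tending to 1.\<close>

lemma approx_weak_pd:
  assumes u: "version u w" and g: "version g v" and z: "z \<in> CR"
  shows "has_weak_D u (1, 0) R g \<Longrightarrow> pdx UNIV (approx k w) z = (real k + 1) / (real k + 2) * approx k v z"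
    and "has_weak_D u (0, 1) R g \<Longrightarrow> pdy UNIV (approx k w) z = (real k + 1) / (real k + 2) * approx k v z"
proof -
  define N where "N = real k + 2"
  define p where "p = (- (real k + 1)) *\<^sub>R z"
  have N: "N > 0" by (simp add: N_def)
  let ?\<phi> = "\<lambda>s. kernel (N *\<^sub>R s + p)"
  have \<phi>: "?\<phi> \<in> test_functions R" unfolding N_def p_def by (rule kernel_test_function[OF z])
  have w: "integrable lborel w" using u by (simp add: version_def)
  note pd = pd_affine_compose[OF test_functions_smooth[OF kernel(1)], of N p]
  let ?M = "mollify kernel N (- (real k + 1)) w"
  let ?X = "mollify (pdx UNIV kernel) N (- (real k + 1)) w" and ?Y = "mollify (pdy UNIV kernel) N (- (real k + 1)) w"
  have "(approx k w has_derivative (\<lambda>h. fst h * (N\<^sup>2 * (- (real k + 1) * ?X z)) + snd h * (N\<^sup>2 * (- (real k + 1) * ?Y z)))) (at z)" for z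
    unfolding approx_def N_def[symmetric]
    by (rule has_derivative_eq_rhs[OF has_derivative_mult_right[OF mollify_has_derivative[OF kernel(1) w]]])
      (simp add: algebra_simps)
  note der = this
  have D: "pdx UNIV (approx k w) z = N\<^sup>2 * (- (real k + 1) * ?X z)"
    "pdy UNIV (approx k w) z = N\<^sup>2 * (- (real k + 1) * ?Y z)"
    by (simp_all add: pdx_def pdy_def frechet_derivative_at[OF der, symmetric])
  have G: "approx k v z = N\<^sup>2 * (LINT s:R|lebesgue. g s * ?\<phi> s)"
    unfolding N_def p_def by (rule approx_as_test_integral[OF g])
  have XY: "N * ?X z = (LINT s:R|lebesgue. u s * pdx UNIV ?\<phi> s)" "N * ?Y z = (LINT s:R|lebesgue. u s * pdy UNIV ?\<phi> s)"
    using version_integral[OF u test_functions_affine_measurable[OF test_functions_pd(1)[OF kernel(1)]], of N p]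
      version_integral[OF u test_functions_affine_measurable[OF test_functions_pd(2)[OF kernel(1)]], of N p]
    unfolding mollify_def p_def[symmetric] pd by (simp_all add: mult.left_commute)
  have arith: "N\<^sup>2 * (- m * (- I / N)) = m / N * (N\<^sup>2 * I)" for m I by simp
  show "pdx UNIV (approx k w) z = (real k + 1) / (real k + 2) * approx k v z" if "has_weak_D u (1, 0) R g"
  proof -
    have "(LINT s:R|lebesgue. u s * pdx UNIV ?\<phi> s) = - (LINT s:R|lebesgue. g s * ?\<phi> s)"
      using that \<phi> by (simp add: has_weak_D_def classical_D_def)
    then have "?X z = - (LINT s:R|lebesgue. g s * ?\<phi> s) / N" using XY(1) N by (simp add: field_simps)
    then show ?thesis unfolding D G N_def[symmetric] by (simp only: arith)
  qed
  show "pdy UNIV (approx k w) z = (real k + 1) / (real k + 2) * approx k v z" if "has_weak_D u (0, 1) R g"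
  proof -
    have "(LINT s:R|lebesgue. u s * pdy UNIV ?\<phi> s) = - (LINT s:R|lebesgue. g s * ?\<phi> s)"
      using that \<phi> by (simp add: has_weak_D_def classical_D_def)
    then have "?Y z = - (LINT s:R|lebesgue. g s * ?\<phi> s) / N" using XY(2) N by (simp add: field_simps)
    then show ?thesis unfolding D G N_def[symmetric] by (simp only: arith)
  qed
qed

text \<open>Every average of \<open>u\<close> is a pairing with a test function, hence 0, and the
  averages converge to \<open>u\<close> in L1.\<close>

lemma AE_zero_if_orthogonal_absolutely_integrable:
  assumes u: "u absolutely_integrable_on R"
    and orth: "\<And>\<phi>. \<phi> \<in> test_functions R \<Longrightarrow> (LINT z:R|lebesgue. u z * \<phi> z) = 0"
  shows "AE z in lebesgue. z \<in> R \<longrightarrow> u z = 0"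
proof -
  obtain w where w: "version u w" using ex_version[OF u] by blast
  have "approx k w z = 0" if "z \<in> R" for k z
  proof -
    have "z \<in> CR" using that R_subset_CR by (rule set_mp[rotated])
    then show ?thesis unfolding approx_as_test_integral[OF w] orth[OF kernel_test_function[OF \<open>z \<in> CR\<close>]] by simp
  qed
  then have "integral R (\<lambda>z. \<bar>approx k w z - u z\<bar>) = integral R (\<lambda>z. \<bar>u z\<bar>)" for k
    by (intro Henstock_Kurzweil_Integration.integral_cong) simp
  then have z: "integral R (\<lambda>z. \<bar>u z\<bar>) = 0"
    using approx_L1_tendsto[OF w] by (simp add: LIMSEQ_const_iff)
  have ai: "(\<lambda>z. \<bar>u z\<bar>) absolutely_integrable_on R"
    using absolutely_integrable_norm[OF u] by (simp add: o_def)
  have "(\<integral>z. indicator R z *\<^sub>R \<bar>u z\<bar> \<partial>lebesgue) = 0"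
    using set_lebesgue_integral_eq_integral(2)[OF ai] z by (simp add: set_lebesgue_integral_def)
  then have "AE z in lebesgue. indicator R z *\<^sub>R \<bar>u z\<bar> = 0"
    using ai by (subst (asm) integral_nonneg_eq_0_iff_AE) (simp_all add: set_integrable_def)
  then show ?thesis by (rule eventually_mono) (simp add: indicator_def)
qed

end

text \<open>Weak derivatives are a priori only locally integrable, so the integrable case is applied
  on the rectangles shrunk by 1 / (n + 1), which exhaust the open box.\<close>

lemma AE_zero_if_orthogonal:
  assumes u: "locally_integrable (box (a, c) (b, d)) u"
    and orth: "\<And>\<phi>. \<phi> \<in> test_functions (box (a, c) (b, d)) \<Longrightarrow> (LINT z:box (a, c) (b, d)|lebesgue. u z * \<phi> z) = 0"
  shows "AE z in lebesgue. z \<in> box (a, c) (b, d) \<longrightarrow> u z = (0 :: real)"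
proof (cases "a < b \<and> c < d")
  case False
  then have "box (a, c) (b, d) = {}" by (auto simp: box_eq_empty Basis_prod_def)
  then show ?thesis by simp
next
  case True
  then interpret O: rect a b c d by unfold_locales auto
  let ?e = "\<lambda>n::nat. 1 / (real n + 1)"
  let ?C = "\<lambda>n. box (a + ?e n, c + ?e n) (b - ?e n, d - ?e n)"
  have "AE z in lebesgue. z \<in> ?C n \<longrightarrow> u z = 0" for n
  proof (cases "a + ?e n < b - ?e n \<and> c + ?e n < d - ?e n")
    case False
    then have "?C n = {}" by (auto simp: box_eq_empty Basis_prod_def)
    then show ?thesis by simp
  next
    case True
    then interpret I: rect "a + ?e n" "b - ?e n" "c + ?e n" "d - ?e n" by unfold_locales auto
    have e: "?e n > 0" by simp
    have CR: "I.CR \<subseteq> O.R" 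
      unfolding subset_iff I.mem_CR O.mem_R using e by (metis add_less_same_cancel2 diff_less_eq less_add_same_cancel1 less_le_trans order.strict_trans1 diff_strict_left_mono diff_zero)
    then have R: "I.R \<subseteq> O.R" using I.R_subset_CR by blast
    show ?thesis
    proof (rule I.AE_zero_if_orthogonal_absolutely_integrable)
      show "u absolutely_integrable_on I.R"
        using u CR compact_cbox I.absolutely_integrable_on_R unfolding locally_integrable_def by blast
      fix \<phi> assume \<phi>: "\<phi> \<in> test_functions I.R"
      obtain K where K: "K \<subseteq> I.R" "\<And>z. z \<notin> K \<Longrightarrow> \<phi> z = 0"
        using test_functions_support[OF \<phi>] by metis
      have "(\<lambda>z. indicator I.R z *\<^sub>R (u z * \<phi> z)) = (\<lambda>z. indicator O.R z *\<^sub>R (u z * \<phi> z))"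
      proof
        show "indicator I.R z *\<^sub>R (u z * \<phi> z) = indicator O.R z *\<^sub>R (u z * \<phi> z)" for z
          using K R by (cases "z \<in> K") (auto simp: indicator_def subset_iff simp del: split_paired_All)
      qed
      then show "(LINT z:I.R|lebesgue. u z * \<phi> z) = 0"
        using orth[OF test_functions_mono[OF R \<phi>]] by (simp add: set_lebesgue_integral_def)
    qed
  qed
  then have "AE z in lebesgue. \<forall>n. z \<in> ?C n \<longrightarrow> u z = 0" unfolding AE_all_countable by blast
  then show ?thesis
  proof (rule eventually_mono, intro impI)
    fix z assume z: "\<forall>n. z \<in> ?C n \<longrightarrow> u z = 0" "z \<in> O.R"
    define m where "m = min (min (fst z - a) (b - fst z)) (min (snd z - c) (d - snd z))"
    have "m > 0" using z(2) by (simp add: m_def O.mem_R)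
    then obtain n where "inverse (real (Suc n)) < m" using reals_Archimedean by blast
    then have "?e n < m" by (simp add: inverse_eq_divide add.commute)
    then have "z \<in> ?C n"
      by (cases z) (simp add: m_def mem_box Basis_prod_def)
    then show "u z = 0" using z(1) by blast
  qed
qed

lemma has_weak_D_unique:
  assumes g: "has_weak_D u \<alpha> (box (a, c) (b, d)) g" and h: "has_weak_D u \<alpha> (box (a, c) (b, d)) h"
  shows "AE z in lebesgue. z \<in> box (a, c) (b, d) \<longrightarrow> g z = h z"
proof -
  have "AE z in lebesgue. z \<in> box (a, c) (b, d) \<longrightarrow> g z - h z = 0"
  proof (rule AE_zero_if_orthogonal)
    have lg: "locally_integrable (box (a, c) (b, d)) g" and lh: "locally_integrable (box (a, c) (b, d)) h"
      using g h by (simp_all add: has_weak_D_def)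
    then show "locally_integrable (box (a, c) (b, d)) (\<lambda>z. g z - h z)"
      unfolding locally_integrable_def by (intro allI impI set_integral_diff(1)) simp_all
    fix \<phi> assume \<phi>: "\<phi> \<in> test_functions (box (a, c) (b, d))"
    have "(LINT z:box (a, c) (b, d)|lebesgue. (g z - h z) * \<phi> z) =
      (LINT z:box (a, c) (b, d)|lebesgue. g z * \<phi> z) - (LINT z:box (a, c) (b, d)|lebesgue. h z * \<phi> z)"
      unfolding left_diff_distrib
      by (rule set_integral_diff(2)[OF test_functions_times_absolutely_integrable[OF \<phi> lg]
            test_functions_times_absolutely_integrable[OF \<phi> lh]])
    also have "\<dots> = 0"
    proof -
      have "(LINT z:box (a, c) (b, d)|lebesgue. u z * classical_D \<alpha> \<phi> z) =
        (-1) ^ (fst \<alpha> + snd \<alpha>) * (LINT z:box (a, c) (b, d)|lebesgue. k z * \<phi> z)"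
        if "has_weak_D u \<alpha> (box (a, c) (b, d)) k" for k
        using that \<phi> unfolding has_weak_D_def by blast
      from trans[OF this[OF g, symmetric] this[OF h]] show ?thesis by simp
    qed
    finally show "(LINT z:box (a, c) (b, d)|lebesgue. (g z - h z) * \<phi> z) = 0" .
  qed
  then show ?thesis by (rule eventually_mono) simp
qed

lemma weak_D_AE:
  assumes "has_weak_D u \<alpha> (box (a, c) (b, d)) g"
  shows "has_weak_D u \<alpha> (box (a, c) (b, d)) (weak_D (box (a, c) (b, d)) \<alpha> u)"
    and "AE z in lebesgue. z \<in> box (a, c) (b, d) \<longrightarrow> g z = weak_D (box (a, c) (b, d)) \<alpha> u z"
proof -
  show "has_weak_D u \<alpha> (box (a, c) (b, d)) (weak_D (box (a, c) (b, d)) \<alpha> u)"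
    unfolding weak_D_def by (rule someI[of "has_weak_D u \<alpha> (box (a, c) (b, d))", OF assms])
  with assms show "AE z in lebesgue. z \<in> box (a, c) (b, d) \<longrightarrow> g z = weak_D (box (a, c) (b, d)) \<alpha> u z"
    by (rule has_weak_D_unique)
qed

section \<open>Classical derivatives as weak derivatives\<close>

lemma DERIV_unique_Icc:
  fixes a b x :: real
  assumes "a < b" "x \<in> {a..b}"
    "(f has_real_derivative D) (at x within {a..b})" "(f has_real_derivative E) (at x within {a..b})"
  shows "D = E"
  using assms vector_derivative_unique_within_closed_interval[of a b x f D E]
  by (simp add: has_real_derivative_iff_has_vector_derivative)

lemma differentiable_on_pd:
  assumes "f differentiable_on S" "z \<in> S"
  shows "(f has_derivative (\<lambda>h. fst h * pdx S f z + snd h * pdy S f z)) (at z within S)"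
proof -
  have D: "(f has_derivative frechet_derivative f (at z within S)) (at z within S)"
    using assms frechet_derivative_works differentiable_on_def by blast
  interpret linear "frechet_derivative f (at z within S)"
    using D has_derivative_linear by blast
  have "frechet_derivative f (at z within S) = (\<lambda>h. fst h * pdx S f z + snd h * pdy S f z)"
  proof
    fix h
    have "h = fst h *\<^sub>R (1, 0) + snd h *\<^sub>R (0, 1)" by (simp add: prod_eq_iff)
    then have "frechet_derivative f (at z within S) h = frechet_derivative f (at z within S) (fst h *\<^sub>R (1, 0) + snd h *\<^sub>R (0, 1))"
      by simp
    also have "\<dots> = fst h * pdx S f z + snd h * pdy S f z"
      unfolding add scaleR by (simp add: pdx_def pdy_def)
    finally show "frechet_derivative f (at z within S) h = fst h * pdx S f z + snd h * pdy S f z" .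
  qed
  then show ?thesis using D by simp
qed

context rect
begin

lemma C1_DERIV:
  assumes f: "f differentiable_on CR" and "x \<in> {a..b}" "y \<in> {c..d}"
  shows "((\<lambda>t. f (t, y)) has_real_derivative pdx CR f (x, y)) (at x within {a..b})"
    and "((\<lambda>t. f (x, t)) has_real_derivative pdy CR f (x, y)) (at y within {c..d})"
proof -
  have CR: "t \<in> {a..b} \<Longrightarrow> s \<in> {c..d} \<Longrightarrow> (t, s) \<in> CR" for t s by (simp add: mem_CR)
  have z: "(x, y) \<in> CR" using assms CR by blast
  note D = differentiable_on_pd[OF f]
  have A: "((\<lambda>t. (t, y)) has_derivative (\<lambda>h. (h, 0))) (at x within {a..b})"
    "((\<lambda>t. (x, t)) has_derivative (\<lambda>h. (0, h))) (at y within {c..d})"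
    by (intro has_derivative_Pair has_derivative_ident has_derivative_const)+
  have B: "(\<lambda>t. (t, y)) ` {a..b} \<subseteq> CR" "(\<lambda>t. (x, t)) ` {c..d} \<subseteq> CR"
    using CR assms(2,3) by (simp_all add: image_subset_iff)
  show "((\<lambda>t. f (t, y)) has_real_derivative pdx CR f (x, y)) (at x within {a..b})"
    unfolding has_field_derivative_def
    by (rule has_derivative_eq_rhs[OF has_derivative_in_compose2[OF D B(1) assms(2) A(1)]])
      (simp_all add: mult.commute mult_commute_abs)
  show "((\<lambda>t. f (x, t)) has_real_derivative pdy CR f (x, y)) (at y within {c..d})"
    unfolding has_field_derivative_def
    by (rule has_derivative_eq_rhs[OF has_derivative_in_compose2[OF D B(2) assms(3) A(2)]])
      (simp_all add: mult.commute mult_commute_abs)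
qed

lemma set_lebesgue_integral_R:
  fixes f :: "real \<times> real \<Rightarrow> real"
  assumes "continuous_on CR f"
  shows "(LINT z:R|lebesgue. f z) = integral CR f"
  using set_lebesgue_integral_eq_integral(2)[OF continuous_absolutely_integrable(1)[OF assms]] integral_open_interval
  by metis

lemma kernel_boundary_zero:
  assumes "\<phi> \<in> test_functions R" "z \<notin> R"
  shows "\<phi> z = 0"
  by (rule test_functions_support[OF assms(1)]) (use assms(2) in blast)

text \<open>Fubini and, on each line, the fundamental theorem for the product, whose boundary values
  vanish with \<phi>. The derivatives of \<open>f\<close> are those within the closed
  rectangle.\<close>

lemma integral_pd_times_test_function:
  assumes f: "f differentiable_on CR" and \<phi>: "\<phi> \<in> test_functions R"
  shows "continuous_on CR (pdx CR f) \<Longrightarrow>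
      integral CR (\<lambda>z. f z * pdx UNIV \<phi> z) = - integral CR (\<lambda>z. pdx CR f z * \<phi> z)"
    and "continuous_on CR (pdy CR f) \<Longrightarrow>
      integral CR (\<lambda>z. f z * pdy UNIV \<phi> z) = - integral CR (\<lambda>z. pdy CR f z * \<phi> z)"
proof -
  have sm: "smooth \<phi>" using \<phi> by (rule test_functions_smooth)
  have cf: "continuous_on CR f" using f by (rule differentiable_imp_continuous_on)
  note c\<phi> = smooth_continuous_on[OF sm] smooth_continuous_on[OF smooth_pdx[OF sm]] smooth_continuous_on[OF smooth_pdy[OF sm]]
  show "integral CR (\<lambda>z. f z * pdx UNIV \<phi> z) = - integral CR (\<lambda>z. pdx CR f z * \<phi> z)"
    if c: "continuous_on CR (pdx CR f)"
  proof -
    have c1: "continuous_on CR (\<lambda>z. f z * pdx UNIV \<phi> z)" and c2: "continuous_on CR (\<lambda>z. pdx CR f z * \<phi> z)"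
      using cf c c\<phi> by (auto intro!: continuous_on_mult)
    have "integral CR (\<lambda>z. f z * pdx UNIV \<phi> z) + integral CR (\<lambda>z. pdx CR f z * \<phi> z) =
        integral CR (\<lambda>z. f z * pdx UNIV \<phi> z + pdx CR f z * \<phi> z)"
      by (rule Henstock_Kurzweil_Integration.integral_add[symmetric]; rule integrable_continuous; fact)
    also have "\<dots> = integral {c..d} (\<lambda>y. integral {a..b} (\<lambda>x. f (x, y) * pdx UNIV \<phi> (x, y) + pdx CR f (x, y) * \<phi> (x, y)))"
      by (rule box_integral_iterated(2)) (intro continuous_on_add c1 c2)
    also have "\<dots> = integral {c..d} (\<lambda>y. 0)"
    proof (rule Henstock_Kurzweil_Integration.integral_cong)
      fix y assume y: "y \<in> {c..d}"
      have "((\<lambda>x. f (x, y) * pdx UNIV \<phi> (x, y) + pdx CR f (x, y) * \<phi> (x, y)) has_integral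
          f (b, y) * \<phi> (b, y) - f (a, y) * \<phi> (a, y)) {a..b}"
      proof (rule fundamental_theorem_of_calculus)
        fix x assume x: "x \<in> {a..b}"
        show "((\<lambda>x. f (x, y) * \<phi> (x, y)) has_vector_derivative f (x, y) * pdx UNIV \<phi> (x, y) + pdx CR f (x, y) * \<phi> (x, y)) (at x within {a..b})"
          unfolding has_real_derivative_iff_has_vector_derivative[symmetric]
          by (rule DERIV_cong[OF DERIV_mult[OF C1_DERIV(1)[OF f x y] smooth_DERIV_fst[OF sm]]]) simp
      qed (use ab in simp)
      moreover have "\<phi> (b, y) = 0" "\<phi> (a, y) = 0" by (simp_all add: kernel_boundary_zero[OF \<phi>] mem_R)
      ultimately show "integral {a..b} (\<lambda>x. f (x, y) * pdx UNIV \<phi> (x, y) + pdx CR f (x, y) * \<phi> (x, y)) = 0"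
        by (simp add: integral_unique)
    qed
    finally show ?thesis by simp
  qed
  show "integral CR (\<lambda>z. f z * pdy UNIV \<phi> z) = - integral CR (\<lambda>z. pdy CR f z * \<phi> z)"
    if c: "continuous_on CR (pdy CR f)"
  proof -
    have c1: "continuous_on CR (\<lambda>z. f z * pdy UNIV \<phi> z)" and c2: "continuous_on CR (\<lambda>z. pdy CR f z * \<phi> z)"
      using cf c c\<phi> by (auto intro!: continuous_on_mult)
    have "integral CR (\<lambda>z. f z * pdy UNIV \<phi> z) + integral CR (\<lambda>z. pdy CR f z * \<phi> z) =
        integral CR (\<lambda>z. f z * pdy UNIV \<phi> z + pdy CR f z * \<phi> z)"
      by (rule Henstock_Kurzweil_Integration.integral_add[symmetric]; rule integrable_continuous; fact)
    also have "\<dots> = integral {a..b} (\<lambda>x. integral {c..d} (\<lambda>y. f (x, y) * pdy UNIV \<phi> (x, y) + pdy CR f (x, y) * \<phi> (x, y)))"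
      by (rule box_integral_iterated(1)) (intro continuous_on_add c1 c2)
    also have "\<dots> = integral {a..b} (\<lambda>x. 0)"
    proof (rule Henstock_Kurzweil_Integration.integral_cong)
      fix x assume x: "x \<in> {a..b}"
      have "((\<lambda>y. f (x, y) * pdy UNIV \<phi> (x, y) + pdy CR f (x, y) * \<phi> (x, y)) has_integral
          f (x, d) * \<phi> (x, d) - f (x, c) * \<phi> (x, c)) {c..d}"
      proof (rule fundamental_theorem_of_calculus)
        fix y assume y: "y \<in> {c..d}"
        show "((\<lambda>y. f (x, y) * \<phi> (x, y)) has_vector_derivative f (x, y) * pdy UNIV \<phi> (x, y) + pdy CR f (x, y) * \<phi> (x, y)) (at y within {c..d})"
          unfolding has_real_derivative_iff_has_vector_derivative[symmetric]
          by (rule DERIV_cong[OF DERIV_mult[OF C1_DERIV(2)[OF f x y] smooth_DERIV_snd[OF sm]]]) simp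
      qed (use cd in simp)
      moreover have "\<phi> (x, d) = 0" "\<phi> (x, c) = 0" by (simp_all add: kernel_boundary_zero[OF \<phi>] mem_R)
      ultimately show "integral {c..d} (\<lambda>y. f (x, y) * pdy UNIV \<phi> (x, y) + pdy CR f (x, y) * \<phi> (x, y)) = 0"
        by (simp add: integral_unique)
    qed
    finally show ?thesis by simp
  qed
qed

lemma C1_has_weak_D:
  assumes f: "f differentiable_on CR"
  shows "continuous_on CR (pdx CR f) \<Longrightarrow> has_weak_D f (1, 0) R (pdx CR f)"
    and "continuous_on CR (pdy CR f) \<Longrightarrow> has_weak_D f (0, 1) R (pdy CR f)"
proof -
  have cf: "continuous_on CR f" using f by (rule differentiable_imp_continuous_on)
  show "has_weak_D f (1, 0) R (pdx CR f)" if c: "continuous_on CR (pdx CR f)"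
    unfolding has_weak_D_def
  proof (intro conjI ballI continuous_absolutely_integrable cf c)
    fix \<phi> assume \<phi>: "\<phi> \<in> test_functions R"
    note sm = test_functions_smooth[OF \<phi>]
    have "continuous_on CR (\<lambda>z. f z * pdx UNIV \<phi> z)" "continuous_on CR (\<lambda>z. pdx CR f z * \<phi> z)"
      using cf c smooth_continuous_on[OF sm] smooth_continuous_on[OF smooth_pdx[OF sm]] by (auto intro!: continuous_on_mult)
    then show "(LINT z:R|lebesgue. f z * classical_D (1, 0) \<phi> z) =
      (-1) ^ (fst (1, 0) + snd (1, 0::nat)) * (LINT z:R|lebesgue. pdx CR f z * \<phi> z)"
      using integral_pd_times_test_function(1)[OF f \<phi> c]
      by (simp add: classical_D_def set_lebesgue_integral_R)
  qed
  show "has_weak_D f (0, 1) R (pdy CR f)" if c: "continuous_on CR (pdy CR f)"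
    unfolding has_weak_D_def
  proof (intro conjI ballI continuous_absolutely_integrable cf c)
    fix \<phi> assume \<phi>: "\<phi> \<in> test_functions R"
    note sm = test_functions_smooth[OF \<phi>]
    have "continuous_on CR (\<lambda>z. f z * pdy UNIV \<phi> z)" "continuous_on CR (\<lambda>z. pdy CR f z * \<phi> z)"
      using cf c smooth_continuous_on[OF sm] smooth_continuous_on[OF smooth_pdy[OF sm]] by (auto intro!: continuous_on_mult)
    then show "(LINT z:R|lebesgue. f z * classical_D (0, 1) \<phi> z) =
      (-1) ^ (fst (0::nat, 1::nat) + snd (0::nat, 1)) * (LINT z:R|lebesgue. pdy CR f z * \<phi> z)"
      using integral_pd_times_test_function(2)[OF f \<phi> c]
      by (simp add: classical_D_def set_lebesgue_integral_R)
  qed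
qed

lemma smooth_has_weak_D:
  assumes "smooth f"
  shows "has_weak_D f (1, 0) R (pdx UNIV f)" "has_weak_D f (0, 1) R (pdy UNIV f)"
proof -
  have dif: "f differentiable_on CR"
    unfolding differentiable_on_def differentiable_def
    using smooth_has_derivative[OF assms] has_derivative_at_withinI by blast
  \<comment> \<open>The derivative within the closed rectangle and the one in the plane agree
    because both are derivatives of the same one-dimensional slices.\<close>
  have eq: "pdx CR f z = pdx UNIV f z" "pdy CR f z = pdy UNIV f z" if "z \<in> CR" for z
  proof -
    have x: "fst z \<in> {a..b}" "snd z \<in> {c..d}" using that by (simp_all add: mem_CR)
    from C1_DERIV[OF dif this]
    have "((\<lambda>t. f (t, snd z)) has_real_derivative pdx CR f z) (at (fst z) within {a..b})"
      "((\<lambda>t. f (fst z, t)) has_real_derivative pdy CR f z) (at (snd z) within {c..d})" by simp_all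
    note P = this
    have "((\<lambda>t. f (t, snd z)) has_real_derivative pdx UNIV f z) (at (fst z) within {a..b})"
      "((\<lambda>t. f (fst z, t)) has_real_derivative pdy UNIV f z) (at (snd z) within {c..d})"
      using smooth_DERIV_fst[OF assms, of "snd z" "fst z"] smooth_DERIV_snd[OF assms, of "fst z" "snd z"] by simp_all
    then show "pdx CR f z = pdx UNIV f z" "pdy CR f z = pdy UNIV f z"
      using DERIV_unique_Icc[OF ab x(1) P(1)] DERIV_unique_Icc[OF cd x(2) P(2)] by blast+
  qed
  have "continuous_on CR (pdx CR f)" "continuous_on CR (pdy CR f)"
    using smooth_continuous_on[OF smooth_pdx[OF assms]] smooth_continuous_on[OF smooth_pdy[OF assms]]
    by (simp_all only: continuous_on_cong[OF refl eq(1)] continuous_on_cong[OF refl eq(2)])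
  from C1_has_weak_D(1)[OF dif this(1)] C1_has_weak_D(2)[OF dif this(2)]
  have w: "has_weak_D f (1, 0) R (pdx CR f)" "has_weak_D f (0, 1) R (pdy CR f)" .
  have inCR: "z \<in> CR" if "z \<in> R" for z using that R_subset_CR by (rule set_mp[rotated])
  show "has_weak_D f (1, 0) R (pdx UNIV f)"
    by (rule has_weak_D_cong_AE[OF w(1)]) (simp_all add: eq(1)[OF inCR])
  show "has_weak_D f (0, 1) R (pdy UNIV f)"
    by (rule has_weak_D_cong_AE[OF w(2)]) (simp_all add: eq(2)[OF inCR])
qed

end

subsection \<open>Sobolev-type inequalities for functions with continuous partial derivatives\<close>

lemma box_integral_slices:
  fixes f :: "real \<times> real \<Rightarrow> real"
  assumes "continuous_on (cbox (a, c) (b, d)) f"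
  shows "(\<lambda>x. integral {c..d} (\<lambda>y. f (x, y))) integrable_on {a..b}"
    and "(\<lambda>y. integral {a..b} (\<lambda>x. f (x, y))) integrable_on {c..d}"
proof -
  show "(\<lambda>x. integral {c..d} (\<lambda>y. f (x, y))) integrable_on {a..b}"
    using integral_integrable_2dim[OF assms] by simp
  have "continuous_on (cbox (c, a) (d, b)) (\<lambda>(y, x). f (x, y))"
    using swap_continuous[of a c b d "\<lambda>x y. f (x, y)"] assms by simp
  from integral_integrable_2dim[OF this]
  show "(\<lambda>y. integral {a..b} (\<lambda>x. f (x, y))) integrable_on {c..d}" by simp
qed

lemma C1_variation:
  fixes g :: "real \<Rightarrow> real"
  assumes g: "\<And>x. x \<in> {a..b} \<Longrightarrow> (g has_real_derivative g' x) (at x within {a..b})"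
    and g': "continuous_on {a..b} g'" and "x \<in> {a..b}" "y \<in> {a..b}"
  shows "\<bar>g x - g y\<bar> \<le> integral {a..b} (\<lambda>t. \<bar>g' t\<bar>)"
proof -
  have *: "\<bar>g t - g s\<bar> \<le> integral {a..b} (\<lambda>t. \<bar>g' t\<bar>)" if "a \<le> s" "s \<le> t" "t \<le> b" for s t
  proof -
    have sub: "{s..t} \<subseteq> {a..b}" using that by simp
    have "(g' has_integral g t - g s) {s..t}"
    proof (rule fundamental_theorem_of_calculus[OF that(2)])
      fix x assume "x \<in> {s..t}"
      then have "x \<in> {a..b}" using sub by blast
      from has_field_derivative_subset[OF g[OF this] sub]
      show "(g has_vector_derivative g' x) (at x within {s..t})"
        by (simp add: has_real_derivative_iff_has_vector_derivative)
    qed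
    then have "\<bar>g t - g s\<bar> = \<bar>integral {s..t} g'\<bar>" by (simp add: integral_unique)
    also have "\<dots> \<le> integral {s..t} (\<lambda>t. \<bar>g' t\<bar>)"
      using continuous_on_subset[OF g' sub] by (intro integral_norm_bound_integral[where f=g', simplified])
        (auto intro!: integrable_continuous_real continuous_intros)
    also have "\<dots> \<le> integral {a..b} (\<lambda>t. \<bar>g' t\<bar>)"
      using continuous_on_subset[OF g' sub] g'
      by (intro integral_subset_le[OF sub]) (auto intro!: integrable_continuous_real continuous_intros)
    finally show ?thesis .
  qed
  show ?thesis
    using *[of x y] *[of y x] assms(3,4) by (cases "x \<le> y") (simp_all add: abs_minus_commute)
qed

lemma C1_pointwise_bound:
  fixes g :: "real \<Rightarrow> real"
  assumes g: "\<And>x. x \<in> {a..b} \<Longrightarrow> (g has_real_derivative g' x) (at x within {a..b})"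
    and g': "continuous_on {a..b} g'" and x: "x \<in> {a..b}"
  shows "(b - a) * \<bar>g x\<bar> \<le> integral {a..b} (\<lambda>t. \<bar>g t\<bar>) + (b - a) * integral {a..b} (\<lambda>t. \<bar>g' t\<bar>)"
proof -
  have cg: "continuous_on {a..b} (\<lambda>t. \<bar>g t\<bar>)"
    using g by (intro continuous_intros DERIV_continuous_on)
  let ?I = "integral {a..b} (\<lambda>t. \<bar>g' t\<bar>)"
  have ab: "a \<le> b" using x by simp
  have "(b - a) * \<bar>g x\<bar> = integral {a..b} (\<lambda>t. \<bar>g x\<bar>)" using ab by simp
  also have "\<dots> \<le> integral {a..b} (\<lambda>t. \<bar>g t\<bar> + ?I)"
  proof (rule integral_le)
    show "\<bar>g x\<bar> \<le> \<bar>g t\<bar> + ?I" if "t \<in> {a..b}" for t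
      using C1_variation[OF g g' x that] by linarith
  qed (auto intro!: integrable_continuous_real continuous_on_add cg)
  also have "\<dots> = integral {a..b} (\<lambda>t. \<bar>g t\<bar>) + (b - a) * ?I"
    using ab by (subst Henstock_Kurzweil_Integration.integral_add) (auto intro!: integrable_continuous_real cg)
  finally show ?thesis .
qed

context rect
begin

text \<open>A relation between a function and its derivative instead of an operator: the derivative
  of an average is \<open>\<rho> k\<close> times the average of the weak derivative, so successive
  derivatives carry different factors and are supplied explicitly.\<close>

definition has_px :: "(real \<times> real \<Rightarrow> real) \<Rightarrow> (real \<times> real \<Rightarrow> real) \<Rightarrow> bool" where
  "has_px F G \<longleftrightarrow> continuous_on CR F \<and> continuous_on CR G \<and>
     (\<forall>x\<in>{a..b}. \<forall>y\<in>{c..d}. ((\<lambda>t. F (t, y)) has_real_derivative G (x, y)) (at x within {a..b}))"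

definition has_py :: "(real \<times> real \<Rightarrow> real) \<Rightarrow> (real \<times> real \<Rightarrow> real) \<Rightarrow> bool" where
  "has_py F G \<longleftrightarrow> continuous_on CR F \<and> continuous_on CR G \<and>
     (\<forall>x\<in>{a..b}. \<forall>y\<in>{c..d}. ((\<lambda>t. F (x, t)) has_real_derivative G (x, y)) (at y within {c..d}))"

abbreviation I1 :: "(real \<times> real \<Rightarrow> real) \<Rightarrow> real" where
  "I1 F \<equiv> integral CR (\<lambda>z. \<bar>F z\<bar>)"

lemma CR_iff: "(x, y) \<in> CR \<longleftrightarrow> x \<in> {a..b} \<and> y \<in> {c..d}"
  by (auto simp: mem_CR)

lemma continuous_slices:
  assumes "continuous_on CR (F :: _ \<Rightarrow> real)"
  shows "y \<in> {c..d} \<Longrightarrow> continuous_on {a..b} (\<lambda>t. F (t, y))"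
    and "x \<in> {a..b} \<Longrightarrow> continuous_on {c..d} (\<lambda>t. F (x, t))"
  by (rule continuous_on_compose2[OF assms]; auto intro!: continuous_intros simp: CR_iff)+

lemma px_variation:
  assumes "has_px F G" "x \<in> {a..b}" "x' \<in> {a..b}" "y \<in> {c..d}"
  shows "\<bar>F (x, y) - F (x', y)\<bar> \<le> integral {a..b} (\<lambda>t. \<bar>G (t, y)\<bar>)"
  using assms by (intro C1_variation[where g="\<lambda>t. F (t, y)" and g'="\<lambda>t. G (t, y)"])
    (simp_all add: has_px_def continuous_slices)

lemma py_variation:
  assumes "has_py F G" "x \<in> {a..b}" "y \<in> {c..d}" "y' \<in> {c..d}"
  shows "\<bar>F (x, y) - F (x, y')\<bar> \<le> integral {c..d} (\<lambda>t. \<bar>G (x, t)\<bar>)"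
  using assms by (intro C1_variation[where g="\<lambda>t. F (x, t)" and g'="\<lambda>t. G (x, t)"])
    (simp_all add: has_py_def continuous_slices)

lemma I1_iterated:
  assumes "continuous_on CR F"
  shows "I1 F = integral {a..b} (\<lambda>x. integral {c..d} (\<lambda>y. \<bar>F (x, y)\<bar>))"
    and "I1 F = integral {c..d} (\<lambda>y. integral {a..b} (\<lambda>x. \<bar>F (x, y)\<bar>))"
    and "(\<lambda>x. integral {c..d} (\<lambda>y. \<bar>F (x, y)\<bar>)) integrable_on {a..b}"
    and "(\<lambda>y. integral {a..b} (\<lambda>x. \<bar>F (x, y)\<bar>)) integrable_on {c..d}"
  using box_integral_iterated[of a c b d "\<lambda>z. \<bar>F z\<bar>"] box_integral_slices[of a c b d "\<lambda>z. \<bar>F z\<bar>"] assms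
  by (simp_all add: continuous_on_rabs)

lemma I1_nonneg: "0 \<le> I1 F"
  by (rule integral_nonneg_real) simp

text \<open>The one-dimensional pointwise bound on each vertical line, integrated over x.\<close>

lemma trace_bound:
  assumes F: "has_py F G" and y: "y \<in> {c..d}"
  shows "(d - c) * integral {a..b} (\<lambda>t. \<bar>F (t, y)\<bar>) \<le> I1 F + (d - c) * I1 G"
proof -
  have cF: "continuous_on CR F" "continuous_on CR G" using F by (simp_all add: has_py_def)
  note iF = I1_iterated(1,3)[OF cF(1)] and iG = I1_iterated(1,3)[OF cF(2)]
  have i0: "(\<lambda>t. \<bar>F (t, y)\<bar>) integrable_on {a..b}"
    by (intro integrable_continuous_real continuous_on_rabs continuous_slices(1)[OF cF(1) y])
  have "(d - c) * integral {a..b} (\<lambda>t. \<bar>F (t, y)\<bar>) = integral {a..b} (\<lambda>t. (d - c) * \<bar>F (t, y)\<bar>)" by simp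
  also have "\<dots> \<le> integral {a..b} (\<lambda>t. integral {c..d} (\<lambda>s. \<bar>F (t, s)\<bar>) + (d - c) * integral {c..d} (\<lambda>s. \<bar>G (t, s)\<bar>))"
  proof (rule integral_le)
    show "(\<lambda>t. integral {c..d} (\<lambda>s. \<bar>F (t, s)\<bar>) + (d - c) * integral {c..d} (\<lambda>s. \<bar>G (t, s)\<bar>)) integrable_on {a..b}"
      by (intro integrable_add integrable_on_mult_right iF iG)
    show "(\<lambda>t. (d - c) * \<bar>F (t, y)\<bar>) integrable_on {a..b}" by (rule integrable_on_mult_right[OF i0])
    show "(d - c) * \<bar>F (t, y)\<bar> \<le> integral {c..d} (\<lambda>s. \<bar>F (t, s)\<bar>) + (d - c) * integral {c..d} (\<lambda>s. \<bar>G (t, s)\<bar>)"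
      if "t \<in> {a..b}" for t
      using F that y by (intro C1_pointwise_bound[where g="\<lambda>s. F (t, s)" and g'="\<lambda>s. G (t, s)"])
        (simp_all add: has_py_def continuous_slices)
  qed
  also have "\<dots> = I1 F + (d - c) * I1 G"
    unfolding iF(1) iG(1) using iF(2) iG(2)
    by (subst Henstock_Kurzweil_Integration.integral_add) (simp_all add: integrable_on_mult_right)
  finally show ?thesis .
qed

text \<open>The one-dimensional bound along the horizontal line through the point, followed by
  \<open>trace_bound\<close> for both of its terms. Of the second derivatives only the mixed one
  enters.\<close>

lemma sup_bound:
  assumes Fx: "has_px F Fx" and Fy: "has_py F Fy" and Fxy: "has_py Fx Fxy" and z: "x \<in> {a..b}" "y \<in> {c..d}"
  shows "(b - a) * (d - c) * \<bar>F (x, y)\<bar> \<le> I1 F + (b - a) * I1 Fx + (d - c) * I1 Fy + (b - a) * (d - c) * I1 Fxy"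
proof -
  have "(b - a) * \<bar>F (x, y)\<bar> \<le> integral {a..b} (\<lambda>t. \<bar>F (t, y)\<bar>) + (b - a) * integral {a..b} (\<lambda>t. \<bar>Fx (t, y)\<bar>)"
    using Fx z by (intro C1_pointwise_bound[where g="\<lambda>t. F (t, y)" and g'="\<lambda>t. Fx (t, y)"])
      (simp_all add: has_px_def continuous_slices)
  then have "(d - c) * ((b - a) * \<bar>F (x, y)\<bar>) \<le> (d - c) * (integral {a..b} (\<lambda>t. \<bar>F (t, y)\<bar>) + (b - a) * integral {a..b} (\<lambda>t. \<bar>Fx (t, y)\<bar>))"
    using cd by (intro mult_left_mono) simp_all
  also have "\<dots> = (d - c) * integral {a..b} (\<lambda>t. \<bar>F (t, y)\<bar>) + (b - a) * ((d - c) * integral {a..b} (\<lambda>t. \<bar>Fx (t, y)\<bar>))"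
    by (simp add: algebra_simps)
  also have "\<dots> \<le> (I1 F + (d - c) * I1 Fy) + (b - a) * (I1 Fx + (d - c) * I1 Fxy)"
    using trace_bound[OF Fy z(2)] trace_bound[OF Fxy z(2)] ab by (intro add_mono mult_left_mono) simp_all
  finally show ?thesis by (simp add: algebra_simps)
qed

text \<open>Each (s, t) of the small rectangle is reached from (x, y) by going along the line at
  height \<open>y\<close> to abscissa \<open>s\<close> and then vertically. Averaging over the small
  rectangle leaves the line integral as it is and divides the strip integral by the width
  \<open>b1 - a1\<close> alone; the height \<open>d1 - c1\<close> cancels.\<close>

lemma mean_oscillation:
  assumes Fx: "has_px F Fx" and Fy: "has_py F Fy"
    and J: "a \<le> a1" "a1 < b1" "b1 \<le> b" and K: "c \<le> c1" "c1 < d1" "d1 \<le> d"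
    and m: "(b1 - a1) * (d1 - c1) * m = integral (cbox (a1, c1) (b1, d1)) F"
    and z: "x \<in> {a..b}" "y \<in> {c..d}"
  shows "\<bar>F (x, y) - m\<bar> \<le> integral {a..b} (\<lambda>t. \<bar>Fx (t, y)\<bar>) +
     integral (cbox (a1, c) (b1, d)) (\<lambda>z. \<bar>Fy z\<bar>) / (b1 - a1)"
proof -
  have cF: "continuous_on CR F" "continuous_on CR Fy" using Fy by (simp_all add: has_py_def)
  have sub: "cbox (a1, c1) (b1, d1) \<subseteq> CR" "cbox (a1, c) (b1, d) \<subseteq> CR" using J K by auto
  let ?Q = "cbox (a1, c1) (b1, d1)"
  let ?A = "integral {a..b} (\<lambda>t. \<bar>Fx (t, y)\<bar>)"
  let ?B = "\<lambda>s. integral {c..d} (\<lambda>t. \<bar>Fy (s, t)\<bar>)"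
  have cq: "continuous_on ?Q F" "continuous_on (cbox (a1, c) (b1, d)) (\<lambda>z. \<bar>Fy z\<bar>)"
    using continuous_on_subset[OF cF(1) sub(1)] continuous_on_subset[OF cF(2) sub(2)] by (simp_all add: continuous_on_rabs)
  have cq': "continuous_on ?Q (\<lambda>z. F (x, y) - F z)" by (intro continuous_intros cq)
  have iB: "?B integrable_on {a1..b1}" using box_integral_slices(1)[OF cq(2)] .
  have pos: "0 < b1 - a1" "0 < d1 - c1" using J K by simp_all
  have "(b1 - a1) * (d1 - c1) * (F (x, y) - m) = integral ?Q (\<lambda>z. F (x, y)) - integral ?Q F"
    using m pos by (simp add: right_diff_distrib content_Pair)
  also have "\<dots> = integral ?Q (\<lambda>z. F (x, y) - F z)"
    by (rule Henstock_Kurzweil_Integration.integral_diff[symmetric]) (auto intro!: integrable_continuous cq)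
  finally have "(b1 - a1) * (d1 - c1) * \<bar>F (x, y) - m\<bar> = \<bar>integral ?Q (\<lambda>z. F (x, y) - F z)\<bar>"
    using pos by (metis abs_mult abs_of_pos mult_pos_pos)
  also have "\<dots> \<le> integral ?Q (\<lambda>z. \<bar>F (x, y) - F z\<bar>)"
    by (rule integral_norm_bound_integral[where f="\<lambda>z. F (x, y) - F z", simplified])
      (intro integrable_continuous continuous_on_rabs cq' order_refl)+
  also have "\<dots> = integral {a1..b1} (\<lambda>s. integral {c1..d1} (\<lambda>t. \<bar>F (x, y) - F (s, t)\<bar>))"
    by (rule box_integral_iterated(1)) (intro continuous_on_rabs cq')
  also have "\<dots> \<le> integral {a1..b1} (\<lambda>s. (d1 - c1) * (?A + ?B s))"
  proof (rule integral_le)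
    show "(\<lambda>s. integral {c1..d1} (\<lambda>t. \<bar>F (x, y) - F (s, t)\<bar>)) integrable_on {a1..b1}"
      by (rule box_integral_slices(1)) (intro continuous_on_rabs cq')
    show "(\<lambda>s. (d1 - c1) * (?A + ?B s)) integrable_on {a1..b1}"
      by (intro integrable_on_mult_right integrable_add iB integrable_const_ivl)
    fix s assume s: "s \<in> {a1..b1}"
    have s': "s \<in> {a..b}" using s J by simp
    have "integral {c1..d1} (\<lambda>t. \<bar>F (x, y) - F (s, t)\<bar>) \<le> integral {c1..d1} (\<lambda>t. ?A + ?B s)"
    proof (rule integral_le)
      have "continuous_on {c1..d1} (\<lambda>t. F (s, t))"
        by (rule continuous_on_subset[OF continuous_slices(2)[OF cF(1) s']]) (use K in simp)
      then show "(\<lambda>t. \<bar>F (x, y) - F (s, t)\<bar>) integrable_on {c1..d1}"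
        by (intro integrable_continuous_real continuous_intros)
      show "(\<lambda>t. ?A + ?B s) integrable_on {c1..d1}" by (rule integrable_const_ivl)
      fix t assume "t \<in> {c1..d1}"
      then have t: "t \<in> {c..d}" using K by simp
      show "\<bar>F (x, y) - F (s, t)\<bar> \<le> ?A + ?B s"
        using px_variation[OF Fx z(1) s' z(2)] py_variation[OF Fy s' z(2) t] by linarith
    qed
    then show "integral {c1..d1} (\<lambda>t. \<bar>F (x, y) - F (s, t)\<bar>) \<le> (d1 - c1) * (?A + ?B s)"
      using pos by simp
  qed
  also have "\<dots> = (d1 - c1) * ((b1 - a1) * ?A + integral {a1..b1} ?B)"
    using pos iB by (simp add: Henstock_Kurzweil_Integration.integral_add integrable_const_ivl)
  also have "integral {a1..b1} ?B = integral (cbox (a1, c) (b1, d)) (\<lambda>z. \<bar>Fy z\<bar>)"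
    using box_integral_iterated(1)[OF cq(2)] by simp
  also have "(d1 - c1) * ((b1 - a1) * ?A + G) = (b1 - a1) * (d1 - c1) * (?A + G / (b1 - a1))" for G
    using pos by (simp add: distrib_left)
  finally have "(b1 - a1) * (d1 - c1) * \<bar>F (x, y) - m\<bar> \<le>
      (b1 - a1) * (d1 - c1) * (?A + integral (cbox (a1, c) (b1, d)) (\<lambda>z. \<bar>Fy z\<bar>) / (b1 - a1))" .
  then show ?thesis using pos by (simp add: mult_le_cancel_left_pos)
qed

text \<open>\<open>mean_oscillation\<close> with the whole rectangle as the small one and m = 0,
  integrated over x and y.\<close>

lemma mean_zero_poincare:
  assumes Fx: "has_px F Fx" and Fy: "has_py F Fy" and 0: "integral CR F = 0"
  shows "I1 F \<le> (b - a) * I1 Fx + (d - c) * I1 Fy"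
proof -
  have cF: "continuous_on CR F" "continuous_on CR Fx" using Fx by (simp_all add: has_px_def)
  note iF = I1_iterated(2,4)[OF cF(1)] and iFx = I1_iterated(2,4)[OF cF(2)]
  have "I1 F \<le> integral {c..d} (\<lambda>y. (b - a) * (integral {a..b} (\<lambda>t. \<bar>Fx (t, y)\<bar>) + I1 Fy / (b - a)))"
    unfolding iF(1)
  proof (rule integral_le)
    show "(\<lambda>y. (b - a) * (integral {a..b} (\<lambda>t. \<bar>Fx (t, y)\<bar>) + I1 Fy / (b - a))) integrable_on {c..d}"
      by (intro integrable_on_mult_right integrable_add iFx integrable_const_ivl)
    fix y assume y: "y \<in> {c..d}"
    have "integral {a..b} (\<lambda>x. \<bar>F (x, y)\<bar>) \<le> integral {a..b} (\<lambda>x. integral {a..b} (\<lambda>t. \<bar>Fx (t, y)\<bar>) + I1 Fy / (b - a))"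
    proof (rule integral_le)
      show "(\<lambda>x. \<bar>F (x, y)\<bar>) integrable_on {a..b}"
        by (intro integrable_continuous_real continuous_on_rabs continuous_slices(1)[OF cF(1) y])
      show "(\<lambda>x. integral {a..b} (\<lambda>t. \<bar>Fx (t, y)\<bar>) + I1 Fy / (b - a)) integrable_on {a..b}"
        by (rule integrable_const_ivl)
      show "\<bar>F (x, y)\<bar> \<le> integral {a..b} (\<lambda>t. \<bar>Fx (t, y)\<bar>) + I1 Fy / (b - a)" if "x \<in> {a..b}" for x
        using mean_oscillation[OF Fx Fy order_refl ab order_refl order_refl cd order_refl _ that y, of 0] 0 by simp
    qed
    then show "integral {a..b} (\<lambda>x. \<bar>F (x, y)\<bar>) \<le> (b - a) * (integral {a..b} (\<lambda>t. \<bar>Fx (t, y)\<bar>) + I1 Fy / (b - a))"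
      using ab by simp
  qed (rule iF(2))
  also have "\<dots> = (b - a) * (I1 Fx + (d - c) * (I1 Fy / (b - a)))"
    unfolding iFx(1) using cd iFx(2) by (simp add: Henstock_Kurzweil_Integration.integral_add integrable_const_ivl)
  also have "\<dots> = (b - a) * I1 Fx + (d - c) * I1 Fy"
    using ab by (simp add: field_simps)
  finally show ?thesis .
qed

lemma has_px_diff: "has_px F F' \<Longrightarrow> has_px G G' \<Longrightarrow> has_px (\<lambda>z. F z - G z) (\<lambda>z. F' z - G' z)"
  and has_py_diff: "has_py F F' \<Longrightarrow> has_py G G' \<Longrightarrow> has_py (\<lambda>z. F z - G z) (\<lambda>z. F' z - G' z)"
  unfolding has_px_def has_py_def by (auto intro!: continuous_intros DERIV_diff)

lemma has_px_linear: "has_px (\<lambda>z. \<alpha> + \<beta> * fst z + \<gamma> * snd z) (\<lambda>z. \<beta>)"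
  and has_py_linear: "has_py (\<lambda>z. \<alpha> + \<beta> * fst z + \<gamma> * snd z) (\<lambda>z. \<gamma>)"
  and has_px_const: "has_px (\<lambda>z. \<alpha>) (\<lambda>z. 0)"
  and has_py_const: "has_py (\<lambda>z. \<alpha>) (\<lambda>z. 0)"
  unfolding has_px_def has_py_def by (auto intro!: continuous_intros derivative_eq_intros)

text \<open>The second-order seminorm in L1 of a function V, weighted so that it scales like V
  itself under separate dilations in x and y. It is used for both first derivatives of
  \<open>u\<close>.\<close>

definition W2 :: "(real \<times> real \<Rightarrow> real) \<Rightarrow> (real \<times> real \<Rightarrow> real) \<Rightarrow> (real \<times> real \<Rightarrow> real) \<Rightarrow> real" where
  "W2 Vxx Vxy Vyy = (b - a) / (d - c) * I1 Vxx + I1 Vxy + (d - c) / (b - a) * I1 Vyy"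

lemma linear_approximation:
  assumes Vx: "has_px V Vx" and Vy: "has_py V Vy" and Vxx: "has_px Vx Vxx" and Vxy: "has_py Vx Vxy"
    and Vyx: "has_px Vy Vxy" and Vyy: "has_py Vy Vyy"
    and \<gamma>: "(b - a) * (d - c) * \<gamma> = integral CR Vy"
  obtains \<alpha> \<beta> where
    "\<And>x y. x \<in> {a..b} \<Longrightarrow> y \<in> {c..d} \<Longrightarrow> \<bar>V (x, y) - (\<alpha> + \<beta> * x + \<gamma> * y)\<bar> \<le> 5 * W2 Vxx Vxy Vyy"
    "\<And>y. y \<in> {c..d} \<Longrightarrow> \<bar>integral {a..b} (\<lambda>t. Vy (t, y)) - (b - a) * \<gamma>\<bar> \<le> 2 * ((b - a) / (d - c)) * W2 Vxx Vxy Vyy"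
proof -
  define h1 h2 where "h1 = b - a" and "h2 = d - c"
  have h: "h1 > 0" "h2 > 0" using ab cd by (simp_all add: h1_def h2_def)
  have cont: "continuous_on CR V" "continuous_on CR Vx" "continuous_on CR Vy"
    using Vx Vy by (simp_all add: has_px_def has_py_def)
  have area: "Henstock_Kurzweil_Integration.content CR = h1 * h2"
    using ab cd by (simp add: content_Pair h1_def h2_def)
  \<comment> \<open>The linear function is fixed by three means: \<open>\<beta>\<close> and the
    prescribed \<open>\<gamma>\<close> make both first derivatives of the residual average to 0, and
    \<open>\<alpha>\<close> the residual itself. Poincare's inequality can then be applied first to
    the derivatives and then to the residual.\<close>
  define \<beta> where "\<beta> = integral CR Vx / (h1 * h2)"
  define \<alpha> where "\<alpha> = integral CR (\<lambda>z. V z - (0 + \<beta> * fst z + \<gamma> * snd z)) / (h1 * h2)"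
  let ?r = "\<lambda>z. V z - (\<alpha> + \<beta> * fst z + \<gamma> * snd z)"
  let ?rx = "\<lambda>z. Vx z - \<beta>" and ?ry = "\<lambda>z. Vy z - \<gamma>"
  note D = has_px_diff[OF Vx has_px_linear[of \<alpha> \<beta> \<gamma>]] has_py_diff[OF Vy has_py_linear[of \<alpha> \<beta> \<gamma>]]
    has_px_diff[OF Vxx has_px_const[of \<beta>], simplified] has_py_diff[OF Vxy has_py_const[of \<beta>], simplified]
    has_px_diff[OF Vyx has_px_const[of \<gamma>], simplified] has_py_diff[OF Vyy has_py_const[of \<gamma>], simplified]
  have "integral CR ?r = integral CR (\<lambda>z. (V z - (0 + \<beta> * fst z + \<gamma> * snd z)) - \<alpha>)"
    by (simp add: algebra_simps)
  also have "\<dots> = 0"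
    using h by (subst Henstock_Kurzweil_Integration.integral_diff)
      (auto intro!: integrable_continuous continuous_intros cont simp: area \<alpha>_def)
  finally have r0: "integral CR ?r = 0" .
  have rx0: "integral CR ?rx = 0"
    using h by (subst Henstock_Kurzweil_Integration.integral_diff)
      (auto intro!: integrable_continuous continuous_intros cont simp: area \<beta>_def)
  have ry0: "integral CR ?ry = 0"
    using \<gamma> by (subst Henstock_Kurzweil_Integration.integral_diff)
      (auto intro!: integrable_continuous continuous_intros cont simp: area h1_def h2_def)
  have nx: "I1 ?rx \<le> h1 * I1 Vxx + h2 * I1 Vxy" 
    using mean_zero_poincare[OF D(3,4) rx0] by (simp add: h1_def h2_def)
  have ny: "I1 ?ry \<le> h1 * I1 Vxy + h2 * I1 Vyy" 
    using mean_zero_poincare[OF D(5,6) ry0] by (simp add: h1_def h2_def)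
  have nr: "I1 ?r \<le> h1 * I1 ?rx + h2 * I1 ?ry" 
    using mean_zero_poincare[OF D(1,2) r0] by (simp add: h1_def h2_def)
  let ?W = "W2 Vxx Vxy Vyy"
  have W: "h1 * h2 * ?W = h1\<^sup>2 * I1 Vxx + h1 * h2 * I1 Vxy + h2\<^sup>2 * I1 Vyy"
    using h by (simp add: W2_def h1_def[symmetric] h2_def[symmetric] field_simps power2_eq_square)
  note nn = I1_nonneg[of Vxx] I1_nonneg[of Vxy] I1_nonneg[of Vyy]
  show ?thesis
  proof (rule that[of \<alpha> \<beta>])
    fix x y assume z: "x \<in> {a..b}" "y \<in> {c..d}"
    have "h1 * h2 * \<bar>?r (x, y)\<bar> \<le> I1 ?r + h1 * I1 ?rx + h2 * I1 ?ry + h1 * h2 * I1 Vxy"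
      unfolding h1_def h2_def by (rule sup_bound[OF D(1,2,4) z])
    also have "\<dots> \<le> 2 * (h1 * (h1 * I1 Vxx + h2 * I1 Vxy) + h2 * (h1 * I1 Vxy + h2 * I1 Vyy)) + h1 * h2 * I1 Vxy"
    proof -
      have "r + p + q + k \<le> 2 * (P + Q) + k" if "r \<le> p + q" "p \<le> P" "q \<le> Q" for r p q k P Q :: real
        using that by argo
      from this[OF nr mult_left_mono[OF nx less_imp_le[OF h(1)]] mult_left_mono[OF ny less_imp_le[OF h(2)]]]
      show ?thesis .
    qed
    \<comment> \<open>The weights of the three terms of \<open>?W\<close> on the left are 2, 5 and
      2.\<close>
    also have "\<dots> \<le> 5 * (h1 * h2 * ?W)"
    proof -
      have "0 \<le> h1\<^sup>2 * I1 Vxx" "0 \<le> h2\<^sup>2 * I1 Vyy" using nn by simp_all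
      then show ?thesis unfolding W by (simp add: power2_eq_square algebra_simps)
    qed
    finally have "h1 * h2 * \<bar>?r (x, y)\<bar> \<le> h1 * h2 * (5 * ?W)" by simp
    then show "\<bar>V (x, y) - (\<alpha> + \<beta> * x + \<gamma> * y)\<bar> \<le> 5 * ?W"
      using h by (simp add: mult_le_cancel_left_pos)
  next
    fix y assume y: "y \<in> {c..d}"
    let ?E = "integral {a..b} (\<lambda>t. Vy (t, y)) - (b - a) * \<gamma>"
    have cy: "continuous_on {a..b} (\<lambda>t. Vy (t, y))" by (rule continuous_slices(1)[OF cont(3) y])
    have "?E = integral {a..b} (\<lambda>t. Vy (t, y) - \<gamma>)"
      using ab by (subst Henstock_Kurzweil_Integration.integral_diff) (auto intro!: integrable_continuous_real cy)
    then have "\<bar>?E\<bar> \<le> integral {a..b} (\<lambda>t. \<bar>Vy (t, y) - \<gamma>\<bar>)"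
    proof -
      have "(\<lambda>t. Vy (t, y) - \<gamma>) integrable_on {a..b}" "(\<lambda>t. \<bar>Vy (t, y) - \<gamma>\<bar>) integrable_on {a..b}"
        by (intro integrable_continuous_real continuous_intros cy)+
      from integral_norm_bound_integral[OF this] show ?thesis unfolding \<open>?E = _\<close> by simp
    qed
    from order_trans[OF mult_left_mono[OF this less_imp_le[OF h(2)]] trace_bound[OF D(6) y, folded h2_def]]
    have "h2 * \<bar>?E\<bar> \<le> I1 ?ry + h2 * I1 Vyy" .
    also have "\<dots> \<le> h1 * I1 Vxy + 2 * (h2 * I1 Vyy)" using ny by simp
    finally have "h2 * (h2 * \<bar>?E\<bar>) \<le> h2 * (h1 * I1 Vxy + 2 * (h2 * I1 Vyy))" using h by simp
    \<comment> \<open>Here the weights are 0, 1 and 2.\<close>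
    also have "\<dots> \<le> 2 * (h1 * h2 * ?W)"
    proof -
      have "0 \<le> h1\<^sup>2 * I1 Vxx" "0 \<le> h1 * h2 * I1 Vxy" using nn h by simp_all
      then show ?thesis unfolding W by (simp add: power2_eq_square algebra_simps)
    qed
    finally have "\<bar>?E\<bar> \<le> 2 * (h1 / h2) * ?W" using h by (simp add: field_simps)
    then show "\<bar>?E\<bar> \<le> 2 * ((b - a) / (d - c)) * ?W" by (simp add: h1_def h2_def)
  qed
qed

end

subsection \<open>The one-dimensional splines\<close>

locale ivl =
  fixes a b :: real
  assumes ab: "a < b"
begin

definition m :: real where "m = (a + b) / 2"
definition h :: real where "h = (b - a) / 2"

lemma h_pos: "h > 0" and ma: "m - a = h" and mb_eq: "m - b = - h" and ba: "b - a = 2 * h" and am: "a < m" and mb: "m < b"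
  using ab by (simp_all add: m_def h_def field_simps)

text \<open>The coefficients \<open>f\<close> and \<open>g\<close> are those of the Taylor expansions at \<open>a\<close> and at \<open>b\<close>.\<close>

definition spl :: "real \<Rightarrow> real \<Rightarrow> real \<Rightarrow> real \<Rightarrow> real \<Rightarrow> real \<Rightarrow> real \<Rightarrow> real" where
  "spl f0 f1 f2 g0 g1 g2 t = (if t < a \<or> b < t then 0
     else if t \<le> m then f0 + f1 * (t - a) + f2 * (t - a)\<^sup>2
     else g0 + g1 * (t - b) + g2 * (t - b)\<^sup>2)"

definition dspl :: "real \<Rightarrow> real \<Rightarrow> real \<Rightarrow> real \<Rightarrow> real \<Rightarrow> real" where
  "dspl f1 f2 g1 g2 t = (if t \<le> m then f1 + 2 * f2 * (t - a) else g1 + 2 * g2 * (t - b))"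

text \<open>The first two hypotheses match values and slopes at the midpoint, where t - a = h and t
  - b = -h.\<close>

lemma spl_DERIV:
  assumes "f0 + f1 * h + f2 * h\<^sup>2 = g0 - g1 * h + g2 * h\<^sup>2" "f1 + 2 * f2 * h = g1 - 2 * g2 * h"
    and t: "t \<in> {a..b}"
  shows "(spl f0 f1 f2 g0 g1 g2 has_real_derivative dspl f1 f2 g1 g2 t) (at t within {a..b})"
proof -
  let ?f = "\<lambda>t. f0 + f1 * (t - a) + f2 * (t - a)\<^sup>2" and ?g = "\<lambda>t. g0 + g1 * (t - b) + g2 * (t - b)\<^sup>2"
  have mid: "?f m = ?g m" "f1 + 2 * f2 * (m - a) = g1 + 2 * g2 * (m - b)"
    using assms(1,2) by (simp_all add: ma mb_eq)
  have eq: "{a..b} = {a..m} \<union> {m..b}" "closure {a..m} \<inter> closure {m..b} = {m}" using am mb by auto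
  have "((\<lambda>t. if t \<in> {a..m} then ?f t else ?g t) has_vector_derivative
     (if t \<in> {a..m} then f1 + 2 * f2 * (t - a) else g1 + 2 * g2 * (t - b))) (at t within {a..m} \<union> {m..b})"
  proof (rule has_vector_derivative_If_within_closures[where S="{a..m}" and T="{m..b}" and f="?f" and g="?g"
        and f'="\<lambda>t. f1 + 2 * f2 * (t - a)" and g'="\<lambda>t. g1 + 2 * g2 * (t - b)"], goal_cases)
    case 1 then show ?case using t eq by blast
  next
    case 3 show ?case
      unfolding has_real_derivative_iff_has_vector_derivative[symmetric] by (auto intro!: derivative_eq_intros)
  next
    case 4 show ?case
      unfolding has_real_derivative_iff_has_vector_derivative[symmetric] by (auto intro!: derivative_eq_intros)
  next
    case 5 then have "t = m" using eq(2) by blast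
    then show ?case using mid(1) by simp
  next
    case 6 then have "t = m" using eq(2) by blast
    then show ?case using mid(2) by simp
  qed simp
  then have "((\<lambda>t. if t \<in> {a..m} then ?f t else ?g t) has_real_derivative dspl f1 f2 g1 g2 t) (at t within {a..b})"
    unfolding eq(1) using t by (simp add: has_real_derivative_iff_has_vector_derivative dspl_def)
  then show ?thesis
    by (rule has_field_derivative_transform_within[where d=1]) (use t in \<open>auto simp: spl_def\<close>)
qed

lemma dspl_continuous:
  assumes "f1 + 2 * f2 * h = g1 - 2 * g2 * h"
  shows "continuous_on {a..b} (dspl f1 f2 g1 g2)"
proof -
  have eq: "{a..b} = {a..m} \<union> {m..b}" using am mb by auto
  have "continuous_on ({a..m} \<union> {m..b}) (\<lambda>t. if t \<le> m then f1 + 2 * f2 * (t - a) else g1 + 2 * g2 * (t - b))"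
    by (intro continuous_on_If continuous_intros) (use assms in \<open>auto simp: ma mb_eq\<close>)
  then show ?thesis unfolding eq[symmetric] dspl_def .
qed

lemma deriv_on_eq:
  assumes "(f has_real_derivative D) (at t within {a..b})" "t \<in> {a..b}"
  shows "deriv_on a b f t = D"
  unfolding deriv_on_def
  using vector_derivative_within_cbox[of a b t f D] assms ab
  by (simp add: has_real_derivative_iff_has_vector_derivative)

lemma splines_DERIV:
  assumes "f \<in> splines a b" "t \<in> {a..b}"
  shows "(f has_real_derivative deriv_on a b f t) (at t within {a..b})"
  using assms unfolding splines_def deriv_on_def has_real_derivative_iff_has_vector_derivative differentiable_on_def
  by (simp add: vector_derivative_works)

lemma spl_splines:
  assumes "f0 + f1 * h + f2 * h\<^sup>2 = g0 - g1 * h + g2 * h\<^sup>2" "f1 + 2 * f2 * h = g1 - 2 * g2 * h"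
  shows "spl f0 f1 f2 g0 g1 g2 \<in> splines a b"
    and "\<And>t. t \<in> {a..b} \<Longrightarrow> deriv_on a b (spl f0 f1 f2 g0 g1 g2) t = dspl f1 f2 g1 g2 t"
proof -
  let ?s = "spl f0 f1 f2 g0 g1 g2"
  note D = spl_DERIV[OF assms]
  show d: "\<And>t. t \<in> {a..b} \<Longrightarrow> deriv_on a b ?s t = dspl f1 f2 g1 g2 t"
    by (rule deriv_on_eq[OF D])
  have "?s differentiable_on {a..b}"
    using D unfolding differentiable_on_def real_differentiable_def by blast
  moreover have "continuous_on {a..b} (deriv_on a b ?s)"
    by (rule continuous_on_eq[OF dspl_continuous[OF assms(2)]]) (simp add: d)
  moreover have "quadratic_on {a..(a + b) / 2} ?s"
    unfolding quadratic_on_def m_def[symmetric]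
    by (rule exI[of _ "f0 - f1 * a + f2 * a\<^sup>2"], rule exI[of _ "f1 - 2 * f2 * a"], rule exI[of _ f2])
      (use mb in \<open>auto simp: spl_def power2_eq_square algebra_simps\<close>)
  moreover have "?s m = g0 + g1 * (m - b) + g2 * (m - b)\<^sup>2"
    using assms(1) am mb by (simp add: spl_def ma mb_eq)
  then have "quadratic_on {(a + b) / 2..b} ?s"
    unfolding quadratic_on_def m_def[symmetric]
    by (intro exI[of _ "g0 - g1 * b + g2 * b\<^sup>2"] exI[of _ "g1 - 2 * g2 * b"] exI[of _ g2] ballI)
      (use am in \<open>auto simp: spl_def power2_eq_square algebra_simps\<close>)
  ultimately show "?s \<in> splines a b" by (auto simp: splines_def spl_def)
qed

lemma splines_diff:
  assumes "f \<in> splines a b" "g \<in> splines a b"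
  shows "(\<lambda>t. f t - g t) \<in> splines a b"
    and "\<And>t. t \<in> {a..b} \<Longrightarrow> deriv_on a b (\<lambda>t. f t - g t) t = deriv_on a b f t - deriv_on a b g t"
proof -
  show d: "\<And>t. t \<in> {a..b} \<Longrightarrow> deriv_on a b (\<lambda>t. f t - g t) t = deriv_on a b f t - deriv_on a b g t"
    by (intro deriv_on_eq DERIV_diff splines_DERIV assms)
  have q: "quadratic_on S (\<lambda>t. f t - g t)" if qf: "quadratic_on S f" and qg: "quadratic_on S g" for S
  proof -
    obtain c0 c1 c2 where "\<forall>t\<in>S. f t = c0 + c1 * t + c2 * t\<^sup>2"
      using qf unfolding quadratic_on_def by blast
    moreover obtain e0 e1 e2 where "\<forall>t\<in>S. g t = e0 + e1 * t + e2 * t\<^sup>2"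
      using qg unfolding quadratic_on_def by blast
    ultimately show ?thesis
      unfolding quadratic_on_def
      by (intro exI[of _ "c0 - e0"] exI[of _ "c1 - e1"] exI[of _ "c2 - e2"]) (simp add: algebra_simps)
  qed
  have "continuous_on {a..b} (deriv_on a b f)" "continuous_on {a..b} (deriv_on a b g)"
    using assms by (simp_all add: splines_def)
  then have "continuous_on {a..b} (\<lambda>t. deriv_on a b f t - deriv_on a b g t)" by (rule continuous_on_diff)
  then have "continuous_on {a..b} (deriv_on a b (\<lambda>t. f t - g t))"
    by (rule continuous_on_eq) (simp add: d)
  then show "(\<lambda>t. f t - g t) \<in> splines a b"
    using assms q by (simp add: splines_def differentiable_on_diff)
qed

lemma quadratic_deriv:
  assumes f: "\<And>t. t \<in> {l..r} \<Longrightarrow> f t = c0 + c1 * t + c2 * t\<^sup>2" and sub: "{l..r} \<subseteq> {a..b}"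
    and D: "(f has_real_derivative D) (at t within {a..b})" and t: "t \<in> {l..r}" "l < r"
  shows "D = c1 + 2 * c2 * t"
proof (rule DERIV_unique_Icc[OF t(2,1)])
  show "(f has_real_derivative D) (at t within {l..r})" by (rule has_field_derivative_subset[OF D sub])
  have "((\<lambda>t. c0 + c1 * t + c2 * t\<^sup>2) has_real_derivative c1 + 2 * c2 * t) (at t within {l..r})"
    by (auto intro!: derivative_eq_intros)
  then show "(f has_real_derivative c1 + 2 * c2 * t) (at t within {l..r})"
    by (rule has_field_derivative_transform_within[where d=1]) (use f t in auto)
qed

text \<open>The end conditions leave c2 (t - a)^2 on the left half and e2 (t - b)^2 on the right
  one. At the midpoint equal values force c2 = e2 and equal slopes force c2 = -e2.\<close>

lemma splines_zero:
  assumes s: "s \<in> splines a b" and v: "s a = 0" "s b = 0" "deriv_on a b s a = 0" "deriv_on a b s b = 0"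
  shows "s t = 0"
proof -
  note D = splines_DERIV[OF s]
  obtain c0 c1 c2 where c: "\<And>t. t \<in> {a..m} \<Longrightarrow> s t = c0 + c1 * t + c2 * t\<^sup>2"
    using s by (auto simp: splines_def quadratic_on_def m_def)
  obtain e0 e1 e2 where e: "\<And>t. t \<in> {m..b} \<Longrightarrow> s t = e0 + e1 * t + e2 * t\<^sup>2"
    using s by (auto simp: splines_def quadratic_on_def m_def)
  have sub: "{a..m} \<subseteq> {a..b}" "{m..b} \<subseteq> {a..b}" using am mb by auto
  have mem: "a \<in> {a..b}" "b \<in> {a..b}" "m \<in> {a..b}" "a \<in> {a..m}" "m \<in> {a..m}" "m \<in> {m..b}" "b \<in> {m..b}"
    using am mb by auto
  have c1: "c1 = - 2 * c2 * a" using quadratic_deriv[OF c sub(1) D[OF mem(1)] mem(4) am] v(3) by simp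
  have e1: "e1 = - 2 * e2 * b" using quadratic_deriv[OF e sub(2) D[OF mem(2)] mem(7) mb] v(4) by simp
  have c0: "c0 = c2 * a\<^sup>2" using c[OF mem(4)] v(1) c1 by (simp add: power2_eq_square)
  have e0: "e0 = e2 * b\<^sup>2" using e[OF mem(7)] v(2) e1 by (simp add: power2_eq_square)
  have sc: "s t = c2 * (t - a)\<^sup>2" if "t \<in> {a..m}" for t
    using c[OF that] by (simp add: c0 c1 power2_eq_square algebra_simps)
  have se: "s t = e2 * (t - b)\<^sup>2" if "t \<in> {m..b}" for t
    using e[OF that] by (simp add: e0 e1 power2_eq_square algebra_simps)
  have "c1 + 2 * c2 * m = e1 + 2 * e2 * m"
    using quadratic_deriv[OF c sub(1) D[OF mem(3)] mem(5) am] quadratic_deriv[OF e sub(2) D[OF mem(3)] mem(6) mb] by simp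
  then have "2 * c2 * (m - a) = 2 * e2 * (m - b)" by (simp add: c1 e1 algebra_simps)
  then have "(c2 + e2) * h = 0" by (simp add: ma mb_eq algebra_simps)
  then have 1: "c2 = - e2" using h_pos by simp
  have "c2 * (m - a)\<^sup>2 = e2 * (m - b)\<^sup>2" using sc[OF mem(5)] se[OF mem(6)] by simp
  then have "c2 * h\<^sup>2 = e2 * h\<^sup>2" by (simp add: ma mb_eq)
  then have "c2 = e2" using h_pos by simp
  then have z: "c2 = 0" "e2 = 0" using 1 by simp_all
  show ?thesis
  proof (cases "t \<in> {a..b}")
    case True
    then consider "t \<in> {a..m}" | "t \<in> {m..b}" by force
    then show ?thesis using sc se z by cases auto
  next
    case False then show ?thesis using s by (simp add: splines_def)
  qed
qed

lemma splines_unique: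
  assumes "f \<in> splines a b" "g \<in> splines a b" "f a = g a" "f b = g b"
    "deriv_on a b f a = deriv_on a b g a" "deriv_on a b f b = deriv_on a b g b"
  shows "f = g"
proof
  fix t
  have "f t - g t = 0"
  proof (rule splines_zero[OF splines_diff(1)[OF assms(1,2)]])
    have "a \<in> {a..b}" "b \<in> {a..b}" using ab by simp_all
    note this[THEN splines_diff(2)[OF assms(1,2)]]
    then show "deriv_on a b (\<lambda>t. f t - g t) a = 0" "deriv_on a b (\<lambda>t. f t - g t) b = 0"
      unfolding assms(5,6) by (simp_all only: diff_self)
  qed (simp_all only: assms(3,4) diff_self)
  then show "f t = g t" by simp
qed

text \<open>Values and slopes at the ends give the constant and linear coefficients; the two
  quadratic ones solve the 2 x 2 matching system at the midpoint.\<close>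

lemma spline_phi_eq: "spline_phi a b b = spl 0 0 (1 / (2 * h\<^sup>2)) 1 0 (- 1 / (2 * h\<^sup>2))"
    "spline_phi a b a = spl 1 0 (- 1 / (2 * h\<^sup>2)) 0 0 (1 / (2 * h\<^sup>2))"
  and spline_psi_eq: "spline_psi a b b = spl 0 0 (- 1 / (4 * h)) 0 1 (3 / (4 * h))"
    "spline_psi a b a = spl 0 1 (- 3 / (4 * h)) 0 0 (1 / (4 * h))"
proof -
  have ends: "a \<in> {a..b}" "b \<in> {a..b}" "a \<noteq> b" "b \<noteq> a" "a \<le> m" "\<not> b \<le> m" "\<not> b < a" using ab am mb by auto
  have V: "spl f0 f1 f2 g0 g1 g2 a = f0" "spl f0 f1 f2 g0 g1 g2 b = g0"
    "dspl f1 f2 g1 g2 a = f1" "dspl f1 f2 g1 g2 b = g1" for f0 f1 f2 g0 g1 g2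
    using ends by (simp_all add: spl_def dspl_def)
  \<comment> \<open>All four functions are given by nodal data \<open>A\<close> and
    \<open>B\<close>, so existence and uniqueness for the definite descriptions are settled
    together.\<close>
  have key: "(THE f. f \<in> splines a b \<and> (\<forall>k\<in>{a, b}. f k = A k \<and> deriv_on a b f k = B k)) = spl f0 f1 f2 g0 g1 g2"
    if "f0 + f1 * h + f2 * h\<^sup>2 = g0 - g1 * h + g2 * h\<^sup>2" "f1 + 2 * f2 * h = g1 - 2 * g2 * h"
      "A a = f0" "A b = g0" "B a = f1" "B b = g1"
    for A B f0 f1 f2 g0 g1 g2
  proof (rule the_equality)
    note S = spl_splines[OF that(1,2)]
    show S': "spl f0 f1 f2 g0 g1 g2 \<in> splines a b \<and>
        (\<forall>k\<in>{a, b}. spl f0 f1 f2 g0 g1 g2 k = A k \<and> deriv_on a b (spl f0 f1 f2 g0 g1 g2) k = B k)"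
      using S(1) S(2)[OF ends(1)] S(2)[OF ends(2)] that(3-6) by (simp add: V)
    show "f = spl f0 f1 f2 g0 g1 g2"
      if "f \<in> splines a b \<and> (\<forall>k\<in>{a, b}. f k = A k \<and> deriv_on a b f k = B k)" for f
      using that S' by (intro splines_unique) simp_all
  qed
  show "spline_phi a b b = spl 0 0 (1 / (2 * h\<^sup>2)) 1 0 (- 1 / (2 * h\<^sup>2))"
    unfolding spline_phi_def by (rule key) (use h_pos ends in \<open>simp_all add: field_simps\<close>)
  show "spline_phi a b a = spl 1 0 (- 1 / (2 * h\<^sup>2)) 0 0 (1 / (2 * h\<^sup>2))"
    unfolding spline_phi_def by (rule key) (use h_pos ends in \<open>simp_all add: field_simps\<close>)
  show "spline_psi a b b = spl 0 0 (- 1 / (4 * h)) 0 1 (3 / (4 * h))"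
    unfolding spline_psi_def by (rule key) (use h_pos ends in \<open>simp_all add: field_simps power2_eq_square\<close>)
  show "spline_psi a b a = spl 0 1 (- 3 / (4 * h)) 0 0 (1 / (4 * h))"
    unfolding spline_psi_def by (rule key) (use h_pos ends in \<open>simp_all add: field_simps power2_eq_square\<close>)
qed

lemma spline_mem:
  "spline_phi a b a \<in> splines a b" "spline_phi a b b \<in> splines a b"
  "spline_psi a b a \<in> splines a b" "spline_psi a b b \<in> splines a b"
  unfolding spline_phi_eq spline_psi_eq
  by (rule spl_splines(1); use h_pos in \<open>simp add: field_simps power2_eq_square\<close>)+

lemma spline_deriv:
  assumes "t \<in> {a..b}"
  shows "deriv_on a b (spline_phi a b b) t = (if t \<le> m then (t - a) / h\<^sup>2 else (b - t) / h\<^sup>2)"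
    "deriv_on a b (spline_phi a b a) t = - (if t \<le> m then (t - a) / h\<^sup>2 else (b - t) / h\<^sup>2)"
    "deriv_on a b (spline_psi a b b) t = (if t \<le> m then - (t - a) / (2 * h) else 1 + 3 * (t - b) / (2 * h))"
    "deriv_on a b (spline_psi a b a) t = (if t \<le> m then 1 - 3 * (t - a) / (2 * h) else (t - b) / (2 * h))"
proof -
  have "deriv_on a b (spl 0 0 (1 / (2 * h\<^sup>2)) 1 0 (- 1 / (2 * h\<^sup>2))) t = dspl 0 (1 / (2 * h\<^sup>2)) 0 (- 1 / (2 * h\<^sup>2)) t"
    "deriv_on a b (spl 1 0 (- 1 / (2 * h\<^sup>2)) 0 0 (1 / (2 * h\<^sup>2))) t = dspl 0 (- 1 / (2 * h\<^sup>2)) 0 (1 / (2 * h\<^sup>2)) t"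
    "deriv_on a b (spl 0 0 (- 1 / (4 * h)) 0 1 (3 / (4 * h))) t = dspl 0 (- 1 / (4 * h)) 1 (3 / (4 * h)) t"
    "deriv_on a b (spl 0 1 (- 3 / (4 * h)) 0 0 (1 / (4 * h))) t = dspl 1 (- 3 / (4 * h)) 0 (1 / (4 * h)) t"
    by (rule spl_splines(2)[OF _ _ assms]; use h_pos in \<open>simp add: field_simps power2_eq_square\<close>)+
  then show "deriv_on a b (spline_phi a b b) t = (if t \<le> m then (t - a) / h\<^sup>2 else (b - t) / h\<^sup>2)"
    "deriv_on a b (spline_phi a b a) t = - (if t \<le> m then (t - a) / h\<^sup>2 else (b - t) / h\<^sup>2)"
    "deriv_on a b (spline_psi a b b) t = (if t \<le> m then - (t - a) / (2 * h) else 1 + 3 * (t - b) / (2 * h))"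
    "deriv_on a b (spline_psi a b a) t = (if t \<le> m then 1 - 3 * (t - a) / (2 * h) else (t - b) / (2 * h))"
    unfolding spline_phi_eq spline_psi_eq by (simp_all add: dspl_def diff_divide_distrib)
qed

lemma spline_value:
  assumes "t \<in> {a..b}"
  shows "spline_phi a b b t = (if t \<le> m then (t - a)\<^sup>2 / (2 * h\<^sup>2) else 1 - (b - t)\<^sup>2 / (2 * h\<^sup>2))"
    "spline_phi a b a t = 1 - (if t \<le> m then (t - a)\<^sup>2 / (2 * h\<^sup>2) else 1 - (b - t)\<^sup>2 / (2 * h\<^sup>2))"
    "spline_psi a b b t = (if t \<le> m then - (t - a)\<^sup>2 / (4 * h) else (t - b) + 3 * (t - b)\<^sup>2 / (4 * h))"
    "spline_psi a b a t = (if t \<le> m then (t - a) - 3 * (t - a)\<^sup>2 / (4 * h) else (t - b)\<^sup>2 / (4 * h))"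
  using assms unfolding spline_phi_eq spline_psi_eq spl_def by (simp_all add: power2_commute[of b t])

text \<open>With u the distance to the end of the half containing \<open>t\<close>, in units of
  \<open>h\<close>, the basis functions and their derivatives become polynomials in u up to powers
  of \<open>h\<close>; the two cases are mirror images up to signs.\<close>

lemma spline_param:
  assumes t: "t \<in> {a..b}"
  obtains u where "0 \<le> u" "u \<le> 1" "t = a + u * h" "deriv_on a b (spline_phi a b b) t = u / h"
    "deriv_on a b (spline_psi a b a) t = 1 - 3 / 2 * u" "deriv_on a b (spline_psi a b b) t = - u / 2"
    "spline_phi a b a t = 1 - u\<^sup>2 / 2" "spline_phi a b b t = u\<^sup>2 / 2"
    "spline_psi a b a t = h * (u - 3 / 4 * u\<^sup>2)" "spline_psi a b b t = - (h * (u\<^sup>2 / 4))"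
  | u where "0 \<le> u" "u \<le> 1" "t = b - u * h" "deriv_on a b (spline_phi a b b) t = u / h"
    "deriv_on a b (spline_psi a b a) t = - u / 2" "deriv_on a b (spline_psi a b b) t = 1 - 3 / 2 * u"
    "spline_phi a b a t = u\<^sup>2 / 2" "spline_phi a b b t = 1 - u\<^sup>2 / 2"
    "spline_psi a b a t = h * (u\<^sup>2 / 4)" "spline_psi a b b t = - (h * (u - 3 / 4 * u\<^sup>2))"
proof (cases "t \<le> m")
  case True
  define u where "u = (t - a) / h"
  have tx: "t - a = u * h" using h_pos by (simp add: u_def)
  have "t - a \<le> h" using True ma by linarith
  then have u: "0 \<le> u" "u \<le> 1" using t h_pos by (simp_all add: u_def)
  have n: "u * h / h\<^sup>2 = u / h" "(u * h)\<^sup>2 / (2 * h\<^sup>2) = u\<^sup>2 / 2" "- (u * h)\<^sup>2 / (4 * h) = - (h * (u\<^sup>2 / 4))"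
    "- (u * h) / (2 * h) = - u / 2" "1 - 3 * (u * h) / (2 * h) = 1 - 3 / 2 * u"
    "u * h - 3 * (u * h)\<^sup>2 / (4 * h) = h * (u - 3 / 4 * u\<^sup>2)"
    using h_pos by (simp_all add: field_simps power2_eq_square)
  have T: "t = a + u * h" using tx by linarith
  show ?thesis
    by (rule that(1)[OF u T]) (simp_all only: spline_deriv[OF t] spline_value[OF t] if_P[OF True] tx n)
next
  case False
  define u where "u = (b - t) / h"
  have tx: "b - t = u * h" "t - b = - (u * h)" using h_pos by (simp_all add: u_def)
  have "b - t \<le> h" using False mb_eq by linarith
  then have u: "0 \<le> u" "u \<le> 1" using t h_pos by (simp_all add: u_def)
  have n: "u * h / h\<^sup>2 = u / h" "1 - (u * h)\<^sup>2 / (2 * h\<^sup>2) = 1 - u\<^sup>2 / 2" "1 - (1 - u\<^sup>2 / 2) = u\<^sup>2 / 2"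
    "(- (u * h))\<^sup>2 / (4 * h) = h * (u\<^sup>2 / 4)"
    "- (u * h) / (2 * h) = - u / 2" "1 + 3 * - (u * h) / (2 * h) = 1 - 3 / 2 * u"
    "- (u * h) + 3 * (- (u * h))\<^sup>2 / (4 * h) = - (h * (u - 3 / 4 * u\<^sup>2))"
    using h_pos by (simp_all add: field_simps power2_eq_square)
  have T: "t = b - u * h" using tx by linarith
  show ?thesis
    by (rule that(2)[OF u T]) (simp_all only: spline_deriv[OF t] spline_value[OF t] if_not_P[OF False] tx n)
qed

text \<open>Hermite interpolation is exact for quadratics. The first two identities are the
  differentiated interpolants of x and x^2 / 2, where the derivatives of the two phi functions are
  opposite; the last two are the interpolants of 1 and x.\<close>

lemma spline_reproduction:
  assumes t: "t \<in> {a..b}"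
  shows "(b - a) * deriv_on a b (spline_phi a b b) t + deriv_on a b (spline_psi a b a) t + deriv_on a b (spline_psi a b b) t = 1"
    and "(b\<^sup>2 - a\<^sup>2) / 2 * deriv_on a b (spline_phi a b b) t + a * deriv_on a b (spline_psi a b a) t + b * deriv_on a b (spline_psi a b b) t = t"
    and "spline_phi a b a t + spline_phi a b b t = 1"
    and "a * spline_phi a b a t + b * spline_phi a b b t + spline_psi a b a t + spline_psi a b b t = t"
proof -
  have gen: "(B - A) * (u / H) + (1 - 3 / 2 * u) + - u / 2 = 1"
    "(B\<^sup>2 - A\<^sup>2) / 2 * (u / H) + A * (1 - 3 / 2 * u) + B * (- u / 2) = A + u * H"
    "A * (1 - u\<^sup>2 / 2) + B * (u\<^sup>2 / 2) + H * (u - 3 / 4 * u\<^sup>2) + - (H * (u\<^sup>2 / 4)) = A + u * H"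
    "(B - A) * (u / H) + - u / 2 + (1 - 3 / 2 * u) = 1"
    "(B\<^sup>2 - A\<^sup>2) / 2 * (u / H) + A * (- u / 2) + B * (1 - 3 / 2 * u) = B - u * H"
    "A * (u\<^sup>2 / 2) + B * (1 - u\<^sup>2 / 2) + H * (u\<^sup>2 / 4) + - (H * (u - 3 / 4 * u\<^sup>2)) = B - u * H"
    if "B - A = 2 * H" "H > 0" for A B H u :: real
  proof -
    have B: "B = A + 2 * H" using that by simp
    show "(B - A) * (u / H) + (1 - 3 / 2 * u) + - u / 2 = 1"
      "(B\<^sup>2 - A\<^sup>2) / 2 * (u / H) + A * (1 - 3 / 2 * u) + B * (- u / 2) = A + u * H"
      "A * (1 - u\<^sup>2 / 2) + B * (u\<^sup>2 / 2) + H * (u - 3 / 4 * u\<^sup>2) + - (H * (u\<^sup>2 / 4)) = A + u * H"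
      "(B - A) * (u / H) + - u / 2 + (1 - 3 / 2 * u) = 1"
      "(B\<^sup>2 - A\<^sup>2) / 2 * (u / H) + A * (- u / 2) + B * (1 - 3 / 2 * u) = B - u * H"
      "A * (u\<^sup>2 / 2) + B * (1 - u\<^sup>2 / 2) + H * (u\<^sup>2 / 4) + - (H * (u - 3 / 4 * u\<^sup>2)) = B - u * H"
      unfolding B using that(2) by (simp_all add: field_simps power2_eq_square)
  qed
  note gen = gen[OF ba h_pos]
  show "(b - a) * deriv_on a b (spline_phi a b b) t + deriv_on a b (spline_psi a b a) t + deriv_on a b (spline_psi a b b) t = 1"
    by (cases rule: spline_param[OF t]) (simp_all only: gen)
  show "(b\<^sup>2 - a\<^sup>2) / 2 * deriv_on a b (spline_phi a b b) t + a * deriv_on a b (spline_psi a b a) t + b * deriv_on a b (spline_psi a b b) t = t"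
    by (cases rule: spline_param[OF t]) (simp_all only: gen)
  show "spline_phi a b a t + spline_phi a b b t = 1"
    by (cases rule: spline_param[OF t]) simp_all
  show "a * spline_phi a b a t + b * spline_phi a b b t + spline_psi a b a t + spline_psi a b b t = t"
    by (cases rule: spline_param[OF t]) (simp_all only: gen)
qed

lemma spline_bounds:
  assumes t: "t \<in> {a..b}"
  shows "\<bar>deriv_on a b (spline_phi a b b) t\<bar> \<le> 2 / (b - a)"
    and "\<bar>deriv_on a b (spline_psi a b a) t\<bar> \<le> 1" and "\<bar>deriv_on a b (spline_psi a b b) t\<bar> \<le> 1"
    and "\<bar>spline_phi a b a t\<bar> \<le> 1" and "\<bar>spline_phi a b b t\<bar> \<le> 1"
    and "\<bar>spline_psi a b a t\<bar> \<le> b - a" and "\<bar>spline_psi a b b t\<bar> \<le> b - a"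
proof -
  obtain u v where u: "0 \<le> u" "u \<le> 1" "0 \<le> v" "v \<le> 1" and P: "deriv_on a b (spline_phi a b b) t = u / h"
    "deriv_on a b (spline_psi a b a) t \<in> {1 - 3 / 2 * u, - u / 2}" "deriv_on a b (spline_psi a b b) t \<in> {1 - 3 / 2 * u, - u / 2}"
    "spline_phi a b a t \<in> {v / 2, 1 - v / 2}" "spline_phi a b b t \<in> {v / 2, 1 - v / 2}"
    "\<bar>spline_psi a b a t\<bar> \<in> {h * \<bar>u - 3 / 4 * v\<bar>, h * \<bar>v / 4\<bar>}" "\<bar>spline_psi a b b t\<bar> \<in> {h * \<bar>u - 3 / 4 * v\<bar>, h * \<bar>v / 4\<bar>}"
  proof (cases rule: spline_param[OF t])
    case (1 u)
    show ?thesis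
      by (rule that[of u "u\<^sup>2"]) (simp_all add: 1(1,2) 1(4-10) power_le_one abs_mult less_imp_le[OF h_pos])
  next
    case (2 u)
    show ?thesis
      by (rule that[of u "u\<^sup>2"]) (simp_all add: 2(1,2) 2(4-10) power_le_one abs_mult less_imp_le[OF h_pos])
  qed
  have "\<bar>u / h\<bar> \<le> 1 / h" using u h_pos by (simp add: divide_right_mono)
  then show "\<bar>deriv_on a b (spline_phi a b b) t\<bar> \<le> 2 / (b - a)" unfolding P(1) ba by simp
  show "\<bar>deriv_on a b (spline_psi a b a) t\<bar> \<le> 1" using P(2) u by (auto simp: abs_le_iff)
  show "\<bar>deriv_on a b (spline_psi a b b) t\<bar> \<le> 1" using P(3) u by (auto simp: abs_le_iff)
  show "\<bar>spline_phi a b a t\<bar> \<le> 1" using P(4) u by (auto simp: abs_le_iff)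
  show "\<bar>spline_phi a b b t\<bar> \<le> 1" using P(5) u by (auto simp: abs_le_iff)
  have "\<bar>u - 3 / 4 * v\<bar> \<le> 2" "\<bar>v / 4\<bar> \<le> 2" using u by (simp_all add: abs_le_iff)
  from this[THEN mult_left_mono, OF less_imp_le[OF h_pos]]
  show "\<bar>spline_psi a b a t\<bar> \<le> b - a" "\<bar>spline_psi a b b t\<bar> \<le> b - a"
    using P(6,7) unfolding ba by auto
qed

section \<open>The dual functions\<close>

lemma half_integrals:
  "((\<lambda>t. c0 + c1 * (t - m) + c2 * (t - m)\<^sup>2 + c3 * (t - m)^3) has_integral
     c0 * h - c1 * h\<^sup>2 / 2 + c2 * h^3 / 3 - c3 * h^4 / 4) {a..m}"
  "((\<lambda>t. c0 + c1 * (t - m) + c2 * (t - m)\<^sup>2 + c3 * (t - m)^3) has_integral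
     c0 * h + c1 * h\<^sup>2 / 2 + c2 * h^3 / 3 + c3 * h^4 / 4) {m..b}"
proof -
  let ?F = "\<lambda>t. c0 * (t - m) + c1 / 2 * (t - m)\<^sup>2 + c2 / 3 * (t - m)^3 + c3 / 4 * (t - m)^4"
  have D: "(?F has_vector_derivative c0 + c1 * (t - m) + c2 * (t - m)\<^sup>2 + c3 * (t - m)^3) (at t within S)" for t S
    unfolding has_real_derivative_iff_has_vector_derivative[symmetric]
    by (auto intro!: derivative_eq_intros)
  have am': "a - m = - h" "b - m = h" using ma mb_eq by simp_all
  show "((\<lambda>t. c0 + c1 * (t - m) + c2 * (t - m)\<^sup>2 + c3 * (t - m)^3) has_integral
     c0 * h - c1 * h\<^sup>2 / 2 + c2 * h^3 / 3 - c3 * h^4 / 4) {a..m}"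
    by (rule has_integral_eq_rhs[OF fundamental_theorem_of_calculus[OF less_imp_le[OF am] D]]) (simp add: am')
  show "((\<lambda>t. c0 + c1 * (t - m) + c2 * (t - m)\<^sup>2 + c3 * (t - m)^3) has_integral
     c0 * h + c1 * h\<^sup>2 / 2 + c2 * h^3 / 3 + c3 * h^4 / 4) {m..b}"
    by (rule has_integral_eq_rhs[OF fundamental_theorem_of_calculus[OF less_imp_le[OF mb] D]]) (simp add: am')
qed

text \<open>The integrands below are at most a linear derivative times a quadratic function, hence
  cubic on each half.\<close>

lemma has_integral_halves:
  assumes "\<And>t. t \<in> {a..m} \<Longrightarrow> f t = c0 + c1 * (t - m) + c2 * (t - m)\<^sup>2 + c3 * (t - m)^3"
    "\<And>t. t \<in> {m..b} \<Longrightarrow> f t = e0 + e1 * (t - m) + e2 * (t - m)\<^sup>2 + e3 * (t - m)^3"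
  shows "(f has_integral (c0 + e0) * h + (e1 - c1) * h\<^sup>2 / 2 + (c2 + e2) * h^3 / 3 + (e3 - c3) * h^4 / 4) {a..b}"
proof -
  have "(f has_integral (c0 * h - c1 * h\<^sup>2 / 2 + c2 * h^3 / 3 - c3 * h^4 / 4) +
     (e0 * h + e1 * h\<^sup>2 / 2 + e2 * h^3 / 3 + e3 * h^4 / 4)) {a..b}"
    by (rule has_integral_combine[OF less_imp_le[OF am] less_imp_le[OF mb]])
      (rule has_integral_eq[OF _ half_integrals(1)] has_integral_eq[OF _ half_integrals(2)]; simp add: assms)+
  then show ?thesis by (rule has_integral_eq_rhs) (simp add: field_simps)
qed

definition dual :: "real \<Rightarrow> real \<Rightarrow> real \<Rightarrow> real" where
  "dual c1 c2 t = c1 * (spline_psi a b a t + spline_psi a b b t) + c2 * spline_theta a b t"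

lemma dual_eq:
  shows "t \<in> {a..m} \<Longrightarrow> dual c1 c2 t = c1 * (- (t - m) * (t - m + h) / h) + c2 * ((t - m)\<^sup>2 / h\<^sup>2 - 1 / 6)"
    and "t \<in> {m..b} \<Longrightarrow> dual c1 c2 t = c1 * ((t - m) * (t - m - h) / h) + c2 * ((t - m)\<^sup>2 / h\<^sup>2 - 1 / 6)"
proof -
  have th: "spline_theta a b t = (t - m)\<^sup>2 / h\<^sup>2 - 1 / 6" for t
    by (simp add: spline_theta_def m_def[symmetric] h_def[symmetric] power_divide)
  have x: "t - a = (t - m) + h" "t - b = (t - m) - h" for t using ma mb_eq by simp_all
  show "dual c1 c2 t = c1 * (- (t - m) * (t - m + h) / h) + c2 * ((t - m)\<^sup>2 / h\<^sup>2 - 1 / 6)" if "t \<in> {a..m}"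
  proof -
    have "t \<in> {a..b}" "t \<le> m" using that mb by auto
    then have "spline_psi a b a t + spline_psi a b b t = - (t - m) * (t - m + h) / h"
      using h_pos unfolding spline_value(3,4)[OF \<open>t \<in> {a..b}\<close>] x by (simp add: field_simps power2_eq_square)
    then show ?thesis unfolding dual_def th by simp
  qed
  show "dual c1 c2 t = c1 * ((t - m) * (t - m - h) / h) + c2 * ((t - m)\<^sup>2 / h\<^sup>2 - 1 / 6)" if "t \<in> {m..b}"
  proof -
    have t: "t \<in> {a..b}" using that am by auto
    have "spline_psi a b a t + spline_psi a b b t = (t - m) * (t - m - h) / h"
    proof (cases "t = m")
      case True
      then show ?thesis using h_pos ma unfolding spline_value(3,4)[OF t] by (simp add: power2_eq_square)
    next
      case False
      then have "\<not> t \<le> m" using that by simp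
      then show ?thesis
        using h_pos unfolding spline_value(3,4)[OF t] x by (simp add: field_simps power2_eq_square)
    qed
    then show ?thesis unfolding dual_def th by simp
  qed
qed

lemma psi_deriv_eq:
  "t \<in> {a..m} \<Longrightarrow> deriv_on a b (spline_psi a b b) t = - (t - m + h) / (2 * h)"
  "t \<in> {m..b} \<Longrightarrow> deriv_on a b (spline_psi a b b) t = (3 * (t - m) - h) / (2 * h)"
  "t \<in> {a..m} \<Longrightarrow> deriv_on a b (spline_psi a b a) t = - (3 * (t - m) + h) / (2 * h)"
  "t \<in> {m..b} \<Longrightarrow> deriv_on a b (spline_psi a b a) t = (t - m - h) / (2 * h)"
proof -
  have x: "t - a = (t - m) + h" "t - b = (t - m) - h" for t using ma mb_eq by simp_all
  have l: "t \<in> {a..b} \<and> t \<le> m" if "t \<in> {a..m}" for t using that mb by auto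
  have r: "t \<in> {a..b} \<and> (\<not> t \<le> m \<or> t = m)" if "t \<in> {m..b}" for t using that am by auto
  show "deriv_on a b (spline_psi a b b) t = - (t - m + h) / (2 * h)" if "t \<in> {a..m}"
    using l[OF that] h_pos by (simp add: spline_deriv x)
  show "deriv_on a b (spline_psi a b a) t = - (3 * (t - m) + h) / (2 * h)" if "t \<in> {a..m}"
    using l[OF that] h_pos by (simp add: spline_deriv x field_simps)
  show "deriv_on a b (spline_psi a b b) t = (3 * (t - m) - h) / (2 * h)" if "t \<in> {m..b}"
    using r[OF that] h_pos by (auto simp: spline_deriv x field_simps)
  show "deriv_on a b (spline_psi a b a) t = (t - m - h) / (2 * h)" if "t \<in> {m..b}"
    using r[OF that] h_pos by (auto simp: spline_deriv x field_simps)
qed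

text \<open>The sum of the two psi is odd about the midpoint and theta is even, so the 2 x 2 system
  for the dual functions decouples: the \<open>c1\<close> part enters the two duality conditions
  with opposite signs, the \<open>c2\<close> part with equal ones. The odd part has integral 0,
  hence the integral of a dual function depends on \<open>c2\<close> alone.\<close>

lemma dual_integrals:
  "((\<lambda>t. deriv_on a b (spline_psi a b b) t * dual c1 c2 t) has_integral (- c1 * h\<^sup>2 / 12 + c2 * h / 6)) {a..b}"
  "((\<lambda>t. deriv_on a b (spline_psi a b a) t * dual c1 c2 t) has_integral (c1 * h\<^sup>2 / 12 + c2 * h / 6)) {a..b}"
  "(dual c1 c2 has_integral c2 * h / 3) {a..b}"
proof -
  \<comment> \<open>The eight witnesses are the coefficients of the product in powers of t - m, on
    the left half and then on the right half.\<close>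
  show "((\<lambda>t. deriv_on a b (spline_psi a b b) t * dual c1 c2 t) has_integral (- c1 * h\<^sup>2 / 12 + c2 * h / 6)) {a..b}"
    by (rule has_integral_eq_rhs, rule has_integral_halves[of _ "c2 / 12" "c1 / 2 + c2 / (12 * h)" "c1 / h - c2 / (2 * h\<^sup>2)" "c1 / (2 * h\<^sup>2) - c2 / (2 * h^3)"
          "c2 / 12" "c1 / 2 - c2 / (4 * h)" "- 2 * c1 / h - c2 / (2 * h\<^sup>2)" "3 * c1 / (2 * h\<^sup>2) + 3 * c2 / (2 * h^3)"])
      (use h_pos in \<open>simp_all add: psi_deriv_eq dual_eq field_simps power2_eq_square power3_eq_cube power4_eq_xxxx\<close>)
  show "((\<lambda>t. deriv_on a b (spline_psi a b a) t * dual c1 c2 t) has_integral (c1 * h\<^sup>2 / 12 + c2 * h / 6)) {a..b}"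
    by (rule has_integral_eq_rhs, rule has_integral_halves[of _ "c2 / 12" "c1 / 2 + c2 / (4 * h)" "2 * c1 / h - c2 / (2 * h\<^sup>2)" "3 * c1 / (2 * h\<^sup>2) - 3 * c2 / (2 * h^3)"
          "c2 / 12" "c1 / 2 - c2 / (12 * h)" "- c1 / h - c2 / (2 * h\<^sup>2)" "c1 / (2 * h\<^sup>2) + c2 / (2 * h^3)"])
      (use h_pos in \<open>simp_all add: psi_deriv_eq dual_eq field_simps power2_eq_square power3_eq_cube power4_eq_xxxx\<close>)
  show "(dual c1 c2 has_integral c2 * h / 3) {a..b}"
    by (rule has_integral_eq_rhs, rule has_integral_halves[of _ "- c2 / 6" "- c1" "- c1 / h + c2 / h\<^sup>2" 0
          "- c2 / 6" "- c1" "c1 / h + c2 / h\<^sup>2" 0])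
      (use h_pos in \<open>simp_all add: dual_eq field_simps power2_eq_square power3_eq_cube\<close>)
qed

lemma dual_continuous: "continuous_on {a..b} (dual c1 c2)"
proof -
  have "continuous_on {a..b} (spline_psi a b a)" "continuous_on {a..b} (spline_psi a b b)"
    using spline_mem(3,4) by (simp_all add: splines_def differentiable_imp_continuous_on)
  then have "continuous_on {a..b} (\<lambda>t. dual c1 c2 t)"
    unfolding dual_def spline_theta_def by (intro continuous_intros) (use ab in auto)
  then show ?thesis .
qed

text \<open>Adding the two duality conditions gives c2 = 3 / h; subtracting them gives c1 = 6 / h^2
  or -6 / h^2.\<close>

lemma dual_fun_eq:
  "dual_fun a b a = dual (6 / h\<^sup>2) (3 / h)" "dual_fun a b b = dual (- 6 / h\<^sup>2) (3 / h)"
proof -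
  have eq: "(LINT t:{a..b}|lebesgue. deriv_on a b (spline_psi a b b) t * dual c1 c2 t) = - c1 * h\<^sup>2 / 12 + c2 * h / 6"
    "(LINT t:{a..b}|lebesgue. deriv_on a b (spline_psi a b a) t * dual c1 c2 t) = c1 * h\<^sup>2 / 12 + c2 * h / 6" for c1 c2
  proof -
    have "continuous_on {a..b} (\<lambda>t. deriv_on a b s t * dual c1 c2 t)" if "s \<in> splines a b" for s
      using that dual_continuous by (intro continuous_intros) (simp_all add: splines_def)
    then have "(LINT t:{a..b}|lebesgue. deriv_on a b s t * dual c1 c2 t) = integral {a..b} (\<lambda>t. deriv_on a b s t * dual c1 c2 t)"
      if "s \<in> splines a b" for s
      using that by (intro set_lebesgue_integral_eq_integral(2) absolutely_integrable_continuous_real)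
    then show "(LINT t:{a..b}|lebesgue. deriv_on a b (spline_psi a b b) t * dual c1 c2 t) = - c1 * h\<^sup>2 / 12 + c2 * h / 6"
      "(LINT t:{a..b}|lebesgue. deriv_on a b (spline_psi a b a) t * dual c1 c2 t) = c1 * h\<^sup>2 / 12 + c2 * h / 6"
      using integral_unique[OF dual_integrals(1)] integral_unique[OF dual_integrals(2)] spline_mem(3,4) by simp_all
  qed
  have ne: "a \<noteq> b" "b \<noteq> a" using ab by simp_all
  have sp: "d \<in> dual_space a b \<longleftrightarrow> (\<exists>c1 c2. d = dual c1 c2)" for d
    unfolding dual_space_def dual_def by auto
  have the: "dual_fun a b e = dual c1 c2"
    if "c1 * h\<^sup>2 / 12 + c2 * h / 6 = of_bool (a = e)" "- c1 * h\<^sup>2 / 12 + c2 * h / 6 = of_bool (b = e)" for e c1 c2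
    unfolding dual_fun_def
  proof (rule the_equality)
    show "dual c1 c2 \<in> dual_space a b \<and>
      (\<forall>k\<in>{a, b}. (LINT t:{a..b}|lebesgue. deriv_on a b (spline_psi a b k) t * dual c1 c2 t) = of_bool (k = e))"
      using that sp by (auto simp only: ball_simps insert_iff empty_iff eq)
    fix d assume d: "d \<in> dual_space a b \<and>
      (\<forall>k\<in>{a, b}. (LINT t:{a..b}|lebesgue. deriv_on a b (spline_psi a b k) t * d t) = of_bool (k = e))"
    then obtain e1 e2 where de: "d = dual e1 e2" using sp by blast
    from d have "e1 * h\<^sup>2 / 12 + e2 * h / 6 = of_bool (a = e)" "- e1 * h\<^sup>2 / 12 + e2 * h / 6 = of_bool (b = e)"
      unfolding de by (simp_all only: ball_simps eq)
    with that have "e1 * h\<^sup>2 = c1 * h\<^sup>2" "e2 * h = c2 * h" by linarith+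
    then show "d = dual c1 c2" using h_pos unfolding de by simp
  qed
  show "dual_fun a b a = dual (6 / h\<^sup>2) (3 / h)" "dual_fun a b b = dual (- 6 / h\<^sup>2) (3 / h)"
    by (rule the; use h_pos ne in simp)+
qed

text \<open>Integral 1 is c2 h / 3 = 1. It makes the edge functionals reproduce constants, so that a
  coefficient can be compared with a mean of the mixed derivative.\<close>

lemma dual_fun_props:
  assumes "e \<in> {a, b}"
  shows "continuous_on {a..b} (dual_fun a b e)" "integral {a..b} (dual_fun a b e) = 1"
    and "\<And>t. t \<in> {a..b} \<Longrightarrow> \<bar>dual_fun a b e t\<bar> \<le> 8 / (b - a)"
proof -
  obtain c1 where c1: "dual_fun a b e = dual c1 (3 / h)" "\<bar>c1\<bar> = 6 / h\<^sup>2"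
    using assms dual_fun_eq by (metis abs_minus_cancel abs_of_pos divide_pos_pos h_pos insert_iff minus_divide_left singletonD zero_less_numeral zero_less_power)
  show "continuous_on {a..b} (dual_fun a b e)" unfolding c1 by (rule dual_continuous)
  show "integral {a..b} (dual_fun a b e) = 1"
    unfolding c1 using integral_unique[OF dual_integrals(3), of c1 "3 / h"] h_pos by simp
  show "\<bar>dual_fun a b e t\<bar> \<le> 8 / (b - a)" if t: "t \<in> {a..b}" for t
  proof -
    define x where "x = \<bar>t - m\<bar>"
    have x: "0 \<le> x" "x \<le> h" using t ma mb_eq by (auto simp: x_def abs_le_iff)
    have "\<bar>spline_psi a b a t + spline_psi a b b t\<bar> = x * (h - x) / h"
    proof -
      have "spline_psi a b a t + spline_psi a b b t = dual 1 0 t" by (simp add: dual_def)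
      also have "\<bar>\<dots>\<bar> = x * (h - x) / h"
        using t h_pos x by (cases "t \<le> m") (simp_all add: dual_eq x_def abs_mult abs_divide)
      finally show ?thesis .
    qed
    also have "\<dots> \<le> h / 4"
    proof -
      have "0 \<le> (x - h / 2)\<^sup>2" by simp
      then show ?thesis using h_pos by (simp add: field_simps power2_eq_square)
    qed
    finally have A: "\<bar>spline_psi a b a t + spline_psi a b b t\<bar> \<le> h / 4" .
    define q where "q = (t - m)\<^sup>2 / h\<^sup>2"
    have "q \<le> 1" using x h_pos by (simp add: q_def x_def abs_le_square_iff[symmetric])
    moreover have "0 \<le> q" by (simp add: q_def)
    ultimately have T: "\<bar>spline_theta a b t\<bar> \<le> 5 / 6"
      unfolding spline_theta_def m_def[symmetric] h_def[symmetric] power_divide q_def[symmetric] by (simp add: abs_if)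
    have "\<bar>dual_fun a b e t\<bar> \<le> \<bar>c1\<bar> * \<bar>spline_psi a b a t + spline_psi a b b t\<bar> + 3 / h * \<bar>spline_theta a b t\<bar>"
      unfolding c1(1) dual_def using h_pos by (intro order_trans[OF abs_triangle_ineq]) (simp add: abs_mult)
    \<comment> \<open>The odd part is at most h / 4 because (x - h / 2)^2 \<ge> 0, and theta lies
      between -1/6 and 5/6. Together this is 3 / (2 h) + 5 / (2 h) = 4 / h.\<close>
    also have "\<dots> \<le> 6 / h\<^sup>2 * (h / 4) + 3 / h * (5 / 6)"
      unfolding c1(2) using A T h_pos by (intro add_mono mult_left_mono) simp_all
    also have "\<dots> = 8 / (b - a)" unfolding ba using h_pos by (simp add: field_simps power2_eq_square)
    finally show ?thesis .
  qed
qed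

end

subsection \<open>Interpolation of smooth functions\<close>

text \<open>The values of the one-dimensional basis functions at a point are passed as functions of the node.\<close>

definition hermite_sum ::
  "real \<Rightarrow> real \<Rightarrow> real \<Rightarrow> real \<Rightarrow> (real \<times> real \<Rightarrow> real) \<Rightarrow> (real \<times> real \<Rightarrow> real) \<Rightarrow> (real \<times> real \<Rightarrow> real) \<Rightarrow>
   (real \<times> real \<Rightarrow> real) \<Rightarrow> (real \<Rightarrow> real) \<Rightarrow> (real \<Rightarrow> real) \<Rightarrow> (real \<Rightarrow> real) \<Rightarrow> (real \<Rightarrow> real) \<Rightarrow> real" where
  "hermite_sum a b c d U V W A \<phi> \<psi> \<phi>' \<psi>' = (\<Sum>e\<in>{a, b}. \<Sum>f\<in>{c, d}.
     U (e, f) * \<phi> e * \<phi>' f + V (e, f) * \<psi> e * \<phi>' f + W (e, f) * \<phi> e * \<psi>' f + A (e, f) * \<psi> e * \<psi>' f)"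

text \<open>Exchanging the coordinates turns the estimate for the x-derivative into the one for the
  y-derivative.\<close>

lemma hermite_sum_swap:
  "hermite_sum a b c d U V W A \<phi> \<psi> \<phi>' \<psi>' =
   hermite_sum c d a b (U \<circ> prod.swap) (W \<circ> prod.swap) (V \<circ> prod.swap) (A \<circ> prod.swap) \<phi>' \<psi>' \<phi> \<psi>"
  unfolding hermite_sum_def by (subst sum.swap) (simp add: algebra_simps)

lemma hermite_sum_expand:
  assumes "a \<noteq> b" "c \<noteq> d"
  shows "hermite_sum a b c d U V W A \<phi> \<psi> \<phi>' \<psi>' =
    (U (a, c) * \<phi> a * \<phi>' c + V (a, c) * \<psi> a * \<phi>' c + W (a, c) * \<phi> a * \<psi>' c + A (a, c) * \<psi> a * \<psi>' c) +
    (U (a, d) * \<phi> a * \<phi>' d + V (a, d) * \<psi> a * \<phi>' d + W (a, d) * \<phi> a * \<psi>' d + A (a, d) * \<psi> a * \<psi>' d) +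
    ((U (b, c) * \<phi> b * \<phi>' c + V (b, c) * \<psi> b * \<phi>' c + W (b, c) * \<phi> b * \<psi>' c + A (b, c) * \<psi> b * \<psi>' c) +
    (U (b, d) * \<phi> b * \<phi>' d + V (b, d) * \<psi> b * \<phi>' d + W (b, d) * \<phi> b * \<psi>' d + A (b, d) * \<psi> b * \<psi>' d))"
  using assms by (simp add: hermite_sum_def)

lemma abs_mult_le: "\<bar>x\<bar> \<le> p \<Longrightarrow> \<bar>y\<bar> \<le> q \<Longrightarrow> \<bar>x * y\<bar> \<le> p * q" for x y p q :: real
  unfolding abs_mult by (intro mult_mono) auto

lemma abs_integral_le:
  fixes f g :: "'a::euclidean_space \<Rightarrow> real"
  assumes "f integrable_on S" "g integrable_on S" "\<And>x. x \<in> S \<Longrightarrow> \<bar>f x\<bar> \<le> g x"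
  shows "\<bar>integral S f\<bar> \<le> integral S g"
  using integral_norm_bound_integral[OF assms(1,2)] assms(3) by simp

sublocale rect \<subseteq> X: ivl a b by unfold_locales (rule ab)
sublocale rect \<subseteq> Y: ivl c d by unfold_locales (rule cd)

context rect
begin

lemma px_integral:
  assumes "has_px F G" "y \<in> {c..d}"
  shows "integral {a..b} (\<lambda>t. G (t, y)) = F (b, y) - F (a, y)"
proof -
  have "((\<lambda>t. G (t, y)) has_integral F (b, y) - F (a, y)) {a..b}"
    using assms ab by (intro fundamental_theorem_of_calculus)
      (simp_all add: has_px_def has_real_derivative_iff_has_vector_derivative)
  then show ?thesis by (rule integral_unique)
qed

text \<open>
  The interpolant reproduces a linear function \<open>\<ell>\<close> in place of \<open>V\<close>, so that the error is that of
  \<open>V - \<ell>\<close>, and the \<open>x\<close>-derivative of the interpolant depends on \<open>U\<close> and \<open>W\<close> only through their increments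
  along the horizontal edges, that is, on \<open>V\<close> and its \<open>y\<close>-derivative.
\<close>

lemma interpolation_dx_error:
  assumes U: "has_px U V" and W: "has_px W Vy" and Vx: "has_px V Vx" and Vy: "has_py V Vy"
    and Vxx: "has_px Vx Vxx" and Vxy: "has_py Vx Vxy" and Vyx: "has_px Vy Vxy" and Vyy: "has_py Vy Vyy"
    and \<gamma>: "(b - a) * (d - c) * \<gamma> = integral CR Vy"
    and x: "x \<in> {a..b}" and y: "y \<in> {c..d}"
  shows "\<bar>V (x, y) - hermite_sum a b c d U V W (\<lambda>_. \<gamma>) (\<lambda>e. deriv_on a b (spline_phi a b e) x)
      (\<lambda>e. deriv_on a b (spline_psi a b e) x) (\<lambda>f. spline_phi c d f y) (\<lambda>f. spline_psi c d f y)\<bar>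
    \<le> 53 * W2 Vxx Vxy Vyy"
proof -
  define h1 h2 where "h1 = b - a" and "h2 = d - c"
  have h: "h1 > 0" "h2 > 0" using ab cd by (simp_all add: h1_def h2_def)
  let ?W = "W2 Vxx Vxy Vyy"
  have W0: "0 \<le> ?W" using h I1_nonneg by (simp add: W2_def h1_def[symmetric] h2_def[symmetric])
  obtain \<alpha> \<beta> where r: "\<And>x y. x \<in> {a..b} \<Longrightarrow> y \<in> {c..d} \<Longrightarrow> \<bar>V (x, y) - (\<alpha> + \<beta> * x + \<gamma> * y)\<bar> \<le> 5 * ?W"
    and ry: "\<And>y. y \<in> {c..d} \<Longrightarrow> \<bar>integral {a..b} (\<lambda>t. Vy (t, y)) - h1 * \<gamma>\<bar> \<le> 2 * (h1 / h2) * ?W"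
    using linear_approximation[OF Vx Vy Vxx Vxy Vyx Vyy \<gamma>] unfolding h1_def h2_def by metis
  have ends: "a \<in> {a..b}" "b \<in> {a..b}" "c \<in> {c..d}" "d \<in> {c..d}" using ab cd by simp_all
  define P Ea Eb where "P = deriv_on a b (spline_phi a b b) x"
    and "Ea = deriv_on a b (spline_psi a b a) x" and "Eb = deriv_on a b (spline_psi a b b) x"
  define f0 f1 g0 g1 where "f0 = spline_phi c d c y" and "f1 = spline_phi c d d y"
    and "g0 = spline_psi c d c y" and "g1 = spline_psi c d d y"
  have Pa: "deriv_on a b (spline_phi a b a) x = - P" using X.spline_deriv[OF x] by (simp add: P_def)
  have id: "h1 * P + Ea + Eb = 1" "(b\<^sup>2 - a\<^sup>2) / 2 * P + a * Ea + b * Eb = x" "f0 + f1 = 1" "c * f0 + d * f1 + g0 + g1 = y"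
    using X.spline_reproduction(1,2)[OF x] Y.spline_reproduction(3,4)[OF y]
    by (simp_all add: P_def Ea_def Eb_def f0_def f1_def g0_def g1_def h1_def)
  have bd: "\<bar>P\<bar> \<le> 2 / h1" "\<bar>Ea\<bar> \<le> 1" "\<bar>Eb\<bar> \<le> 1" "\<bar>f0\<bar> \<le> 1" "\<bar>f1\<bar> \<le> 1" "\<bar>g0\<bar> \<le> h2" "\<bar>g1\<bar> \<le> h2"
    unfolding P_def Ea_def Eb_def f0_def f1_def g0_def g1_def h1_def h2_def
    by (rule X.spline_bounds[OF x] Y.spline_bounds[OF y])+
  \<comment> \<open>The nodal data of the residual: \<open>r'\<close> for the slopes
    \<open>V\<close>, \<open>i\<close> for the increments of \<open>U\<close> along a horizontal
    edge against the integral of the linear function, and \<open>j\<close> for the increments of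
    \<open>W\<close> against \<open>\<gamma>\<close> times the length.\<close>
  define r' where "r' x y = V (x, y) - (\<alpha> + \<beta> * x + \<gamma> * y)" for x y
  define i where "i y = U (b, y) - U (a, y) - (h1 * (\<alpha> + \<gamma> * y) + \<beta> * ((b\<^sup>2 - a\<^sup>2) / 2))" for y
  define j where "j y = W (b, y) - W (a, y) - h1 * \<gamma>" for y
  have ib: "\<bar>i y\<bar> \<le> h1 * (5 * ?W)" if y: "y \<in> {c..d}" for y
  proof -
    have cV: "continuous_on {a..b} (\<lambda>t. V (t, y))"
      using Vx y by (intro continuous_slices(1)) (simp_all add: has_px_def)
    have L: "((\<lambda>t. \<alpha> + \<beta> * t + \<gamma> * y) has_integral h1 * (\<alpha> + \<gamma> * y) + \<beta> * ((b\<^sup>2 - a\<^sup>2) / 2)) {a..b}"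
    proof -
      have "((\<lambda>t. \<alpha> + \<beta> * t + \<gamma> * y) has_integral
          (\<alpha> + \<gamma> * y) * b + \<beta> / 2 * b\<^sup>2 - ((\<alpha> + \<gamma> * y) * a + \<beta> / 2 * a\<^sup>2)) {a..b}"
        by (rule fundamental_theorem_of_calculus)
          (use ab in \<open>auto intro!: derivative_eq_intros simp flip: has_real_derivative_iff_has_vector_derivative\<close>)
      then show ?thesis by (rule has_integral_eq_rhs) (simp add: h1_def field_simps)
    qed
    have "i y = integral {a..b} (\<lambda>t. V (t, y)) - integral {a..b} (\<lambda>t. \<alpha> + \<beta> * t + \<gamma> * y)"
      using px_integral[OF U y] integral_unique[OF L] by (simp add: i_def)
    also have "\<dots> = integral {a..b} (\<lambda>t. V (t, y) - (\<alpha> + \<beta> * t + \<gamma> * y))"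
      by (rule Henstock_Kurzweil_Integration.integral_diff[symmetric])
        (intro integrable_continuous_real cV continuous_intros)+
    also have "\<bar>\<dots>\<bar> \<le> integral {a..b} (\<lambda>t. 5 * ?W)"
      by (rule abs_integral_le)
        (use r y in \<open>auto intro!: integrable_continuous_real continuous_intros cV\<close>)
    also have "\<dots> = h1 * (5 * ?W)" using ab by (simp add: h1_def)
    finally show ?thesis .
  qed
  have jb: "\<bar>j y\<bar> \<le> 2 * (h1 / h2) * ?W" if y: "y \<in> {c..d}" for y
    using ry[OF y] px_integral[OF W y] by (simp add: j_def)
  have rb: "\<bar>r' x y\<bar> \<le> 5 * ?W" if "x \<in> {a..b}" "y \<in> {c..d}" for x y
    using r[OF that] by (simp add: r'_def)
  have ne: "a \<noteq> b" "c \<noteq> d" using ab cd by simp_all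
  let ?H = "hermite_sum a b c d U V W (\<lambda>_. \<gamma>) (\<lambda>e. deriv_on a b (spline_phi a b e) x)
      (\<lambda>e. deriv_on a b (spline_psi a b e) x) (\<lambda>f. spline_phi c d f y) (\<lambda>f. spline_psi c d f y)"
  let ?e0 = "(i c * P + r' a c * Ea + r' b c * Eb) * f0 + (i d * P + r' a d * Ea + r' b d * Eb) * f1 + j c * P * g0 + j d * P * g1"
  define q where "q = (b\<^sup>2 - a\<^sup>2) / 2"
  \<comment> \<open>Sorted by \<open>\<alpha>\<close>, \<open>\<beta>\<close> and
    \<open>\<gamma>\<close>, so that the four reproduction identities collapse everything except
    \<open>?e0\<close>, the interpolant of the residual data.\<close>
  have H: "?H = (\<alpha> * (h1 * P + Ea + Eb) + \<beta> * (q * P + a * Ea + b * Eb)) * (f0 + f1)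
      + \<gamma> * (h1 * P + Ea + Eb) * (c * f0 + d * f1 + g0 + g1) + ?e0"
    unfolding hermite_sum_expand[OF ne] Pa P_def[symmetric] Ea_def[symmetric] Eb_def[symmetric]
      f0_def[symmetric] f1_def[symmetric] g0_def[symmetric] g1_def[symmetric] i_def j_def r'_def q_def[symmetric]
    by (simp add: algebra_simps)
  have "?H = \<alpha> + \<beta> * x + \<gamma> * y + ?e0"
    unfolding H id q_def by simp
  then have "\<bar>V (x, y) - ?H\<bar> = \<bar>r' x y - ?e0\<bar>" by (simp add: r'_def)
  \<comment> \<open>53 is 5 for the residual at the point, 20 for each horizontal edge (10 from an
    increment divided by the length, 5 from each slope) and 4 for each of the two increments of
    \<open>W\<close>.\<close>
  also have "\<dots> \<le> 5 * ?W + ((10 * ?W + 5 * ?W + 5 * ?W) + (10 * ?W + 5 * ?W + 5 * ?W) + 4 * ?W + 4 * ?W)"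
  proof -
    have iP: "\<bar>i y * P\<bar> \<le> 10 * ?W" if y: "y \<in> {c..d}" for y
      using abs_mult_le[OF ib[OF y] bd(1)] h by simp
    have rE: "\<bar>r' a y * Ea\<bar> \<le> 5 * ?W" "\<bar>r' b y * Eb\<bar> \<le> 5 * ?W" if y: "y \<in> {c..d}" for y
      using abs_mult_le[OF rb[OF ends(1) y] bd(2)] abs_mult_le[OF rb[OF ends(2) y] bd(3)] by simp_all
    have s: "\<bar>i y * P + r' a y * Ea + r' b y * Eb\<bar> \<le> 10 * ?W + 5 * ?W + 5 * ?W" if y: "y \<in> {c..d}" for y
      using iP[OF y] rE[OF y] by (intro order_trans[OF abs_triangle_ineq] add_mono)
    have jP: "\<bar>j y * P\<bar> \<le> 4 / h2 * ?W" if y: "y \<in> {c..d}" for y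
      using abs_mult_le[OF jb[OF y] bd(1)] h by (simp add: field_simps)
    have sf: "\<bar>(i c * P + r' a c * Ea + r' b c * Eb) * f0\<bar> \<le> 10 * ?W + 5 * ?W + 5 * ?W"
      "\<bar>(i d * P + r' a d * Ea + r' b d * Eb) * f1\<bar> \<le> 10 * ?W + 5 * ?W + 5 * ?W"
      using abs_mult_le[OF s[OF ends(3)] bd(4)] abs_mult_le[OF s[OF ends(4)] bd(5)] by simp_all
    have jg: "\<bar>j c * P * g0\<bar> \<le> 4 * ?W" "\<bar>j d * P * g1\<bar> \<le> 4 * ?W"
      using abs_mult_le[OF jP[OF ends(3)] bd(6)] abs_mult_le[OF jP[OF ends(4)] bd(7)] h by simp_all
    show ?thesis
      using rb[OF x y] sf jg
      by (intro order_trans[OF abs_triangle_ineq4] order_trans[OF abs_triangle_ineq] add_mono)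
  qed
  finally show ?thesis by simp
qed

lemma has_px_swap: "has_px F G \<Longrightarrow> rect.has_py c d a b (F \<circ> prod.swap) (G \<circ> prod.swap)"
  and has_py_swap: "has_py F G \<Longrightarrow> rect.has_px c d a b (F \<circ> prod.swap) (G \<circ> prod.swap)"
proof -
  interpret S: rect c d a b by unfold_locales (rule cd, rule ab)
  have cs: "continuous_on S.CR (F \<circ> prod.swap)" if "continuous_on CR F" for F :: "real \<times> real \<Rightarrow> real"
    unfolding o_def by (rule continuous_on_compose2[OF that]) (auto intro!: continuous_intros)
  show "has_px F G \<Longrightarrow> S.has_py (F \<circ> prod.swap) (G \<circ> prod.swap)"
    unfolding has_px_def S.has_py_def using cs by simp
  show "has_py F G \<Longrightarrow> S.has_px (F \<circ> prod.swap) (G \<circ> prod.swap)"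
    unfolding has_py_def S.has_px_def using cs by simp
qed

lemma integral_swap_CR:
  fixes F :: "real \<times> real \<Rightarrow> real"
  assumes "continuous_on CR F"
  shows "integral (cbox (c, a) (d, b)) (F \<circ> prod.swap) = integral CR F"
proof -
  have "(\<lambda>(x, y). F (y, x)) = F \<circ> prod.swap" by (simp add: fun_eq_iff)
  then show ?thesis using integral_swap_2dim[of a c b d "\<lambda>x y. F (x, y)"] assms by simp
qed

text \<open>The x-estimate on the transposed rectangle; \<open>W2\<close> is invariant under the
  exchange of coordinates.\<close>

lemma interpolation_dy_error:
  assumes U: "has_py U W" and V: "has_py V Wx" and Wy: "has_py W Wy" and Wx: "has_px W Wx"
    and Wyy: "has_py Wy Wyy" and Wxy: "has_px Wy Wxy" and Wyx: "has_py Wx Wxy" and Wxx: "has_px Wx Wxx"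
    and \<gamma>: "(b - a) * (d - c) * \<gamma> = integral CR Wx"
    and x: "x \<in> {a..b}" and y: "y \<in> {c..d}"
  shows "\<bar>W (x, y) - hermite_sum a b c d U V W (\<lambda>_. \<gamma>) (\<lambda>e. spline_phi a b e x)
      (\<lambda>e. spline_psi a b e x) (\<lambda>f. deriv_on c d (spline_phi c d f) y) (\<lambda>f. deriv_on c d (spline_psi c d f) y)\<bar>
    \<le> 53 * W2 Wxx Wxy Wyy"
proof -
  interpret S: rect c d a b by unfold_locales (rule cd, rule ab)
  have cont: "continuous_on CR Wx" "continuous_on CR (\<lambda>z. \<bar>Wyy z\<bar>)" "continuous_on CR (\<lambda>z. \<bar>Wxy z\<bar>)" "continuous_on CR (\<lambda>z. \<bar>Wxx z\<bar>)"
    using Wyy Wxy Wxx unfolding has_px_def has_py_def by (simp_all add: continuous_on_rabs)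
  have \<gamma>': "(d - c) * (b - a) * \<gamma> = integral S.CR (Wx \<circ> prod.swap)"
    using \<gamma> integral_swap_CR[OF cont(1)] by (simp add: mult.commute mult.left_commute)
  have I: "S.I1 (F \<circ> prod.swap) = I1 F" if "continuous_on CR (\<lambda>z. \<bar>F z\<bar>)" for F
    using integral_swap_CR[OF that] by (simp add: o_def)
  have W2: "S.W2 (Wyy \<circ> prod.swap) (Wxy \<circ> prod.swap) (Wxx \<circ> prod.swap) = W2 Wxx Wxy Wyy"
    unfolding S.W2_def W2_def I[OF cont(2)] I[OF cont(3)] I[OF cont(4)] by simp
  have "\<bar>(W \<circ> prod.swap) (y, x) - hermite_sum c d a b (U \<circ> prod.swap) (W \<circ> prod.swap) (V \<circ> prod.swap) (\<lambda>_. \<gamma>)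
      (\<lambda>f. deriv_on c d (spline_phi c d f) y) (\<lambda>f. deriv_on c d (spline_psi c d f) y) (\<lambda>e. spline_phi a b e x) (\<lambda>e. spline_psi a b e x)\<bar>
    \<le> 53 * S.W2 (Wyy \<circ> prod.swap) (Wxy \<circ> prod.swap) (Wxx \<circ> prod.swap)"
    by (rule S.interpolation_dx_error[OF has_py_swap[OF U] has_py_swap[OF V] has_py_swap[OF Wy] has_px_swap[OF Wx]
          has_py_swap[OF Wyy] has_px_swap[OF Wxy] has_py_swap[OF Wyx] has_px_swap[OF Wxx] \<gamma>' y x])
  then show ?thesis
    unfolding W2 hermite_sum_swap[of a b] by (simp add: o_def)
qed

end

subsection \<open>Passage to the limit\<close>

context rect
begin

abbreviation \<rho> :: "nat \<Rightarrow> real" where "\<rho> k \<equiv> (real k + 1) / (real k + 2)"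

lemma \<rho>_tendsto: "\<rho> \<longlonglongrightarrow> 1"
proof -
  have "(\<lambda>k. 1 - inverse (real (Suc (Suc k)))) \<longlonglongrightarrow> 1 - 0"
    by (intro tendsto_diff tendsto_const LIMSEQ_Suc[OF LIMSEQ_inverse_real_of_nat])
  moreover have "1 - inverse (real (Suc (Suc k))) = \<rho> k" for k by (simp add: field_simps)
  ultimately show ?thesis by simp
qed

lemma version_integrable: "version u w \<Longrightarrow> integrable lborel w"
  by (simp add: version_def)

lemma continuous_approx: "version u w \<Longrightarrow> continuous_on S (approx k w)"
  using smooth_continuous_on[OF smooth_approx[OF version_integrable]] .

lemma approx_has_px:
  assumes "version u w" "version g v" "has_weak_D u (1, 0) R g"
  shows "has_px (approx k w) (\<lambda>z. \<rho> k * approx k v z)"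
  unfolding has_px_def
proof (intro conjI ballI)
  show "continuous_on CR (approx k w)" by (rule continuous_approx[OF assms(1)])
  show "continuous_on CR (\<lambda>z. \<rho> k * approx k v z)" by (intro continuous_on_mult continuous_on_const continuous_approx[OF assms(2)])
  fix x y assume "x \<in> {a..b}" "y \<in> {c..d}"
  then have "(x, y) \<in> CR" by (simp add: mem_CR)
  from approx_weak_pd(1)[OF assms(1,2) this assms(3), of k]
    smooth_DERIV_fst[OF smooth_approx[OF version_integrable[OF assms(1)]], of k y x]
  show "((\<lambda>t. approx k w (t, y)) has_real_derivative \<rho> k * approx k v (x, y)) (at x within {a..b})" by simp
qed

lemma approx_has_py:
  assumes "version u w" "version g v" "has_weak_D u (0, 1) R g"
  shows "has_py (approx k w) (\<lambda>z. \<rho> k * approx k v z)"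
  unfolding has_py_def
proof (intro conjI ballI)
  show "continuous_on CR (approx k w)" by (rule continuous_approx[OF assms(1)])
  show "continuous_on CR (\<lambda>z. \<rho> k * approx k v z)" by (intro continuous_on_mult continuous_on_const continuous_approx[OF assms(2)])
  fix x y assume "x \<in> {a..b}" "y \<in> {c..d}"
  then have "(x, y) \<in> CR" by (simp add: mem_CR)
  from approx_weak_pd(2)[OF assms(1,2) this assms(3), of k]
    smooth_DERIV_snd[OF smooth_approx[OF version_integrable[OF assms(1)]], of k x y]
  show "((\<lambda>t. approx k w (x, t)) has_real_derivative \<rho> k * approx k v (x, y)) (at y within {c..d})" by simp
qed

lemma has_px_scale: "has_px F G \<Longrightarrow> has_px (\<lambda>z. r * F z) (\<lambda>z. r * G z)"
  and has_py_scale: "has_py F G \<Longrightarrow> has_py (\<lambda>z. r * F z) (\<lambda>z. r * G z)"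
  unfolding has_px_def has_py_def by (auto intro!: continuous_intros DERIV_cmult)

lemma L1_tendsto_integrals:
  assumes F: "\<And>k. F k absolutely_integrable_on S" and f: "f absolutely_integrable_on S"
    and lim: "(\<lambda>k. integral S (\<lambda>z. \<bar>F k z - f z\<bar>)) \<longlonglongrightarrow> 0"
  shows "(\<lambda>k. integral S (F k)) \<longlonglongrightarrow> integral S (f :: real \<times> real \<Rightarrow> real)"
    and "(\<lambda>k. integral S (\<lambda>z. \<bar>F k z\<bar>)) \<longlonglongrightarrow> integral S (\<lambda>z. \<bar>f z\<bar>)"
proof -
  have int: "F k integrable_on S" "f integrable_on S" for k
    using F f set_lebesgue_integral_eq_integral(1) by blast+
  have abs: "(\<lambda>z. \<bar>g z\<bar>) integrable_on S" if "g absolutely_integrable_on S" for g :: "real \<times> real \<Rightarrow> real"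
    using absolutely_integrable_norm[OF that] set_lebesgue_integral_eq_integral(1) by (fastforce simp: o_def)
  note absd = abs[OF set_integral_diff(1)[OF F f]]
  have b1: "\<bar>integral S (F k) - integral S f\<bar> \<le> integral S (\<lambda>z. \<bar>F k z - f z\<bar>)" for k
    unfolding Henstock_Kurzweil_Integration.integral_diff[OF int(1) int(2), symmetric]
    by (rule abs_integral_le[OF integrable_diff[OF int(1) int(2)] absd]) simp
  have b2: "\<bar>integral S (\<lambda>z. \<bar>F k z\<bar>) - integral S (\<lambda>z. \<bar>f z\<bar>)\<bar> \<le> integral S (\<lambda>z. \<bar>F k z - f z\<bar>)" for k
    unfolding Henstock_Kurzweil_Integration.integral_diff[OF abs[OF F] abs[OF f], symmetric]
    by (rule abs_integral_le[OF integrable_diff[OF abs[OF F] abs[OF f]] absd]) simp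
  show "(\<lambda>k. integral S (F k)) \<longlonglongrightarrow> integral S f"
    by (rule LIM_zero_cancel, rule Lim_null_comparison[OF _ lim]) (simp add: b1)
  show "(\<lambda>k. integral S (\<lambda>z. \<bar>F k z\<bar>)) \<longlonglongrightarrow> integral S (\<lambda>z. \<bar>f z\<bar>)"
    by (rule LIM_zero_cancel, rule Lim_null_comparison[OF _ lim]) (simp add: b2)
qed

lemma approx_integral_tendsto:
  assumes "version g w" "g absolutely_integrable_on R"
  shows "(\<lambda>k. integral CR (approx k w)) \<longlonglongrightarrow> integral CR g" "(\<lambda>k. I1 (approx k w)) \<longlonglongrightarrow> I1 g"
  using L1_tendsto_integrals[OF continuous_absolutely_integrable(1)[OF continuous_approx[OF assms(1)]] assms(2) approx_L1_tendsto[OF assms(1)]]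
  by (simp_all add: integral_open_interval)

text \<open>For fixed k the averages form a smooth function with a consistent chain of derivatives,
  to which the smooth estimate applies. The limit is pointwise for \<open>u\<close> and its first
  derivatives, which are continuous up to the boundary, and in L1 for the second and third
  derivatives.\<close>

lemma interpolation_error:
  assumes u: "u differentiable_on CR" "continuous_on CR (pdx CR u)" "continuous_on CR (pdy CR u)"
    and D2: "has_weak_D (pdx CR u) (1, 0) R gxx" "has_weak_D (pdx CR u) (0, 1) R gxy"
      "has_weak_D (pdy CR u) (1, 0) R gxy" "has_weak_D (pdy CR u) (0, 1) R gyy"
    and D3: "has_weak_D gxx (1, 0) R gxxx" "has_weak_D gxx (0, 1) R gxxy" "has_weak_D gxy (1, 0) R gxxy"
      "has_weak_D gxy (0, 1) R gxyy" "has_weak_D gyy (1, 0) R gxyy" "has_weak_D gyy (0, 1) R gyyy"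
    and L1: "gxx absolutely_integrable_on R" "gxy absolutely_integrable_on R" "gyy absolutely_integrable_on R"
      "gxxx absolutely_integrable_on R" "gxxy absolutely_integrable_on R" "gxyy absolutely_integrable_on R" "gyyy absolutely_integrable_on R"
    and \<gamma>: "(b - a) * (d - c) * \<gamma> = integral CR gxy"
    and x: "x \<in> {a..b}" and y: "y \<in> {c..d}"
  shows "\<bar>pdx CR u (x, y) - hermite_sum a b c d u (pdx CR u) (pdy CR u) (\<lambda>_. \<gamma>) (\<lambda>e. deriv_on a b (spline_phi a b e) x)
      (\<lambda>e. deriv_on a b (spline_psi a b e) x) (\<lambda>f. spline_phi c d f y) (\<lambda>f. spline_psi c d f y)\<bar>
    \<le> 53 * W2 gxxx gxxy gxyy"
    and "\<bar>pdy CR u (x, y) - hermite_sum a b c d u (pdx CR u) (pdy CR u) (\<lambda>_. \<gamma>) (\<lambda>e. spline_phi a b e x)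
      (\<lambda>e. spline_psi a b e x) (\<lambda>f. deriv_on c d (spline_phi c d f) y) (\<lambda>f. deriv_on c d (spline_psi c d f) y)\<bar>
    \<le> 53 * W2 gxxy gxyy gyyy"
proof -
  have cu: "continuous_on CR u" using u(1) by (rule differentiable_imp_continuous_on)
  obtain w where w: "version u w" "\<And>z. z \<in> R \<Longrightarrow> w z = u z" using version_continuous[OF cu] by metis
  obtain wx where wx: "version (pdx CR u) wx" "\<And>z. z \<in> R \<Longrightarrow> wx z = pdx CR u z" using version_continuous[OF u(2)] by metis
  obtain wy where wy: "version (pdy CR u) wy" "\<And>z. z \<in> R \<Longrightarrow> wy z = pdy CR u z" using version_continuous[OF u(3)] by metis
  obtain wxx where wxx: "version gxx wxx" using ex_version[OF L1(1)] by metis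
  obtain wxy where wxy: "version gxy wxy" using ex_version[OF L1(2)] by metis
  obtain wyy where wyy: "version gyy wyy" using ex_version[OF L1(3)] by metis
  obtain wxxx where wxxx: "version gxxx wxxx" using ex_version[OF L1(4)] by metis
  obtain wxxy where wxxy: "version gxxy wxxy" using ex_version[OF L1(5)] by metis
  obtain wxyy where wxyy: "version gxyy wxyy" using ex_version[OF L1(6)] by metis
  obtain wyyy where wyyy: "version gyyy wyyy" using ex_version[OF L1(7)] by metis
  note ux = C1_has_weak_D(1)[OF u(1,2)] and uy = C1_has_weak_D(2)[OF u(1,3)]
  let ?U = "\<lambda>k. approx k w" and ?V = "\<lambda>k z. \<rho> k * approx k wx z" and ?W = "\<lambda>k z. \<rho> k * approx k wy z"
  \<comment> \<open>Each differentiation contributes one factor \<open>\<rho> k\<close>: second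
    derivatives carry two, third derivatives three.\<close>
  let ?A2 = "\<lambda>w k z. \<rho> k * (\<rho> k * approx k w z)" and ?A3 = "\<lambda>w k z. \<rho> k * (\<rho> k * (\<rho> k * approx k w z))"
  \<comment> \<open>The mean of the smooth mixed derivative instead of \<open>\<gamma>\<close>,
    because the smooth estimate at stage k is tied to the mean of its own function.\<close>
  define g where "g k = integral CR (?A2 wxy k) / ((b - a) * (d - c))" for k
  have g: "(b - a) * (d - c) * g k = integral CR (?A2 wxy k)" for k
    using ab cd by (simp add: g_def)
  have g_lim: "g \<longlonglongrightarrow> \<gamma>"
  proof -
    have "(\<lambda>k. \<rho> k * (\<rho> k * integral CR (approx k wxy)) / ((b - a) * (d - c))) \<longlonglongrightarrow> 1 * (1 * integral CR gxy) / ((b - a) * (d - c))"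
      using ab cd by (intro tendsto_intros \<rho>_tendsto approx_integral_tendsto(1)[OF wxy L1(2)]) simp
    moreover have "1 * (1 * integral CR gxy) / ((b - a) * (d - c)) = \<gamma>" using \<gamma>[symmetric] ab cd by simp
    ultimately show ?thesis unfolding g_def by simp
  qed
  have inCR: "(e, f) \<in> CR" if "e \<in> {a, b}" "f \<in> {c, d}" for e f
    using that ab cd by (auto simp: mem_CR)
  have xy: "(x, y) \<in> CR" using x y by (simp add: mem_CR)
  have U: "(\<lambda>k. ?U k z) \<longlonglongrightarrow> u z" if "z \<in> CR" for z
    by (rule approx_tendsto[OF version_integrable[OF w(1)] cu w(2) that])
  have V: "(\<lambda>k. ?V k z) \<longlonglongrightarrow> pdx CR u z" if "z \<in> CR" for z
    using tendsto_mult[OF \<rho>_tendsto approx_tendsto[OF version_integrable[OF wx(1)] u(2) wx(2) that]] by simp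
  have W: "(\<lambda>k. ?W k z) \<longlonglongrightarrow> pdy CR u z" if "z \<in> CR" for z
    using tendsto_mult[OF \<rho>_tendsto approx_tendsto[OF version_integrable[OF wy(1)] u(3) wy(2) that]] by simp
  have H: "(\<lambda>k. hermite_sum a b c d (?U k) (?V k) (?W k) (\<lambda>_. g k) p q p' q')
    \<longlonglongrightarrow> hermite_sum a b c d u (pdx CR u) (pdy CR u) (\<lambda>_. \<gamma>) p q p' q'" for p q p' q'
    unfolding hermite_sum_def
    by (intro tendsto_sum tendsto_add tendsto_mult tendsto_const U V W g_lim inCR)
  have I: "(\<lambda>k. I1 (?A3 w k)) \<longlonglongrightarrow> I1 g" if "version g w" "g absolutely_integrable_on R" for g w
  proof -
    have "I1 (?A3 w k) = \<rho> k * (\<rho> k * (\<rho> k * I1 (approx k w)))" for k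
      by (simp add: abs_mult)
    moreover have "(\<lambda>k. \<rho> k * (\<rho> k * (\<rho> k * I1 (approx k w)))) \<longlonglongrightarrow> 1 * (1 * (1 * I1 g))"
      by (intro tendsto_mult \<rho>_tendsto approx_integral_tendsto(2)[OF that])
    ultimately show ?thesis by simp
  qed
  have B: "(\<lambda>k. 53 * W2 (?A3 w1 k) (?A3 w2 k) (?A3 w3 k)) \<longlonglongrightarrow> 53 * W2 g1 g2 g3"
    if "version g1 w1" "g1 absolutely_integrable_on R" "version g2 w2" "g2 absolutely_integrable_on R" "version g3 w3" "g3 absolutely_integrable_on R"
    for g1 w1 g2 w2 g3 w3
    unfolding W2_def by (intro tendsto_add tendsto_mult tendsto_const I that)
  show "\<bar>pdx CR u (x, y) - hermite_sum a b c d u (pdx CR u) (pdy CR u) (\<lambda>_. \<gamma>) (\<lambda>e. deriv_on a b (spline_phi a b e) x)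
      (\<lambda>e. deriv_on a b (spline_psi a b e) x) (\<lambda>f. spline_phi c d f y) (\<lambda>f. spline_psi c d f y)\<bar>
    \<le> 53 * W2 gxxx gxxy gxyy"
  proof (rule LIMSEQ_le[OF tendsto_rabs[OF tendsto_diff[OF V[OF xy] H]] B[OF wxxx L1(4) wxxy L1(5) wxyy L1(6)]], intro exI allI impI)
    fix k
    show "\<bar>?V k (x, y) - hermite_sum a b c d (?U k) (?V k) (?W k) (\<lambda>_. g k) (\<lambda>e. deriv_on a b (spline_phi a b e) x)
      (\<lambda>e. deriv_on a b (spline_psi a b e) x) (\<lambda>f. spline_phi c d f y) (\<lambda>f. spline_psi c d f y)\<bar>
      \<le> 53 * W2 (?A3 wxxx k) (?A3 wxxy k) (?A3 wxyy k)"
      by (rule interpolation_dx_error[where Vy="?A2 wxy k" and Vx="?A2 wxx k"];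
          (rule g x y)?; (intro has_px_scale has_py_scale)?;
          (rule approx_has_px[OF w(1) wx(1) ux] approx_has_px[OF wy(1) wxy D2(3)] approx_has_px[OF wx(1) wxx D2(1)]
            approx_has_py[OF wx(1) wxy D2(2)] approx_has_px[OF wxx wxxx D3(1)] approx_has_py[OF wxx wxxy D3(2)]
            approx_has_px[OF wxy wxxy D3(3)] approx_has_py[OF wxy wxyy D3(4)])?)
  qed
  show "\<bar>pdy CR u (x, y) - hermite_sum a b c d u (pdx CR u) (pdy CR u) (\<lambda>_. \<gamma>) (\<lambda>e. spline_phi a b e x)
      (\<lambda>e. spline_psi a b e x) (\<lambda>f. deriv_on c d (spline_phi c d f) y) (\<lambda>f. deriv_on c d (spline_psi c d f) y)\<bar>
    \<le> 53 * W2 gxxy gxyy gyyy"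
  proof (rule LIMSEQ_le[OF tendsto_rabs[OF tendsto_diff[OF W[OF xy] H]] B[OF wxxy L1(5) wxyy L1(6) wyyy L1(7)]], intro exI allI impI)
    fix k
    show "\<bar>?W k (x, y) - hermite_sum a b c d (?U k) (?V k) (?W k) (\<lambda>_. g k) (\<lambda>e. spline_phi a b e x)
      (\<lambda>e. spline_psi a b e x) (\<lambda>f. deriv_on c d (spline_phi c d f) y) (\<lambda>f. deriv_on c d (spline_psi c d f) y)\<bar>
      \<le> 53 * W2 (?A3 wxxy k) (?A3 wxyy k) (?A3 wyyy k)"
      by (rule interpolation_dy_error[where Wx="?A2 wxy k" and Wy="?A2 wyy k"];
          (rule g x y)?; (intro has_px_scale has_py_scale)?;
          (rule approx_has_py[OF w(1) wy(1) uy] approx_has_py[OF wx(1) wxy D2(2)] approx_has_py[OF wy(1) wyy D2(4)]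
            approx_has_px[OF wy(1) wxy D2(3)] approx_has_py[OF wyy wyyy D3(6)] approx_has_px[OF wyy wxyy D3(5)]
            approx_has_py[OF wxy wxyy D3(4)] approx_has_px[OF wxy wxxy D3(3)])?)
  qed
qed

end

subsection \<open>Traces and edge functionals\<close>

lemma test_functions_classical_D:
  assumes "\<phi> \<in> test_functions \<Omega>"
  shows "classical_D \<alpha> \<phi> \<in> test_functions \<Omega>"
proof -
  have "(pdx UNIV ^^ m) \<psi> \<in> test_functions \<Omega> \<and> (pdy UNIV ^^ m) \<psi> \<in> test_functions \<Omega>"
    if "\<psi> \<in> test_functions \<Omega>" for m \<psi>
    using that by (induction m) (auto intro: test_functions_pd)
  then show ?thesis using assms by (simp add: classical_D_def)
qed

lemma has_weak_D_diff:
  assumes u: "has_weak_D u \<alpha> \<Omega> g" and v: "has_weak_D v \<alpha> \<Omega> h"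
  shows "has_weak_D (\<lambda>z. u z - v z) \<alpha> \<Omega> (\<lambda>z. g z - h z)"
proof -
  have loc: "locally_integrable \<Omega> u" "locally_integrable \<Omega> g" "locally_integrable \<Omega> v" "locally_integrable \<Omega> h"
    using u v by (simp_all add: has_weak_D_def)
  have diff: "locally_integrable \<Omega> (\<lambda>z. p z - q z)" if "locally_integrable \<Omega> p" "locally_integrable \<Omega> q" for p q
    using that unfolding locally_integrable_def by (intro allI impI set_integral_diff(1)) simp_all
  have eq: "(LINT z:\<Omega>|lebesgue. (p z - q z) * \<phi> z) = (LINT z:\<Omega>|lebesgue. p z * \<phi> z) - (LINT z:\<Omega>|lebesgue. q z * \<phi> z)"
    if "locally_integrable \<Omega> p" "locally_integrable \<Omega> q" "\<phi> \<in> test_functions \<Omega>" for p q \<phi>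
    unfolding left_diff_distrib
    by (rule set_integral_diff(2)[OF test_functions_times_absolutely_integrable[OF that(3,1)]
            test_functions_times_absolutely_integrable[OF that(3,2)]])
  show ?thesis
    unfolding has_weak_D_def
  proof (intro conjI ballI diff loc)
    fix \<phi> assume \<phi>: "\<phi> \<in> test_functions \<Omega>"
    have "(LINT z:\<Omega>|lebesgue. u z * classical_D \<alpha> \<phi> z) = (-1) ^ (fst \<alpha> + snd \<alpha>) * (LINT z:\<Omega>|lebesgue. g z * \<phi> z)"
      "(LINT z:\<Omega>|lebesgue. v z * classical_D \<alpha> \<phi> z) = (-1) ^ (fst \<alpha> + snd \<alpha>) * (LINT z:\<Omega>|lebesgue. h z * \<phi> z)"
      using u v \<phi> unfolding has_weak_D_def by blast+
    then show "(LINT z:\<Omega>|lebesgue. (u z - v z) * classical_D \<alpha> \<phi> z) =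
      (-1) ^ (fst \<alpha> + snd \<alpha>) * (LINT z:\<Omega>|lebesgue. (g z - h z) * \<phi> z)"
      unfolding eq[OF loc(1,3) test_functions_classical_D[OF \<phi>]] eq[OF loc(2,4) \<phi>] by (simp add: right_diff_distrib)
  qed
qed

lemma has_weak_D_0: "locally_integrable \<Omega> u \<Longrightarrow> has_weak_D u (0, 0) \<Omega> u"
  by (simp add: has_weak_D_def classical_D_def)

lemma integrable_lebesgue_on_iff:
  fixes f :: "'a::euclidean_space \<Rightarrow> real"
  assumes "S \<in> sets lebesgue"
  shows "integrable (lebesgue_on S) f \<longleftrightarrow> f absolutely_integrable_on S"
  unfolding set_integrable_def using assms by (subst integrable_restrict_space) simp_all

lemma integral_lebesgue_on_eq:
  fixes f :: "'a::euclidean_space \<Rightarrow> real"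
  assumes "f absolutely_integrable_on S" "S \<in> sets lebesgue"
  shows "integral\<^sup>L (lebesgue_on S) f = integral S f"
  using assms integrable_lebesgue_on_iff lebesgue_integral_eq_integral by blast

lemma absolutely_integrable_abs:
  fixes f :: "'a::euclidean_space \<Rightarrow> real"
  shows "f absolutely_integrable_on S \<Longrightarrow> (\<lambda>z. \<bar>f z\<bar>) absolutely_integrable_on S"
  using absolutely_integrable_norm[where f=f and S=S] by (simp add: o_def)

lemma Lp_1:
  fixes f :: "'a::euclidean_space \<Rightarrow> real"
  assumes "S \<in> sets lebesgue"
  shows "f \<in> Lp 1 S \<longleftrightarrow> f absolutely_integrable_on S"
proof -
  have "f \<in> Lp 1 S \<longleftrightarrow> f \<in> borel_measurable (lebesgue_on S) \<and> integrable (lebesgue_on S) (\<lambda>z. \<bar>f z\<bar>)"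
    by (simp add: Lp_def)
  also have "\<dots> \<longleftrightarrow> integrable (lebesgue_on S) f"
    using integrable_norm_iff[of f "lebesgue_on S"] by auto
  finally show ?thesis using integrable_lebesgue_on_iff[OF assms] by simp
qed

lemma Lp_norm_1:
  fixes f :: "'a::euclidean_space \<Rightarrow> real"
  assumes "f absolutely_integrable_on S" "S \<in> sets lebesgue"
  shows "Lp_norm 1 S f = integral S (\<lambda>z. \<bar>f z\<bar>)"
  using integral_lebesgue_on_eq[OF absolutely_integrable_abs[OF assms(1)] assms(2)]
  by (simp add: Lp_norm_def integral_nonneg_real)

lemma multi_indices_1: "multi_indices 1 = {(1, 0), (0, 1)}"
  and multi_indices_le_1: "(\<Union>l\<le>1. multi_indices l) = {(0, 0), (1, 0), (0, 1)}"
  and multi_indices_2: "multi_indices 2 = {(2, 0), (1, 1), (0, 2)}"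
proof -
  have 1: "m + n = 1 \<longleftrightarrow> (m = 1 \<and> n = 0) \<or> (m = 0 \<and> n = 1)" "m + n = 2 \<longleftrightarrow> (m = 2 \<and> n = 0) \<or> (m = 1 \<and> n = 1) \<or> (m = 0 \<and> n = 2)"
    "m + n \<le> 1 \<longleftrightarrow> (m = 0 \<and> n = 0) \<or> (m = 1 \<and> n = 0) \<or> (m = 0 \<and> n = 1)" for m n :: nat
    by arith+
  show "multi_indices 1 = {(1, 0), (0, 1)}" "multi_indices 2 = {(2, 0), (1, 1), (0, 2)}"
    unfolding multi_indices_def by (rule set_eqI; unfold mem_Collect_eq 1; simp only: insert_iff empty_iff prod_eq_iff fst_conv snd_conv; blast)+
  have "\<alpha> \<in> (\<Union>l\<le>1. multi_indices l) \<longleftrightarrow> fst \<alpha> + snd \<alpha> \<le> 1" for \<alpha>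
    by (simp add: multi_indices_def)
  then show "(\<Union>l\<le>1. multi_indices l) = {(0, 0), (1, 0), (0, 1)}"
    by (intro set_eqI) (simp only: 1 insert_iff empty_iff prod_eq_iff fst_conv snd_conv, blast)
qed

text \<open>By Fubini, integrating out one variable does not increase the L1 norm. Applied to
  weighted strips along an edge it yields convergence of the edge values.\<close>

lemma L1_marginal:
  fixes F :: "nat \<Rightarrow> real \<times> real \<Rightarrow> real"
  assumes F: "\<And>k. integrable lborel (F k)" and f: "integrable lborel f"
    and lim: "(\<lambda>k. \<integral>z. \<bar>F k z - f z\<bar> \<partial>lborel) \<longlonglongrightarrow> 0"
  shows "integrable lborel (\<lambda>x. \<integral>t. f (x, t) \<partial>lborel)"
    and "\<And>k. integrable lborel (\<lambda>x. \<integral>t. F k (x, t) \<partial>lborel)"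
    and "(\<lambda>k. \<integral>x. \<bar>(\<integral>t. F k (x, t) \<partial>lborel) - (\<integral>t. f (x, t) \<partial>lborel)\<bar> \<partial>lborel) \<longlonglongrightarrow> 0"
proof -
  have P: "integrable (lborel \<Otimes>\<^sub>M lborel) (F k)" "integrable (lborel \<Otimes>\<^sub>M lborel) f" for k
    using F f by (simp_all add: lborel_prod)
  show i1: "integrable lborel (\<lambda>x. \<integral>t. f (x, t) \<partial>lborel)"
    by (rule lborel_pair.integrable_fst'[OF P(2)])
  show i2: "integrable lborel (\<lambda>x. \<integral>t. F k (x, t) \<partial>lborel)" for k
    by (rule lborel_pair.integrable_fst'[OF P(1)])
  have D: "integrable (lborel \<Otimes>\<^sub>M lborel) (\<lambda>z. \<bar>F k z - f z\<bar>)" for k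
    by (intro integrable_abs Bochner_Integration.integrable_diff P)
  have bound: "(\<integral>x. \<bar>(\<integral>t. F k (x, t) \<partial>lborel) - (\<integral>t. f (x, t) \<partial>lborel)\<bar> \<partial>lborel) \<le> (\<integral>z. \<bar>F k z - f z\<bar> \<partial>lborel)" for k
  proof -
    have "(\<integral>x. \<bar>(\<integral>t. F k (x, t) \<partial>lborel) - (\<integral>t. f (x, t) \<partial>lborel)\<bar> \<partial>lborel)
      \<le> (\<integral>x. (\<integral>t. \<bar>F k (x, t) - f (x, t)\<bar> \<partial>lborel) \<partial>lborel)"
    proof (rule integral_mono_AE)
      show "integrable lborel (\<lambda>x. \<integral>t. \<bar>F k (x, t) - f (x, t)\<bar> \<partial>lborel)"
        by (rule lborel_pair.integrable_fst'[OF D])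
      show "AE x in lborel. \<bar>(\<integral>t. F k (x, t) \<partial>lborel) - (\<integral>t. f (x, t) \<partial>lborel)\<bar> \<le> (\<integral>t. \<bar>F k (x, t) - f (x, t)\<bar> \<partial>lborel)"
        using lborel_pair.AE_integrable_fst'[OF P(1)[of k]] lborel_pair.AE_integrable_fst'[OF P(2)]
      proof eventually_elim
        case (elim x)
        then have "(\<integral>t. F k (x, t) \<partial>lborel) - (\<integral>t. f (x, t) \<partial>lborel) = (\<integral>t. F k (x, t) - f (x, t) \<partial>lborel)" by simp
        then show ?case by (simp add: integral_abs_bound)
      qed
    qed (intro integrable_abs Bochner_Integration.integrable_diff i1 i2)
    also have "\<dots> = (\<integral>z. \<bar>F k z - f z\<bar> \<partial>lborel)"
      using lborel_pair.integral_fst'[OF D] by (simp add: lborel_prod)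
    finally show ?thesis .
  qed
  show "(\<lambda>k. \<integral>x. \<bar>(\<integral>t. F k (x, t) \<partial>lborel) - (\<integral>t. f (x, t) \<partial>lborel)\<bar> \<partial>lborel) \<longlonglongrightarrow> 0"
    by (rule Lim_null_comparison[OF _ lim]) (simp add: bound)
qed

context rect
begin

text \<open>The boundary is a null set, so integrability on the open rectangle carries over to
  subsets of the closed one.\<close>

lemma absolutely_integrable_CR:
  fixes f :: "real \<times> real \<Rightarrow> real"
  assumes "f absolutely_integrable_on R" "S \<subseteq> CR" "S \<in> sets lebesgue"
  shows "f absolutely_integrable_on S"
proof -
  have neg: "negligible (CR - R)"
    using negligible_frontier_interval by blast
  have "f absolutely_integrable_on CR"
  proof (rule absolutely_integrable_spike_set[OF assms(1)])
    show "negligible {x \<in> R - CR. f x \<noteq> 0}"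
      by (rule negligible_subset[OF negligible_empty]) (use R_subset_CR in blast)
    show "negligible {x \<in> CR - R. f x \<noteq> 0}" by (rule negligible_subset[OF neg]) blast
  qed
  then show ?thesis using assms(2,3) by (intro set_integrable_subset[of lebesgue CR f S])
qed

lemma integral_subset_le_R:
  fixes f :: "real \<times> real \<Rightarrow> real"
  assumes "f absolutely_integrable_on R" "S \<subseteq> CR" "S \<in> sets lebesgue"
  shows "integral S (\<lambda>z. \<bar>f z\<bar>) \<le> integral R (\<lambda>z. \<bar>f z\<bar>)"
proof -
  have "integral S (\<lambda>z. \<bar>f z\<bar>) \<le> integral CR (\<lambda>z. \<bar>f z\<bar>)"
    using absolutely_integrable_abs[OF absolutely_integrable_CR[OF assms]]
      absolutely_integrable_abs[OF absolutely_integrable_CR[OF assms(1) order_refl]] assms(2)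
    by (intro integral_subset_le) (auto dest: set_lebesgue_integral_eq_integral(1))
  then show ?thesis by (simp add: integral_open_interval)
qed

text \<open>For exponent 1 the combined norm is a plain sum, so convergence in it amounts to
  convergence of its three parts.\<close>

lemma sobolev_norm_1_1:
  assumes f: "f absolutely_integrable_on R" "fx absolutely_integrable_on R" "fy absolutely_integrable_on R"
    and D: "has_weak_D f (1, 0) R fx" "has_weak_D f (0, 1) R fy"
  shows "f \<in> sobolev 1 1 R"
    and "sobolev_norm 1 1 R f = integral R (\<lambda>z. \<bar>f z\<bar>) + integral R (\<lambda>z. \<bar>fx z\<bar>) + integral R (\<lambda>z. \<bar>fy z\<bar>)"
proof -
  note D0 = has_weak_D_0[OF locally_integrable_R[OF f(1)]]
  have mi: "\<alpha> \<in> {(0, 0), (1, 0), (0, 1)}" if "l \<le> 1" "\<alpha> \<in> multi_indices l" for l \<alpha>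
    using that multi_indices_le_1 by blast
  show "f \<in> sobolev 1 1 R"
    unfolding sobolev_def
  proof (intro CollectI conjI allI impI ballI)
    show "f \<in> Lp 1 R" using f(1) by (simp add: Lp_1)
    fix l :: nat and \<alpha> assume "l \<le> 1" "\<alpha> \<in> multi_indices l"
    then consider "\<alpha> = (0, 0)" | "\<alpha> = (1, 0)" | "\<alpha> = (0, 1)" using mi by blast
    then show "\<exists>g\<in>Lp 1 R. has_weak_D f \<alpha> R g"
      by cases (use f D D0 Lp_1[of R] in auto)
  qed
  have n: "Lp_norm 1 R (weak_D R \<alpha> f) = integral R (\<lambda>z. \<bar>g z\<bar>)" if "has_weak_D f \<alpha> R g" "g absolutely_integrable_on R" for \<alpha> g
  proof -
    note ae = weak_D_AE(2)[OF that(1)]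
    have "AE z in lebesgue. z \<in> R \<longrightarrow> \<bar>g z\<bar> = \<bar>weak_D R \<alpha> f z\<bar>" using ae by (rule eventually_mono) simp
    then show ?thesis
      using Lp_norm_1[OF absolutely_integrable_cong_AE_on[OF ae that(2)]] integral_cong_AE_on[of R "\<lambda>z. \<bar>g z\<bar>"] by simp
  qed
  have ne: "(0::nat, 0::nat) \<notin> {(1, 0), (0, 1)}" "(1::nat, 0::nat) \<notin> {(0, 1)}" by simp_all
  show "sobolev_norm 1 1 R f = integral R (\<lambda>z. \<bar>f z\<bar>) + integral R (\<lambda>z. \<bar>fx z\<bar>) + integral R (\<lambda>z. \<bar>fy z\<bar>)"
    unfolding sobolev_norm_def multi_indices_le_1 lp_combine_def
    using n[OF D0 f(1)] n[OF D(1) f(2)] n[OF D(2) f(3)]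
    by (simp add: integral_nonneg_real)
qed

lemma smooth_absolutely_integrable: "smooth v \<Longrightarrow> v absolutely_integrable_on R"
  using continuous_absolutely_integrable(1)[OF smooth_continuous_on] .

lemma smooth_minus_sobolev_norm:
  assumes v: "smooth v"
    and w: "w absolutely_integrable_on R" "wx absolutely_integrable_on R" "wy absolutely_integrable_on R"
    and D: "has_weak_D w (1, 0) R wx" "has_weak_D w (0, 1) R wy"
  shows "sobolev_norm 1 1 R (\<lambda>z. v z - w z) = integral R (\<lambda>z. \<bar>v z - w z\<bar>) +
     integral R (\<lambda>z. \<bar>pdx UNIV v z - wx z\<bar>) + integral R (\<lambda>z. \<bar>pdy UNIV v z - wy z\<bar>)"
  by (intro sobolev_norm_1_1(2) set_integral_diff(1) has_weak_D_diff smooth_has_weak_D smooth_absolutely_integrable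
      smooth_pdx smooth_pdy assms)

text \<open>Supplies the smooth approximating sequence that the definition of a trace asks
  for.\<close>

lemma approx_sobolev_tendsto:
  assumes w: "w absolutely_integrable_on R" "wx absolutely_integrable_on R" "wy absolutely_integrable_on R"
    and D: "has_weak_D w (1, 0) R wx" "has_weak_D w (0, 1) R wy" and v: "version w v"
  shows "(\<lambda>k. integral R (\<lambda>z. \<bar>approx k v z - w z\<bar>)) \<longlonglongrightarrow> 0"
    "(\<lambda>k. integral R (\<lambda>z. \<bar>pdx UNIV (approx k v) z - wx z\<bar>)) \<longlonglongrightarrow> 0"
    "(\<lambda>k. integral R (\<lambda>z. \<bar>pdy UNIV (approx k v) z - wy z\<bar>)) \<longlonglongrightarrow> 0"
proof -
  show "(\<lambda>k. integral R (\<lambda>z. \<bar>approx k v z - w z\<bar>)) \<longlonglongrightarrow> 0" by (rule approx_L1_tendsto[OF v])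
  have gen: "(\<lambda>k. integral R (\<lambda>z. \<bar>P k z - g z\<bar>)) \<longlonglongrightarrow> 0"
    if g: "g absolutely_integrable_on R" and vg: "version g h" and P: "\<And>k z. z \<in> CR \<Longrightarrow> P k z = \<rho> k * approx k h z" for g h P
  proof -
    have ai: "approx k h absolutely_integrable_on R" for k
      by (rule smooth_absolutely_integrable[OF smooth_approx[OF version_integrable[OF vg]]])
    \<comment> \<open>The factor \<open>\<rho> k\<close> is removed by \<rho> A - g = (A - g) - (1 -
      \<rho>) A, where the L1 norms of the averages A converge and 1 - \<rho> tends to 0.\<close>
    have bound: "\<bar>integral R (\<lambda>z. \<bar>P k z - g z\<bar>)\<bar> \<le> integral R (\<lambda>z. \<bar>approx k h z - g z\<bar>) + (1 - \<rho> k) * integral R (\<lambda>z. \<bar>approx k h z\<bar>)" for k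
    proof -
      note i1 = absolutely_integrable_abs[OF set_integral_diff(1)[OF ai g], THEN set_lebesgue_integral_eq_integral(1)]
      note i2 = absolutely_integrable_abs[OF ai, THEN set_lebesgue_integral_eq_integral(1)]
      have eq: "integral R (\<lambda>z. \<bar>P k z - g z\<bar>) = integral R (\<lambda>z. \<bar>\<rho> k * approx k h z - g z\<bar>)"
        by (rule Henstock_Kurzweil_Integration.integral_cong) (use P R_subset_CR in \<open>metis subsetD\<close>)
      have "(\<lambda>z. \<rho> k * approx k h z) absolutely_integrable_on R"
        using ai set_integrable_mult_right by blast
      note i3 = absolutely_integrable_abs[OF set_integral_diff(1)[OF this g], THEN set_lebesgue_integral_eq_integral(1)]
      have "\<bar>integral R (\<lambda>z. \<bar>\<rho> k * approx k h z - g z\<bar>)\<bar> \<le> integral R (\<lambda>z. \<bar>approx k h z - g z\<bar> + (1 - \<rho> k) * \<bar>approx k h z\<bar>)"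
      proof (rule abs_integral_le[OF i3 integrable_add[OF i1 integrable_on_mult_right[OF i2]]])
        fix z assume "z \<in> R"
        have r: "0 \<le> 1 - \<rho> k" by (simp add: field_simps)
        have "\<rho> k * approx k h z - g z = (approx k h z - g z) - (1 - \<rho> k) * approx k h z" by (simp only: left_diff_distrib mult_1)
        then have "\<bar>\<rho> k * approx k h z - g z\<bar> \<le> \<bar>approx k h z - g z\<bar> + \<bar>(1 - \<rho> k) * approx k h z\<bar>"
          by (metis abs_triangle_ineq4)
        then show "\<bar>\<bar>\<rho> k * approx k h z - g z\<bar>\<bar> \<le> \<bar>approx k h z - g z\<bar> + (1 - \<rho> k) * \<bar>approx k h z\<bar>"
          unfolding abs_abs abs_mult abs_of_nonneg[OF r] .
      qed
      also have "\<dots> = integral R (\<lambda>z. \<bar>approx k h z - g z\<bar>) + (1 - \<rho> k) * integral R (\<lambda>z. \<bar>approx k h z\<bar>)"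
        by (subst Henstock_Kurzweil_Integration.integral_add[OF i1 integrable_on_mult_right[OF i2]]) simp
      finally show ?thesis unfolding eq .
    qed
    have lim: "(\<lambda>k. integral R (\<lambda>z. \<bar>approx k h z - g z\<bar>) + (1 - \<rho> k) * integral R (\<lambda>z. \<bar>approx k h z\<bar>)) \<longlonglongrightarrow>
      0 + (1 - 1) * integral R (\<lambda>z. \<bar>g z\<bar>)"
      using approx_integral_tendsto(2)[OF vg g]
      by (intro tendsto_add tendsto_mult tendsto_diff tendsto_const \<rho>_tendsto approx_L1_tendsto[OF vg])
        (simp add: integral_open_interval)
    show ?thesis by (rule Lim_null_comparison[of _ _ _ ]) (use bound lim in simp_all)
  qed
  obtain vx where vx: "version wx vx" using ex_version[OF w(2)] by blast
  obtain vy where vy: "version wy vy" using ex_version[OF w(3)] by blast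
  show "(\<lambda>k. integral R (\<lambda>z. \<bar>pdx UNIV (approx k v) z - wx z\<bar>)) \<longlonglongrightarrow> 0"
    by (rule gen[OF w(2) vx approx_weak_pd(1)[OF v vx _ D(1)]])
  show "(\<lambda>k. integral R (\<lambda>z. \<bar>pdy UNIV (approx k v) z - wy z\<bar>)) \<longlonglongrightarrow> 0"
    by (rule gen[OF w(3) vy approx_weak_pd(2)[OF v vy _ D(2)]])
qed

text \<open>A point (t, y0) of the edge is joined to the rectangle carrying the mean in three moves:
  vertically to height y inside the adjacent cell, horizontally along y to the columns of that
  rectangle, vertically inside these columns. The last two moves are
  \<open>mean_oscillation\<close>. Averaging over y in the cell turns the line integral at height y
  into a strip integral divided by \<open>d1 - c1\<close>. There is one term per move, and each
  domain of integration contains the adjacent cell or the rectangle of the mean.\<close>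

lemma edge_oscillation:
  assumes vx: "has_px v vx" and vy: "has_py v vy"
    and J: "a \<le> a1" "a1 < b1" "b1 \<le> b" and K: "c \<le> c1" "c1 < d1" "d1 \<le> d" and y0: "y0 \<in> {c1..d1}"
    and M: "a \<le> a2" "a2 < b2" "b2 \<le> b" "c \<le> c2" "c2 < d2" "d2 \<le> d"
    and m: "(b2 - a2) * (d2 - c2) * m = integral (cbox (a2, c2) (b2, d2)) v"
  shows "integral {a1..b1} (\<lambda>t. \<bar>v (t, y0) - m\<bar>) \<le> (b1 - a1) *
    (integral (cbox (a1, c1) (b1, d1)) (\<lambda>z. \<bar>vy z\<bar>) / (b1 - a1) + integral (cbox (a, c1) (b, d1)) (\<lambda>z. \<bar>vx z\<bar>) / (d1 - c1) +
     integral (cbox (a2, c) (b2, d)) (\<lambda>z. \<bar>vy z\<bar>) / (b2 - a2))"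
proof -
  have cv: "continuous_on CR v" "continuous_on CR vx" "continuous_on CR vy" using vx vy by (simp_all add: has_px_def has_py_def)
  have sub: "cbox (a1, c1) (b1, d1) \<subseteq> CR" "cbox (a, c1) (b, d1) \<subseteq> CR" using J K by auto
  have c1: "continuous_on (cbox (a1, c1) (b1, d1)) (\<lambda>z. \<bar>vy z\<bar>)" and c2: "continuous_on (cbox (a, c1) (b, d1)) (\<lambda>z. \<bar>vx z\<bar>)"
    using continuous_on_subset[OF cv(3) sub(1)] continuous_on_subset[OF cv(2) sub(2)] by (simp_all add: continuous_on_rabs)
  define A where "A = (\<lambda>t. integral {c1..d1} (\<lambda>s. \<bar>vy (t, s)\<bar>))"
  define X where "X = (\<lambda>y. integral {a..b} (\<lambda>r. \<bar>vx (r, y)\<bar>))"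
  define G where "G = integral (cbox (a2, c) (b2, d)) (\<lambda>z. \<bar>vy z\<bar>) / (b2 - a2)"
  define N where "N = integral (cbox (a, c1) (b, d1)) (\<lambda>z. \<bar>vx z\<bar>)"
  have iX: "X integrable_on {c1..d1}" "integral {c1..d1} X = N"
    using box_integral_slices(2)[OF c2] box_integral_iterated(2)[OF c2] by (simp_all add: X_def N_def)
  have iA: "A integrable_on {a1..b1}" "integral {a1..b1} A = integral (cbox (a1, c1) (b1, d1)) (\<lambda>z. \<bar>vy z\<bar>)"
    using box_integral_slices(1)[OF c1] box_integral_iterated(1)[OF c1] by (simp_all add: A_def)
  have pos: "0 < b1 - a1" "0 < d1 - c1" using J K by simp_all
  have y0': "y0 \<in> {c..d}" using y0 K by simp
  have pt: "\<bar>v (t, y0) - m\<bar> \<le> A t + N / (d1 - c1) + G" if t: "t \<in> {a1..b1}" for t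
  proof -
    have t': "t \<in> {a..b}" using t J by simp
    have "(d1 - c1) * \<bar>v (t, y0) - m\<bar> = integral {c1..d1} (\<lambda>y. \<bar>v (t, y0) - m\<bar>)" using pos by simp
    also have "\<dots> \<le> integral {c1..d1} (\<lambda>y. A t + (X y + G))"
    proof (rule integral_le)
      show "(\<lambda>y. A t + (X y + G)) integrable_on {c1..d1}"
        by (intro integrable_add integrable_const_ivl iX)
      fix y assume y: "y \<in> {c1..d1}"
      then have y': "y \<in> {c..d}" using K by simp
      have Ksub: "{c1..d1} \<subseteq> {c..d}" using K by simp
      have "\<bar>v (t, y0) - v (t, y)\<bar> \<le> A t"
        unfolding A_def
      proof (rule C1_variation[where g="\<lambda>s. v (t, s)" and g'="\<lambda>s. vy (t, s)"])
        show "((\<lambda>s. v (t, s)) has_real_derivative vy (t, s)) (at s within {c1..d1})" if "s \<in> {c1..d1}" for s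
          using vy t' that Ksub unfolding has_py_def by (blast intro: has_field_derivative_subset)
        show "continuous_on {c1..d1} (\<lambda>s. vy (t, s))"
          by (rule continuous_on_subset[OF continuous_slices(2)[OF cv(3) t'] Ksub])
      qed (rule y0 y)+
      moreover have "\<bar>v (t, y) - m\<bar> \<le> X y + G"
        unfolding X_def G_def by (rule mean_oscillation[OF vx vy M m t' y'])
      ultimately show "\<bar>v (t, y0) - m\<bar> \<le> A t + (X y + G)" by linarith
    qed (rule integrable_const_ivl)
    also have "\<dots> = (d1 - c1) * A t + (N + (d1 - c1) * G)"
      using pos iX by (simp add: Henstock_Kurzweil_Integration.integral_add integrable_const_ivl integrable_add)
    also have "\<dots> = (d1 - c1) * (A t + N / (d1 - c1) + G)" using pos by (simp add: field_simps)
    finally show ?thesis using pos by (simp add: mult_le_cancel_left_pos)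
  qed
  have cJ: "continuous_on {a1..b1} (\<lambda>t. v (t, y0))"
    by (rule continuous_on_subset[OF continuous_slices(1)[OF cv(1) y0']]) (use J in simp)
  have "integral {a1..b1} (\<lambda>t. \<bar>v (t, y0) - m\<bar>) \<le> integral {a1..b1} (\<lambda>t. A t + (N / (d1 - c1) + G))"
  proof (rule integral_le)
    show "(\<lambda>t. \<bar>v (t, y0) - m\<bar>) integrable_on {a1..b1}"
      by (intro integrable_continuous_real continuous_intros cJ)
    show "(\<lambda>t. A t + (N / (d1 - c1) + G)) integrable_on {a1..b1}"
      by (intro integrable_add integrable_const_ivl iA)
    show "\<bar>v (t, y0) - m\<bar> \<le> A t + (N / (d1 - c1) + G)" if "t \<in> {a1..b1}" for t using pt[OF that] by simp
  qed
  also have "\<dots> = integral (cbox (a1, c1) (b1, d1)) (\<lambda>z. \<bar>vy z\<bar>) + (b1 - a1) * (N / (d1 - c1) + G)"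
    using pos iA by (simp add: Henstock_Kurzweil_Integration.integral_add integrable_const_ivl)
  also have "\<dots> = (b1 - a1) * (integral (cbox (a1, c1) (b1, d1)) (\<lambda>z. \<bar>vy z\<bar>) / (b1 - a1) + N / (d1 - c1) + G)"
    using pos by (simp add: distrib_left)
  finally show ?thesis unfolding N_def G_def .
qed

lemma smooth_has_px: "smooth v \<Longrightarrow> has_px v (pdx UNIV v)"
  and smooth_has_py: "smooth v \<Longrightarrow> has_py v (pdy UNIV v)"
  unfolding has_px_def has_py_def
  by (simp_all add: smooth_continuous_on smooth_pdx smooth_pdy smooth_DERIV_fst smooth_DERIV_snd)

lemma edge_oscillation_vertical:
  assumes vx: "has_px v vx" and vy: "has_py v vy"
    and J: "a \<le> a1" "a1 < b1" "b1 \<le> b" and K: "c \<le> c1" "c1 < d1" "d1 \<le> d" and x0: "x0 \<in> {a1..b1}"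
    and M: "a \<le> a2" "a2 < b2" "b2 \<le> b" "c \<le> c2" "c2 < d2" "d2 \<le> d"
    and m: "(b2 - a2) * (d2 - c2) * m = integral (cbox (a2, c2) (b2, d2)) v"
  shows "integral {c1..d1} (\<lambda>t. \<bar>v (x0, t) - m\<bar>) \<le> (d1 - c1) *
    (integral (cbox (a1, c1) (b1, d1)) (\<lambda>z. \<bar>vx z\<bar>) / (d1 - c1) + integral (cbox (a1, c) (b1, d)) (\<lambda>z. \<bar>vy z\<bar>) / (b1 - a1) +
     integral (cbox (a, c2) (b, d2)) (\<lambda>z. \<bar>vx z\<bar>) / (d2 - c2))"
proof -
  interpret S: rect c d a b by unfold_locales (rule cd, rule ab)
  have cv: "continuous_on CR v" "continuous_on CR vx" "continuous_on CR vy" using vx vy by (simp_all add: has_px_def has_py_def)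
  have sw: "integral (cbox (q, p) (q', p')) (F \<circ> prod.swap) = integral (cbox (p, q) (p', q')) F"
    if "continuous_on CR F" "cbox (p, q) (p', q') \<subseteq> CR" "p < p'" "q < q'" for F :: "real \<times> real \<Rightarrow> real" and p q p' q'
  proof -
    interpret T: rect p p' q q' by unfold_locales (use that in auto)
    show ?thesis by (rule T.integral_swap_CR[OF continuous_on_subset[OF that(1,2)]])
  qed
  have ca: "continuous_on CR (\<lambda>z. \<bar>vx z\<bar>)" "continuous_on CR (\<lambda>z. \<bar>vy z\<bar>)" using cv by (simp_all add: continuous_on_rabs)
  have sub: "cbox (a1, c1) (b1, d1) \<subseteq> CR" "cbox (a1, c) (b1, d) \<subseteq> CR" "cbox (a, c2) (b, d2) \<subseteq> CR" "cbox (a2, c2) (b2, d2) \<subseteq> CR"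
    using J K M by auto
  have m': "(d2 - c2) * (b2 - a2) * m = integral (cbox (c2, a2) (d2, b2)) (v \<circ> prod.swap)"
    using m sw[OF cv(1) sub(4)] M by (simp add: mult.commute mult.left_commute)
  have abs: "(\<lambda>z. \<bar>(F \<circ> prod.swap) z\<bar>) = (\<lambda>z. \<bar>F z\<bar>) \<circ> prod.swap" for F :: "real \<times> real \<Rightarrow> real" by (simp add: o_def)
  show ?thesis
    using S.edge_oscillation[OF has_py_swap[OF vy] has_px_swap[OF vx] K J x0 M(4,5,6,1,2,3) m']
    unfolding abs sw[OF ca(1) sub(1) J(2) K(2)] sw[OF ca(2) sub(2) J(2) cd] sw[OF ca(1) sub(3) ab M(5)]
    by simp
qed

end

section \<open>From smooth functions to traces\<close>

lemma functional_tendsto: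
  fixes D g :: "real \<Rightarrow> real" and f :: "nat \<Rightarrow> real \<Rightarrow> real"
  assumes lr: "l < r" and D: "continuous_on {l..r} D" and g: "g absolutely_integrable_on {l..r}"
    and f: "\<And>k. continuous_on {l..r} (f k)"
    and lim: "(\<lambda>k. integral {l..r} (\<lambda>t. \<bar>f k t - g t\<bar>)) \<longlonglongrightarrow> 0"
  shows "(\<lambda>k. integral {l..r} (\<lambda>t. f k t * D t)) \<longlonglongrightarrow> (LINT t:{l..r}|lebesgue. g t * D t)"
proof -
  obtain B where "\<forall>t\<in>{l..r}. \<bar>D t\<bar> \<le> B"
    using compact_imp_bounded[OF compact_continuous_image[OF D compact_Icc]] unfolding bounded_iff by auto
  then have B: "\<bar>D t\<bar> \<le> B" if "t \<in> {l..r}" for t using that by blast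
  have prod: "(\<lambda>t. h t * D t) absolutely_integrable_on {l..r}" if "h absolutely_integrable_on {l..r}" for h
  proof -
    have "(\<lambda>t. D t * h t) absolutely_integrable_on {l..r}"
    proof (rule absolutely_integrable_bounded_measurable_product_real[OF _ _ _ that])
      show "D \<in> borel_measurable (lebesgue_on {l..r})"
        using D by (rule continuous_imp_measurable_on_sets_lebesgue) simp
      show "bounded (D ` {l..r})" using compact_imp_bounded[OF compact_continuous_image[OF D compact_Icc]] .
    qed simp
    then show ?thesis by (simp add: mult.commute)
  qed
  note gD = prod[OF g] and fa = absolutely_integrable_continuous_real[OF f]
  have "(\<lambda>k. integral {l..r} (\<lambda>t. f k t * D t)) \<longlonglongrightarrow> integral {l..r} (\<lambda>t. g t * D t)"
  proof (rule LIM_zero_cancel, rule Lim_null_comparison)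
    show "eventually (\<lambda>k. norm (integral {l..r} (\<lambda>t. f k t * D t) - integral {l..r} (\<lambda>t. g t * D t))
       \<le> B * integral {l..r} (\<lambda>t. \<bar>f k t - g t\<bar>)) sequentially"
    proof (rule always_eventually, rule allI)
      fix k
      note int = prod[OF fa[of k], THEN set_lebesgue_integral_eq_integral(1)] gD[THEN set_lebesgue_integral_eq_integral(1)]
      note ai = absolutely_integrable_abs[OF set_integral_diff(1)[OF fa[of k] g], THEN set_lebesgue_integral_eq_integral(1)]
      have "\<bar>integral {l..r} (\<lambda>t. f k t * D t - g t * D t)\<bar> \<le> integral {l..r} (\<lambda>t. B * \<bar>f k t - g t\<bar>)"
      proof (rule abs_integral_le[OF integrable_diff[OF int] integrable_on_mult_right[OF ai]])
        fix t assume "t \<in> {l..r}"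
        from mult_left_mono[OF B[OF this], of "\<bar>f k t - g t\<bar>"]
        show "\<bar>f k t * D t - g t * D t\<bar> \<le> B * \<bar>f k t - g t\<bar>"
          unfolding left_diff_distrib[symmetric] abs_mult by (simp add: mult.commute)
      qed
      then show "norm (integral {l..r} (\<lambda>t. f k t * D t) - integral {l..r} (\<lambda>t. g t * D t))
        \<le> B * integral {l..r} (\<lambda>t. \<bar>f k t - g t\<bar>)"
        using Henstock_Kurzweil_Integration.integral_diff[OF int] by simp
    qed
    show "(\<lambda>k. B * integral {l..r} (\<lambda>t. \<bar>f k t - g t\<bar>)) \<longlonglongrightarrow> 0"
      using tendsto_mult_right_zero[OF lim] .
  qed
  then show ?thesis using set_lebesgue_integral_eq_integral(2)[OF gD] by simp
qed

text \<open>Because \<open>D\<close> has integral 1, the constant \<open>m\<close> may be moved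
  under the integral.\<close>

lemma mean_functional_bound:
  fixes D f :: "real \<Rightarrow> real"
  assumes D: "continuous_on {l..r} D" "integral {l..r} D = 1" "\<And>t. t \<in> {l..r} \<Longrightarrow> \<bar>D t\<bar> \<le> B"
    and f: "continuous_on {l..r} f"
  shows "\<bar>integral {l..r} (\<lambda>t. f t * D t) - m\<bar> \<le> B * integral {l..r} (\<lambda>t. \<bar>f t - m\<bar>)"
proof -
  have "integral {l..r} (\<lambda>t. f t * D t) - m = integral {l..r} (\<lambda>t. f t * D t) - integral {l..r} (\<lambda>t. m * D t)"
    using D(2) by simp
  also have "\<dots> = integral {l..r} (\<lambda>t. f t * D t - m * D t)"
    by (rule Henstock_Kurzweil_Integration.integral_diff[symmetric])
      (intro integrable_continuous_real continuous_intros D f)+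
  also have "\<bar>\<dots>\<bar> \<le> integral {l..r} (\<lambda>t. B * \<bar>f t - m\<bar>)"
  proof (rule abs_integral_le)
    fix t assume "t \<in> {l..r}"
    from mult_left_mono[OF D(3)[OF this], of "\<bar>f t - m\<bar>"]
    show "\<bar>f t * D t - m * D t\<bar> \<le> B * \<bar>f t - m\<bar>"
      unfolding left_diff_distrib[symmetric] abs_mult by (simp add: mult.commute)
  qed (intro integrable_continuous_real continuous_intros D f)+
  finally show ?thesis by simp
qed

context rect
begin

text \<open>A trace is known only through its defining sequence, so estimates are made along this
  sequence. Each of the three L1 distances is bounded by the Sobolev norm of the difference.\<close>

lemma has_trace_tendsto:
  assumes tr: "has_trace w R \<gamma> {l..r} g" and lr: "l < r"
    and \<gamma>: "continuous_on {l..r} \<gamma>"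
    and w: "w absolutely_integrable_on R" "wx absolutely_integrable_on R" "wy absolutely_integrable_on R"
    and Dw: "has_weak_D w (1, 0) R wx" "has_weak_D w (0, 1) R wy"
  obtains v where "\<And>k::nat. smooth (v k)"
    "(\<lambda>k. integral R (\<lambda>z. \<bar>v k z - w z\<bar>)) \<longlonglongrightarrow> 0"
    "(\<lambda>k. integral R (\<lambda>z. \<bar>pdx UNIV (v k) z - wx z\<bar>)) \<longlonglongrightarrow> 0"
    "(\<lambda>k. integral R (\<lambda>z. \<bar>pdy UNIV (v k) z - wy z\<bar>)) \<longlonglongrightarrow> 0"
    "\<And>D. continuous_on {l..r} D \<Longrightarrow>
      (\<lambda>k. integral {l..r} (\<lambda>t. v k (\<gamma> t) * D t)) \<longlonglongrightarrow> (LINT t:{l..r}|lebesgue. g t * D t)"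
proof -
  obtain v where v: "\<And>k::nat. smooth (v k)" "(\<lambda>k. sobolev_norm 1 1 R (\<lambda>z. v k z - w z)) \<longlonglongrightarrow> 0"
    "(\<lambda>k. Lp_norm 1 {l..r} (\<lambda>t. v k (\<gamma> t) - g t)) \<longlonglongrightarrow> 0" and g: "g \<in> Lp 1 {l..r}"
    using tr unfolding has_trace_def by blast
  have ga: "g absolutely_integrable_on {l..r}" using g by (simp add: Lp_1)
  have cv: "continuous_on {l..r} (\<lambda>t. v k (\<gamma> t))" for k
    by (rule continuous_on_compose2[OF smooth_continuous_on[OF v(1), of UNIV] \<gamma>]) simp
  note S = smooth_minus_sobolev_norm[OF v(1) w Dw]
  show ?thesis
  proof (rule that[OF v(1)])
    show "(\<lambda>k. integral R (\<lambda>z. \<bar>v k z - w z\<bar>)) \<longlonglongrightarrow> 0"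
      by (rule Lim_null_comparison[OF always_eventually[OF allI] v(2)]) (unfold S, simp add: integral_nonneg_real)
    show "(\<lambda>k. integral R (\<lambda>z. \<bar>pdx UNIV (v k) z - wx z\<bar>)) \<longlonglongrightarrow> 0"
      by (rule Lim_null_comparison[OF always_eventually[OF allI] v(2)]) (unfold S, simp add: integral_nonneg_real)
    show "(\<lambda>k. integral R (\<lambda>z. \<bar>pdy UNIV (v k) z - wy z\<bar>)) \<longlonglongrightarrow> 0"
      by (rule Lim_null_comparison[OF always_eventually[OF allI] v(2)]) (unfold S, simp add: integral_nonneg_real)
    have "Lp_norm 1 {l..r} (\<lambda>t. v k (\<gamma> t) - g t) = integral {l..r} (\<lambda>t. \<bar>v k (\<gamma> t) - g t\<bar>)" for k
      by (rule Lp_norm_1[OF set_integral_diff(1)[OF absolutely_integrable_continuous_real[OF cv] ga]]) simp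
    then have "(\<lambda>k. integral {l..r} (\<lambda>t. \<bar>v k (\<gamma> t) - g t\<bar>)) \<longlonglongrightarrow> 0" using v(3) by simp
    then show "(\<lambda>k. integral {l..r} (\<lambda>t. v k (\<gamma> t) * D t)) \<longlonglongrightarrow> (LINT t:{l..r}|lebesgue. g t * D t)"
      if "continuous_on {l..r} D" for D
      by (rule functional_tendsto[OF lr that ga cv])
  qed
qed

lemma L1_subset_tendsto:
  fixes F :: "nat \<Rightarrow> real \<times> real \<Rightarrow> real"
  assumes F: "\<And>k. F k absolutely_integrable_on R" and f: "f absolutely_integrable_on R"
    and lim: "(\<lambda>k. integral R (\<lambda>z. \<bar>F k z - f z\<bar>)) \<longlonglongrightarrow> 0" and S: "S \<subseteq> CR" "S \<in> sets lebesgue"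
  shows "(\<lambda>k. integral S (F k)) \<longlonglongrightarrow> integral S f" "(\<lambda>k. integral S (\<lambda>z. \<bar>F k z\<bar>)) \<longlonglongrightarrow> integral S (\<lambda>z. \<bar>f z\<bar>)"
proof -
  have "(\<lambda>k. integral S (\<lambda>z. \<bar>F k z - f z\<bar>)) \<longlonglongrightarrow> 0"
    by (rule Lim_null_comparison[OF _ lim])
      (use integral_subset_le_R[OF set_integral_diff(1)[OF F f] S] in \<open>simp add: integral_nonneg_real\<close>)
  note L1_tendsto_integrals[OF absolutely_integrable_CR[OF F S] absolutely_integrable_CR[OF f S] this]
  then show "(\<lambda>k. integral S (F k)) \<longlonglongrightarrow> integral S f" "(\<lambda>k. integral S (\<lambda>z. \<bar>F k z\<bar>)) \<longlonglongrightarrow> integral S (\<lambda>z. \<bar>f z\<bar>)"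
    by blast+
qed

lemma trace_functional_horizontal:
  assumes w: "w absolutely_integrable_on R" "wx absolutely_integrable_on R" "wy absolutely_integrable_on R"
    and Dw: "has_weak_D w (1, 0) R wx" "has_weak_D w (0, 1) R wy"
    and J: "a \<le> a1" "a1 < b1" "b1 \<le> b" and K: "c \<le> c1" "c1 < d1" "d1 \<le> d" and y0: "y0 \<in> {c1..d1}"
    and M: "a \<le> a2" "a2 < b2" "b2 \<le> b" "c \<le> c2" "c2 < d2" "d2 \<le> d"
    and m: "(b2 - a2) * (d2 - c2) * m = integral (cbox (a2, c2) (b2, d2)) w"
    and tr: "has_trace w R (\<lambda>t. (t, y0)) {a1..b1} g"
    and D: "continuous_on {a1..b1} D" "integral {a1..b1} D = 1" "\<And>t. t \<in> {a1..b1} \<Longrightarrow> \<bar>D t\<bar> \<le> 8 / (b1 - a1)"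
  shows "\<bar>(LINT t:{a1..b1}|lebesgue. g t * D t) - m\<bar> \<le> 8 *
    (integral (cbox (a1, c1) (b1, d1)) (\<lambda>z. \<bar>wy z\<bar>) / (b1 - a1) + integral (cbox (a, c1) (b, d1)) (\<lambda>z. \<bar>wx z\<bar>) / (d1 - c1) +
     integral (cbox (a2, c) (b2, d)) (\<lambda>z. \<bar>wy z\<bar>) / (b2 - a2))"
proof -
  have "continuous_on {a1..b1} (\<lambda>t. (t, y0))" by (intro continuous_intros)
  note c = this
  obtain v where v: "\<And>k::nat. smooth (v k)"
    "(\<lambda>k. integral R (\<lambda>z. \<bar>v k z - w z\<bar>)) \<longlonglongrightarrow> 0"
    "(\<lambda>k. integral R (\<lambda>z. \<bar>pdx UNIV (v k) z - wx z\<bar>)) \<longlonglongrightarrow> 0"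
    "(\<lambda>k. integral R (\<lambda>z. \<bar>pdy UNIV (v k) z - wy z\<bar>)) \<longlonglongrightarrow> 0"
    "\<And>D. continuous_on {a1..b1} D \<Longrightarrow>
      (\<lambda>k. integral {a1..b1} (\<lambda>t. v k (t, y0) * D t)) \<longlonglongrightarrow> (LINT t:{a1..b1}|lebesgue. g t * D t)"
    by (rule has_trace_tendsto[OF tr J(2) c w Dw]) (rule that)
  have sub: "cbox (a1, c1) (b1, d1) \<subseteq> CR" "cbox (a, c1) (b, d1) \<subseteq> CR" "cbox (a2, c) (b2, d) \<subseteq> CR" "cbox (a2, c2) (b2, d2) \<subseteq> CR"
    using J K M by auto
  note ai = smooth_absolutely_integrable[OF v(1)] smooth_absolutely_integrable[OF smooth_pdx[OF v(1)]]
    smooth_absolutely_integrable[OF smooth_pdy[OF v(1)]]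
  \<comment> \<open>Every \<open>v k\<close> is compared with its own mean; these means converge to
    \<open>m\<close>.\<close>
  define \<mu> where "\<mu> k = integral (cbox (a2, c2) (b2, d2)) (v k) / ((b2 - a2) * (d2 - c2))" for k
  have \<mu>: "(b2 - a2) * (d2 - c2) * \<mu> k = integral (cbox (a2, c2) (b2, d2)) (v k)" for k
    using M by (simp add: \<mu>_def)
  have "\<mu> \<longlonglongrightarrow> integral (cbox (a2, c2) (b2, d2)) w / ((b2 - a2) * (d2 - c2))"
    unfolding \<mu>_def using M by (intro tendsto_divide tendsto_const L1_subset_tendsto(1)[OF ai(1) w(1) v(2) sub(4)]) simp_all
  then have \<mu>_lim: "\<mu> \<longlonglongrightarrow> m" using m[symmetric] M by simp
  let ?B = "\<lambda>p q. 8 * (integral (cbox (a1, c1) (b1, d1)) (\<lambda>z. \<bar>q z\<bar>) / (b1 - a1) + integral (cbox (a, c1) (b, d1)) (\<lambda>z. \<bar>p z\<bar>) / (d1 - c1) +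
     integral (cbox (a2, c) (b2, d)) (\<lambda>z. \<bar>q z\<bar>) / (b2 - a2))"
  have L1: "(\<lambda>k. integral (cbox (a1, c1) (b1, d1)) (\<lambda>z. \<bar>pdy UNIV (v k) z\<bar>)) \<longlonglongrightarrow> integral (cbox (a1, c1) (b1, d1)) (\<lambda>z. \<bar>wy z\<bar>)"
    by (rule L1_subset_tendsto(2)[OF ai(3) w(3) v(4) sub(1)]) simp
  have L2: "(\<lambda>k. integral (cbox (a, c1) (b, d1)) (\<lambda>z. \<bar>pdx UNIV (v k) z\<bar>)) \<longlonglongrightarrow> integral (cbox (a, c1) (b, d1)) (\<lambda>z. \<bar>wx z\<bar>)"
    by (rule L1_subset_tendsto(2)[OF ai(2) w(2) v(3) sub(2)]) simp
  have L3: "(\<lambda>k. integral (cbox (a2, c) (b2, d)) (\<lambda>z. \<bar>pdy UNIV (v k) z\<bar>)) \<longlonglongrightarrow> integral (cbox (a2, c) (b2, d)) (\<lambda>z. \<bar>wy z\<bar>)"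
    by (rule L1_subset_tendsto(2)[OF ai(3) w(3) v(4) sub(3)]) simp
  have nz: "b1 - a1 \<noteq> 0" "d1 - c1 \<noteq> 0" "b2 - a2 \<noteq> 0" using J K M by simp_all
  have bound: "\<bar>integral {a1..b1} (\<lambda>t. v k (t, y0) * D t) - \<mu> k\<bar> \<le> ?B (pdx UNIV (v k)) (pdy UNIV (v k))" for k
  proof -
    have cvk: "continuous_on {a1..b1} (\<lambda>t. v k (t, y0))"
      by (rule continuous_on_compose2[OF smooth_continuous_on[OF v(1), of UNIV]]) (auto intro!: continuous_intros)
    have "\<bar>integral {a1..b1} (\<lambda>t. v k (t, y0) * D t) - \<mu> k\<bar> \<le> 8 / (b1 - a1) * integral {a1..b1} (\<lambda>t. \<bar>v k (t, y0) - \<mu> k\<bar>)"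
      by (rule mean_functional_bound[OF D cvk])
    also have "\<dots> \<le> 8 / (b1 - a1) * ((b1 - a1) * (?B (pdx UNIV (v k)) (pdy UNIV (v k)) / 8))"
      unfolding nonzero_mult_div_cancel_left[OF zero_neq_numeral[symmetric]]
      by (rule mult_left_mono[OF edge_oscillation[OF smooth_has_px[OF v(1)] smooth_has_py[OF v(1)] J K y0 M \<mu>]]) (use J(2) K(2) in simp)
    also have "\<dots> = ?B (pdx UNIV (v k)) (pdy UNIV (v k))" using J(2) by simp
    finally show ?thesis .
  qed
  show ?thesis
    by (rule LIMSEQ_le[OF tendsto_rabs[OF tendsto_diff[OF v(5)[OF D(1)] \<mu>_lim]]
      tendsto_mult[OF tendsto_const tendsto_add[OF tendsto_add[OF tendsto_divide[OF L1 tendsto_const nz(1)] tendsto_divide[OF L2 tendsto_const nz(2)]] tendsto_divide[OF L3 tendsto_const nz(3)]]] exI[of _ 0]]) (use bound in blast)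
qed

lemma trace_functional_vertical:
  assumes w: "w absolutely_integrable_on R" "wx absolutely_integrable_on R" "wy absolutely_integrable_on R"
    and Dw: "has_weak_D w (1, 0) R wx" "has_weak_D w (0, 1) R wy"
    and J: "a \<le> a1" "a1 < b1" "b1 \<le> b" and K: "c \<le> c1" "c1 < d1" "d1 \<le> d" and x0: "x0 \<in> {a1..b1}"
    and M: "a \<le> a2" "a2 < b2" "b2 \<le> b" "c \<le> c2" "c2 < d2" "d2 \<le> d"
    and m: "(b2 - a2) * (d2 - c2) * m = integral (cbox (a2, c2) (b2, d2)) w"
    and tr: "has_trace w R (\<lambda>t. (x0, t)) {c1..d1} g"
    and D: "continuous_on {c1..d1} D" "integral {c1..d1} D = 1" "\<And>t. t \<in> {c1..d1} \<Longrightarrow> \<bar>D t\<bar> \<le> 8 / (d1 - c1)"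
  shows "\<bar>(LINT t:{c1..d1}|lebesgue. g t * D t) - m\<bar> \<le> 8 *
    (integral (cbox (a1, c1) (b1, d1)) (\<lambda>z. \<bar>wx z\<bar>) / (d1 - c1) + integral (cbox (a1, c) (b1, d)) (\<lambda>z. \<bar>wy z\<bar>) / (b1 - a1) +
     integral (cbox (a, c2) (b, d2)) (\<lambda>z. \<bar>wx z\<bar>) / (d2 - c2))"
proof -
  have "continuous_on {c1..d1} (\<lambda>t. (x0, t))" by (intro continuous_intros)
  note c = this
  obtain v where v: "\<And>k::nat. smooth (v k)"
    "(\<lambda>k. integral R (\<lambda>z. \<bar>v k z - w z\<bar>)) \<longlonglongrightarrow> 0"
    "(\<lambda>k. integral R (\<lambda>z. \<bar>pdx UNIV (v k) z - wx z\<bar>)) \<longlonglongrightarrow> 0"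
    "(\<lambda>k. integral R (\<lambda>z. \<bar>pdy UNIV (v k) z - wy z\<bar>)) \<longlonglongrightarrow> 0"
    "\<And>D. continuous_on {c1..d1} D \<Longrightarrow>
      (\<lambda>k. integral {c1..d1} (\<lambda>t. v k (x0, t) * D t)) \<longlonglongrightarrow> (LINT t:{c1..d1}|lebesgue. g t * D t)"
    by (rule has_trace_tendsto[OF tr K(2) c w Dw]) (rule that)
  have sub: "cbox (a1, c1) (b1, d1) \<subseteq> CR" "cbox (a1, c) (b1, d) \<subseteq> CR" "cbox (a, c2) (b, d2) \<subseteq> CR" "cbox (a2, c2) (b2, d2) \<subseteq> CR"
    using J K M by auto
  note ai = smooth_absolutely_integrable[OF v(1)] smooth_absolutely_integrable[OF smooth_pdx[OF v(1)]]
    smooth_absolutely_integrable[OF smooth_pdy[OF v(1)]]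
  define \<mu> where "\<mu> k = integral (cbox (a2, c2) (b2, d2)) (v k) / ((b2 - a2) * (d2 - c2))" for k
  have \<mu>: "(b2 - a2) * (d2 - c2) * \<mu> k = integral (cbox (a2, c2) (b2, d2)) (v k)" for k
    using M by (simp add: \<mu>_def)
  have "\<mu> \<longlonglongrightarrow> integral (cbox (a2, c2) (b2, d2)) w / ((b2 - a2) * (d2 - c2))"
    unfolding \<mu>_def using M by (intro tendsto_divide tendsto_const L1_subset_tendsto(1)[OF ai(1) w(1) v(2) sub(4)]) simp_all
  then have \<mu>_lim: "\<mu> \<longlonglongrightarrow> m" using m[symmetric] M by simp
  let ?B = "\<lambda>p q. 8 * (integral (cbox (a1, c1) (b1, d1)) (\<lambda>z. \<bar>p z\<bar>) / (d1 - c1) + integral (cbox (a1, c) (b1, d)) (\<lambda>z. \<bar>q z\<bar>) / (b1 - a1) +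
     integral (cbox (a, c2) (b, d2)) (\<lambda>z. \<bar>p z\<bar>) / (d2 - c2))"
  have L1: "(\<lambda>k. integral (cbox (a1, c1) (b1, d1)) (\<lambda>z. \<bar>pdx UNIV (v k) z\<bar>)) \<longlonglongrightarrow> integral (cbox (a1, c1) (b1, d1)) (\<lambda>z. \<bar>wx z\<bar>)"
    by (rule L1_subset_tendsto(2)[OF ai(2) w(2) v(3) sub(1)]) simp
  have L2: "(\<lambda>k. integral (cbox (a1, c) (b1, d)) (\<lambda>z. \<bar>pdy UNIV (v k) z\<bar>)) \<longlonglongrightarrow> integral (cbox (a1, c) (b1, d)) (\<lambda>z. \<bar>wy z\<bar>)"
    by (rule L1_subset_tendsto(2)[OF ai(3) w(3) v(4) sub(2)]) simp
  have L3: "(\<lambda>k. integral (cbox (a, c2) (b, d2)) (\<lambda>z. \<bar>pdx UNIV (v k) z\<bar>)) \<longlonglongrightarrow> integral (cbox (a, c2) (b, d2)) (\<lambda>z. \<bar>wx z\<bar>)"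
    by (rule L1_subset_tendsto(2)[OF ai(2) w(2) v(3) sub(3)]) simp
  have nz: "d1 - c1 \<noteq> 0" "b1 - a1 \<noteq> 0" "d2 - c2 \<noteq> 0" using J K M by simp_all
  have bound: "\<bar>integral {c1..d1} (\<lambda>t. v k (x0, t) * D t) - \<mu> k\<bar> \<le> ?B (pdx UNIV (v k)) (pdy UNIV (v k))" for k
  proof -
    have cvk: "continuous_on {c1..d1} (\<lambda>t. v k (x0, t))"
      by (rule continuous_on_compose2[OF smooth_continuous_on[OF v(1), of UNIV]]) (auto intro!: continuous_intros)
    have "\<bar>integral {c1..d1} (\<lambda>t. v k (x0, t) * D t) - \<mu> k\<bar> \<le> 8 / (d1 - c1) * integral {c1..d1} (\<lambda>t. \<bar>v k (x0, t) - \<mu> k\<bar>)"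
      by (rule mean_functional_bound[OF D cvk])
    also have "\<dots> \<le> 8 / (d1 - c1) * ((d1 - c1) * (?B (pdx UNIV (v k)) (pdy UNIV (v k)) / 8))"
      unfolding nonzero_mult_div_cancel_left[OF zero_neq_numeral[symmetric]]
      by (rule mult_left_mono[OF edge_oscillation_vertical[OF smooth_has_px[OF v(1)] smooth_has_py[OF v(1)] J K x0 M \<mu>]]) (use J(2) K(2) in simp)
    also have "\<dots> = ?B (pdx UNIV (v k)) (pdy UNIV (v k))" using K(2) by simp
    finally show ?thesis .
  qed
  show ?thesis
    by (rule LIMSEQ_le[OF tendsto_rabs[OF tendsto_diff[OF v(5)[OF D(1)] \<mu>_lim]]
      tendsto_mult[OF tendsto_const tendsto_add[OF tendsto_add[OF tendsto_divide[OF L1 tendsto_const nz(1)] tendsto_divide[OF L2 tendsto_const nz(2)]] tendsto_divide[OF L3 tendsto_const nz(3)]]] exI[of _ 0]]) (use bound in blast)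
qed

end

section \<open>Existence of traces\<close>

lemma integrable_lborel_absolutely_integrable:
  fixes f :: "'a::euclidean_space \<Rightarrow> real"
  assumes "integrable lborel f" "S \<in> sets lebesgue"
  shows "f absolutely_integrable_on S"
proof -
  have "integrable lebesgue f" using assms(1) by (simp add: integrable_completion)
  then show ?thesis
    unfolding set_integrable_def using assms(2) by (intro integrable_mult_indicator)
qed

text \<open>The trace is the marginal of \<open>f\<close> divided by \<open>h\<close>: the marginals
  of \<open>F k\<close> converge in L1 and are \<open>h\<close> times the edge values
  \<open>p k\<close>. Equality on the open interval suffices, the end points being a null
  set.\<close>

lemma ex_L1_trace:
  fixes F :: "nat \<Rightarrow> real \<times> real \<Rightarrow> real"
  assumes F: "\<And>k. integrable lborel (F k)" and f: "integrable lborel f"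
    and lim: "(\<lambda>k. \<integral>z. \<bar>F k z - f z\<bar> \<partial>lborel) \<longlonglongrightarrow> 0" and lr: "l < r" and "h > 0"
    and p: "\<And>k. continuous_on {l..r} (p k)" "\<And>k x. x \<in> {l<..<r} \<Longrightarrow> (\<integral>t. F k (x, t) \<partial>lborel) = h * p k x"
  obtains g where "g \<in> Lp 1 {l..r}" "(\<lambda>k. Lp_norm 1 {l..r} (\<lambda>t. p k t - g t)) \<longlonglongrightarrow> 0"
proof -
  let ?f = "\<lambda>x. \<integral>t. f (x, t) \<partial>lborel" and ?F = "\<lambda>k x. \<integral>t. F k (x, t) \<partial>lborel"
  note M = L1_marginal[OF F f lim]
  define g where "g x = ?f x / h" for x
  have ga: "g absolutely_integrable_on {l..r}"
    unfolding g_def by (rule integrable_lborel_absolutely_integrable[OF integrable_divide_zero[OF M(1)]]) simp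
  have d: "integrable lborel (\<lambda>x. \<bar>?F k x - ?f x\<bar>)" for k
    by (intro integrable_abs Bochner_Integration.integrable_diff M(1,2))
  have bound: "norm (Lp_norm 1 {l..r} (\<lambda>t. p k t - g t)) \<le> 1 / h * (\<integral>x. \<bar>?F k x - ?f x\<bar> \<partial>lborel)" for k
  proof -
    have "Lp_norm 1 {l..r} (\<lambda>t. p k t - g t) = integral {l..r} (\<lambda>t. \<bar>p k t - g t\<bar>)"
      by (rule Lp_norm_1[OF set_integral_diff(1)[OF absolutely_integrable_continuous_real[OF p(1)] ga]]) simp
    also have "\<dots> = integral {l<..<r} (\<lambda>t. \<bar>p k t - g t\<bar>)"
      by (simp add: integral_open_interval_real)
    also have "\<dots> = integral {l<..<r} (\<lambda>t. 1 / h * \<bar>?F k t - ?f t\<bar>)"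
    proof (rule Henstock_Kurzweil_Integration.integral_cong)
      fix x assume "x \<in> {l<..<r}"
      then have "?F k x - ?f x = h * (p k x - g x)" using p(2) \<open>h > 0\<close> by (simp add: g_def right_diff_distrib)
      then show "\<bar>p k x - g x\<bar> = 1 / h * \<bar>?F k x - ?f x\<bar>" using \<open>h > 0\<close> by (simp add: abs_mult)
    qed
    also have "\<dots> = 1 / h * integral {l<..<r} (\<lambda>t. \<bar>?F k t - ?f t\<bar>)" by simp
    also have "integral {l<..<r} (\<lambda>t. \<bar>?F k t - ?f t\<bar>) \<le> integral UNIV (\<lambda>t. \<bar>?F k t - ?f t\<bar>)"
      by (intro integral_subset_le set_lebesgue_integral_eq_integral(1)[OF integrable_lborel_absolutely_integrable[OF d]]) simp_all
    also have "integral UNIV (\<lambda>t. \<bar>?F k t - ?f t\<bar>) = (\<integral>x. \<bar>?F k x - ?f x\<bar> \<partial>lborel)"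
      by (rule integral_unique[OF has_integral_integral_lborel[OF d]])
    finally have "Lp_norm 1 {l..r} (\<lambda>t. p k t - g t) \<le> 1 / h * (\<integral>x. \<bar>?F k x - ?f x\<bar> \<partial>lborel)"
      using \<open>h > 0\<close> by (simp add: divide_right_mono)
    moreover have "0 \<le> Lp_norm 1 {l..r} (\<lambda>t. p k t - g t)" by (simp add: Lp_norm_def)
    ultimately show ?thesis by simp
  qed
  show ?thesis
  proof (rule that[of g])
    show "g \<in> Lp 1 {l..r}" using ga by (simp add: Lp_1)
    show "(\<lambda>k. Lp_norm 1 {l..r} (\<lambda>t. p k t - g t)) \<longlonglongrightarrow> 0"
      by (rule Lim_null_comparison[OF always_eventually[OF allI[OF bound]]])
        (rule tendsto_mult_right_zero[OF M(3)])
  qed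
qed

text \<open>The integrand is the derivative of (t - e) p t, where e = l + r - s is the end opposite
  to \<open>s\<close>; the weight kills the boundary term at e.\<close>

lemma weighted_integral_by_parts:
  fixes p :: "real \<Rightarrow> real"
  assumes p: "\<And>t. t \<in> {l..r} \<Longrightarrow> (p has_real_derivative p' t) (at t within {l..r})" and lr: "l < r"
    and s: "s \<in> {l, r}" and c: "continuous_on {l..r} p'"
  shows "(\<integral>t. indicator {l<..<r} t * (p t + (t - (l + r - s)) * p' t) \<partial>lborel) = (r - l) * p s"
proof -
  let ?e = "l + r - s"
  have cp: "continuous_on {l..r} p" using p by (rule DERIV_continuous_on)
  have "((\<lambda>t. p t + (t - ?e) * p' t) has_integral (r - ?e) * p r - (l - ?e) * p l) {l..r}"
  proof (rule fundamental_theorem_of_calculus)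
    fix t assume "t \<in> {l..r}"
    from DERIV_mult[OF DERIV_diff[OF DERIV_ident DERIV_const] p[OF this], of ?e]
    show "((\<lambda>t. (t - ?e) * p t) has_vector_derivative p t + (t - ?e) * p' t) (at t within {l..r})"
      by (simp add: has_real_derivative_iff_has_vector_derivative[symmetric] mult.commute[of "p' t"])
  qed (use lr in simp)
  moreover have "(r - ?e) * p r - (l - ?e) * p l = (r - l) * p s" using s by (auto simp: algebra_simps)
  ultimately have "integral {l..r} (\<lambda>t. p t + (t - ?e) * p' t) = (r - l) * p s" by (simp add: integral_unique)
  moreover have "set_integrable lborel {l..r} (\<lambda>t. p t + (t - ?e) * p' t)"
    by (rule borel_integrable_atLeastAtMost') (intro continuous_intros cp c)
  then have "set_integrable lborel {l<..<r} (\<lambda>t. p t + (t - ?e) * p' t)"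
    by (rule set_integrable_subset) auto
  from set_borel_integral_eq_integral(2)[OF this]
  have "(\<integral>t. indicator {l<..<r} t * (p t + (t - ?e) * p' t) \<partial>lborel) = integral {l<..<r} (\<lambda>t. p t + (t - ?e) * p' t)"
    by (simp add: set_lebesgue_integral_def)
  ultimately show ?thesis by (simp add: integral_open_interval_real)
qed

context rect
begin

text \<open>
  For smooth \<open>v\<close> the weighted integral of \<open>v + \<theta> v\<^sub>d\<close> over a strip adjacent to the edge, with \<open>v\<^sub>d\<close> the
  normal derivative and \<open>\<theta>\<close> vanishing on the side opposite to the edge, recovers the values on the
  edge. The right-hand side makes sense for Sobolev functions.
\<close>

lemma strip_tendsto:
  assumes w: "w absolutely_integrable_on R" and g: "g absolutely_integrable_on R"
    and Q: "box (a1, c1) (b1, d1) \<subseteq> R" and w0: "version w w0" and g0: "version g g0"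
    and v: "\<And>k. continuous_on UNIV (v k)" "\<And>k. continuous_on UNIV (dv k)"
    and lim: "(\<lambda>k. integral R (\<lambda>z. \<bar>v k z - w z\<bar>)) \<longlonglongrightarrow> 0" "(\<lambda>k. integral R (\<lambda>z. \<bar>dv k z - g z\<bar>)) \<longlonglongrightarrow> 0"
    and \<theta>: "continuous_on UNIV \<theta>" "\<forall>z\<in>box (a1, c1) (b1, d1). \<bar>\<theta> z\<bar> \<le> B"
  defines "F \<equiv> \<lambda>p q z. indicator (box (a1, c1) (b1, d1)) z * (p z + \<theta> z * q z)"
  shows "\<And>k. integrable lborel (F (v k) (dv k))" "integrable lborel (F w0 g0)"
    "(\<lambda>k. \<integral>z. \<bar>F (v k) (dv k) z - F w0 g0 z\<bar> \<partial>lborel) \<longlonglongrightarrow> 0"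
proof -
  let ?Q = "box (a1, c1) (b1, d1)"
  have [measurable]: "\<theta> \<in> borel_measurable borel" using \<theta>(1) by (rule borel_measurable_continuous_onI)
  have Fint: "integrable lborel (\<lambda>z. indicator ?Q z * (p z + \<theta> z * q z))" if "integrable lborel p" "integrable lborel q" for p q
  proof -
    have "integrable lborel (\<lambda>z. p z * indicator ?Q z)"
      by (rule integrable_mult_bounded[OF that(1), where B=1]) (simp_all add: indicator_def)
    moreover have "integrable lborel (\<lambda>z. q z * (indicator ?Q z * \<theta> z))"
    proof (rule integrable_mult_bounded[OF that(2), where B="\<bar>B\<bar>"])
      show "\<bar>indicator ?Q z * \<theta> z\<bar> \<le> \<bar>B\<bar>" for z
        using bspec[OF \<theta>(2), of z] by (cases "z \<in> ?Q") simp_all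
    qed measurable
    ultimately have "integrable lborel (\<lambda>z. p z * indicator ?Q z + q z * (indicator ?Q z * \<theta> z))"
      by (rule Bochner_Integration.integrable_add)
    then show ?thesis by (simp add: algebra_simps)
  qed
  show i2: "integrable lborel (F w0 g0)"
    unfolding F_def using w0 g0 by (intro Fint) (simp_all add: version_def)
  \<comment> \<open>\<open>F\<close> looks only at values inside the small rectangle, so continuous
    functions, which need not be integrable over the plane, may first be cut off to the closed
    rectangle.\<close>
  have ind: "F (\<lambda>z. indicator CR z * p z) (\<lambda>z. indicator CR z * q z) = F p q" for p q
  proof
    show "F (\<lambda>z. indicator CR z * p z) (\<lambda>z. indicator CR z * q z) z = F p q z" for z
    proof (cases "z \<in> ?Q")
      case True
      then have "z \<in> CR" using Q R_subset_CR by blast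
      then show ?thesis unfolding F_def by (simp only: indicator_simps mult_1)
    qed (simp add: F_def)
  qed
  have cint: "integrable lborel (\<lambda>z. indicator CR z * p z)" if "continuous_on UNIV p" for p :: "real \<times> real \<Rightarrow> real"
    using borel_integrable_compact[OF compact_cbox continuous_on_subset[OF that subset_UNIV], of "(a, c)" "(b, d)"] by simp
  show i1: "integrable lborel (F (v k) (dv k))" for k
  proof -
    have "integrable lborel (F (\<lambda>z. indicator CR z * v k z) (\<lambda>z. indicator CR z * dv k z))"
      unfolding F_def by (intro Fint cint v)
    then show ?thesis unfolding ind .
  qed
  have va: "v k absolutely_integrable_on R" "dv k absolutely_integrable_on R" for k
    using continuous_absolutely_integrable(1) continuous_on_subset[OF v(1) subset_UNIV] continuous_on_subset[OF v(2) subset_UNIV] by blast+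
  have wa: "w0 absolutely_integrable_on R" "g0 absolutely_integrable_on R"
    using w0 g0 by (simp_all add: version_def integrable_lborel_absolutely_integrable)
  have eq: "integral R (\<lambda>z. \<bar>p z - u0 z\<bar>) = integral R (\<lambda>z. \<bar>p z - u z\<bar>)" if "version u u0" for p u u0
  proof (rule integral_cong_AE_on)
    have "AE z in lebesgue. z \<in> R \<longrightarrow> u z = u0 z" using that by (simp add: version_def)
    then show "AE z in lebesgue. z \<in> R \<longrightarrow> \<bar>p z - u0 z\<bar> = \<bar>p z - u z\<bar>" by (rule eventually_mono) simp
  qed
  have bound: "norm (\<integral>z. \<bar>F (v k) (dv k) z - F w0 g0 z\<bar> \<partial>lborel) \<le>
    integral R (\<lambda>z. \<bar>v k z - w z\<bar>) + \<bar>B\<bar> * integral R (\<lambda>z. \<bar>dv k z - g z\<bar>)" for k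
  proof -
    let ?H = "\<lambda>z. \<bar>v k z - w0 z\<bar> + \<bar>B\<bar> * \<bar>dv k z - g0 z\<bar>"
    have d: "integrable lborel (\<lambda>z. \<bar>F (v k) (dv k) z - F w0 g0 z\<bar>)"
      by (intro integrable_abs Bochner_Integration.integrable_diff i1 i2)
    note ai1 = absolutely_integrable_abs[OF set_integral_diff(1)[OF va(1) wa(1)], of k]
    note ai2 = absolutely_integrable_abs[OF set_integral_diff(1)[OF va(2) wa(2)], of k]
    note h1 = set_lebesgue_integral_eq_integral(1)[OF ai1]
    note h2 = set_lebesgue_integral_eq_integral(1)[OF ai2]
    have "(\<integral>z. \<bar>F (v k) (dv k) z - F w0 g0 z\<bar> \<partial>lborel) = integral UNIV (\<lambda>z. \<bar>F (v k) (dv k) z - F w0 g0 z\<bar>)"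
      by (rule integral_unique[OF has_integral_integral_lborel[OF d], symmetric])
    also have "\<dots> = integral UNIV (\<lambda>z. if z \<in> R then \<bar>F (v k) (dv k) z - F w0 g0 z\<bar> else 0)"
    proof (rule Henstock_Kurzweil_Integration.integral_cong)
      show "\<bar>F (v k) (dv k) z - F w0 g0 z\<bar> = (if z \<in> R then \<bar>F (v k) (dv k) z - F w0 g0 z\<bar> else 0)" for z
      proof (cases "z \<in> R")
        case False
        then have "z \<notin> ?Q" using Q by blast
        then show ?thesis using False by (simp add: F_def)
      qed simp
    qed
    also have "\<dots> = integral R (\<lambda>z. \<bar>F (v k) (dv k) z - F w0 g0 z\<bar>)" by (rule integral_restrict_UNIV)
    also have "\<dots> \<le> integral R ?H"
    proof (rule integral_le)
      show "(\<lambda>z. \<bar>F (v k) (dv k) z - F w0 g0 z\<bar>) integrable_on R"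
        by (rule set_lebesgue_integral_eq_integral(1)[OF integrable_lborel_absolutely_integrable[OF d]]) simp
      show "?H integrable_on R" by (intro integrable_add integrable_on_mult_right h1 h2)
      show "\<bar>F (v k) (dv k) z - F w0 g0 z\<bar> \<le> ?H z" for z
      proof (cases "z \<in> ?Q")
        case True
        have "F (v k) (dv k) z - F w0 g0 z = (v k z - w0 z) + \<theta> z * (dv k z - g0 z)"
          using True by (simp add: F_def algebra_simps)
        also have "\<bar>\<dots>\<bar> \<le> \<bar>v k z - w0 z\<bar> + \<bar>\<theta> z * (dv k z - g0 z)\<bar>" by (rule abs_triangle_ineq)
        also have "\<dots> \<le> ?H z"
          unfolding abs_mult using bspec[OF \<theta>(2) True] by (intro add_left_mono mult_right_mono) simp_all
        finally show ?thesis .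
      qed (simp add: F_def)
    qed
    also have "\<dots> = integral R (\<lambda>z. \<bar>v k z - w0 z\<bar>) + \<bar>B\<bar> * integral R (\<lambda>z. \<bar>dv k z - g0 z\<bar>)"
      by (subst Henstock_Kurzweil_Integration.integral_add[OF h1 integrable_on_mult_right[OF h2]]) simp
    finally show ?thesis unfolding eq[OF w0] eq[OF g0] by simp
  qed
  have "(\<lambda>k. integral R (\<lambda>z. \<bar>v k z - w z\<bar>) + \<bar>B\<bar> * integral R (\<lambda>z. \<bar>dv k z - g z\<bar>)) \<longlonglongrightarrow> 0 + \<bar>B\<bar> * 0"
    by (intro tendsto_add tendsto_mult tendsto_const lim)
  then have "(\<lambda>k. integral R (\<lambda>z. \<bar>v k z - w z\<bar>) + \<bar>B\<bar> * integral R (\<lambda>z. \<bar>dv k z - g z\<bar>)) \<longlonglongrightarrow> 0" by simp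
  then show "(\<lambda>k. \<integral>z. \<bar>F (v k) (dv k) z - F w0 g0 z\<bar> \<partial>lborel) \<longlonglongrightarrow> 0"
    by (rule Lim_null_comparison[OF always_eventually[OF allI[OF bound]]])
qed

text \<open>\<open>edge_trace\<close> is a choice and has the trace property only once some trace is
  known to exist. The edge is a side of a sub-rectangle, which serves as the strip.\<close>

lemma ex_trace:
  assumes w: "w absolutely_integrable_on R" "wx absolutely_integrable_on R" "wy absolutely_integrable_on R"
    and Dw: "has_weak_D w (1, 0) R wx" "has_weak_D w (0, 1) R wy"
    and J: "a \<le> a1" "a1 < b1" "b1 \<le> b" and K: "c \<le> c1" "c1 < d1" "d1 \<le> d"
  shows "y0 \<in> {c1, d1} \<Longrightarrow> \<exists>g. has_trace w R (\<lambda>t. (t, y0)) {a1..b1} g"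
    and "x0 \<in> {a1, b1} \<Longrightarrow> \<exists>g. has_trace w R (\<lambda>t. (x0, t)) {c1..d1} g"
proof -
  obtain w0 where w0: "version w w0" using ex_version[OF w(1)] by blast
  obtain wx0 where wx0: "version wx wx0" using ex_version[OF w(2)] by blast
  obtain wy0 where wy0: "version wy wy0" using ex_version[OF w(3)] by blast
  define v where "v k = approx k w0" for k
  have sv: "smooth (v k)" for k unfolding v_def by (rule smooth_approx[OF version_integrable[OF w0]])
  note lim = approx_sobolev_tendsto[OF w Dw w0, folded v_def]
  have Q: "box (a1, c1) (b1, d1) \<subseteq> R" using J K by (auto simp: subset_iff mem_box Basis_prod_def)
  have inQ: "(x, t) \<in> box (a1, c1) (b1, d1) \<longleftrightarrow> x \<in> {a1<..<b1} \<and> t \<in> {c1<..<d1}" for x t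
    by (auto simp: mem_box Basis_prod_def)
  have S: "sobolev_norm 1 1 R (\<lambda>z. v k z - w z) = integral R (\<lambda>z. \<bar>v k z - w z\<bar>) +
     integral R (\<lambda>z. \<bar>pdx UNIV (v k) z - wx z\<bar>) + integral R (\<lambda>z. \<bar>pdy UNIV (v k) z - wy z\<bar>)" for k
    by (rule smooth_minus_sobolev_norm[OF sv w Dw])
  have Slim: "(\<lambda>k. sobolev_norm 1 1 R (\<lambda>z. v k z - w z)) \<longlonglongrightarrow> 0"
    unfolding S using tendsto_add[OF tendsto_add[OF lim(1,2)] lim(3)] by simp
  have sob: "v k \<in> sobolev 1 1 R" for k
    by (rule sobolev_norm_1_1(1)[OF smooth_absolutely_integrable[OF sv] smooth_absolutely_integrable[OF smooth_pdx[OF sv]]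
          smooth_absolutely_integrable[OF smooth_pdy[OF sv]] smooth_has_weak_D[OF sv]])
  have tr: "has_trace w R \<gamma> I g" if "g \<in> Lp 1 I" "(\<lambda>k. Lp_norm 1 I (\<lambda>t. v k (\<gamma> t) - g t)) \<longlonglongrightarrow> 0" for \<gamma> I g
    unfolding has_trace_def using sobolev_norm_1_1(1)[OF w Dw] that sv sob Slim by blast
  have cv: "continuous_on UNIV (v k)" "continuous_on UNIV (pdx UNIV (v k))" "continuous_on UNIV (pdy UNIV (v k))" for k
    using smooth_continuous_on sv smooth_pdx smooth_pdy by blast+
  show "\<exists>g. has_trace w R (\<lambda>t. (t, y0)) {a1..b1} g" if y0: "y0 \<in> {c1, d1}"
  proof -
    \<comment> \<open>Vanishes on the side opposite to the edge, since c1 + d1 - y0 is the other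
      end.\<close>
    let ?\<theta> = "\<lambda>z::real \<times> real. snd z - (c1 + d1 - y0)"
    have \<theta>: "\<forall>z\<in>box (a1, c1) (b1, d1). \<bar>?\<theta> z\<bar> \<le> d1 - c1"
    proof
      show "\<bar>?\<theta> z\<bar> \<le> d1 - c1" if "z \<in> box (a1, c1) (b1, d1)" for z
        using that y0 inQ[of "fst z" "snd z"] by auto
    qed
    have c\<theta>: "continuous_on UNIV ?\<theta>" by (intro continuous_intros)
    note T = strip_tendsto[OF w(1,3) Q w0 wy0 cv(1,3) lim(1,3) c\<theta> \<theta>]
    obtain g where "g \<in> Lp 1 {a1..b1}" "(\<lambda>k. Lp_norm 1 {a1..b1} (\<lambda>t. v k (t, y0) - g t)) \<longlonglongrightarrow> 0"
    proof (rule ex_L1_trace[OF T J(2), of "d1 - c1" "\<lambda>k t. v k (t, y0)"])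
      show "continuous_on {a1..b1} (\<lambda>t. v k (t, y0))" for k
        by (rule continuous_on_compose2[OF cv(1)]) (auto intro!: continuous_intros)
      fix k x assume x: "x \<in> {a1<..<b1}"
      have "indicator (box (a1, c1) (b1, d1)) (x, t) = (indicator {c1<..<d1} t :: real)" for t
        using x inQ by (simp add: indicator_def)
      moreover have "continuous_on {c1..d1} (\<lambda>t. pdy UNIV (v k) (x, t))"
        by (rule continuous_on_compose2[OF cv(3)]) (auto intro!: continuous_intros)
      ultimately show "(\<integral>t. indicator (box (a1, c1) (b1, d1)) (x, t) * (v k (x, t) + ?\<theta> (x, t) * pdy UNIV (v k) (x, t)) \<partial>lborel) = (d1 - c1) * v k (x, y0)"
        using weighted_integral_by_parts[OF smooth_DERIV_snd[OF sv, of k x] K(2) y0] by simp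
    qed (use K in simp_all)
    then have "has_trace w R (\<lambda>t. (t, y0)) {a1..b1} g" by (rule tr)
    then show ?thesis by (intro exI)
  qed
  show "\<exists>g. has_trace w R (\<lambda>t. (x0, t)) {c1..d1} g" if x0: "x0 \<in> {a1, b1}"
  proof -
    let ?\<theta> = "\<lambda>z::real \<times> real. fst z - (a1 + b1 - x0)"
    have \<theta>: "\<forall>z\<in>box (a1, c1) (b1, d1). \<bar>?\<theta> z\<bar> \<le> b1 - a1"
    proof
      show "\<bar>?\<theta> z\<bar> \<le> b1 - a1" if "z \<in> box (a1, c1) (b1, d1)" for z
        using that x0 inQ[of "fst z" "snd z"] by auto
    qed
    have c\<theta>: "continuous_on UNIV ?\<theta>" by (intro continuous_intros)
    note T = strip_tendsto[OF w(1,2) Q w0 wx0 cv(1,2) lim(1,2) c\<theta> \<theta>]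
    \<comment> \<open>The marginal lemma integrates out the second variable, so vertical edges are
      treated after an exchange of coordinates.\<close>
    have swi: "integrable lborel (\<lambda>z. f (prod.swap z))" if "integrable lborel f" for f :: "real \<times> real \<Rightarrow> real"
      using lborel_pair.integrable_product_swap[of f] that by (simp add: lborel_prod case_prod_unfold prod.swap_def)
    have swe: "(\<integral>z. f (prod.swap z) \<partial>lborel) = (\<integral>z. f z \<partial>lborel)" if "integrable lborel f" for f :: "real \<times> real \<Rightarrow> real"
      using lborel_pair.integral_product_swap[of f] that borel_measurable_integrable[OF that] by (simp add: lborel_prod case_prod_unfold prod.swap_def)
    have T3: "(\<lambda>k. \<integral>z. \<bar>indicator (box (a1, c1) (b1, d1)) (prod.swap z) * (v k (prod.swap z) + ?\<theta> (prod.swap z) * pdx UNIV (v k) (prod.swap z)) -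
       indicator (box (a1, c1) (b1, d1)) (prod.swap z) * (w0 (prod.swap z) + ?\<theta> (prod.swap z) * wx0 (prod.swap z))\<bar> \<partial>lborel) \<longlonglongrightarrow> 0"
      using T(3) unfolding swe[OF integrable_abs[OF Bochner_Integration.integrable_diff[OF T(1,2)]]] .
    obtain g where "g \<in> Lp 1 {c1..d1}" "(\<lambda>k. Lp_norm 1 {c1..d1} (\<lambda>t. v k (x0, t) - g t)) \<longlonglongrightarrow> 0"
    proof (rule ex_L1_trace[OF swi[OF T(1)] swi[OF T(2)] T3 K(2), of "b1 - a1" "\<lambda>k t. v k (x0, t)"])
      show "continuous_on {c1..d1} (\<lambda>t. v k (x0, t))" for k
        by (rule continuous_on_compose2[OF cv(1)]) (auto intro!: continuous_intros)
      fix k y assume y: "y \<in> {c1<..<d1}"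
      have "indicator (box (a1, c1) (b1, d1)) (prod.swap (y, t)) = (indicator {a1<..<b1} t :: real)" for t
        using y inQ by (simp add: indicator_def)
      moreover have "continuous_on {a1..b1} (\<lambda>t. pdx UNIV (v k) (t, y))"
        by (rule continuous_on_compose2[OF cv(2)]) (auto intro!: continuous_intros)
      ultimately show "(\<integral>t. indicator (box (a1, c1) (b1, d1)) (prod.swap (y, t)) *
        (v k (prod.swap (y, t)) + ?\<theta> (prod.swap (y, t)) * pdx UNIV (v k) (prod.swap (y, t))) \<partial>lborel) = (b1 - a1) * v k (x0, y)"
        using weighted_integral_by_parts[OF smooth_DERIV_fst[OF sv, of k y] J(2) x0] by simp
    qed (use J in simp_all)
    then have "has_trace w R (\<lambda>t. (x0, t)) {c1..d1} g" by (rule tr)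
    then show ?thesis by (intro exI)
  qed
qed

end

subsection \<open>Lebesgue norms on rectangles\<close>

lemma AE_lebesgue_on:
  assumes "S \<in> sets lebesgue"
  shows "(AE z in lebesgue_on S. P z) \<longleftrightarrow> (AE z in lebesgue. z \<in> S \<longrightarrow> P z)"
  using assms by (intro AE_restrict_space_iff) simp

text \<open>\<open>weak_D\<close> returns an arbitrary representative; this allows membership and
  norm to be computed from any known weak derivative.\<close>

lemma Lp_cong_AE:
  fixes f g :: "'a::euclidean_space \<Rightarrow> real"
  assumes f: "f \<in> Lp p S" and ae: "AE z in lebesgue. z \<in> S \<longrightarrow> f z = g z" and S: "S \<in> sets lebesgue"
  shows "g \<in> Lp p S" and "Lp_norm p S g = Lp_norm p S f"
proof -
  have fm: "f \<in> borel_measurable (lebesgue_on S)" using f by (simp add: Lp_def)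
  have "(\<lambda>z. if z \<in> S then f z else 0) \<in> borel_measurable lebesgue"
    using borel_measurable_if[OF S] fm by blast
  then have "(\<lambda>z. if z \<in> S then g z else 0) \<in> borel_measurable lebesgue"
    by (rule borel_measurable_AE) (rule eventually_mono[OF ae], simp)
  then have gm: "g \<in> borel_measurable (lebesgue_on S)" using borel_measurable_if[OF S] by blast
  have ae': "AE z in lebesgue_on S. f z = g z" using ae AE_lebesgue_on[OF S] by blast
  have E: "esssup (lebesgue_on S) (\<lambda>z. ereal \<bar>f z\<bar>) = esssup (lebesgue_on S) (\<lambda>z. ereal \<bar>g z\<bar>)"
  proof (rule esssup_AE_cong)
    show "AE z in lebesgue_on S. ereal \<bar>f z\<bar> = ereal \<bar>g z\<bar>" using ae' by (rule eventually_mono) simp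
  qed (use fm gm in measurable)
  have a: "AE z in lebesgue_on S. \<bar>f z\<bar> powr real_of_ereal p = \<bar>g z\<bar> powr real_of_ereal p"
    using ae' by (rule eventually_mono) simp
  have m: "(\<lambda>z. \<bar>f z\<bar> powr real_of_ereal p) \<in> borel_measurable (lebesgue_on S)"
    "(\<lambda>z. \<bar>g z\<bar> powr real_of_ereal p) \<in> borel_measurable (lebesgue_on S)"
    using fm gm by measurable
  show "g \<in> Lp p S"
    using f gm E integrable_cong_AE[OF m a] unfolding Lp_def by (simp split: if_splits)
  show "Lp_norm p S g = Lp_norm p S f"
    unfolding Lp_norm_def E integral_cong_AE[OF m a] ..
qed

text \<open>1 / p is 0 for infinite p, so powers with exponent \<open>real_of_ereal (1 / p)\<close>
  cover both cases in one formula.\<close>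

lemma exponent_cases:
  fixes p :: ereal
  assumes "1 \<le> p"
  obtains (infinite) "p = \<infinity>" "real_of_ereal (1 / p) = 0"
    | (finite) r where "p = ereal r" "1 \<le> r" "real_of_ereal p = r" "real_of_ereal (1 / p) = 1 / r"
proof (cases p)
  case (real r)
  then have "1 \<le> r" using assms by (simp add: one_ereal_def)
  then show ?thesis using finite[of r] real by (simp add: one_ereal_def)
next
  case PInf
  then show ?thesis using infinite by simp
next
  case MInf
  then show ?thesis using assms by simp
qed

text \<open>The estimates add up individual derivatives while seminorms combine them in the p-norm;
  for two nonnegative entries the p-norm lies between the maximum and the sum.\<close>

lemma lp_combine_bounds:
  fixes r :: "'i \<Rightarrow> real"
  assumes p: "1 \<le> p" and "i \<noteq> j" and r: "0 \<le> r i" "0 \<le> r j"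
  shows "r i \<le> lp_combine p {i, j} r" "r j \<le> lp_combine p {i, j} r" "lp_combine p {i, j} r \<le> r i + r j"
proof -
  have "r i \<le> lp_combine p {i, j} r \<and> r j \<le> lp_combine p {i, j} r \<and> lp_combine p {i, j} r \<le> r i + r j"
    using p
  proof (cases rule: exponent_cases)
    case infinite
    then show ?thesis using r by (simp add: lp_combine_def)
  next
    case (finite q)
    let ?s = "r i powr q + r j powr q"
    have e: "lp_combine p {i, j} r = ?s powr (1 / q)"
      using finite \<open>i \<noteq> j\<close> by (simp add: lp_combine_def)
    have root: "t = (t powr q) powr (1 / q)" if "0 \<le> t" for t
      using that finite(2) by (simp add: powr_powr)
    have 1: "t \<le> ?s powr (1 / q)" if "0 \<le> t" "t powr q \<le> ?s" for t
      using powr_mono2[OF _ _ that(2), of "1 / q"] root[OF that(1)] finite(2) by simp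
    \<comment> \<open>Write t^q = t t^(q - 1) and enlarge the second base to the sum; adding over
      both entries gives (r i + r j)^q.\<close>
    have part: "t powr q \<le> t * (r i + r j) powr (q - 1)" if "0 \<le> t" "t \<le> r i + r j" for t
    proof (cases "t = 0")
      case False
      have "t powr q = t powr 1 * t powr (q - 1)" using powr_add[of t 1 "q - 1"] by simp
      also have "\<dots> \<le> t * (r i + r j) powr (q - 1)"
        using False that finite(2) by (simp add: mult_left_mono powr_mono2)
      finally show ?thesis .
    qed simp
    have "?s \<le> r i * (r i + r j) powr (q - 1) + r j * (r i + r j) powr (q - 1)"
      by (intro add_mono part) (use r in simp_all)
    also have "\<dots> = (r i + r j) powr 1 * (r i + r j) powr (q - 1)" using r by (simp add: distrib_right)
    also have "\<dots> = (r i + r j) powr q"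
      using powr_add[of "r i + r j" 1 "q - 1"] by simp
    finally have "?s powr (1 / q) \<le> ((r i + r j) powr q) powr (1 / q)"
      using finite(2) by (intro powr_mono2) simp_all
    then have "?s powr (1 / q) \<le> r i + r j" using root[of "r i + r j"] r by simp
    then show ?thesis using 1[OF r(1)] 1[OF r(2)] unfolding e by simp
  qed
  then show "r i \<le> lp_combine p {i, j} r" "r j \<le> lp_combine p {i, j} r" "lp_combine p {i, j} r \<le> r i + r j" by blast+
qed

lemma content_cbox_real_pair:
  fixes a b c d :: real
  assumes "a \<le> b" "c \<le> d"
  shows "measure lborel (cbox (a, c) (b, d)) = (b - a) * (d - c)"
  using assms by (simp add: content_Pair)

context rect
begin

lemma const_absolutely_integrable: "(\<lambda>_. k :: real) absolutely_integrable_on R"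
  by (rule continuous_absolutely_integrable(1)) (rule continuous_on_const)

lemma Lp_infinity_AE:
  assumes "f \<in> Lp \<infinity> R"
  shows "AE z in lebesgue. z \<in> R \<longrightarrow> \<bar>f z\<bar> \<le> Lp_norm \<infinity> R f"
proof -
  let ?E = "esssup (lebesgue_on R) (\<lambda>z. ereal \<bar>f z\<bar>)"
  have "?E < \<infinity>" using assms by (simp add: Lp_def)
  have "AE z in lebesgue_on R. ereal \<bar>f z\<bar> \<le> ?E" by (rule esssup_AE)
  then have "AE z in lebesgue_on R. \<bar>f z\<bar> \<le> Lp_norm \<infinity> R f"
  proof (rule eventually_mono)
    fix z assume "ereal \<bar>f z\<bar> \<le> ?E"
    with \<open>?E < \<infinity>\<close> show "\<bar>f z\<bar> \<le> Lp_norm \<infinity> R f"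
      unfolding Lp_norm_def by (cases ?E) simp_all
  qed
  then show ?thesis by (simp add: AE_lebesgue_on)
qed

lemma Lp_absolutely_integrable:
  assumes p: "1 \<le> p" and f: "f \<in> Lp p R"
  shows "f absolutely_integrable_on R"
proof -
  note c = const_absolutely_integrable[folded integrable_lebesgue_on_iff[OF R_lebesgue(1)]]
  have fm: "f \<in> borel_measurable (lebesgue_on R)" using f by (simp add: Lp_def)
  have "integrable (lebesgue_on R) f"
    using p
  proof (cases rule: exponent_cases)
    case infinite
    have "AE z in lebesgue_on R. norm (f z) \<le> norm (\<bar>Lp_norm \<infinity> R f\<bar>)"
      unfolding AE_lebesgue_on[OF R_lebesgue(1)]
    proof (rule eventually_mono[OF Lp_infinity_AE])
      show "f \<in> Lp \<infinity> R" using f infinite by simp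
      show "z \<in> R \<longrightarrow> norm (f z) \<le> norm \<bar>Lp_norm \<infinity> R f\<bar>" if "z \<in> R \<longrightarrow> \<bar>f z\<bar> \<le> Lp_norm \<infinity> R f" for z
      proof
        assume "z \<in> R"
        with that have "\<bar>f z\<bar> \<le> Lp_norm \<infinity> R f" by blast
        also have "\<dots> \<le> \<bar>Lp_norm \<infinity> R f\<bar>" by (rule abs_ge_self)
        finally show "norm (f z) \<le> norm \<bar>Lp_norm \<infinity> R f\<bar>" by simp
      qed
    qed
    then show ?thesis by (rule Bochner_Integration.integrable_bound[OF c fm])
  next
    case (finite r)
    have i: "integrable (lebesgue_on R) (\<lambda>z. \<bar>f z\<bar> powr r)" using f finite by (simp add: Lp_def)
    \<comment> \<open>On a set of finite measure 1 + |f|^r is an integrable majorant.\<close>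
    have "\<bar>t\<bar> \<le> 1 + \<bar>t\<bar> powr r" for t :: real
    proof (cases "\<bar>t\<bar> \<le> 1")
      case True
      then show ?thesis using powr_ge_zero[of "\<bar>t\<bar>" r] by linarith
    next
      case False
      then have "\<bar>t\<bar> powr 1 \<le> \<bar>t\<bar> powr r" using finite(2) by (intro powr_mono) simp_all
      then show ?thesis using False by simp
    qed
    then have "AE z in lebesgue_on R. norm (f z) \<le> norm (1 + \<bar>f z\<bar> powr r)" by simp
    then show ?thesis by (rule Bochner_Integration.integrable_bound[OF Bochner_Integration.integrable_add[OF c i] fm])
  qed
  then show ?thesis using integrable_lebesgue_on_iff[OF R_lebesgue(1)] by blast
qed

text \<open>
  Hoelder's inequality up to the factor 2, which comes from splitting \<open>\<bar>f\<bar>\<close> at a suitable level \<open>\<tau>\<close>: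
  \<open>t \<le> \<tau> + \<tau>\<^sup>1\<^sup>-\<^sup>r t\<^sup>r\<close>.
\<close>

lemma Lp_integral_bound:
  assumes p: "1 \<le> p" and f: "f \<in> Lp p R" and S: "cbox (l, s) (r, t) \<subseteq> CR" "l < r" "s < t"
  shows "integral (cbox (l, s) (r, t)) (\<lambda>z. \<bar>f z\<bar>) \<le>
    2 * ((r - l) * (t - s)) powr (1 - real_of_ereal (1 / p)) * Lp_norm p R f"
    (is "?I \<le> _ * ?N")
proof -
  let ?S = "cbox (l, s) (r, t)"
  define Q where "Q = (r - l) * (t - s)"
  have A: "0 < Q" using S by (simp add: Q_def)
  have cont: "measure lborel ?S = Q" unfolding Q_def using S by (intro content_cbox_real_pair) simp_all
  have fa: "(\<lambda>z. \<bar>f z\<bar>) absolutely_integrable_on ?S"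
    by (rule absolutely_integrable_abs[OF absolutely_integrable_CR[OF Lp_absolutely_integrable[OF p f] S(1)]]) simp
  note fi = set_lebesgue_integral_eq_integral(1)[OF fa]
  have ci: "integral ?S (\<lambda>_. k) = k * Q" for k :: real using cont by simp
  have cint: "(\<lambda>_. k) integrable_on ?S" for k :: real by (rule integrable_const)
  have "?I \<le> 2 * Q powr (1 - real_of_ereal (1 / p)) * ?N"
    using p
  proof (cases rule: exponent_cases)
    case infinite
    have "AE z in lebesgue. z \<in> R \<longrightarrow> \<bar>f z\<bar> \<le> ?N" using Lp_infinity_AE f infinite by simp
    moreover have "AE z in lebesgue. z \<notin> CR - R"
      using AE_not_in[of "CR - R" lebesgue] negligible_frontier_interval[of "(a, c)" "(b, d)"]
      unfolding negligible_iff_null_sets by blast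
    \<comment> \<open>The minimum turns the almost everywhere bound into one valid at every point,
      as the comparison of gauge integrals requires.\<close>
    ultimately have ae: "AE z in lebesgue. z \<in> ?S \<longrightarrow> \<bar>f z\<bar> = min \<bar>f z\<bar> ?N"
    proof (rule eventually_elim2)
      fix z assume z: "z \<in> R \<longrightarrow> \<bar>f z\<bar> \<le> ?N" "z \<notin> CR - R"
      show "z \<in> ?S \<longrightarrow> \<bar>f z\<bar> = min \<bar>f z\<bar> ?N"
      proof
        assume "z \<in> ?S"
        then have "z \<in> CR" by (rule subsetD[OF S(1)])
        then have "\<bar>f z\<bar> \<le> ?N" using z by blast
        then show "\<bar>f z\<bar> = min \<bar>f z\<bar> ?N" by (rule min_absorb1[symmetric])
      qed
    qed
    have "?I = integral ?S (\<lambda>z. min \<bar>f z\<bar> ?N)" by (rule integral_cong_AE_on[OF ae])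
    also have "\<dots> \<le> integral ?S (\<lambda>_. ?N)"
      by (rule integral_le[OF set_lebesgue_integral_eq_integral(1)[OF absolutely_integrable_cong_AE_on[OF ae fa]] cint]) simp
    finally have I: "?I \<le> ?N * Q" unfolding ci .
    moreover have "0 \<le> ?I" by (rule integral_nonneg_real) simp
    ultimately have "0 \<le> ?N * Q" by linarith
    moreover have "2 * Q powr (1 - real_of_ereal (1 / p)) * ?N = 2 * (?N * Q)" using A infinite by simp
    ultimately show ?thesis using I by linarith
  next
    case (finite q)
    have "integrable (lebesgue_on R) (\<lambda>z. \<bar>f z\<bar> powr q)" using f finite by (simp add: Lp_def)
    then have qa: "(\<lambda>z. \<bar>f z\<bar> powr q) absolutely_integrable_on R"
      using integrable_lebesgue_on_iff[OF R_lebesgue(1)] by blast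
    have qS: "(\<lambda>z. \<bar>f z\<bar> powr q) integrable_on ?S"
      by (rule set_lebesgue_integral_eq_integral(1)[OF absolutely_integrable_CR[OF qa S(1)]]) simp
    define I where "I = integral R (\<lambda>z. \<bar>f z\<bar> powr q)"
    have I0: "0 \<le> I" unfolding I_def by (rule integral_nonneg_real) simp
    have N: "?N = I powr (1 / q)"
      using finite integral_lebesgue_on_eq[OF qa R_lebesgue(1)] by (simp add: Lp_norm_def I_def)
    have IS: "integral ?S (\<lambda>z. \<bar>f z\<bar> powr q) \<le> I"
      using integral_subset_le_R[OF qa S(1)] by (simp add: I_def)
    have split: "t \<le> \<tau> + \<tau> powr (1 - q) * t powr q" if "0 \<le> t" "0 < \<tau>" for t \<tau> :: real
    proof (cases "t \<le> \<tau>")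
      case True
      moreover have "0 \<le> \<tau> powr (1 - q) * t powr q" by simp
      ultimately show ?thesis by linarith
    next
      case False
      have "t = t powr (1 - q) * t powr q" using False that by (simp flip: powr_add)
      also have "\<dots> \<le> \<tau> powr (1 - q) * t powr q"
        using False that finite(2) by (intro mult_right_mono powr_mono2') simp_all
      finally show ?thesis using that by simp
    qed
    let ?A' = "Q powr (1 - 1 / q)"
    have A': "0 < ?A'" using A by simp
    have main: "?I \<le> 2 * ?A' * (?N + \<epsilon>)" if "0 < \<epsilon>" for \<epsilon>
    proof -
      \<comment> \<open>The added \<epsilon> keeps the splitting level positive when the norm is
        0.\<close>
      define k where "k = ?N + \<epsilon>"
      have k: "0 < k" using that unfolding k_def N by (simp add: add_nonneg_pos)
      \<comment> \<open>At this level both parts of the splitting have the bound k Q^(1 - 1/q); this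
        is where the factor 2 arises.\<close>
      define \<tau> where "\<tau> = k * Q powr (- (1 / q))"
      have l: "0 < \<tau>" using k A by (simp add: \<tau>_def)
      have "?I \<le> integral ?S (\<lambda>z. \<tau> + \<tau> powr (1 - q) * \<bar>f z\<bar> powr q)"
        by (rule integral_le[OF fi integrable_add[OF cint integrable_on_mult_right[OF qS]]]) (use split l in simp)
      also have "\<dots> = \<tau> * Q + \<tau> powr (1 - q) * integral ?S (\<lambda>z. \<bar>f z\<bar> powr q)"
        using Henstock_Kurzweil_Integration.integral_add[OF cint integrable_on_mult_right[OF qS], of \<tau> "\<tau> powr (1 - q)"] unfolding ci by simp
      also have "\<dots> \<le> \<tau> * Q + \<tau> powr (1 - q) * k powr q"
      proof -
        have "I = (I powr (1 / q)) powr q" using I0 finite(2) by (simp add: powr_powr)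
        also have "\<dots> \<le> k powr q" using that finite(2) unfolding k_def N by (intro powr_mono2) simp_all
        finally show ?thesis using IS by (intro add_left_mono mult_left_mono) simp_all
      qed
      also have "\<tau> * Q = k * ?A'"
      proof -
        have "\<tau> * Q = k * (Q powr (- (1 / q)) * Q powr 1)" using A by (simp add: \<tau>_def)
        also have "Q powr (- (1 / q)) * Q powr 1 = ?A'" unfolding powr_add[symmetric] by simp
        finally show ?thesis .
      qed
      also have "\<tau> powr (1 - q) * k powr q = k * ?A'"
      proof -
        have "- (1 / q) * (1 - q) = 1 - 1 / q" using finite(2) by (simp add: field_simps)
        then have 1: "(Q powr (- (1 / q))) powr (1 - q) = ?A'" unfolding powr_powr by (simp only:)
        have 2: "k powr (1 - q) * k powr q = k" using k by (simp flip: powr_add)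
        have "\<tau> powr (1 - q) = k powr (1 - q) * (Q powr (- (1 / q))) powr (1 - q)"
          unfolding \<tau>_def by (rule powr_mult)
        then have "\<tau> powr (1 - q) * k powr q = (k powr (1 - q) * k powr q) * ?A'" unfolding 1 by simp
        then show ?thesis unfolding 2 .
      qed
      finally show ?thesis by (simp add: k_def algebra_simps)
    qed
    have "?I \<le> 2 * ?A' * ?N"
    proof (rule field_le_epsilon)
      fix e :: real assume "0 < e"
      then have "?I \<le> 2 * ?A' * (?N + e / (2 * ?A'))" by (intro main) (use A' in simp)
      also have "\<dots> = 2 * ?A' * ?N + e" using A' by (simp only: distrib_left) simp
      finally show "?I \<le> 2 * ?A' * ?N + e" .
    qed
    then show ?thesis unfolding finite(4) .
  qed
  then show ?thesis unfolding Q_def .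
qed

text \<open>For infinite p the norm is an essential supremum converted to a real number, whose sign
  is not evident. The integral bound settles all p at once.\<close>

lemma Lp_norm_nonneg:
  assumes p: "1 \<le> p" and f: "f \<in> Lp p R"
  shows "0 \<le> Lp_norm p R f"
proof -
  let ?A = "2 * ((b - a) * (d - c)) powr (1 - real_of_ereal (1 / p))"
  have "0 \<le> integral CR (\<lambda>z. \<bar>f z\<bar>)" by (rule integral_nonneg_real) simp
  also have "\<dots> \<le> ?A * Lp_norm p R f" by (rule Lp_integral_bound[OF p f order_refl ab cd])
  finally have "0 \<le> ?A * Lp_norm p R f" .
  moreover have "0 < ?A" using ab cd by simp
  ultimately show ?thesis by (simp only: zero_le_mult_iff) linarith
qed

text \<open>Hoelder gives the area to the power 1 - 1/p. One side cancels in the quotient, the other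
  remains, and area^(-1/p) is at most \<mu>^(-1/p). This is how the smallest element enters the mesh
  constant.\<close>

lemma Lp_integral_over_side:
  assumes p: "1 \<le> p" and f: "f \<in> Lp p R"
    and S: "a \<le> l" "l < r" "r \<le> b" "c \<le> s" "s < t" "t \<le> d" and \<mu>: "0 < \<mu>" "\<mu> \<le> (r - l) * (t - s)"
  shows "integral (cbox (l, s) (r, t)) (\<lambda>z. \<bar>f z\<bar>) / (r - l) \<le> 2 * (t - s) * \<mu> powr (- real_of_ereal (1 / p)) * Lp_norm p R f"
    and "integral (cbox (l, s) (r, t)) (\<lambda>z. \<bar>f z\<bar>) / (t - s) \<le> 2 * (r - l) * \<mu> powr (- real_of_ereal (1 / p)) * Lp_norm p R f"
proof -
  define \<sigma> where "\<sigma> = real_of_ereal (1 / p)"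
  have \<sigma>: "0 \<le> \<sigma>" using p unfolding \<sigma>_def by (cases rule: exponent_cases) simp_all
  let ?A = "(r - l) * (t - s)" and ?N = "Lp_norm p R f" and ?I = "integral (cbox (l, s) (r, t)) (\<lambda>z. \<bar>f z\<bar>)"
  have A: "0 < ?A" using S by simp
  have sub: "cbox (l, s) (r, t) \<subseteq> CR" using S by (intro subset_box_imp) (simp add: Basis_prod_def)
  have "?I \<le> 2 * ?A powr (1 - \<sigma>) * ?N"
    unfolding \<sigma>_def by (rule Lp_integral_bound[OF p f sub S(2,5)])
  also have "?A powr (1 - \<sigma>) = ?A * ?A powr (- \<sigma>)"
    using A powr_add[of ?A 1 "- \<sigma>"] by simp
  also have "2 * (?A * ?A powr (- \<sigma>)) * ?N \<le> 2 * (?A * \<mu> powr (- \<sigma>)) * ?N"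
    using \<mu> \<sigma> A Lp_norm_nonneg[OF p f] by (intro mult_right_mono mult_left_mono powr_mono2') simp_all
  finally have I: "?I \<le> 2 * (?A * \<mu> powr (- \<sigma>)) * ?N" .
  have e: "2 * (h * k * X) * N / h = 2 * k * X * N" "2 * (k * h * X) * N / h = 2 * k * X * N" if "h \<noteq> 0" for h k X N :: real
    using that by simp_all
  have ne: "r - l \<noteq> 0" "t - s \<noteq> 0" using S by simp_all
  show "?I / (r - l) \<le> 2 * (t - s) * \<mu> powr (- real_of_ereal (1 / p)) * ?N"
    using divide_right_mono[OF I, of "r - l"] S unfolding \<sigma>_def[symmetric] e(1)[OF ne(1)] by simp
  show "?I / (t - s) \<le> 2 * (r - l) * \<mu> powr (- real_of_ereal (1 / p)) * ?N"
    using divide_right_mono[OF I, of "t - s"] S unfolding \<sigma>_def[symmetric] e(2)[OF ne(2)] by simp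
qed

lemma bounded_Lp:
  assumes p: "1 \<le> p" and f: "continuous_on CR f" and B: "\<forall>z\<in>R. \<bar>f z\<bar> \<le> B"
  shows "f \<in> Lp p R" and "Lp_norm p R f \<le> B * ((b - a) * (d - c)) powr real_of_ereal (1 / p)"
proof -
  let ?A = "(b - a) * (d - c)"
  have "((a + b) / 2, (c + d) / 2) \<in> R" using ab cd by (simp add: mem_R)
  then have "\<bar>f ((a + b) / 2, (c + d) / 2)\<bar> \<le> B" by (rule bspec[OF B])
  then have B0: "0 \<le> B" by linarith
  have A: "0 < ?A" using ab cd by simp
  have cont: "measure lborel CR = ?A" using ab cd by (intro content_cbox_real_pair) simp_all
  have fa: "f absolutely_integrable_on R" by (rule continuous_absolutely_integrable(1)[OF f])
  then have fi: "integrable (lebesgue_on R) f" using integrable_lebesgue_on_iff[OF R_lebesgue(1)] by blast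
  then have fm: "f \<in> borel_measurable (lebesgue_on R)" by (rule borel_measurable_integrable)
  have B': "AE z in lebesgue_on R. \<bar>f z\<bar> \<le> B" using B by (simp add: AE_lebesgue_on)
  have "f \<in> Lp p R \<and> Lp_norm p R f \<le> B * ?A powr real_of_ereal (1 / p)"
    using p
  proof (cases rule: exponent_cases)
    case infinite
    let ?E = "esssup (lebesgue_on R) (\<lambda>z. ereal \<bar>f z\<bar>)"
    have "?E \<le> ereal B"
    proof (rule esssup_I)
      show "AE z in lebesgue_on R. ereal \<bar>f z\<bar> \<le> ereal B" using B' by simp
    qed (use fm in measurable)
    then have "?E < \<infinity>" "real_of_ereal ?E \<le> B" using B0 by (cases ?E; simp)+
    then have "f \<in> Lp p R" "Lp_norm p R f \<le> B" using fm by (simp_all add: Lp_def Lp_norm_def infinite(1))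
    moreover have "?A powr real_of_ereal (1 / p) = 1"
      unfolding infinite(2) powr_zero_eq_one by (rule if_not_P[OF not_sym[OF less_imp_neq[OF A]]])
    ultimately show ?thesis by (simp only: mult_1_right)
  next
    case (finite q)
    have m: "(\<lambda>z. \<bar>f z\<bar> powr q) \<in> borel_measurable (lebesgue_on R)" using fm by measurable
    have le: "\<bar>f z\<bar> powr q \<le> B powr q" if "z \<in> R" for z
      using bspec[OF B that] finite(2) by (intro powr_mono2) simp_all
    have qi: "integrable (lebesgue_on R) (\<lambda>z. \<bar>f z\<bar> powr q)"
    proof (rule Bochner_Integration.integrable_bound[OF _ m])
      show "integrable (lebesgue_on R) (\<lambda>_. B powr q)"
        using const_absolutely_integrable integrable_lebesgue_on_iff[OF R_lebesgue(1)] by blast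
      show "AE z in lebesgue_on R. norm (\<bar>f z\<bar> powr q) \<le> norm (B powr q)"
        unfolding AE_lebesgue_on[OF R_lebesgue(1)] using le by simp
    qed
    then have qa: "(\<lambda>z. \<bar>f z\<bar> powr q) absolutely_integrable_on R"
      using integrable_lebesgue_on_iff[OF R_lebesgue(1)] by blast
    have "(\<integral>z. \<bar>f z\<bar> powr q \<partial>lebesgue_on R) = integral R (\<lambda>z. \<bar>f z\<bar> powr q)"
      by (rule integral_lebesgue_on_eq[OF qa R_lebesgue(1)])
    also have "\<dots> \<le> integral R (\<lambda>_. B powr q)"
      by (rule integral_le[OF set_lebesgue_integral_eq_integral(1)[OF qa] set_lebesgue_integral_eq_integral(1)[OF const_absolutely_integrable] le])
    also have "\<dots> = integral CR (\<lambda>_. B powr q)" by (rule integral_open_interval)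
    also have "\<dots> = B powr q * ?A" using cont by simp
    finally have "(\<integral>z. \<bar>f z\<bar> powr q \<partial>lebesgue_on R) powr (1 / q) \<le> (B powr q * ?A) powr (1 / q)"
      using finite(2) by (intro powr_mono2) simp_all
    also have "\<dots> = B * ?A powr (1 / q)"
      using A B0 finite(2) by (subst powr_mult) (simp_all add: powr_powr)
    finally show ?thesis using finite fm qi by (simp add: Lp_def Lp_norm_def)
  qed
  then show "f \<in> Lp p R" "Lp_norm p R f \<le> B * ?A powr real_of_ereal (1 / p)" by blast+
qed

text \<open>The interpolation error is classically differentiable on the closed macro-element, so a
  pointwise bound of its gradient suffices. The 2 counts the two first derivatives.\<close>

lemma C1_sobolev:
  assumes p: "1 \<le> p" and f: "f differentiable_on CR" "continuous_on CR (pdx CR f)" "continuous_on CR (pdy CR f)"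
    and B: "\<And>z. z \<in> CR \<Longrightarrow> \<bar>pdx CR f z\<bar> \<le> B" "\<And>z. z \<in> CR \<Longrightarrow> \<bar>pdy CR f z\<bar> \<le> B"
  shows "f \<in> sobolev 1 p R"
    and "sobolev_seminorm 1 p R f \<le> 2 * B * ((b - a) * (d - c)) powr real_of_ereal (1 / p)"
proof -
  note cf = differentiable_imp_continuous_on[OF f(1)]
  note D0 = has_weak_D_0[OF continuous_absolutely_integrable(2)[OF cf]]
  note D = C1_has_weak_D(1)[OF f(1,2)] C1_has_weak_D(2)[OF f(1,3)]
  have "compact (f ` CR)" by (rule compact_continuous_image[OF cf compact_cbox])
  then obtain B0 where B0: "\<And>z. z \<in> CR \<Longrightarrow> \<bar>f z\<bar> \<le> B0"
    using compact_imp_bounded bounded_iff by (metis imageI real_norm_def)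
  have RC: "z \<in> R \<Longrightarrow> z \<in> CR" for z using R_subset_CR by blast
  have BR: "\<forall>z\<in>R. \<bar>f z\<bar> \<le> B0" "\<forall>z\<in>R. \<bar>pdx CR f z\<bar> \<le> B" "\<forall>z\<in>R. \<bar>pdy CR f z\<bar> \<le> B"
    using B0 B RC by blast+
  note Lf = bounded_Lp[OF p cf BR(1)] and Lx = bounded_Lp[OF p f(2) BR(2)] and Ly = bounded_Lp[OF p f(3) BR(3)]
  have mi: "\<alpha> \<in> {(0, 0), (1, 0), (0, 1)}" if "l \<le> 1" "\<alpha> \<in> multi_indices l" for l \<alpha>
    using that multi_indices_le_1 by blast
  show "f \<in> sobolev 1 p R"
    unfolding sobolev_def
  proof (intro CollectI conjI allI impI ballI)
    show "f \<in> Lp p R" by (rule Lf(1))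
    fix l :: nat and \<alpha> assume "l \<le> 1" "\<alpha> \<in> multi_indices l"
    then consider "\<alpha> = (0, 0)" | "\<alpha> = (1, 0)" | "\<alpha> = (0, 1)" using mi by blast
    then show "\<exists>g\<in>Lp p R. has_weak_D f \<alpha> R g"
    proof cases
      case 1 then show ?thesis using D0 Lf(1) by blast
    next
      case 2 then show ?thesis using D(1) Lx(1) by blast
    next
      case 3 then show ?thesis using D(2) Ly(1) by blast
    qed
  qed
  let ?r = "\<lambda>\<alpha>. Lp_norm p R (weak_D R \<alpha> f)"
  note cx = Lp_cong_AE[OF Lx(1) weak_D_AE(2)[OF D(1)] R_lebesgue(1)]
  note cy = Lp_cong_AE[OF Ly(1) weak_D_AE(2)[OF D(2)] R_lebesgue(1)]
  have ne: "(1::nat, 0::nat) \<noteq> (0, 1)" by simp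
  have "sobolev_seminorm 1 p R f \<le> ?r (1, 0) + ?r (0, 1)"
    unfolding sobolev_seminorm_def multi_indices_1
    by (rule lp_combine_bounds(3)[OF p ne Lp_norm_nonneg[OF p cx(1)] Lp_norm_nonneg[OF p cy(1)]])
  also have "\<dots> \<le> B * ((b - a) * (d - c)) powr real_of_ereal (1 / p) + B * ((b - a) * (d - c)) powr real_of_ereal (1 / p)"
    unfolding cx(2) cy(2) by (intro add_mono Lx(2) Ly(2))
  finally show "sobolev_seminorm 1 p R f \<le> 2 * B * ((b - a) * (d - c)) powr real_of_ereal (1 / p)" by simp
qed

end

subsection \<open>Patches\<close>

lemma strict_mono_on_index:
  fixes x :: "nat \<Rightarrow> real"
  assumes x: "strict_mono_on {0..n} x" and "i \<le> n" "k \<le> n"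
  shows "x i < x k \<longleftrightarrow> i < k" "x i \<le> x k \<longleftrightarrow> i \<le> k" "x i = x k \<longleftrightarrow> i = k"
  using strict_mono_on_less[OF x, of i k] strict_mono_on_less_eq[OF x, of i k] strict_mono_on_eq[OF x, of i k] assms
  by simp_all

lemma convex_rectangle: "convex ({a..b} \<times> {c..d} :: (real \<times> real) set)"
  by (intro convex_Times) simp_all

lemma vertex_in_edges:
  assumes "edge_choice n m x y \<sigma>" "i < n" "j < m" "k \<in> {i, Suc i}" "l \<in> {j, Suc j}"
  shows "mesh_edge n m (\<sigma> k l)" "(x k, y l) \<in> edge_set x y (\<sigma> k l)"
proof -
  have "k \<le> n" "l \<le> m" using assms by auto
  then show "mesh_edge n m (\<sigma> k l)" "(x k, y l) \<in> edge_set x y (\<sigma> k l)"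
    using assms(1) unfolding edge_choice_def by blast+
qed

lemma edge_set_bounds:
  assumes x: "strict_mono_on {0..n} x" and y: "strict_mono_on {0..m} y" and e: "mesh_edge n m e"
  shows "edge_set x y e \<subseteq> {x 0..x n} \<times> {y 0..y m}"
proof (cases e)
  case (Horizontal i j)
  then have ij: "i < n" "j \<le> m" using e by simp_all
  then have "x 0 \<le> x i" "x (Suc i) \<le> x n" "y 0 \<le> y j" "y j \<le> y m"
    using strict_mono_on_index(2)[OF x] strict_mono_on_index(2)[OF y] by simp_all
  then show ?thesis using Horizontal by auto
next
  case (Vertical i j)
  then have ij: "i \<le> n" "j < m" using e by simp_all
  then have "x 0 \<le> x i" "x i \<le> x n" "y 0 \<le> y j" "y (Suc j) \<le> y m"
    using strict_mono_on_index(2)[OF x] strict_mono_on_index(2)[OF y] by simp_all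
  then show ?thesis using Vertical by auto
qed

lemma finite_rect_patches: "finite (rect_patches n m x y)"
proof (rule finite_subset)
  show "rect_patches n m x y \<subseteq> (\<lambda>(i, j, k, l). {x i..x k} \<times> {y j..y l}) ` ({..n} \<times> {..m} \<times> {..n} \<times> {..m})"
  proof
    fix S assume "S \<in> rect_patches n m x y"
    then obtain i j k l where S: "S = {x i..x k} \<times> {y j..y l}" and b: "i < k" "k \<le> n" "j < l" "l \<le> m"
      unfolding rect_patches_def by blast
    have "(i, j, k, l) \<in> {..n} \<times> {..m} \<times> {..n} \<times> {..m}" using b by simp
    from imageI[OF this, of "\<lambda>(i, j, k, l). {x i..x k} \<times> {y j..y l}"]
    show "S \<in> (\<lambda>(i, j, k, l). {x i..x k} \<times> {y j..y l}) ` ({..n} \<times> {..m} \<times> {..n} \<times> {..m})"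
      by (simp add: S)
  qed
qed simp

text \<open>The minimum in \<open>patch\<close> is attained: there are finitely many rectangular
  patches, and the whole mesh contains all the edges. The index bounds hold because the edges
  contain two opposite vertices of the macro-element.\<close>

lemma patch_cases:
  assumes x: "strict_mono_on {0..n} x" and y: "strict_mono_on {0..m} y" and \<sigma>: "edge_choice n m x y \<sigma>"
    and i: "i < n" and j: "j < m"
  obtains i0 k0 j0 l0 where "patch n m x y \<sigma> i j = {x i0..x k0} \<times> {y j0..y l0}"
    "i0 \<le> i" "Suc i \<le> k0" "k0 \<le> n" "j0 \<le> j" "Suc j \<le> l0" "l0 \<le> m"
    "\<And>k l. k \<in> {i, Suc i} \<Longrightarrow> l \<in> {j, Suc j} \<Longrightarrow> edge_set x y (\<sigma> k l) \<subseteq> {x i0..x k0} \<times> {y j0..y l0}"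
proof -
  let ?E = "\<Union>k\<in>{i, Suc i}. \<Union>l\<in>{j, Suc j}. edge_set x y (\<sigma> k l)"
  define P where "P S \<longleftrightarrow> S \<in> rect_patches n m x y \<and> convex hull ?E \<subseteq> S" for S
  let ?T = "{x 0..x n} \<times> {y 0..y m}"
  have "?E \<subseteq> ?T"
    by (intro UN_least edge_set_bounds[OF x y] vertex_in_edges(1)[OF \<sigma> i j])
  then have "convex hull ?E \<subseteq> ?T" by (rule hull_minimal) (rule convex_rectangle)
  moreover have "?T \<in> rect_patches n m x y"
    unfolding rect_patches_def using i j
    by (intro CollectI exI[of _ 0] exI[of _ n] exI[of _ m]) simp
  ultimately have "P ?T" unfolding P_def by blast
  have "finite {S. P S}" by (rule finite_subset[OF _ finite_rect_patches[of n m x y]]) (simp add: P_def subset_iff)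
  with \<open>P ?T\<close> have "\<exists>S. is_arg_min (measure lebesgue) P S"
    using ex_is_arg_min_if_finite[of "{S. P S}" "measure lebesgue"] by auto
  then have "is_arg_min (measure lebesgue) P (arg_min (measure lebesgue) P)"
    unfolding arg_min_def by (rule someI_ex)
  then have "P (patch n m x y \<sigma> i j)" unfolding patch_def P_def is_arg_min_def by blast
  then obtain i0 j0 k0 l0 where S: "patch n m x y \<sigma> i j = {x i0..x k0} \<times> {y j0..y l0}"
    and b: "i0 < k0" "k0 \<le> n" "j0 < l0" "l0 \<le> m" and h: "convex hull ?E \<subseteq> {x i0..x k0} \<times> {y j0..y l0}"
    unfolding P_def rect_patches_def by auto
  have E: "edge_set x y (\<sigma> k l) \<subseteq> {x i0..x k0} \<times> {y j0..y l0}" if "k \<in> {i, Suc i}" "l \<in> {j, Suc j}" for k l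
    using that h hull_subset[of ?E convex] by blast
  have "(x i, y j) \<in> {x i0..x k0} \<times> {y j0..y l0}" "(x (Suc i), y (Suc j)) \<in> {x i0..x k0} \<times> {y j0..y l0}"
    by (rule subsetD[OF E vertex_in_edges(2)[OF \<sigma> i j]]; simp)+
  then have "x i0 \<le> x i" "x (Suc i) \<le> x k0" "y j0 \<le> y j" "y (Suc j) \<le> y l0" by simp_all
  then have "i0 \<le> i" "Suc i \<le> k0" "j0 \<le> j" "Suc j \<le> l0"
    using strict_mono_on_index(2)[OF x, of i0 i] strict_mono_on_index(2)[OF x, of "Suc i" k0]
      strict_mono_on_index(2)[OF y, of j0 j] strict_mono_on_index(2)[OF y, of "Suc j" l0] b i j by simp_all
  then show ?thesis using that[OF S] b E by blast
qed

text \<open>Besides the edge itself an adjacent element inside the patch is needed: \<open>q\<close>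
  is its row for a horizontal edge and its column for a vertical one.\<close>

lemma edge_cases:
  assumes x: "strict_mono_on {0..n} x" and y: "strict_mono_on {0..m} y"
    and e: "mesh_edge n m e" "(x k, y l) \<in> edge_set x y e" "edge_set x y e \<subseteq> {x i0..x k0} \<times> {y j0..y l0}"
    and b: "i0 < k0" "k0 \<le> n" "j0 < l0" "l0 \<le> m" and kl: "k \<le> n" "l \<le> m"
  obtains (horizontal) i' q where "e = Horizontal i' l" "k \<in> {i', Suc i'}" "i0 \<le> i'" "Suc i' \<le> k0" "j0 \<le> q" "Suc q \<le> l0" "l \<in> {q, Suc q}"
    | (vertical) j' q where "e = Vertical k j'" "l \<in> {j', Suc j'}" "j0 \<le> j'" "Suc j' \<le> l0" "i0 \<le> q" "Suc q \<le> k0" "k \<in> {q, Suc q}"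
proof -
  \<comment> \<open>On the last grid line of the patch the neighbour with the smaller index is
    taken.\<close>
  have adj: "\<exists>q. s \<le> q \<and> Suc q \<le> t \<and> k \<in> {q, Suc q}" if "s \<le> k" "k \<le> t" "s < t" for s t k :: nat
  proof (cases "k < t")
    case True then show ?thesis using that by (intro exI[of _ k]) simp
  next
    case False then show ?thesis using that by (intro exI[of _ "k - 1"]) auto
  qed
  note X = strict_mono_on_index[OF x] and Y = strict_mono_on_index[OF y]
  have "(x k, y l) \<in> {x i0..x k0} \<times> {y j0..y l0}" using e by blast
  then have "x i0 \<le> x k" "x k \<le> x k0" "y j0 \<le> y l" "y l \<le> y l0" by simp_all
  then have kl': "i0 \<le> k" "k \<le> k0" "j0 \<le> l" "l \<le> l0" using X(2) Y(2) b kl by simp_all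
  show ?thesis
  proof (cases e)
    case (Horizontal i' j')
    then have ij: "i' < n" "j' \<le> m" using e by simp_all
    have "x i' \<le> x k" "x k \<le> x (Suc i')" "y l = y j'" using e(2) Horizontal by simp_all
    then have 1: "i' \<le> k" "k \<le> Suc i'" "l = j'" using X(2) Y(3) ij kl by simp_all
    have "x i' \<le> x (Suc i')" using X(2) ij by simp
    then have "(x i', y j') \<in> edge_set x y e" "(x (Suc i'), y j') \<in> edge_set x y e" using Horizontal by simp_all
    then have "(x i', y j') \<in> {x i0..x k0} \<times> {y j0..y l0}" "(x (Suc i'), y j') \<in> {x i0..x k0} \<times> {y j0..y l0}"
      using e(3) by blast+
    then have "x i0 \<le> x i'" "x (Suc i') \<le> x k0" by simp_all
    then have 2: "i0 \<le> i'" "Suc i' \<le> k0" using X(2) ij b by simp_all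
    obtain q where "j0 \<le> q" "Suc q \<le> l0" "l \<in> {q, Suc q}" using adj[OF kl'(3,4) b(3)] by blast
    moreover have "k \<in> {i', Suc i'}" using 1 by auto
    ultimately show ?thesis using horizontal[of i' q] Horizontal 1 2 by blast
  next
    case (Vertical i' j')
    then have ij: "i' \<le> n" "j' < m" using e by simp_all
    have "x k = x i'" "y j' \<le> y l" "y l \<le> y (Suc j')" using e(2) Vertical by simp_all
    then have 1: "k = i'" "j' \<le> l" "l \<le> Suc j'" using X(3) Y(2) ij kl by simp_all
    have "y j' \<le> y (Suc j')" using Y(2) ij by simp
    then have "(x i', y j') \<in> edge_set x y e" "(x i', y (Suc j')) \<in> edge_set x y e" using Vertical by simp_all
    then have "(x i', y j') \<in> {x i0..x k0} \<times> {y j0..y l0}" "(x i', y (Suc j')) \<in> {x i0..x k0} \<times> {y j0..y l0}"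
      using e(3) by blast+
    then have "y j0 \<le> y j'" "y (Suc j') \<le> y l0" by simp_all
    then have 2: "j0 \<le> j'" "Suc j' \<le> l0" using Y(2) ij b by simp_all
    obtain q where "i0 \<le> q" "Suc q \<le> k0" "k \<in> {q, Suc q}" using adj[OF kl'(1,2) b(1)] by blast
    moreover have "l \<in> {j', Suc j'}" using 1 by auto
    ultimately show ?thesis using vertical[of j' q] Vertical 1 2 by blast
  qed
qed

section \<open>Areas and side lengths\<close>

lemma finite_mesh: "finite (mesh n m x y)"
proof -
  have "mesh n m x y = (\<lambda>(i, j). macro x y i j) ` ({..<n} \<times> {..<m})" unfolding mesh_def by auto
  then show ?thesis by simp
qed

lemma measure_rectangle:
  assumes "a \<le> b" "c \<le> d"
  shows "measure lebesgue ({a..b} \<times> {c..d}) = (b - a) * (d - c :: real)"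
proof -
  have "{a..b} \<times> {c..d} = cbox (a, c) (b, d)" by (simp add: cbox_Pair_eq)
  then show ?thesis using assms by (simp add: content_Pair)
qed

lemma min_measure:
  assumes x: "strict_mono_on {0..n} x" and y: "strict_mono_on {0..m} y" and k: "k0 \<le> n" and l: "l0 \<le> m"
    and \<mu>: "\<mu> = Min (measure lebesgue ` {M' \<in> mesh n m x y. M' \<subseteq> {x i0..x k0} \<times> {y j0..y l0}})"
    and ne: "i0 < k0" "j0 < l0"
  shows "0 < \<mu>" and "\<And>q r. i0 \<le> q \<Longrightarrow> Suc q \<le> k0 \<Longrightarrow> j0 \<le> r \<Longrightarrow> Suc r \<le> l0 \<Longrightarrow> \<mu> \<le> (x (Suc q) - x q) * (y (Suc r) - y r)"
proof -
  let ?A = "{M' \<in> mesh n m x y. M' \<subseteq> {x i0..x k0} \<times> {y j0..y l0}}"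
  have fin: "finite (measure lebesgue ` ?A)" using finite_mesh[of n m x y] by simp
  have meas: "measure lebesgue (macro x y q r) = (x (Suc q) - x q) * (y (Suc r) - y r)"
    "0 < (x (Suc q) - x q) * (y (Suc r) - y r)" if "q < n" "r < m" for q r
  proof -
    have "x q < x (Suc q)" "y r < y (Suc r)"
      using strict_mono_on_index(1)[OF x] strict_mono_on_index(1)[OF y] that by simp_all
    then show "measure lebesgue (macro x y q r) = (x (Suc q) - x q) * (y (Suc r) - y r)"
      "0 < (x (Suc q) - x q) * (y (Suc r) - y r)"
      unfolding macro_def by (simp_all add: measure_rectangle)
  qed
  have mem: "macro x y q r \<in> ?A" if "i0 \<le> q" "Suc q \<le> k0" "j0 \<le> r" "Suc r \<le> l0" for q r
  proof -
    have qr: "q < n" "r < m" using that k l by simp_all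
    have "x i0 \<le> x q" "x (Suc q) \<le> x k0" "y j0 \<le> y r" "y (Suc r) \<le> y l0"
      using strict_mono_on_index(2)[OF x] strict_mono_on_index(2)[OF y] that k l qr by simp_all
    then have "macro x y q r \<subseteq> {x i0..x k0} \<times> {y j0..y l0}"
      unfolding macro_def by (intro Sigma_mono) simp_all
    moreover have "macro x y q r \<in> mesh n m x y" unfolding mesh_def using qr by blast
    ultimately show ?thesis by simp
  qed
  show "\<mu> \<le> (x (Suc q) - x q) * (y (Suc r) - y r)" if "i0 \<le> q" "Suc q \<le> k0" "j0 \<le> r" "Suc r \<le> l0" for q r
    unfolding \<mu> using Min_le[OF fin imageI[OF mem[OF that]]] meas(1)[of q r] that k l by simp
  \<comment> \<open>The element at the lower left corner of the patch shows that the minimum runs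
    over a nonempty set.\<close>
  have ne': "measure lebesgue ` ?A \<noteq> {}" using mem[of i0 j0] ne by (simp only: image_is_empty) (metis Suc_leI empty_iff order_refl)
  have "\<mu> \<in> measure lebesgue ` ?A" unfolding \<mu> by (rule Min_in[OF fin ne'])
  then obtain M' where M': "M' \<in> mesh n m x y" "\<mu> = measure lebesgue M'" by auto
  then obtain q r where "M' = macro x y q r" "q < n" "r < m" unfolding mesh_def by auto
  then show "0 < \<mu>" using meas[of q r] M'(2) by simp
qed

lemma side_rectangle:
  assumes "a \<le> b" "c \<le> d"
  shows "side1 ({a..b} \<times> {c..d}) = b - a" "side2 ({a..b} \<times> {c..d}) = d - c"
proof -
  have "fst ` ({a..b} \<times> {c..d}) = {a..b}" "snd ` ({a..b} \<times> {c..d}) = {c..d}"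
    using assms by (simp_all add: fst_image_times snd_image_times)
  then show "side1 ({a..b} \<times> {c..d}) = b - a" "side2 ({a..b} \<times> {c..d}) = d - c"
    unfolding side1_def side2_def using assms by simp_all
qed

subsection \<open>The interpolation error as a continuously differentiable function\<close>

lemma hermite_sum_DERIV_1:
  assumes "\<And>e. e \<in> {a, b} \<Longrightarrow> ((\<lambda>t. \<phi> e t) has_real_derivative d\<phi> e) (at x within S)"
    "\<And>e. e \<in> {a, b} \<Longrightarrow> ((\<lambda>t. \<psi> e t) has_real_derivative d\<psi> e) (at x within S)"
  shows "((\<lambda>t. hermite_sum a b c d U V W A (\<lambda>e. \<phi> e t) (\<lambda>e. \<psi> e t) \<phi>' \<psi>') has_real_derivative
    hermite_sum a b c d U V W A d\<phi> d\<psi> \<phi>' \<psi>') (at x within S)"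
  unfolding hermite_sum_def by (intro DERIV_sum DERIV_add DERIV_cmult_right DERIV_cmult assms)

lemma hermite_sum_DERIV_2:
  assumes "\<And>e. e \<in> {c, d} \<Longrightarrow> ((\<lambda>t. \<phi>' e t) has_real_derivative d\<phi> e) (at x within S)"
    "\<And>e. e \<in> {c, d} \<Longrightarrow> ((\<lambda>t. \<psi>' e t) has_real_derivative d\<psi> e) (at x within S)"
  shows "((\<lambda>t. hermite_sum a b c d U V W A \<phi> \<psi> (\<lambda>e. \<phi>' e t) (\<lambda>e. \<psi>' e t)) has_real_derivative
    hermite_sum a b c d U V W A \<phi> \<psi> d\<phi> d\<psi>) (at x within S)"
  unfolding hermite_sum_def by (intro DERIV_sum DERIV_add DERIV_cmult assms)

text \<open>The coefficients occur only in the terms with two psi factors, one for each of the 4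
  vertices.\<close>

lemma hermite_sum_diff_le:
  assumes "a \<noteq> b" "c \<noteq> d"
    and A: "\<And>e f. e \<in> {a, b} \<Longrightarrow> f \<in> {c, d} \<Longrightarrow> \<bar>A (e, f) - A' (e, f)\<bar> \<le> \<delta>"
    and \<psi>: "\<And>e. e \<in> {a, b} \<Longrightarrow> \<bar>\<psi> e\<bar> \<le> r" and \<psi>': "\<And>f. f \<in> {c, d} \<Longrightarrow> \<bar>\<psi>' f\<bar> \<le> s"
  shows "\<bar>hermite_sum a b c d U V W A \<phi> \<psi> \<phi>' \<psi>' - hermite_sum a b c d U V W A' \<phi> \<psi> \<phi>' \<psi>'\<bar> \<le> 4 * (\<delta> * r * s)"
proof -
  have "hermite_sum a b c d U V W A \<phi> \<psi> \<phi>' \<psi>' - hermite_sum a b c d U V W A' \<phi> \<psi> \<phi>' \<psi>' =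
    (\<Sum>e\<in>{a, b}. \<Sum>f\<in>{c, d}. (A (e, f) - A' (e, f)) * \<psi> e * \<psi>' f)"
    unfolding hermite_sum_def sum_subtractf[symmetric] by (intro sum.cong refl) (simp add: algebra_simps)
  also have "\<bar>\<dots>\<bar> \<le> (\<Sum>e\<in>{a, b}. \<bar>\<Sum>f\<in>{c, d}. (A (e, f) - A' (e, f)) * \<psi> e * \<psi>' f\<bar>)"
    by (rule sum_abs)
  also have "\<dots> \<le> (\<Sum>e\<in>{a, b}. \<Sum>f\<in>{c, d}. \<bar>(A (e, f) - A' (e, f)) * \<psi> e * \<psi>' f\<bar>)"
    by (intro sum_mono sum_abs)
  also have "\<dots> \<le> (\<Sum>e\<in>{a, b}. \<Sum>f\<in>{c, d}. \<delta> * r * s)"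
    by (intro sum_mono abs_mult_le A \<psi> \<psi>')
  also have "\<dots> = 4 * (\<delta> * r * s)" using assms(1,2) by simp
  finally show ?thesis .
qed

context ivl
begin

lemma spline_basis:
  assumes "e \<in> {a, b}"
  shows "spline_phi a b e \<in> splines a b" "spline_psi a b e \<in> splines a b"
    and "\<And>t. t \<in> {a..b} \<Longrightarrow> \<bar>deriv_on a b (spline_psi a b e) t\<bar> \<le> 1"
    and "\<And>t. t \<in> {a..b} \<Longrightarrow> \<bar>spline_psi a b e t\<bar> \<le> b - a"
proof -
  from assms consider "e = a" | "e = b" by blast
  then show "spline_phi a b e \<in> splines a b" "spline_psi a b e \<in> splines a b"
    by (cases; simp only: spline_mem)+
  from assms show "\<bar>deriv_on a b (spline_psi a b e) t\<bar> \<le> 1" "\<bar>spline_psi a b e t\<bar> \<le> b - a" if "t \<in> {a..b}" for t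
    using spline_bounds(2,3,6,7)[OF that] by blast+
qed

lemma splines_continuous:
  assumes "f \<in> splines a b"
  shows "continuous_on {a..b} f" "continuous_on {a..b} (deriv_on a b f)"
  using assms differentiable_imp_continuous_on unfolding splines_def by blast+

end

context rect
begin

lemma CR_times: "CR = {a..b} \<times> {c..d}"
  by (simp add: cbox_Pair_eq)

lemma hermite_sum_continuous:
  assumes "\<And>e. e \<in> {a, b} \<Longrightarrow> continuous_on {a..b} (\<phi> e)" "\<And>e. e \<in> {a, b} \<Longrightarrow> continuous_on {a..b} (\<psi> e)"
    "\<And>f. f \<in> {c, d} \<Longrightarrow> continuous_on {c..d} (\<phi>' f)" "\<And>f. f \<in> {c, d} \<Longrightarrow> continuous_on {c..d} (\<psi>' f)"
  shows "continuous_on CR (\<lambda>z. hermite_sum a b c d U V W A (\<lambda>e. \<phi> e (fst z)) (\<lambda>e. \<psi> e (fst z)) (\<lambda>f. \<phi>' f (snd z)) (\<lambda>f. \<psi>' f (snd z)))"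
proof -
  have 1: "continuous_on CR (\<lambda>z. g (fst z))" if "continuous_on {a..b} g" for g :: "real \<Rightarrow> real"
    by (rule continuous_on_compose2[OF that]) (auto simp: CR_times intro!: continuous_intros)
  have 2: "continuous_on CR (\<lambda>z. g (snd z))" if "continuous_on {c..d} g" for g :: "real \<Rightarrow> real"
    by (rule continuous_on_compose2[OF that]) (auto simp: CR_times intro!: continuous_intros)
  show ?thesis
    unfolding hermite_sum_def
    by (intro continuous_on_sum continuous_on_add continuous_on_mult continuous_on_const 1 2 assms)
qed

text \<open>The splines are 0 outside their interval, hence all derivatives are taken within the
  closed rectangle and identified along slices, where the spline derivatives are known.\<close>

lemma minus_hermite_sum:
  fixes U V W A
  defines "H \<equiv> \<lambda>z. hermite_sum a b c d U V W A (\<lambda>e. spline_phi a b e (fst z)) (\<lambda>e. spline_psi a b e (fst z))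
    (\<lambda>f. spline_phi c d f (snd z)) (\<lambda>f. spline_psi c d f (snd z))"
    and "Hx \<equiv> \<lambda>z. hermite_sum a b c d U V W A (\<lambda>e. deriv_on a b (spline_phi a b e) (fst z)) (\<lambda>e. deriv_on a b (spline_psi a b e) (fst z))
    (\<lambda>f. spline_phi c d f (snd z)) (\<lambda>f. spline_psi c d f (snd z))"
    and "Hy \<equiv> \<lambda>z. hermite_sum a b c d U V W A (\<lambda>e. spline_phi a b e (fst z)) (\<lambda>e. spline_psi a b e (fst z))
    (\<lambda>f. deriv_on c d (spline_phi c d f) (snd z)) (\<lambda>f. deriv_on c d (spline_psi c d f) (snd z))"
  assumes u: "u differentiable_on CR" "continuous_on CR (pdx CR u)" "continuous_on CR (pdy CR u)"
  shows "(\<lambda>z. u z - H z) differentiable_on CR"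
    and "\<And>z. z \<in> CR \<Longrightarrow> pdx CR (\<lambda>z. u z - H z) z = pdx CR u z - Hx z"
    and "\<And>z. z \<in> CR \<Longrightarrow> pdy CR (\<lambda>z. u z - H z) z = pdy CR u z - Hy z"
    and "continuous_on CR (pdx CR (\<lambda>z. u z - H z))" and "continuous_on CR (pdy CR (\<lambda>z. u z - H z))"
proof -
  have 1: "(\<lambda>z. g (fst z)) differentiable (at z within CR)" if g: "g \<in> splines a b" and z: "z \<in> CR" for g z
  proof -
    have im: "fst ` CR = {a..b}" using cd by (simp add: CR_times fst_image_times)
    have "fst z \<in> {a..b}" using z unfolding CR_times by (simp add: mem_Times_iff)
    with g have "g differentiable (at (fst z) within fst ` CR)"
      unfolding im splines_def differentiable_on_def by simp
    from differentiable_chain_within[OF _ this] show ?thesis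
      by (simp add: o_def bounded_linear_imp_differentiable bounded_linear_fst)
  qed
  have 2: "(\<lambda>z. g (snd z)) differentiable (at z within CR)" if g: "g \<in> splines c d" and z: "z \<in> CR" for g z
  proof -
    have im: "snd ` CR = {c..d}" using ab by (simp add: CR_times snd_image_times)
    have "snd z \<in> {c..d}" using z unfolding CR_times by (simp add: mem_Times_iff)
    with g have "g differentiable (at (snd z) within snd ` CR)"
      unfolding im splines_def differentiable_on_def by simp
    from differentiable_chain_within[OF _ this] show ?thesis
      by (simp add: o_def bounded_linear_imp_differentiable bounded_linear_snd)
  qed
  have "H differentiable_on CR"
    unfolding differentiable_on_def H_def hermite_sum_def
    by (intro ballI differentiable_sum differentiable_add differentiable_mult differentiable_const 1 2 X.spline_basis Y.spline_basis finite.intros)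
  with u(1) show diff: "(\<lambda>z. u z - H z) differentiable_on CR" by (rule differentiable_on_diff)
  show px: "pdx CR (\<lambda>z. u z - H z) z = pdx CR u z - Hx z" if "z \<in> CR" for z
  proof -
    obtain x y where z: "z = (x, y)" by (cases z)
    have xy: "x \<in> {a..b}" "y \<in> {c..d}" using that unfolding z CR_times by simp_all
    have "((\<lambda>t. H (t, y)) has_real_derivative Hx (x, y)) (at x within {a..b})"
      unfolding H_def Hx_def fst_conv snd_conv
      by (intro hermite_sum_DERIV_1 X.splines_DERIV X.spline_basis xy)
    from DERIV_diff[OF C1_DERIV(1)[OF u(1) xy] this] show ?thesis
      unfolding z by (rule DERIV_unique_Icc[OF ab xy(1) C1_DERIV(1)[OF diff xy]])
  qed
  show py: "pdy CR (\<lambda>z. u z - H z) z = pdy CR u z - Hy z" if "z \<in> CR" for z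
  proof -
    obtain x y where z: "z = (x, y)" by (cases z)
    have xy: "x \<in> {a..b}" "y \<in> {c..d}" using that unfolding z CR_times by simp_all
    have "((\<lambda>t. H (x, t)) has_real_derivative Hy (x, y)) (at y within {c..d})"
      unfolding H_def Hy_def fst_conv snd_conv
      by (intro hermite_sum_DERIV_2 Y.splines_DERIV Y.spline_basis xy)
    from DERIV_diff[OF C1_DERIV(2)[OF u(1) xy] this] show ?thesis
      unfolding z by (rule DERIV_unique_Icc[OF cd xy(2) C1_DERIV(2)[OF diff xy]])
  qed
  have "continuous_on CR (\<lambda>z. pdx CR u z - Hx z)"
    unfolding Hx_def
    by (intro continuous_on_diff u hermite_sum_continuous X.splines_continuous Y.splines_continuous X.spline_basis Y.spline_basis)
  then show "continuous_on CR (pdx CR (\<lambda>z. u z - H z))" by (subst continuous_on_cong[OF refl px])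
  have "continuous_on CR (\<lambda>z. pdy CR u z - Hy z)"
    unfolding Hy_def
    by (intro continuous_on_diff u hermite_sum_continuous X.splines_continuous Y.splines_continuous X.spline_basis Y.spline_basis)
  then show "continuous_on CR (pdy CR (\<lambda>z. u z - H z))" by (subst continuous_on_cong[OF refl py])
qed

end

subsection \<open>The error estimate\<close>

context rect
begin

text \<open>Triangle inequality through the interpolant with \<open>\<gamma>\<close> as its
  coefficients. In the difference of the two interpolants one psi factor is differentiated and
  bounded by 1, the other is bounded by the side length.\<close>

lemma hermite_interpolation_error:
  fixes A u
  defines "H \<equiv> \<lambda>z. hermite_sum a b c d u (pdx CR u) (pdy CR u) A (\<lambda>e. spline_phi a b e (fst z)) (\<lambda>e. spline_psi a b e (fst z))
    (\<lambda>f. spline_phi c d f (snd z)) (\<lambda>f. spline_psi c d f (snd z))"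
  assumes u: "u differentiable_on CR" "continuous_on CR (pdx CR u)" "continuous_on CR (pdy CR u)"
    and D2: "has_weak_D (pdx CR u) (1, 0) R gxx" "has_weak_D (pdx CR u) (0, 1) R gxy"
      "has_weak_D (pdy CR u) (1, 0) R gxy" "has_weak_D (pdy CR u) (0, 1) R gyy"
    and D3: "has_weak_D gxx (1, 0) R gxxx" "has_weak_D gxx (0, 1) R gxxy" "has_weak_D gxy (1, 0) R gxxy"
      "has_weak_D gxy (0, 1) R gxyy" "has_weak_D gyy (1, 0) R gxyy" "has_weak_D gyy (0, 1) R gyyy"
    and L1: "gxx absolutely_integrable_on R" "gxy absolutely_integrable_on R" "gyy absolutely_integrable_on R"
      "gxxx absolutely_integrable_on R" "gxxy absolutely_integrable_on R" "gxyy absolutely_integrable_on R" "gyyy absolutely_integrable_on R"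
    and \<gamma>: "(b - a) * (d - c) * \<gamma> = integral CR gxy"
    and A: "\<And>e f. e \<in> {a, b} \<Longrightarrow> f \<in> {c, d} \<Longrightarrow> \<bar>A (e, f) - \<gamma>\<bar> \<le> \<delta>"
    and z: "z \<in> CR"
  shows "\<bar>pdx CR (\<lambda>z. u z - H z) z\<bar> \<le> 53 * W2 gxxx gxxy gxyy + 4 * (\<delta> * 1 * (d - c))"
    and "\<bar>pdy CR (\<lambda>z. u z - H z) z\<bar> \<le> 53 * W2 gxxy gxyy gyyy + 4 * (\<delta> * (b - a) * 1)"
proof -
  obtain x y where xy: "z = (x, y)" by (cases z)
  have x: "x \<in> {a..b}" and y: "y \<in> {c..d}" using z unfolding xy CR_times by simp_all
  have ne: "a \<noteq> b" "c \<noteq> d" using ab cd by simp_all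
  note E = interpolation_error[OF u D2 D3 L1 \<gamma> x y]
  note P = minus_hermite_sum(2,3)[OF u z[unfolded xy], where U=u and V="pdx CR u" and W="pdy CR u" and A=A]
  have tri: "\<bar>s - t\<bar> \<le> B + B'" if "\<bar>s - t'\<bar> \<le> B" "\<bar>t - t'\<bar> \<le> B'" for s t t' B B' :: real
    using that by linarith
  show "\<bar>pdx CR (\<lambda>z. u z - H z) z\<bar> \<le> 53 * W2 gxxx gxxy gxyy + 4 * (\<delta> * 1 * (d - c))"
    unfolding H_def xy P(1) fst_conv snd_conv
    by (rule tri[OF E(1)], rule hermite_sum_diff_le[OF ne])
      (rule A X.spline_basis(3)[OF _ x] Y.spline_basis(4)[OF _ y]; assumption)+
  show "\<bar>pdy CR (\<lambda>z. u z - H z) z\<bar> \<le> 53 * W2 gxxy gxyy gyyy + 4 * (\<delta> * (b - a) * 1)"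
    unfolding H_def xy P(2) fst_conv snd_conv
    by (rule tri[OF E(2)], rule hermite_sum_diff_le[OF ne])
      (rule A X.spline_basis(4)[OF _ x] Y.spline_basis(3)[OF _ y]; assumption)+
qed

text \<open>Each term of \<open>W2\<close> can be written as a side of the small rectangle times an
  L1 norm divided by a side, so it gains two side lengths in all.\<close>

lemma W2_le:
  assumes p: "1 \<le> p" and M: "a \<le> a2" "a2 < b2" "b2 \<le> b" "c \<le> c2" "c2 < d2" "d2 \<le> d"
    and \<mu>: "0 < \<mu>" "\<mu> \<le> (b2 - a2) * (d2 - c2)"
    and f: "f \<in> Lp p R" "g \<in> Lp p R" "h \<in> Lp p R"
  shows "rect.W2 a2 b2 c2 d2 f g h \<le> 2 * \<mu> powr (- real_of_ereal (1 / p)) *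
    ((b2 - a2)\<^sup>2 * Lp_norm p R f + (b2 - a2) * (d2 - c2) * Lp_norm p R g + (d2 - c2)\<^sup>2 * Lp_norm p R h)"
proof -
  interpret M: rect a2 b2 c2 d2 using M by unfold_locales
  let ?q = "\<mu> powr (- real_of_ereal (1 / p))"
  define h1 h2 where "h1 = b2 - a2" and "h2 = d2 - c2"
  have h: "0 < h1" "0 < h2" using M by (simp_all add: h1_def h2_def)
  note S = Lp_integral_over_side[OF p _ M \<mu>, folded h1_def h2_def]
  have 1: "h1 * (M.I1 f / h2) \<le> h1 * (2 * h1 * ?q * Lp_norm p R f)"
    using h by (intro mult_left_mono S(2)[OF f(1)]) simp
  have 2: "h1 * (M.I1 g / h1) \<le> h1 * (2 * h2 * ?q * Lp_norm p R g)"
    using h by (intro mult_left_mono S(1)[OF f(2)]) simp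
  have 3: "h2 * (M.I1 h / h1) \<le> h2 * (2 * h2 * ?q * Lp_norm p R h)"
    using h by (intro mult_left_mono S(1)[OF f(3)]) simp
  have "M.W2 f g h = h1 * (M.I1 f / h2) + h1 * (M.I1 g / h1) + h2 * (M.I1 h / h1)"
    unfolding M.W2_def h1_def[symmetric] h2_def[symmetric] using h by simp
  also have "\<dots> \<le> h1 * (2 * h1 * ?q * Lp_norm p R f) + h1 * (2 * h2 * ?q * Lp_norm p R g) + h2 * (2 * h2 * ?q * Lp_norm p R h)"
    by (intro add_mono 1 2 3)
  also have "\<dots> = 2 * ?q * (h1\<^sup>2 * Lp_norm p R f + h1 * h2 * Lp_norm p R g + h2\<^sup>2 * Lp_norm p R h)"
    by (simp add: algebra_simps power2_eq_square)
  finally show ?thesis unfolding h1_def h2_def .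
qed

text \<open>\<open>t\<close> is the coefficient \<open>a\<^sub>X\<close>, \<open>X = (e, f)\<close>, for one of the two edges at \<open>X\<close> of a rectangle of area at least \<open>\<mu>\<close>.\<close>

definition edge_functional :: "(real \<times> real \<Rightarrow> real) \<Rightarrow> real \<Rightarrow> real \<Rightarrow> real \<Rightarrow> real \<Rightarrow> bool" where
  "edge_functional w \<mu> e f t \<longleftrightarrow> (\<exists>a1 b1 c1 d1. a \<le> a1 \<and> a1 < b1 \<and> b1 \<le> b \<and> c \<le> c1 \<and> c1 < d1 \<and> d1 \<le> d \<and>
     e \<in> {a1, b1} \<and> f \<in> {c1, d1} \<and> \<mu> \<le> (b1 - a1) * (d1 - c1) \<and>
     (t = (LINT s:{a1..b1}|lebesgue. edge_trace R (\<lambda>s. (s, f)) {a1..b1} w s * dual_fun a1 b1 e s) \<or>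
      t = (LINT s:{c1..d1}|lebesgue. edge_trace R (\<lambda>s. (e, s)) {c1..d1} w s * dual_fun c1 d1 f s)))"

lemma edge_functionalI:
  assumes "a \<le> a1" "a1 < b1" "b1 \<le> b" "c \<le> c1" "c1 < d1" "d1 \<le> d" "e \<in> {a1, b1}" "f \<in> {c1, d1}"
    and "\<mu> \<le> (b1 - a1) * (d1 - c1)"
    and "t = (LINT s:{a1..b1}|lebesgue. edge_trace R (\<lambda>s. (s, f)) {a1..b1} w s * dual_fun a1 b1 e s) \<or>
      t = (LINT s:{c1..d1}|lebesgue. edge_trace R (\<lambda>s. (e, s)) {c1..d1} w s * dual_fun c1 d1 f s)"
  shows "edge_functional w \<mu> e f t"
  unfolding edge_functional_def
  by (rule exI[of _ a1], rule exI[of _ b1], rule exI[of _ c1], rule exI[of _ d1], intro conjI) (rule assms)+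

lemma edge_functional_error:
  assumes p: "1 \<le> p" and M: "a \<le> a2" "a2 < b2" "b2 \<le> b" "c \<le> c2" "c2 < d2" "d2 \<le> d"
    and \<mu>: "0 < \<mu>" "\<mu> \<le> (b2 - a2) * (d2 - c2)"
    and C0: "b - a \<le> C0 * (b2 - a2)" "d - c \<le> C0 * (d2 - c2)"
    and w: "w \<in> Lp p R" "wx \<in> Lp p R" "wy \<in> Lp p R"
    and Dw: "has_weak_D w (1, 0) R wx" "has_weak_D w (0, 1) R wy"
    and m: "(b2 - a2) * (d2 - c2) * m = integral (cbox (a2, c2) (b2, d2)) w"
    and t: "edge_functional w \<mu> e f t"
  shows "\<bar>t - m\<bar> \<le> 32 * C0 * \<mu> powr (- real_of_ereal (1 / p)) *
    ((b2 - a2) * Lp_norm p R wx + (d2 - c2) * Lp_norm p R wy)"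
proof -
  obtain a1 b1 c1 d1 where J: "a \<le> a1" "a1 < b1" "b1 \<le> b" and K: "c \<le> c1" "c1 < d1" "d1 \<le> d"
    and ef: "e \<in> {a1, b1}" "f \<in> {c1, d1}" and \<mu>1: "\<mu> \<le> (b1 - a1) * (d1 - c1)"
    and t': "t = (LINT s:{a1..b1}|lebesgue. edge_trace R (\<lambda>s. (s, f)) {a1..b1} w s * dual_fun a1 b1 e s) \<or>
      t = (LINT s:{c1..d1}|lebesgue. edge_trace R (\<lambda>s. (e, s)) {c1..d1} w s * dual_fun c1 d1 f s)"
    using t unfolding edge_functional_def by blast
  interpret J: ivl a1 b1 using J by unfold_locales
  interpret K: ivl c1 d1 using K by unfold_locales
  note ai = Lp_absolutely_integrable[OF p w(1)] Lp_absolutely_integrable[OF p w(2)] Lp_absolutely_integrable[OF p w(3)]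
  let ?q = "\<mu> powr (- real_of_ereal (1 / p))"
  \<comment> \<open>\<open>X\<close> and \<open>Y\<close> bound, up to the factor 2, the quotients
    of L1 norms of \<open>wx\<close> and \<open>wy\<close> by a side, since no side of a rectangle
    in the patch exceeds \<open>C0\<close> times the corresponding side of the
    macro-element.\<close>
  define X where "X = C0 * (b2 - a2) * ?q * Lp_norm p R wx"
  define Y where "Y = C0 * (d2 - c2) * ?q * Lp_norm p R wy"
  have n: "0 \<le> Lp_norm p R wx" "0 \<le> Lp_norm p R wy" by (rule Lp_norm_nonneg[OF p w(2)], rule Lp_norm_nonneg[OF p w(3)])
  have X: "2 * r * ?q * Lp_norm p R wx \<le> 2 * X" if "r \<le> b - a" for r
    unfolding X_def using that C0(1) n(1) mult_right_mono[of r "C0 * (b2 - a2)" "?q * Lp_norm p R wx"] by (simp add: mult.assoc)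
  have Y: "2 * r * ?q * Lp_norm p R wy \<le> 2 * Y" if "r \<le> d - c" for r
    unfolding Y_def using that C0(2) n(2) mult_right_mono[of r "C0 * (d2 - c2)" "?q * Lp_norm p R wy"] by (simp add: mult.assoc)
  have X0: "0 \<le> X" and Y0: "0 \<le> Y"
  proof -
    have "0 \<le> 2 * (b - a) * ?q * Lp_norm p R wx" "0 \<le> 2 * (d - c) * ?q * Lp_norm p R wy" using n ab cd by simp_all
    then show "0 \<le> X" "0 \<le> Y" using X[of "b - a"] Y[of "d - c"] by simp_all
  qed
  have area: "\<mu> \<le> r * s" if "\<mu> \<le> r' * s'" "r' \<le> r" "s' \<le> s" "0 < r'" "0 < s'" for r s r' s'
    using that by (intro order_trans[OF that(1)] mult_mono) simp_all
  \<comment> \<open>The strips contain the cell next to the edge or the macro-element, so their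
    areas are at least \<open>\<mu>\<close> as well.\<close>
  have \<mu>2: "\<mu> \<le> (b - a) * (d1 - c1)" "\<mu> \<le> (b1 - a1) * (d - c)" by (rule area[OF \<mu>1]; use J K in simp)+
  have \<mu>3: "\<mu> \<le> (b2 - a2) * (d - c)" "\<mu> \<le> (b - a) * (d2 - c2)" by (rule area[OF \<mu>(2)]; use M in simp)+
  have le: "a \<le> a" "b \<le> b" "c \<le> c" "d \<le> d" by simp_all
  \<comment> \<open>Three terms with the factor 8 * 2: two of them fall on one of \<open>X\<close>
    and \<open>Y\<close>, giving 32, and one on the other, giving 16.\<close>
  have "\<bar>t - m\<bar> \<le> 32 * (X + Y)"
    using t'
  proof
    assume tt: "t = (LINT s:{a1..b1}|lebesgue. edge_trace R (\<lambda>s. (s, f)) {a1..b1} w s * dual_fun a1 b1 e s)"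
    have tr: "has_trace w R (\<lambda>s. (s, f)) {a1..b1} (edge_trace R (\<lambda>s. (s, f)) {a1..b1} w)"
      unfolding edge_trace_def by (rule someI_ex[OF ex_trace(1)[OF ai Dw J K ef(2)]])
    have f': "f \<in> {c1..d1}" using ef(2) K by auto
    have "\<bar>t - m\<bar> \<le> 8 * (integral (cbox (a1, c1) (b1, d1)) (\<lambda>z. \<bar>wy z\<bar>) / (b1 - a1) +
      integral (cbox (a, c1) (b, d1)) (\<lambda>z. \<bar>wx z\<bar>) / (d1 - c1) + integral (cbox (a2, c) (b2, d)) (\<lambda>z. \<bar>wy z\<bar>) / (b2 - a2))"
      unfolding tt by (rule trace_functional_horizontal[OF ai Dw J K f' M m tr J.dual_fun_props[OF ef(1)]])
    also have "\<dots> \<le> 8 * (2 * Y + 2 * X + 2 * Y)"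
    proof (intro mult_left_mono add_mono)
      show "integral (cbox (a1, c1) (b1, d1)) (\<lambda>z. \<bar>wy z\<bar>) / (b1 - a1) \<le> 2 * Y"
        by (rule order_trans[OF Lp_integral_over_side(1)[OF p w(3) J K \<mu>(1) \<mu>1] Y]) (use K in simp)
      show "integral (cbox (a, c1) (b, d1)) (\<lambda>z. \<bar>wx z\<bar>) / (d1 - c1) \<le> 2 * X"
        by (rule order_trans[OF Lp_integral_over_side(2)[OF p w(2) le(1) ab le(2) K \<mu>(1) \<mu>2(1)] X]) simp
      show "integral (cbox (a2, c) (b2, d)) (\<lambda>z. \<bar>wy z\<bar>) / (b2 - a2) \<le> 2 * Y"
        by (rule order_trans[OF Lp_integral_over_side(1)[OF p w(3) M(1-3) le(3) cd le(4) \<mu>(1) \<mu>3(1)] Y]) simp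
    qed simp
    finally show ?thesis using X0 by simp
  next
    assume tt: "t = (LINT s:{c1..d1}|lebesgue. edge_trace R (\<lambda>s. (e, s)) {c1..d1} w s * dual_fun c1 d1 f s)"
    have tr: "has_trace w R (\<lambda>s. (e, s)) {c1..d1} (edge_trace R (\<lambda>s. (e, s)) {c1..d1} w)"
      unfolding edge_trace_def by (rule someI_ex[OF ex_trace(2)[OF ai Dw J K ef(1)]])
    have e': "e \<in> {a1..b1}" using ef(1) J by auto
    have "\<bar>t - m\<bar> \<le> 8 * (integral (cbox (a1, c1) (b1, d1)) (\<lambda>z. \<bar>wx z\<bar>) / (d1 - c1) +
      integral (cbox (a1, c) (b1, d)) (\<lambda>z. \<bar>wy z\<bar>) / (b1 - a1) + integral (cbox (a, c2) (b, d2)) (\<lambda>z. \<bar>wx z\<bar>) / (d2 - c2))"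
      unfolding tt by (rule trace_functional_vertical[OF ai Dw J K e' M m tr K.dual_fun_props[OF ef(2)]])
    also have "\<dots> \<le> 8 * (2 * X + 2 * Y + 2 * X)"
    proof (intro mult_left_mono add_mono)
      show "integral (cbox (a1, c1) (b1, d1)) (\<lambda>z. \<bar>wx z\<bar>) / (d1 - c1) \<le> 2 * X"
        by (rule order_trans[OF Lp_integral_over_side(2)[OF p w(2) J K \<mu>(1) \<mu>1] X]) (use J in simp)
      show "integral (cbox (a1, c) (b1, d)) (\<lambda>z. \<bar>wy z\<bar>) / (b1 - a1) \<le> 2 * Y"
        by (rule order_trans[OF Lp_integral_over_side(1)[OF p w(3) J le(3) cd le(4) \<mu>(1) \<mu>2(2)] Y]) simp
      show "integral (cbox (a, c2) (b, d2)) (\<lambda>z. \<bar>wx z\<bar>) / (d2 - c2) \<le> 2 * X"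
        by (rule order_trans[OF Lp_integral_over_side(2)[OF p w(2) le(1) ab le(2) M(4-6) \<mu>(1) \<mu>3(2)] X]) simp
    qed simp
    finally show ?thesis using Y0 by simp
  qed
  then show ?thesis unfolding X_def Y_def by (simp add: algebra_simps)
qed

lemma quasi_interpolation_error:
  fixes A u a2 b2 c2 d2
  defines "N \<equiv> cbox (a2, c2) (b2, d2)" and "D \<equiv> box (a2, c2) (b2, d2)"
  defines "H \<equiv> \<lambda>z. hermite_sum a2 b2 c2 d2 u (pdx N u) (pdy N u) A (\<lambda>e. spline_phi a2 b2 e (fst z)) (\<lambda>e. spline_psi a2 b2 e (fst z))
    (\<lambda>f. spline_phi c2 d2 f (snd z)) (\<lambda>f. spline_psi c2 d2 f (snd z))"
  assumes p: "1 \<le> p" and M: "a \<le> a2" "a2 < b2" "b2 \<le> b" "c \<le> c2" "c2 < d2" "d2 \<le> d"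
    and \<mu>: "0 < \<mu>" "\<mu> \<le> (b2 - a2) * (d2 - c2)"
    and C0: "b - a \<le> C0 * (b2 - a2)" "d - c \<le> C0 * (d2 - c2)"
    and u: "u \<in> sobolev 3 p R" "Ck_on 1 N u"
    and A: "\<And>e f. e \<in> {a2, b2} \<Longrightarrow> f \<in> {c2, d2} \<Longrightarrow> edge_functional (weak_D R (1, 1) u) \<mu> e f (A (e, f))"
  shows "(\<lambda>z. u z - H z) \<in> sobolev 1 p D"
    and "sobolev_seminorm 1 p D (\<lambda>z. u z - H z) \<le> 2 * (106 + 128 * C0) *
      ((b2 - a2) * (d2 - c2) / \<mu>) powr real_of_ereal (1 / p) *
      ((b2 - a2)\<^sup>2 * sobolev_seminorm 1 p R (weak_D R (2, 0) u) +
       (b2 - a2) * (d2 - c2) * sobolev_seminorm 1 p R (weak_D R (1, 1) u) +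
       (d2 - c2)\<^sup>2 * sobolev_seminorm 1 p R (weak_D R (0, 2) u))"
proof -
  interpret M: rect a2 b2 c2 d2 using M by unfold_locales
  \<comment> \<open>All derivative relations are stated between these chosen representatives, so
    that null sets need not be tracked from here on.\<close>
  define G where "G m n = weak_D R (m, n) u" for m n
  have G: "G m n \<in> Lp p R" "has_weak_D u (m, n) R (G m n)" if "m + n \<le> 3" for m n
  proof -
    have "(m, n) \<in> multi_indices (m + n)" by (simp add: multi_indices_def)
    then have "\<exists>g\<in>Lp p R. has_weak_D u (m, n) R g"
      by (rule conjunct2[OF u(1)[unfolded sobolev_def mem_Collect_eq], rule_format, OF that])
    then obtain g where g: "g \<in> Lp p R" "has_weak_D u (m, n) R g" by blast
    show "G m n \<in> Lp p R" unfolding G_def by (rule Lp_cong_AE(1)[OF g(1) weak_D_AE(2)[OF g(2)] R_lebesgue(1)])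
    show "has_weak_D u (m, n) R (G m n)" unfolding G_def by (rule weak_D_AE(1)[OF g(2)])
  qed
  have Gx: "has_weak_D (G m n) (1, 0) R (G m' n)" if "m' = Suc m" "m' + n \<le> 3" for m m' n
    using has_weak_D_compose(1)[OF G(2)] G(2) that by simp
  have Gy: "has_weak_D (G m n) (0, 1) R (G m n')" if "n' = Suc n" "m + n' \<le> 3" for m n n'
    using has_weak_D_compose(2)[OF G(2)] G(2) that by simp
  have DR: "D \<subseteq> R" unfolding D_def using M by (intro subset_box_imp) (simp add: Basis_prod_def)
  have NC: "N \<subseteq> CR" unfolding N_def using M by (intro subset_box_imp) (simp add: Basis_prod_def)
  have GD: "has_weak_D u (m, n) D (G m n)" if "m + n \<le> 3" for m n
    by (rule has_weak_D_subset[OF G(2)[OF that] DR])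
  have Gi: "G m n absolutely_integrable_on D" if "m + n \<le> 3" for m n
    by (rule absolutely_integrable_CR[OF Lp_absolutely_integrable[OF p G(1)[OF that]]]) (unfold D_def, rule order_trans[OF DR[unfolded D_def] R_subset_CR], rule M.R_lebesgue(1))
  have uN: "u differentiable_on N" "continuous_on N (pdx N u)" "continuous_on N (pdy N u)"
    using u(2) by simp_all
  note ux = M.C1_has_weak_D(1)[folded N_def D_def, OF uN(1,2)] and uy = M.C1_has_weak_D(2)[folded N_def D_def, OF uN(1,3)]
  have D2: "has_weak_D (pdx N u) (1, 0) D (G 2 0)" "has_weak_D (pdx N u) (0, 1) D (G 1 1)"
    "has_weak_D (pdy N u) (1, 0) D (G 1 1)" "has_weak_D (pdy N u) (0, 1) D (G 0 2)"
    by (rule has_weak_D_compose(1)[OF ux] has_weak_D_compose(2)[OF ux] has_weak_D_compose(1)[OF uy] has_weak_D_compose(2)[OF uy];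
        use GD[of 2 0] GD[of 1 1] GD[of 0 2] in \<open>simp only: numeral_2_eq_2 One_nat_def add_0_right add_0_left add_Suc; simp\<close>)+
  have D3: "has_weak_D (G 2 0) (1, 0) D (G 3 0)" "has_weak_D (G 2 0) (0, 1) D (G 2 1)" "has_weak_D (G 1 1) (1, 0) D (G 2 1)"
    "has_weak_D (G 1 1) (0, 1) D (G 1 2)" "has_weak_D (G 0 2) (1, 0) D (G 1 2)" "has_weak_D (G 0 2) (0, 1) D (G 0 3)"
    by (rule has_weak_D_subset[OF Gx DR] has_weak_D_subset[OF Gy DR]; simp)+
  define h1 h2 where "h1 = b2 - a2" and "h2 = d2 - c2"
  have h: "0 < h1" "0 < h2" using M by (simp_all add: h1_def h2_def)
  define s q where "s = real_of_ereal (1 / p)" and "q = \<mu> powr (- s)"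
  have q: "0 < q" using \<mu>(1) by (simp add: q_def)
  define n where "n i j = Lp_norm p R (G i j)" for i j
  have n0: "0 \<le> n i j" if "i + j \<le> 3" for i j unfolding n_def by (rule Lp_norm_nonneg[OF p G(1)[OF that]])
  define S where "S i j = sobolev_seminorm 1 p R (G i j)" for i j
  have S: "n (Suc i) j \<le> S i j" "n i (Suc j) \<le> S i j" if "i + j = 2" for i j
  proof -
    let ?r = "\<lambda>\<beta>. Lp_norm p R (weak_D R \<beta> (G i j))"
    have ij: "i + j \<le> 3" "Suc i + j \<le> 3" "i + Suc j \<le> 3" using that by simp_all
    have r: "?r (1, 0) = n (Suc i) j" "?r (0, 1) = n i (Suc j)"
      unfolding n_def
      by (rule Lp_cong_AE(2)[OF G(1)[OF ij(2)] weak_D_AE(2)[OF Gx[OF refl ij(2)]] R_lebesgue(1)],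
          rule Lp_cong_AE(2)[OF G(1)[OF ij(3)] weak_D_AE(2)[OF Gy[OF refl ij(3)]] R_lebesgue(1)])
    have "?r (1, 0) \<le> S i j \<and> ?r (0, 1) \<le> S i j"
      unfolding S_def sobolev_seminorm_def multi_indices_1
      by (intro conjI lp_combine_bounds(1,2)[OF p]) (simp_all only: r n0 ij, simp_all)
    then show "n (Suc i) j \<le> S i j" "n i (Suc j) \<le> S i j" unfolding r by simp_all
  qed
  \<comment> \<open>A mixed third derivative is a first derivative of two different second ones.
    Choosing between them lets the same \<open>T\<close> dominate the bounds for both components of
    the gradient.\<close>
  have Sn: "n 3 0 \<le> S 2 0" "n 2 1 \<le> S 2 0" "n 2 1 \<le> S 1 1" "n 1 2 \<le> S 1 1" "n 1 2 \<le> S 0 2" "n 0 3 \<le> S 0 2"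
    using S[of 2 0] S[of 1 1] S[of 0 2] by (simp_all add: numeral_2_eq_2 numeral_3_eq_3)
  define T where "T = h1\<^sup>2 * S 2 0 + h1 * h2 * S 1 1 + h2\<^sup>2 * S 0 2"
  have TT: "h1\<^sup>2 * r1 + h1 * h2 * r2 + h2\<^sup>2 * r3 \<le> T" if "r1 \<le> S 2 0" "r2 \<le> S 1 1" "r3 \<le> S 0 2" for r1 r2 r3
    unfolding T_def using h that by (intro add_mono mult_left_mono) simp_all
  note W = W2_le[OF p M \<mu>, folded s_def q_def h1_def h2_def]
  have W1: "M.W2 (G 3 0) (G 2 1) (G 1 2) \<le> 2 * q * T" "M.W2 (G 2 1) (G 1 2) (G 0 3) \<le> 2 * q * T"
    by (rule order_trans[OF W]; use q TT Sn in \<open>simp add: G n_def\<close>)+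
  define m where "m = integral N (G 1 1) / (h1 * h2)"
  have m: "(b2 - a2) * (d2 - c2) * m = integral N (G 1 1)"
    unfolding m_def h1_def[symmetric] h2_def[symmetric] using h by simp
  define \<delta> where "\<delta> = 32 * C0 * q * (h1 * n 2 1 + h2 * n 1 2)"
  have d: "\<bar>A (e, f) - m\<bar> \<le> \<delta>" if "e \<in> {a2, b2}" "f \<in> {c2, d2}" for e f
    unfolding \<delta>_def q_def s_def n_def h1_def h2_def
    by (rule edge_functional_error[OF p M \<mu> C0 _ _ _ _ _ m[unfolded N_def] A[OF that, folded G_def]])
      (rule G Gx Gy; simp)+
  have C: "0 \<le> C0"
  proof -
    have "0 < C0 * (b2 - a2)" using C0(1) ab by linarith
    then show ?thesis using M by (simp add: zero_less_mult_iff)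
  qed
  have n12: "0 \<le> n 2 1" "0 \<le> n 1 2" using n0 by simp_all
  have S0: "0 \<le> S 2 0" "0 \<le> S 0 2" using Sn n0[of 2 1] n0[of 1 2] by linarith+
  \<comment> \<open>The absent term is padded with 0 to match the shape of \<open>T\<close>, which
    uses that the seminorms are nonnegative; 128 = 4 * 32.\<close>
  have dT: "4 * (\<delta> * 1 * h2) \<le> 128 * C0 * q * T" "4 * (\<delta> * h1 * 1) \<le> 128 * C0 * q * T"
  proof -
    have "4 * (\<delta> * 1 * h2) = 128 * C0 * q * (h1\<^sup>2 * 0 + h1 * h2 * n 2 1 + h2\<^sup>2 * n 1 2)"
      by (simp add: \<delta>_def algebra_simps power2_eq_square)
    also have "\<dots> \<le> 128 * C0 * q * T" using C q S0 Sn by (intro mult_left_mono TT) simp_all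
    finally show "4 * (\<delta> * 1 * h2) \<le> 128 * C0 * q * T" .
    have "4 * (\<delta> * h1 * 1) = 128 * C0 * q * (h1\<^sup>2 * n 2 1 + h1 * h2 * n 1 2 + h2\<^sup>2 * 0)"
      by (simp add: \<delta>_def algebra_simps power2_eq_square)
    also have "\<dots> \<le> 128 * C0 * q * T" using C q S0 Sn by (intro mult_left_mono TT) simp_all
    finally show "4 * (\<delta> * h1 * 1) \<le> 128 * C0 * q * T" .
  qed
  have Gi': "G 2 0 absolutely_integrable_on D" "G 1 1 absolutely_integrable_on D" "G 0 2 absolutely_integrable_on D"
    "G 3 0 absolutely_integrable_on D" "G 2 1 absolutely_integrable_on D" "G 1 2 absolutely_integrable_on D" "G 0 3 absolutely_integrable_on D"
    by (rule Gi; simp)+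
  note E = M.hermite_interpolation_error[folded N_def D_def, where A=A and u=u, OF uN D2 D3 Gi' m d, folded h1_def h2_def]
  \<comment> \<open>106 = 53 * 2 stems from the interpolation with the mean, 128 \<open>C0\<close>
    from replacing the mean by the coefficients.\<close>
  let ?B = "(106 + 128 * C0) * (q * T)"
  have B: "\<bar>pdx N (\<lambda>z. u z - H z) z\<bar> \<le> ?B" "\<bar>pdy N (\<lambda>z. u z - H z) z\<bar> \<le> ?B" if "z \<in> N" for z
  proof -
    have "53 * r + r' \<le> ?B" if "r \<le> 2 * q * T" "r' \<le> 128 * C0 * q * T" for r r'
    proof -
      have "53 * r + r' \<le> 53 * (2 * q * T) + 128 * C0 * q * T" using that by (intro add_mono mult_left_mono) simp_all
      then show ?thesis by (simp add: algebra_simps)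
    qed
    note b = this
    show "\<bar>pdx N (\<lambda>z. u z - H z) z\<bar> \<le> ?B"
      unfolding H_def by (rule order_trans[OF E(1) b[OF W1(1) dT(1)]], assumption, assumption, rule that)
    show "\<bar>pdy N (\<lambda>z. u z - H z) z\<bar> \<le> ?B"
      unfolding H_def by (rule order_trans[OF E(2) b[OF W1(2) dT(2)]], assumption, assumption, rule that)
  qed
  have "(\<lambda>z. u z - H z) differentiable_on N" "continuous_on N (pdx N (\<lambda>z. u z - H z))" "continuous_on N (pdy N (\<lambda>z. u z - H z))"
    unfolding H_def by (rule M.minus_hermite_sum(1,4,5)[folded N_def, OF uN])+
  note Q = M.C1_sobolev[folded N_def D_def, OF p this]
  show "(\<lambda>z. u z - H z) \<in> sobolev 1 p D" by (rule Q(1)) (rule B; assumption)+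
  have "sobolev_seminorm 1 p D (\<lambda>z. u z - H z) \<le> 2 * ?B * ((b2 - a2) * (d2 - c2)) powr real_of_ereal (1 / p)"
    by (rule Q(2)) (rule B; assumption)+
  also have "\<dots> = 2 * (106 + 128 * C0) * (q * (h1 * h2) powr s) * T"
    unfolding h1_def h2_def s_def by simp
  \<comment> \<open>The norm of a constant over the macro-element supplies its measure and completes
    the mesh constant.\<close>
  also have "q * (h1 * h2) powr s = (h1 * h2 / \<mu>) powr s"
  proof -
    have "\<mu> powr (- s) * Z powr s = (Z / \<mu>) powr s" if "0 \<le> Z" for Z
    proof -
      have 1: "(Z / \<mu>) powr s = Z powr s / \<mu> powr s" using that \<mu>(1) by (simp add: powr_divide)
      show ?thesis unfolding 1 powr_minus by (simp add: divide_inverse mult.commute)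
    qed
    then show ?thesis unfolding q_def using h by simp
  qed
  finally show "sobolev_seminorm 1 p D (\<lambda>z. u z - H z) \<le> 2 * (106 + 128 * C0) *
      ((b2 - a2) * (d2 - c2) / \<mu>) powr real_of_ereal (1 / p) *
      ((b2 - a2)\<^sup>2 * sobolev_seminorm 1 p R (weak_D R (2, 0) u) +
       (b2 - a2) * (d2 - c2) * sobolev_seminorm 1 p R (weak_D R (1, 1) u) +
       (d2 - c2)\<^sup>2 * sobolev_seminorm 1 p R (weak_D R (0, 2) u))"
    unfolding T_def S_def G_def h1_def h2_def s_def .
qed

end

text \<open>Vertices are indexed by grid numbers in \<open>quasi_interp\<close> and by coordinates
  in \<open>hermite_sum\<close>; the conditionals recover the number from the coordinate.\<close>

lemma quasi_interp_eq_hermite_sum: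
  assumes "x i \<noteq> x (Suc i)" "y j \<noteq> y (Suc j)"
  shows "quasi_interp x y \<sigma> \<Omega> i j u z =
    hermite_sum (x i) (x (Suc i)) (y j) (y (Suc j)) u (pdx (macro x y i j) u) (pdy (macro x y i j) u)
      (\<lambda>(e, f). edge_coeff x y \<sigma> \<Omega> u (if e = x i then i else Suc i) (if f = y j then j else Suc j))
      (\<lambda>e. spline_phi (x i) (x (Suc i)) e (fst z)) (\<lambda>e. spline_psi (x i) (x (Suc i)) e (fst z))
      (\<lambda>f. spline_phi (y j) (y (Suc j)) f (snd z)) (\<lambda>f. spline_psi (y j) (y (Suc j)) f (snd z))"
  unfolding hermite_sum_expand[OF assms] quasi_interp_def Let_def using assms by simp

theorem theorem17:
  fixes p :: ereal and C0 :: real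
  assumes "1 \<le> p"
  shows "\<exists>C::real. \<forall>n m x y \<sigma> i j M \<omega> u.
    strict_mono_on {0..n} x \<longrightarrow> strict_mono_on {0..m} y \<longrightarrow>
    edge_choice n m x y \<sigma> \<longrightarrow>
    i < n \<longrightarrow> j < m \<longrightarrow>
    M = macro x y i j \<longrightarrow> \<omega> = patch n m x y \<sigma> i j \<longrightarrow>
    side1 \<omega> \<le> C0 * side1 M \<longrightarrow> side2 \<omega> \<le> C0 * side2 M \<longrightarrow>
    u \<in> sobolev 3 p (interior \<omega>) \<longrightarrow> Ck_on 1 M u \<longrightarrow>
    (\<lambda>z. u z - quasi_interp x y \<sigma> (interior \<omega>) i j u z) \<in> sobolev 1 p (interior M) \<and>
    sobolev_seminorm 1 p (interior M) (\<lambda>z. u z - quasi_interp x y \<sigma> (interior \<omega>) i j u z)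
      \<le> C * mesh_constant n m x y p M \<omega> *
        (\<Sum>\<alpha>\<in>multi_indices 2. h_pow M \<alpha> *
           sobolev_seminorm 1 p (interior \<omega>) (weak_D (interior \<omega>) \<alpha> u))"
proof (intro exI[of _ "2 * (106 + 128 * C0)"] allI impI)
  fix n m x y \<sigma> i j M \<omega> u
  assume x: "strict_mono_on {0..n} x" and y: "strict_mono_on {0..m} y" and \<sigma>: "edge_choice n m x y \<sigma>"
    and i: "i < n" and j: "j < m" and M: "M = macro x y i j" and \<omega>: "\<omega> = patch n m x y \<sigma> i j"
    and sides: "side1 \<omega> \<le> C0 * side1 M" "side2 \<omega> \<le> C0 * side2 M"
    and u: "u \<in> sobolev 3 p (interior \<omega>)" "Ck_on 1 M u"
  obtain i0 k0 j0 l0 where patch: "patch n m x y \<sigma> i j = {x i0..x k0} \<times> {y j0..y l0}"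
    and b: "i0 \<le> i" "Suc i \<le> k0" "k0 \<le> n" "j0 \<le> j" "Suc j \<le> l0" "l0 \<le> m"
    and E: "\<And>k l. k \<in> {i, Suc i} \<Longrightarrow> l \<in> {j, Suc j} \<Longrightarrow> edge_set x y (\<sigma> k l) \<subseteq> {x i0..x k0} \<times> {y j0..y l0}"
    by (rule patch_cases[OF x y \<sigma> i j]) (rule that)
  note X = strict_mono_on_index[OF x] and Y = strict_mono_on_index[OF y]
  have le: "x i0 \<le> x i" "x i < x (Suc i)" "x (Suc i) \<le> x k0" "y j0 \<le> y j" "y j < y (Suc j)" "y (Suc j) \<le> y l0"
    using X(1,2) Y(1,2) b by simp_all
  interpret rect "x i0" "x k0" "y j0" "y l0"
    by unfold_locales (use le in linarith)+
  have \<omega>C: "\<omega> = CR" unfolding \<omega> patch by (simp add: cbox_Pair_eq)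
  have MC: "M = cbox (x i, y j) (x (Suc i), y (Suc j))" unfolding M macro_def by (simp add: cbox_Pair_eq)
  have int: "interior \<omega> = R" "interior M = box (x i, y j) (x (Suc i), y (Suc j))" unfolding \<omega>C MC by (rule interior_cbox)+
  have side: "side1 M = x (Suc i) - x i" "side2 M = y (Suc j) - y j" "side1 \<omega> = x k0 - x i0" "side2 \<omega> = y l0 - y j0"
    unfolding M macro_def \<omega> patch by (rule side_rectangle; use le in linarith)+
  define \<mu> where "\<mu> = Min (measure lebesgue ` {M' \<in> mesh n m x y. M' \<subseteq> {x i0..x k0} \<times> {y j0..y l0}})"
  have lt: "i0 < k0" "j0 < l0" using b by simp_all
  note \<mu> = min_measure[OF x y b(3) b(6) \<mu>_def lt]
  let ?A = "\<lambda>(e, f). edge_coeff x y \<sigma> (interior \<omega>) u (if e = x i then i else Suc i) (if f = y j then j else Suc j)"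
  have ne: "x i \<noteq> x (Suc i)" "y j \<noteq> y (Suc j)" using le by simp_all
  \<comment> \<open>Each chosen edge is a side of an element of the patch, in row or column
    \<open>q\<close>, and the area of that element is at least \<open>\<mu>\<close>.\<close>
  have coeff: "edge_functional (weak_D R (1, 1) u) \<mu> (x k) (y l) (edge_coeff x y \<sigma> (interior \<omega>) u k l)"
    if kl: "k \<in> {i, Suc i}" "l \<in> {j, Suc j}" for k l
  proof -
    note e = vertex_in_edges[OF \<sigma> i j kl] and E = E[OF kl]
    have kl': "k \<le> n" "l \<le> m" using kl i j by auto
    show ?thesis
    proof (cases rule: edge_cases[OF x y e E lt(1) b(3) lt(2) b(6) kl'])
      case (1 i' q)
      have q: "i' < n" "q < m" "x i0 \<le> x i'" "x i' < x (Suc i')" "x (Suc i') \<le> x k0" "y j0 \<le> y q" "y q < y (Suc q)" "y (Suc q) \<le> y l0"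
        using X(1,2) Y(1,2) 1 b by simp_all
      have ends: "x k \<in> {x i', x (Suc i')}" "y l \<in> {y q, y (Suc q)}" using 1 by auto
      have "edge_coeff x y \<sigma> (interior \<omega>) u k l = (LINT s:{x i'..x (Suc i')}|lebesgue.
          edge_trace R (\<lambda>s. (s, y l)) {x i'..x (Suc i')} (weak_D R (1, 1) u) s * dual_fun (x i') (x (Suc i')) (x k) s)"
        unfolding edge_coeff_def 1(1) int by simp
      then show ?thesis
        by (intro edge_functionalI[OF q(3-8) ends \<mu>(2)[OF 1(3,4,5,6)]] disjI1)
    next
      case (2 j' q)
      have q: "j' < m" "q < n" "x i0 \<le> x q" "x q < x (Suc q)" "x (Suc q) \<le> x k0" "y j0 \<le> y j'" "y j' < y (Suc j')" "y (Suc j') \<le> y l0"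
        using X(1,2) Y(1,2) 2 b by simp_all
      have ends: "x k \<in> {x q, x (Suc q)}" "y l \<in> {y j', y (Suc j')}" using 2 by auto
      have "edge_coeff x y \<sigma> (interior \<omega>) u k l = (LINT s:{y j'..y (Suc j')}|lebesgue.
          edge_trace R (\<lambda>s. (x k, s)) {y j'..y (Suc j')} (weak_D R (1, 1) u) s * dual_fun (y j') (y (Suc j')) (y l) s)"
        unfolding edge_coeff_def 2(1) int by simp
      then show ?thesis
        by (intro edge_functionalI[OF q(3-8) ends \<mu>(2)[OF 2(5,6,3,4)]] disjI2)
    qed
  qed
  have A: "edge_functional (weak_D R (1, 1) u) \<mu> e f (?A (e, f))"
    if "e \<in> {x i, x (Suc i)}" "f \<in> {y j, y (Suc j)}" for e f
  proof -
    from that obtain k l where kl: "k \<in> {i, Suc i}" "l \<in> {j, Suc j}" "e = x k" "f = y l" by blast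
    then have "(if e = x i then i else Suc i) = k" "(if f = y j then j else Suc j) = l" using ne by auto
    then show ?thesis using coeff[OF kl(1,2)] kl(3,4) by simp
  qed
  have \<mu>M: "\<mu> \<le> (x (Suc i) - x i) * (y (Suc j) - y j)" by (rule \<mu>(2)) (use b in simp_all)
  have meas: "mesh_constant n m x y p M \<omega> = ((x (Suc i) - x i) * (y (Suc j) - y j) / \<mu>) powr real_of_ereal (1 / p)"
    unfolding mesh_constant_def \<mu>_def \<omega> patch M macro_def using le by (simp add: measure_rectangle)
  have eq: "(\<lambda>z. u z - quasi_interp x y \<sigma> (interior \<omega>) i j u z) = (\<lambda>z. u z - hermite_sum (x i) (x (Suc i)) (y j) (y (Suc j)) u
      (pdx M u) (pdy M u) ?A
      (\<lambda>e. spline_phi (x i) (x (Suc i)) e (fst z)) (\<lambda>e. spline_psi (x i) (x (Suc i)) e (fst z))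
      (\<lambda>f. spline_phi (y j) (y (Suc j)) f (snd z)) (\<lambda>f. spline_psi (y j) (y (Suc j)) f (snd z)))"
    unfolding quasi_interp_eq_hermite_sum[where x=x and y=y, OF ne] M ..
  have sides': "x k0 - x i0 \<le> C0 * (x (Suc i) - x i)" "y l0 - y j0 \<le> C0 * (y (Suc j) - y j)"
    using sides unfolding side by simp_all
  note Q = quasi_interpolation_error[OF assms le \<mu>(1) \<mu>M sides' u[unfolded int MC], where A="?A", folded MC]
  have mi: "(\<Sum>\<alpha>\<in>multi_indices 2. h_pow M \<alpha> * sobolev_seminorm 1 p (interior \<omega>) (weak_D (interior \<omega>) \<alpha> u)) =
      (x (Suc i) - x i)\<^sup>2 * sobolev_seminorm 1 p R (weak_D R (2, 0) u) +
      (x (Suc i) - x i) * (y (Suc j) - y j) * sobolev_seminorm 1 p R (weak_D R (1, 1) u) +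
      (y (Suc j) - y j)\<^sup>2 * sobolev_seminorm 1 p R (weak_D R (0, 2) u)"
    unfolding multi_indices_2 h_pow_def side int by (simp add: add.assoc)
  show "(\<lambda>z. u z - quasi_interp x y \<sigma> (interior \<omega>) i j u z) \<in> sobolev 1 p (interior M) \<and>
    sobolev_seminorm 1 p (interior M) (\<lambda>z. u z - quasi_interp x y \<sigma> (interior \<omega>) i j u z)
      \<le> 2 * (106 + 128 * C0) * mesh_constant n m x y p M \<omega> *
        (\<Sum>\<alpha>\<in>multi_indices 2. h_pow M \<alpha> * sobolev_seminorm 1 p (interior \<omega>) (weak_D (interior \<omega>) \<alpha> u))"
    unfolding eq meas mi int(2) by (rule conjI; rule Q; rule A; assumption)
qed

end
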